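(* Let $\mathcal G=(G,\mathfrak g)$ be a Lie supergroup such that $G$ is connected and $\mathfrak g$ is a real simple Lie superalgebra with $\mathfrak g_{\bar 1}\neq\{0\}$. If $\mathfrak g$ is one of the following Lie superalgebras, then $\mathcal G$ does not have any nontrivial unitary representations (i.e. every unitary representation $(\pi,\rho^\pi,\mathscr H)$ of $\mathcal G$ satisfies $\rho^\pi=0$). (i) $\mathfrak{sl}(m|n,\mathbb R)$ where $m>2$ or $n>2$. (ii) $\mathfrak{su}(p,q|r,s)$ where $p,q,r,s>0$. (iii) $\mathfrak{su}^*(2p|2q)$ where $p,q>0$ and $p+q>2$. (iv) $\mathfrak{p\overline q}(m)$ where $m>1$. (v) $\mathfrak{usp}(m)$ where $m>1$. (vi) $\mathfrak{osp}^*(m|p,q)$ where $p,q,m>0$. (vii) $\mathfrak{osp}(p,q|2n)$ where $p,q,n>0$. (viii) Real forms of $\mathbf P(n)$, $n>1$. (ix) $\mathfrak{psq}(n,\mathbb R)$ where $n>2$, $\mathfrak{psq}^*(n)$ where $n>2$, and $\mathfrak{psq}(p,q)$ where $p,q>0$. (x) Real forms of $\mathbf W(n)$, $\mathbf S(n)$, and $\tilde{\mathbf S}(n)$. (xi) $\mathbf H(p,q)$ where $p+q>4$.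
   Context: Lie supergroup: a Harish-Chandra pair $\mathcal G=(G,\mathfrak g)$, i.e. $G$ is a Lie group, $\mathfrak g=\mathfrak g_{\bar 0}\oplus\mathfrak g_{\bar 1}$ a finite dimensional real Lie superalgebra, $\mathfrak g_{\bar 0}$ is the Lie algebra of $G$, $G$ acts smoothly on $\mathfrak g$ by automorphisms (action denoted $\mathrm{Ad}$), and the differential of this action is the adjoint action of $\mathfrak g_{\bar 0}$ on $\mathfrak g$. Unitary representation of $(G,\mathfrak g)$: a triple $(\pi,\rho^\pi,\mathscr H)$ where $\mathscr H=\mathscr H_{\bar 0}\oplus\mathscr H_{\bar 1}$ is a separable complex Hilbert space with $\mathscr H_{\bar 0}\perp\mathscr H_{\bar 1}$ closed subspaces; $\pi$ is a unitary representation of $G$ on $\mathscr H$ by grading-preserving operators; and, with $\mathscr H^\infty$ the space of smooth vectors of $\pi$, $\rho^\pi:\mathfrak g\to\mathrm{End}_{\mathbb C}(\mathscr H^\infty)$ is an $\mathbb R$-linear $\mathbb Z_2$-graded map such that: $\rho^\pi(X)=\mathsf d\pi(X)$ for $X\in\mathfrak g_{\bar 0}$; $\rho^\pi(X)\rho^\pi(Y)+\rho^\pi(Y)\rho^\pi(X)=-i\rho^\pi([X,Y])$ for $X,Y\in\mathfrak g_{\bar 1}$; $\rho^\pi(X)$ is symmetric for $X\in\mathfrak g_{\bar 1}$; and $\rho^\pi(\mathrm{Ad}(g)X)=\pi(g)\rho^\pi(X)\pi(g)^{-1}$ for $g\in G$, $X\in\mathfrak g$. A (super)algebra is simple if its bracket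 is nonzero and it has no proper nonzero two-sided ideals. A real form of a complex Lie superalgebra $\mathfrak s$ is a real Lie superalgebra $\mathfrak g$ with $\mathfrak g\otimes_{\mathbb R}\mathbb C\cong\mathfrak s$. Notation: $\mathrm I_n$ is the identity matrix, $\mathrm I_{p,q}=\mathrm{diag}(\mathrm I_p,-\mathrm I_q)$, $\mathrm J_n=\begin{bmatrix}0&\mathrm I_n\\ -\mathrm I_n&0\end{bmatrix}$, $A^t$ transpose, $A^*$ conjugate transpose. For $\mathbb K=\mathbb R,\mathbb C$, $\mathfrak{sl}(m|n,\mathbb K)$ consists of block matrices $\begin{bmatrix}A&B\\ C&D\end{bmatrix}$ over $\mathbb K$ with $A$ of size $m\times m$, $D$ of size $n\times n$, $\mathrm{tr}A=\mathrm{tr}D$, with even part $B=C=0$, odd part $A=D=0$, and the supercommutator as bracket. In (i)–(iii), when the listed algebra has a nonzero center ($m=n$, $p+q=r+s$, $p=q$ respectively), the symbol is understood as its quotient by its center (the algebras denoted $\mathfrak{psl}$, $\mathfrak{psu}$, $\mathfrak{psu}^*$). $\mathfrak{su}(p,q|r,s)$: matrices in $\mathfrak{sl}(p+q|r+s,\mathbb C)$ with $A=-\mathrm I_{p,q}A^*\mathrm I_{p,q}$, $D=-\mathrm I_{r,s}D^*\mathrm I_{r,s}$, $B=i\,\mathrm I_{p,q}C^*\mathrm I_{r,s}$, $C=i\,\mathrm I_{r,s}B^*\mathrm I_{p,q}$. $\mathfrak{su}^*(2p|2q)$: matrices $X\in\mathfrak{sl}(2p|2q,\mathbb C)$ with $XJ=J\overline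 X$, where $J=\mathrm{diag}(\mathrm J_p,\mathrm J_q)$. $\mathfrak{p\overline q}(m)$: quotient by its center of $\overline{\mathfrak q}(m)=\{\begin{bmatrix}A&B\\ C&D\end{bmatrix}\in\mathfrak{sl}(m|m,\mathbb C): A=\overline D, B=\overline C\}$. $\mathfrak{usp}(m)$: quotient by its center of $\mathfrak{up}(m)=\{\begin{bmatrix}A&B\\ C&D\end{bmatrix}\in\mathfrak{sl}(m|m,\mathbb C): A=-D^*, B=B^*, C=-C^*\}$. $\mathfrak{osp}(m|2n,\mathbb C)$: matrices in $\mathfrak{sl}(m|2n,\mathbb C)$ with $A=-A^t$, $B=-C^t\mathrm J_n$, $C=-\mathrm J_nB^t$, $D=\mathrm J_nD^t\mathrm J_n$. $\mathfrak{osp}(p,q|2n)$ is the fixed point set in $\mathfrak{osp}(p+q|2n,\mathbb C)$ of $\begin{bmatrix}A&B\\ C&D\end{bmatrix}\mapsto\begin{bmatrix}\mathrm I_{p,q}\overline A\,\mathrm I_{p,q}&\mathrm I_{p,q}\overline B\\ \overline C\,\mathrm I_{p,q}&\overline D\end{bmatrix}$. $\mathfrak{osp}^*(m|p,q)$ ($m$ even) is the real form of $\mathfrak{osp}(m|2(p+q),\mathbb C)$ with even part isomorphic to $\mathfrak{so}^*(m)\oplus\mathfrak{sp}(p,q)$. $\mathbf P(n)$: matrices $\begin{bmatrix}A&B\\ C&-A^t\end{bmatrix}$ in $\mathfrak{sl}(n+1|n+1,\mathbb C)$ with $\mathrm{tr}A=0$, $B=B^t$, $C=-C^t$. $\mathfrak{psq}$: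 consider matrices $\begin{bmatrix}A&B\\ B&A\end{bmatrix}$ with $A,B$ complex $n\times n$ and $\mathrm{tr}B=0$. $\mathfrak{psq}(n,\mathbb R)$ is the quotient by its center of the subalgebra with $A,B$ real; $\mathfrak{psq}^*(n)$ ($n$ even) is the quotient by its center of the subalgebra with $A\mathrm J_{n/2}=\mathrm J_{n/2}\overline A$, $B\mathrm J_{n/2}=\mathrm J_{n/2}\overline B$; $\mathfrak{psq}(p,q)$ ($n=p+q$) is the quotient by its center of the subalgebra with $A=-\mathrm I_{p,q}A^*\mathrm I_{p,q}$, $B=i\,\mathrm I_{p,q}B^*\mathrm I_{p,q}$. These are real forms of $\mathbf Q(n-1)$. Cartan type: let $\mathbf\Lambda(n,\mathbb K)$ be the Grassmann algebra over $\mathbb K$ on odd generators $\xi_1,\dots,\xi_n$ and $\partial_i=\partial/\partial\xi_i$. $\mathbf W(n)=\mathrm{Der}_{\mathbb C}(\mathbf\Lambda(n,\mathbb C))$ ($n\ge3$); $\mathbf S(n)=\{\sum f_i\partial_i\in\mathbf W(n):\sum\partial_i(f_i)=0\}$ ($n\ge4$); $\tilde{\mathbf S}(n)=\{D\in\mathbf W(n):(1+\xi_1\cdots\xi_n)D\in\mathbf S(n)\}$ ($n\ge4$ even). $\mathbf H(p,q)$, with $n=p+q$, is the derived algebra of the real Lie superalgebra $\{\sum_i\epsilon_i\,\partial_i(f)\,\partial_i: f\in\mathbf\Lambda(n,\mathbb R)\}\subseteq\mathrm{Der}_{\mathbb R}(\mathbf\Lambda(n,\mathbb R))$, with $\epsilon_i=1$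 for $i\le p$ and $\epsilon_i=-1$ for $i>p$; it is a real form of $\mathbf H(n)$. *)

theory Defs
  imports "HOL-Analysis.Analysis" "HOL-Algebra.Group" "Jordan_Normal_Form.Matrix"
begin

section \<open>Smooth manifolds and Lie groups\<close>

text \<open>A function on an open subset of a Euclidean space is of class \<open>C\<^sup>k\<close> iff all its directional
  derivatives exist and are of class \<open>C\<^bsup>k-1\<^esup>\<close>.  The target may be infinite-dimensional.\<close>

primrec Ck_on :: "nat \<Rightarrow> 'e::euclidean_space set \<Rightarrow> ('e \<Rightarrow> 'f::real_normed_vector) \<Rightarrow> bool" where
  "Ck_on 0 U f \<longleftrightarrow> continuous_on U f"
| "Ck_on (Suc k) U f \<longleftrightarrow> (\<forall>x\<in>U. f differentiable (at x)) \<and>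
     (\<forall>v. Ck_on k U (\<lambda>x. frechet_derivative f (at x) v))"

definition smooth_on :: "'e::euclidean_space set \<Rightarrow> ('e \<Rightarrow> 'f::real_normed_vector) \<Rightarrow> bool" where
  "smooth_on U f \<longleftrightarrow> open U \<and> (\<forall>k. Ck_on k U f)"

type_synonym ('g, 'e) chart = "'g set \<times> ('g \<Rightarrow> 'e)"

definition is_chart :: "('g::topological_space, 'e::topological_space) chart \<Rightarrow> bool" where
  "is_chart c \<longleftrightarrow> open (fst c) \<and> open (snd c ` fst c) \<and>
     (\<exists>h. homeomorphism (fst c) (snd c ` fst c) (snd c) h)"

definition smooth_atlas :: "('g::topological_space, 'e::euclidean_space) chart set \<Rightarrow> bool" where
  "smooth_atlas A \<longleftrightarrow> (\<forall>c\<in>A. is_chart c) \<and> (\<Union>c\<in>A. fst c) = UNIV \<and>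
     (\<forall>(U, \<phi>)\<in>A. \<forall>(V, \<psi>)\<in>A. smooth_on (\<phi> ` (U \<inter> V)) (\<psi> \<circ> inv_into U \<phi>))"

definition smooth_map ::
  "('g::topological_space, 'e::euclidean_space) chart set \<Rightarrow>
   ('m::topological_space, 'f::real_normed_vector) chart set \<Rightarrow> ('g \<Rightarrow> 'm) \<Rightarrow> bool" where
  "smooth_map A B F \<longleftrightarrow> continuous_on UNIV F \<and>
     (\<forall>(U, \<phi>)\<in>A. \<forall>(V, \<psi>)\<in>B. smooth_on (\<phi> ` (U \<inter> F -` V)) (\<psi> \<circ> F \<circ> inv_into U \<phi>))"

definition std_atlas :: "('v, 'v) chart set" where
  "std_atlas = {(UNIV, \<lambda>x. x)}"

definition prod_atlas ::
  "('g, 'e) chart set \<Rightarrow> ('m, 'f) chart set \<Rightarrow> ('g \<times> 'm, 'e \<times> 'f) chart set" where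
  "prod_atlas A B = {(U \<times> V, \<lambda>(x, y). (\<phi> x, \<psi> y)) | U \<phi> V \<psi>. (U, \<phi>) \<in> A \<and> (V, \<psi>) \<in> B}"

definition smooth_fun :: "('g::topological_space, 'e::euclidean_space) chart set \<Rightarrow> ('g \<Rightarrow> real) set" where
  "smooth_fun A = {f. smooth_map A std_atlas f}"

locale lie_group = group G
  for G :: "'g::{t2_space, second_countable_topology} monoid" (structure) +
  fixes A :: "('g, 'e::euclidean_space) chart set"
  assumes carrier_UNIV: "carrier G = UNIV"
    and atlas: "smooth_atlas A"
    and smooth_mult: "smooth_map (prod_atlas A A) A (\<lambda>(x, y). x \<otimes> y)"
    and smooth_inv: "smooth_map A A (\<lambda>x. inv x)"


section \<open>Superalgebras with explicit carriers\<close>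

text \<open>\<open>'s\<close> is the type of scalars.  Ordinary algebras are those with odd part zero.\<close>

record ('s, 'v) superalgebra =
  sa_carrier :: "'v set"
  sa_zero :: 'v
  sa_add :: "'v \<Rightarrow> 'v \<Rightarrow> 'v"
  sa_scale :: "'s \<Rightarrow> 'v \<Rightarrow> 'v"
  sa_br :: "'v \<Rightarrow> 'v \<Rightarrow> 'v"
  sa_even :: "'v set"
  sa_odd :: "'v set"

definition sa_iso :: "('s, 'v) superalgebra \<Rightarrow> ('s, 'w) superalgebra \<Rightarrow> ('v \<Rightarrow> 'w) \<Rightarrow> bool" where
  "sa_iso L M \<phi> \<longleftrightarrow>
     bij_betw \<phi> (sa_carrier L) (sa_carrier M) \<and>
     (\<forall>x\<in>sa_carrier L. \<forall>y\<in>sa_carrier L. \<phi> (sa_add L x y) = sa_add M (\<phi> x) (\<phi> y)) \<and>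
     (\<forall>c. \<forall>x\<in>sa_carrier L. \<phi> (sa_scale L c x) = sa_scale M c (\<phi> x)) \<and>
     (\<forall>x\<in>sa_carrier L. \<forall>y\<in>sa_carrier L. \<phi> (sa_br L x y) = sa_br M (\<phi> x) (\<phi> y)) \<and>
     \<phi> ` sa_even L = sa_even M \<and> \<phi> ` sa_odd L = sa_odd M"

definition sa_isomorphic :: "('s, 'v) superalgebra \<Rightarrow> ('s, 'w) superalgebra \<Rightarrow> bool"
  (infix \<open>\<cong>\<^sub>s\<close> 50) where
  "L \<cong>\<^sub>s M \<longleftrightarrow> (\<exists>\<phi>. sa_iso L M \<phi>)"

definition sa_sub :: "('s, 'v) superalgebra \<Rightarrow> 'v set \<Rightarrow> ('s, 'v) superalgebra" where
  "sa_sub L S = L\<lparr>sa_carrier := S, sa_even := S \<inter> sa_even L, sa_odd := S \<inter> sa_odd L\<rparr>"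

definition sa_even_part :: "('s, 'v) superalgebra \<Rightarrow> ('s, 'v) superalgebra" where
  "sa_even_part L = sa_sub L (sa_even L)"

definition sa_subspace :: "('s, 'v) superalgebra \<Rightarrow> 'v set \<Rightarrow> bool" where
  "sa_subspace L S \<longleftrightarrow> S \<subseteq> sa_carrier L \<and> sa_zero L \<in> S \<and>
     (\<forall>x\<in>S. \<forall>y\<in>S. sa_add L x y \<in> S) \<and> (\<forall>c. \<forall>x\<in>S. sa_scale L c x \<in> S)"

definition sa_derived :: "('s, 'v) superalgebra \<Rightarrow> ('s, 'v) superalgebra" where
  "sa_derived L = sa_sub L
     (\<Inter>{S. sa_subspace L S \<and> (\<forall>x\<in>sa_carrier L. \<forall>y\<in>sa_carrier L. sa_br L x y \<in> S)})"

definition sa_center :: "('s, 'v) superalgebra \<Rightarrow> 'v set" where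
  "sa_center L = {z \<in> sa_carrier L. \<forall>x\<in>sa_carrier L. sa_br L z x = sa_zero L}"

text \<open>The quotient by the center; its elements are the cosets \<open>x + Z\<close>.  If the center is zero,
  the cosets are singletons and the quotient is canonically isomorphic to \<open>L\<close>.\<close>

definition sa_mod_center :: "('s, 'v) superalgebra \<Rightarrow> ('s, 'v set) superalgebra" where
  "sa_mod_center L = (let coset = (\<lambda>x. sa_add L x ` sa_center L) in
    \<lparr> sa_carrier = coset ` sa_carrier L,
      sa_zero = coset (sa_zero L),
      sa_add = (\<lambda>X Y. \<Union>x\<in>X. \<Union>y\<in>Y. coset (sa_add L x y)),
      sa_scale = (\<lambda>c X. \<Union>x\<in>X. coset (sa_scale L c x)),
      sa_br = (\<lambda>X Y. \<Union>x\<in>X. \<Union>y\<in>Y. coset (sa_br L x y)),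
      sa_even = coset ` sa_even L,
      sa_odd = coset ` sa_odd L \<rparr>)"

definition sa_direct_sum ::
  "('s, 'v) superalgebra \<Rightarrow> ('s, 'w) superalgebra \<Rightarrow> ('s, 'v \<times> 'w) superalgebra" where
  "sa_direct_sum L M =
    \<lparr> sa_carrier = sa_carrier L \<times> sa_carrier M,
      sa_zero = (sa_zero L, sa_zero M),
      sa_add = (\<lambda>(x, x') (y, y'). (sa_add L x y, sa_add M x' y')),
      sa_scale = (\<lambda>c (x, x'). (sa_scale L c x, sa_scale M c x')),
      sa_br = (\<lambda>(x, x') (y, y'). (sa_br L x y, sa_br M x' y')),
      sa_even = sa_even L \<times> sa_even M,
      sa_odd = sa_odd L \<times> sa_odd M \<rparr>"

text \<open>The pair \<open>(x, y)\<close> stands for \<open>x \<otimes> 1 + y \<otimes> \<i>\<close>.\<close>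

definition complexification :: "(real, 'v) superalgebra \<Rightarrow> (complex, 'v \<times> 'v) superalgebra" where
  "complexification L = (let minus = (\<lambda>x y. sa_add L x (sa_scale L (-1) y)) in
    \<lparr> sa_carrier = sa_carrier L \<times> sa_carrier L,
      sa_zero = (sa_zero L, sa_zero L),
      sa_add = (\<lambda>(x, y) (u, v). (sa_add L x u, sa_add L y v)),
      sa_scale = (\<lambda>c (x, y).
        (minus (sa_scale L (Re c) x) (sa_scale L (Im c) y),
         sa_add L (sa_scale L (Re c) y) (sa_scale L (Im c) x))),
      sa_br = (\<lambda>(x, y) (u, v).
        (minus (sa_br L x u) (sa_br L y v), sa_add L (sa_br L x v) (sa_br L y u))),
      sa_even = sa_even L \<times> sa_even L,
      sa_odd = sa_odd L \<times> sa_odd L \<rparr>)"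

definition real_form_of :: "(real, 'v) superalgebra \<Rightarrow> (complex, 'w) superalgebra \<Rightarrow> bool" where
  "real_form_of L S \<longleftrightarrow> complexification L \<cong>\<^sub>s S"

text \<open>The supercommutator \<open>[x,y] = xy - (-1)\<^bsup>|x||y|\<^esup> yx\<close>, extended bilinearly to non-homogeneous elements;
  \<open>e\<close> and \<open>o'\<close> are the projections to the even and odd part.\<close>

definition supercommutator ::
  "('v \<Rightarrow> 'v \<Rightarrow> 'v) \<Rightarrow> ('v \<Rightarrow> 'v \<Rightarrow> 'v) \<Rightarrow> ('v \<Rightarrow> 'v \<Rightarrow> 'v) \<Rightarrow> ('v \<Rightarrow> 'v) \<Rightarrow> ('v \<Rightarrow> 'v) \<Rightarrow> 'v \<Rightarrow> 'v \<Rightarrow> 'v" where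
  "supercommutator ml pl mi e o' x y =
     pl (pl (mi (ml (e x) (e y)) (ml (e y) (e x)))
              (mi (ml (e x) (o' y)) (ml (o' y) (e x))))
         (pl (mi (ml (o' x) (e y)) (ml (e y) (o' x)))
              (pl (ml (o' x) (o' y)) (ml (o' y) (o' x))))"


section \<open>Real Lie superalgebras and Lie supergroups\<close>

text \<open>A real Lie superalgebra whose underlying space is all of a Euclidean space; the inner
  product only serves to provide the topology of a finite-dimensional space.\<close>

locale real_lie_superalgebra =
  fixes g0 g1 :: "'a::euclidean_space set" and br :: "'a \<Rightarrow> 'a \<Rightarrow> 'a"
  assumes subspace_even: "subspace g0" and subspace_odd: "subspace g1"
    and direct_sum: "g0 \<inter> g1 = {0}" "{x + y | x y. x \<in> g0 \<and> y \<in> g1} = UNIV"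
    and bilinear: "bilinear br"
    and graded: "x \<in> g0 \<Longrightarrow> y \<in> g0 \<Longrightarrow> br x y \<in> g0" "x \<in> g0 \<Longrightarrow> y \<in> g1 \<Longrightarrow> br x y \<in> g1"
      "x \<in> g1 \<Longrightarrow> y \<in> g0 \<Longrightarrow> br x y \<in> g1" "x \<in> g1 \<Longrightarrow> y \<in> g1 \<Longrightarrow> br x y \<in> g0"
    and super_antisym: "x \<in> g0 \<Longrightarrow> y \<in> g0 \<union> g1 \<Longrightarrow> br x y = - br y x"
      "x \<in> g1 \<Longrightarrow> y \<in> g1 \<Longrightarrow> br x y = br y x"
    and super_jacobi:
      "x \<in> g0 \<Longrightarrow> y \<in> g0 \<union> g1 \<Longrightarrow> z \<in> g0 \<union> g1 \<Longrightarrow> br x (br y z) = br (br x y) z + br y (br x z)"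
      "x \<in> g1 \<Longrightarrow> y \<in> g0 \<Longrightarrow> z \<in> g0 \<union> g1 \<Longrightarrow> br x (br y z) = br (br x y) z + br y (br x z)"
      "x \<in> g1 \<Longrightarrow> y \<in> g1 \<Longrightarrow> z \<in> g0 \<union> g1 \<Longrightarrow> br x (br y z) = br (br x y) z - br y (br x z)"

definition superalgebra_of ::
  "'a::real_vector set \<Rightarrow> 'a set \<Rightarrow> ('a \<Rightarrow> 'a \<Rightarrow> 'a) \<Rightarrow> (real, 'a) superalgebra" where
  "superalgebra_of g0 g1 br =
    \<lparr> sa_carrier = UNIV, sa_zero = 0, sa_add = (+), sa_scale = (*\<^sub>R), sa_br = br,
      sa_even = g0, sa_odd = g1 \<rparr>"

text \<open>As usual for superalgebras, ideals are understood to be graded.\<close>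

definition super_ideal :: "'a::real_vector set \<Rightarrow> 'a set \<Rightarrow> ('a \<Rightarrow> 'a \<Rightarrow> 'a) \<Rightarrow> 'a set \<Rightarrow> bool" where
  "super_ideal g0 g1 br I \<longleftrightarrow> subspace I \<and>
     I = {x + y | x y. x \<in> I \<inter> g0 \<and> y \<in> I \<inter> g1} \<and>
     (\<forall>x. \<forall>y\<in>I. br x y \<in> I \<and> br y x \<in> I)"

definition simple_superalgebra :: "'a::real_vector set \<Rightarrow> 'a set \<Rightarrow> ('a \<Rightarrow> 'a \<Rightarrow> 'a) \<Rightarrow> bool" where
  "simple_superalgebra g0 g1 br \<longleftrightarrow> (\<exists>x y. br x y \<noteq> 0) \<and>
     (\<forall>I. super_ideal g0 g1 br I \<longrightarrow> I = {0} \<or> I = UNIV)"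

text \<open>The Lie algebra of a Lie group: left-invariant vector fields, viewed as derivations of the
  algebra of smooth functions, with the commutator as bracket.\<close>

definition left_invariant_derivations ::
  "'g::topological_space monoid \<Rightarrow> ('g, 'e::euclidean_space) chart set \<Rightarrow>
   (('g \<Rightarrow> real) \<Rightarrow> ('g \<Rightarrow> real)) set" where
  "left_invariant_derivations G A = {D \<in> smooth_fun A \<rightarrow>\<^sub>E smooth_fun A.
     (\<forall>f\<in>smooth_fun A. \<forall>h\<in>smooth_fun A. \<forall>a b x. D (\<lambda>x. a * f x + b * h x) x = a * D f x + b * D h x) \<and>
     (\<forall>f\<in>smooth_fun A. \<forall>h\<in>smooth_fun A. \<forall>x. D (\<lambda>x. f x * h x) x = D f x * h x + f x * D h x) \<and>
     (\<forall>f\<in>smooth_fun A. \<forall>g x. D (\<lambda>x. f (g \<otimes>\<^bsub>G\<^esub> x)) x = D f (g \<otimes>\<^bsub>G\<^esub> x))}"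

definition lie_algebra_of ::
  "'g::topological_space monoid \<Rightarrow> ('g, 'e::euclidean_space) chart set \<Rightarrow>
   (real, ('g \<Rightarrow> real) \<Rightarrow> ('g \<Rightarrow> real)) superalgebra" where
  "lie_algebra_of G A =
    \<lparr> sa_carrier = left_invariant_derivations G A,
      sa_zero = (\<lambda>f\<in>smooth_fun A. \<lambda>x. 0),
      sa_add = (\<lambda>D E. \<lambda>f\<in>smooth_fun A. \<lambda>x. D f x + E f x),
      sa_scale = (\<lambda>c D. \<lambda>f\<in>smooth_fun A. \<lambda>x. c * D f x),
      sa_br = (\<lambda>D E. \<lambda>f\<in>smooth_fun A. \<lambda>x. D (E f) x - E (D f) x),
      sa_even = left_invariant_derivations G A,
      sa_odd = {\<lambda>f\<in>smooth_fun A. \<lambda>x. 0} \<rparr>"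

text \<open>The differential at the identity of a smooth map \<open>F\<close> from \<open>G\<close> to a normed space, in the
  direction of the tangent vector \<open>D\<close> at the identity, is \<open>(F \<circ> \<gamma>)'(0)\<close> for a smooth curve \<open>\<gamma>\<close>
  through the identity with velocity \<open>D\<close>.  Such curves exist for every left-invariant \<open>D\<close>, for
  example \<open>t \<mapsto> exp(tD)\<close>, and for smooth \<open>F\<close> the value is the same for all of them.\<close>

definition has_differential_at_one ::
  "'g::topological_space monoid \<Rightarrow> ('g, 'e::euclidean_space) chart set \<Rightarrow>
   ('g \<Rightarrow> 'f::real_normed_vector) \<Rightarrow> (('g \<Rightarrow> real) \<Rightarrow> ('g \<Rightarrow> real)) \<Rightarrow> 'f \<Rightarrow> bool" where
  "has_differential_at_one G A F D Y \<longleftrightarrow>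
     (\<exists>\<gamma> :: real \<Rightarrow> 'g. smooth_map std_atlas A \<gamma> \<and> \<gamma> 0 = \<one>\<^bsub>G\<^esub> \<and>
        (\<forall>f\<in>smooth_fun A. ((\<lambda>t. f (\<gamma> t)) has_real_derivative D f \<one>\<^bsub>G\<^esub>) (at 0)) \<and>
        ((\<lambda>t. F (\<gamma> t)) has_vector_derivative Y) (at 0))"

text \<open>The map \<open>\<iota>\<close> is the identification of the even part with the Lie algebra of \<open>G\<close>.\<close>

locale lie_supergroup = lie_group G A + real_lie_superalgebra g0 g1 br
  for G :: "'g::{t2_space, second_countable_topology} monoid" (structure)
    and A :: "('g, 'e::euclidean_space) chart set"
    and g0 g1 :: "'a::euclidean_space set" and br :: "'a \<Rightarrow> 'a \<Rightarrow> 'a" +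
  fixes \<iota> :: "'a \<Rightarrow> ('g \<Rightarrow> real) \<Rightarrow> ('g \<Rightarrow> real)" and Ad :: "'g \<Rightarrow> 'a \<Rightarrow> 'a"
  assumes even_part: "sa_iso (sa_even_part (superalgebra_of g0 g1 br)) (lie_algebra_of G A) \<iota>"
    and Ad_one: "Ad \<one> X = X"
    and Ad_mult: "Ad (g \<otimes> h) X = Ad g (Ad h X)"
    and Ad_linear: "linear (Ad g)"
    and Ad_graded: "Ad g ` g0 \<subseteq> g0" "Ad g ` g1 \<subseteq> g1"
    and Ad_bracket: "Ad g (br X Y) = br (Ad g X) (Ad g Y)"
    and Ad_smooth: "smooth_map (prod_atlas A std_atlas) std_atlas (\<lambda>(g, X). Ad g X)"
    and Ad_differential: "X \<in> g0 \<Longrightarrow> has_differential_at_one G A (\<lambda>g. Ad g Y) (\<iota> X) (br X Y)"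


section \<open>Unitary representations\<close>

class complex_hilbert_space = banach +
  fixes scaleC :: "complex \<Rightarrow> 'a \<Rightarrow> 'a" (infixr \<open>*\<^sub>C\<close> 75)
    and cinner :: "'a \<Rightarrow> 'a \<Rightarrow> complex"
  assumes scaleC_add_right: "c *\<^sub>C (x + y) = c *\<^sub>C x + c *\<^sub>C y"
    and scaleC_add_left: "(c + d) *\<^sub>C x = c *\<^sub>C x + d *\<^sub>C x"
    and scaleC_scaleC: "c *\<^sub>C d *\<^sub>C x = (c * d) *\<^sub>C x"
    and scaleC_of_real: "complex_of_real r *\<^sub>C x = r *\<^sub>R x"
    and cinner_add_left: "cinner (x + y) z = cinner x z + cinner y z"
    and cinner_scaleC_left: "cinner (c *\<^sub>C x) y = c * cinner x y"
    and cinner_commute: "cinner x y = cnj (cinner y x)"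
    and cinner_self: "cinner x x = complex_of_real ((norm x)\<^sup>2)"

definition smooth_vectors ::
  "('g::topological_space, 'e::euclidean_space) chart set \<Rightarrow> ('g \<Rightarrow> 'h::real_normed_vector \<Rightarrow> 'h) \<Rightarrow> 'h set" where
  "smooth_vectors A \<pi> = {v. smooth_map A std_atlas (\<lambda>g. \<pi> g v)}"

text \<open>Only the values of \<open>\<rho> X\<close> on smooth vectors are meaningful.\<close>

locale unitary_representation = lie_supergroup G A g0 g1 br \<iota> Ad
  for G :: "'g::{t2_space, second_countable_topology} monoid" (structure)
    and A :: "('g, 'e::euclidean_space) chart set"
    and g0 g1 :: "'a::euclidean_space set" and br :: "'a \<Rightarrow> 'a \<Rightarrow> 'a"
    and \<iota> :: "'a \<Rightarrow> ('g \<Rightarrow> real) \<Rightarrow> ('g \<Rightarrow> real)" and Ad :: "'g \<Rightarrow> 'a \<Rightarrow> 'a" +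
  fixes H0 H1 :: "'h::complex_hilbert_space set"
    and \<pi> :: "'g \<Rightarrow> 'h \<Rightarrow> 'h" and \<rho> :: "'a \<Rightarrow> 'h \<Rightarrow> 'h"
  assumes separable: "separable_space (euclidean :: 'h topology)"
    and grading: "subspace H0" "subspace H1" "closed H0" "closed H1"
      "v \<in> H0 \<Longrightarrow> c *\<^sub>C v \<in> H0" "v \<in> H1 \<Longrightarrow> c *\<^sub>C v \<in> H1"
      "v \<in> H0 \<Longrightarrow> w \<in> H1 \<Longrightarrow> cinner v w = 0"
      "{v + w | v w. v \<in> H0 \<and> w \<in> H1} = UNIV"
    and pi_linear: "\<pi> g (v + w) = \<pi> g v + \<pi> g w" "\<pi> g (c *\<^sub>C v) = c *\<^sub>C \<pi> g v"
    and pi_unitary: "surj (\<pi> g)" "cinner (\<pi> g v) (\<pi> g w) = cinner v w"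
    and pi_hom: "\<pi> \<one> v = v" "\<pi> (g \<otimes> h) v = \<pi> g (\<pi> h v)"
    and pi_continuous: "continuous_on UNIV (\<lambda>g. \<pi> g v)"
    and pi_graded: "\<pi> g ` H0 \<subseteq> H0" "\<pi> g ` H1 \<subseteq> H1"
    and rho_closed: "v \<in> smooth_vectors A \<pi> \<Longrightarrow> \<rho> X v \<in> smooth_vectors A \<pi>"
    and rho_complex_linear: "v \<in> smooth_vectors A \<pi> \<Longrightarrow> w \<in> smooth_vectors A \<pi> \<Longrightarrow> \<rho> X (v + w) = \<rho> X v + \<rho> X w"
      "v \<in> smooth_vectors A \<pi> \<Longrightarrow> \<rho> X (c *\<^sub>C v) = c *\<^sub>C \<rho> X v"
    and rho_real_linear: "v \<in> smooth_vectors A \<pi> \<Longrightarrow> \<rho> (a *\<^sub>R X + b *\<^sub>R Y) v = a *\<^sub>R \<rho> X v + b *\<^sub>R \<rho> Y v"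
    and rho_graded: "X \<in> g0 \<Longrightarrow> \<rho> X ` (smooth_vectors A \<pi> \<inter> H0) \<subseteq> H0"
      "X \<in> g0 \<Longrightarrow> \<rho> X ` (smooth_vectors A \<pi> \<inter> H1) \<subseteq> H1"
      "X \<in> g1 \<Longrightarrow> \<rho> X ` (smooth_vectors A \<pi> \<inter> H0) \<subseteq> H1"
      "X \<in> g1 \<Longrightarrow> \<rho> X ` (smooth_vectors A \<pi> \<inter> H1) \<subseteq> H0"
    and rho_even: "X \<in> g0 \<Longrightarrow> v \<in> smooth_vectors A \<pi> \<Longrightarrow>
      has_differential_at_one G A (\<lambda>g. \<pi> g v) (\<iota> X) (\<rho> X v)"
    and rho_odd: "X \<in> g1 \<Longrightarrow> Y \<in> g1 \<Longrightarrow> v \<in> smooth_vectors A \<pi> \<Longrightarrow>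
      \<rho> X (\<rho> Y v) + \<rho> Y (\<rho> X v) = (- \<i>) *\<^sub>C \<rho> (br X Y) v"
    and rho_symmetric: "X \<in> g1 \<Longrightarrow> v \<in> smooth_vectors A \<pi> \<Longrightarrow> w \<in> smooth_vectors A \<pi> \<Longrightarrow>
      cinner (\<rho> X v) w = cinner v (\<rho> X w)"
    and rho_Ad: "v \<in> smooth_vectors A \<pi> \<Longrightarrow> \<rho> (Ad g X) v = \<pi> g (\<rho> X (inv_into UNIV (\<pi> g) v))"


section \<open>Matrix Lie superalgebras\<close>

definition mat_even :: "nat \<Rightarrow> nat \<Rightarrow> 'k::zero mat \<Rightarrow> 'k mat" where
  "mat_even m n X = mat (m + n) (m + n) (\<lambda>(i, j). if (i < m) = (j < m) then X $$ (i, j) else 0)"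

definition mat_odd :: "nat \<Rightarrow> nat \<Rightarrow> 'k::zero mat \<Rightarrow> 'k mat" where
  "mat_odd m n X = mat (m + n) (m + n) (\<lambda>(i, j). if (i < m) = (j < m) then 0 else X $$ (i, j))"

text \<open>\<open>(m|n)\<close>-block matrices over \<open>'k\<close>, as a superalgebra over \<open>'s\<close> via the embedding \<open>\<sigma>\<close> of scalars
  (the identity, or the inclusion of the reals).\<close>

definition gl_super :: "('s \<Rightarrow> 'k) \<Rightarrow> nat \<Rightarrow> nat \<Rightarrow> ('s, 'k::ring_1 mat) superalgebra" where
  "gl_super \<sigma> m n =
    \<lparr> sa_carrier = carrier_mat (m + n) (m + n),
      sa_zero = 0\<^sub>m (m + n) (m + n),
      sa_add = (+),
      sa_scale = (\<lambda>c X. \<sigma> c \<cdot>\<^sub>m X),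
      sa_br = supercommutator (*) (+) (-) (mat_even m n) (mat_odd m n),
      sa_even = {X \<in> carrier_mat (m + n) (m + n). mat_even m n X = X},
      sa_odd = {X \<in> carrier_mat (m + n) (m + n). mat_odd m n X = X} \<rparr>"

abbreviation gl_real :: "nat \<Rightarrow> nat \<Rightarrow> (real, 'k::real_algebra_1 mat) superalgebra" where
  "gl_real \<equiv> gl_super of_real"

abbreviation gl_complex :: "nat \<Rightarrow> nat \<Rightarrow> (complex, complex mat) superalgebra" where
  "gl_complex \<equiv> gl_super (\<lambda>c. c)"

definition mtrace :: "'k::comm_monoid_add mat \<Rightarrow> 'k" where
  "mtrace X = (\<Sum>i<dim_row X. X $$ (i, i))"

abbreviation mcnj :: "complex mat \<Rightarrow> complex mat" where
  "mcnj \<equiv> map_mat cnj"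

abbreviation mstar :: "complex mat \<Rightarrow> complex mat" where
  "mstar X \<equiv> transpose_mat (mcnj X)"

definition diag_block :: "'k::zero mat \<Rightarrow> 'k mat \<Rightarrow> 'k mat" where
  "diag_block P Q = four_block_mat P (0\<^sub>m (dim_row P) (dim_col Q)) (0\<^sub>m (dim_row Q) (dim_col P)) Q"

definition Ipq :: "nat \<Rightarrow> nat \<Rightarrow> 'k::ring_1 mat" where
  "Ipq p q = diag_block (1\<^sub>m p) (- 1\<^sub>m q)"

definition Jmat :: "nat \<Rightarrow> 'k::ring_1 mat" where
  "Jmat n = four_block_mat (0\<^sub>m n n) (1\<^sub>m n) (- 1\<^sub>m n) (0\<^sub>m n n)"

definition is_blocks :: "nat \<Rightarrow> nat \<Rightarrow> 'k mat \<Rightarrow> 'k mat \<Rightarrow> 'k mat \<Rightarrow> 'k mat \<Rightarrow> 'k mat \<Rightarrow> bool" where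
  "is_blocks m n X A B C D \<longleftrightarrow> A \<in> carrier_mat m m \<and> B \<in> carrier_mat m n \<and>
     C \<in> carrier_mat n m \<and> D \<in> carrier_mat n n \<and> X = four_block_mat A B C D"

definition sl_set :: "nat \<Rightarrow> nat \<Rightarrow> 'k::comm_ring_1 mat set" where
  "sl_set m n = {X. \<exists>A B C D. is_blocks m n X A B C D \<and> mtrace A = mtrace D}"

definition sl_real :: "nat \<Rightarrow> nat \<Rightarrow> (real, real mat set) superalgebra" where
  "sl_real m n = sa_mod_center (sa_sub (gl_real m n) (sl_set m n))"

definition su :: "nat \<Rightarrow> nat \<Rightarrow> nat \<Rightarrow> nat \<Rightarrow> (real, complex mat set) superalgebra" where
  "su p q r s = sa_mod_center (sa_sub (gl_real (p + q) (r + s))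
     {X \<in> sl_set (p + q) (r + s). \<exists>A B C D. is_blocks (p + q) (r + s) X A B C D \<and>
        A = - (Ipq p q * mstar A * Ipq p q) \<and> D = - (Ipq r s * mstar D * Ipq r s) \<and>
        B = \<i> \<cdot>\<^sub>m (Ipq p q * mstar C * Ipq r s) \<and> C = \<i> \<cdot>\<^sub>m (Ipq r s * mstar B * Ipq p q)})"

text \<open>This is \<open>su\<^sup>*(2p|2q)\<close>.\<close>

definition su_star :: "nat \<Rightarrow> nat \<Rightarrow> (real, complex mat set) superalgebra" where
  "su_star p q = sa_mod_center (sa_sub (gl_real (2 * p) (2 * q))
     {X \<in> sl_set (2 * p) (2 * q).
        X * diag_block (Jmat p) (Jmat q) = diag_block (Jmat p) (Jmat q) * mcnj X})"

definition pqbar :: "nat \<Rightarrow> (real, complex mat set) superalgebra" where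
  "pqbar m = sa_mod_center (sa_sub (gl_real m m)
     {X \<in> sl_set m m. \<exists>A B C D. is_blocks m m X A B C D \<and> A = mcnj D \<and> B = mcnj C})"

definition usp :: "nat \<Rightarrow> (real, complex mat set) superalgebra" where
  "usp m = sa_mod_center (sa_sub (gl_real m m)
     {X \<in> sl_set m m. \<exists>A B C D. is_blocks m m X A B C D \<and>
        A = - mstar D \<and> B = mstar B \<and> C = - mstar C})"

text \<open>The underlying set of \<open>osp(m|2n, \<complex>)\<close>.\<close>

definition osp_set :: "nat \<Rightarrow> nat \<Rightarrow> complex mat set" where
  "osp_set m n = {X \<in> sl_set m (2 * n). \<exists>A B C D. is_blocks m (2 * n) X A B C D \<and>
     A = - transpose_mat A \<and> B = - (transpose_mat C * Jmat n) \<and>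
     C = - (Jmat n * transpose_mat B) \<and> D = Jmat n * transpose_mat D * Jmat n}"

definition osp_complex :: "nat \<Rightarrow> nat \<Rightarrow> (complex, complex mat) superalgebra" where
  "osp_complex m n = sa_sub (gl_complex m (2 * n)) (osp_set m n)"

text \<open>This is \<open>osp(p,q|2n)\<close>.\<close>

definition osp :: "nat \<Rightarrow> nat \<Rightarrow> nat \<Rightarrow> (real, complex mat) superalgebra" where
  "osp p q n = sa_sub (gl_real (p + q) (2 * n))
     {X \<in> osp_set (p + q) n. \<exists>A B C D. is_blocks (p + q) (2 * n) X A B C D \<and>
        X = four_block_mat (Ipq p q * mcnj A * Ipq p q) (Ipq p q * mcnj B) (mcnj C * Ipq p q) (mcnj D)}"

text \<open>\<open>so\<^sup>*(m)\<close> for even \<open>m\<close>: the complex orthogonal matrices commuting with the quaternionic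
  structure \<open>v \<mapsto> J \<bar>v\<close>.\<close>

definition so_star :: "nat \<Rightarrow> (real, complex mat) superalgebra" where
  "so_star m = sa_sub (gl_real m 0)
     {X \<in> carrier_mat m m. X = - transpose_mat X \<and> X * Jmat (m div 2) = Jmat (m div 2) * mcnj X}"

text \<open>\<open>sp(p,q)\<close>: the intersection of \<open>sp(2(p+q), \<complex>)\<close> with the Lie algebra of the Hermitian form of
  signature \<open>(2p, 2q)\<close>.\<close>

definition sp_pq :: "nat \<Rightarrow> nat \<Rightarrow> (real, complex mat) superalgebra" where
  "sp_pq p q = (let n = p + q; K = diag_block (Ipq p q) (Ipq p q) in
     sa_sub (gl_real (2 * n) 0)
       {X \<in> carrier_mat (2 * n) (2 * n). X = Jmat n * transpose_mat X * Jmat n \<and>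
          mstar X * K = - (K * X)})"

text \<open>\<open>L\<close> is (isomorphic to) \<open>osp\<^sup>*(m|p,q)\<close>.\<close>

definition is_osp_star :: "nat \<Rightarrow> nat \<Rightarrow> nat \<Rightarrow> (real, 'v) superalgebra \<Rightarrow> bool" where
  "is_osp_star m p q L \<longleftrightarrow> real_form_of L (osp_complex m (p + q)) \<and>
     sa_even_part L \<cong>\<^sub>s sa_direct_sum (so_star m) (sp_pq p q)"

definition P_complex :: "nat \<Rightarrow> (complex, complex mat) superalgebra" where
  "P_complex n = sa_sub (gl_complex (n + 1) (n + 1))
     {X \<in> sl_set (n + 1) (n + 1). \<exists>A B C. is_blocks (n + 1) (n + 1) X A B C (- transpose_mat A) \<and>
        mtrace A = 0 \<and> B = transpose_mat B \<and> C = - transpose_mat C}"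

definition q_set :: "nat \<Rightarrow> ('k::comm_ring_1 mat \<Rightarrow> 'k mat \<Rightarrow> bool) \<Rightarrow> 'k mat set" where
  "q_set n P = {X. \<exists>A B. is_blocks n n X A B B A \<and> mtrace B = 0 \<and> P A B}"

definition psq_real :: "nat \<Rightarrow> (real, real mat set) superalgebra" where
  "psq_real n = sa_mod_center (sa_sub (gl_real n n) (q_set n (\<lambda>A B. True)))"

definition psq_star :: "nat \<Rightarrow> (real, complex mat set) superalgebra" where
  "psq_star n = sa_mod_center (sa_sub (gl_real n n) (q_set n (\<lambda>A B.
     A * Jmat (n div 2) = Jmat (n div 2) * mcnj A \<and> B * Jmat (n div 2) = Jmat (n div 2) * mcnj B)))"

definition psq :: "nat \<Rightarrow> nat \<Rightarrow> (real, complex mat set) superalgebra" where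
  "psq p q = sa_mod_center (sa_sub (gl_real (p + q) (p + q)) (q_set (p + q) (\<lambda>A B.
     A = - (Ipq p q * mstar A * Ipq p q) \<and> B = \<i> \<cdot>\<^sub>m (Ipq p q * mstar B * Ipq p q))))"


section \<open>Lie superalgebras of Cartan type\<close>

text \<open>An element of the Grassmann algebra is given by its coefficients with respect to the monomials
  \<open>\<xi>\<^sub>I = \<xi>\<^bsub>i\<^sub>1\<^esub> \<cdots> \<xi>\<^bsub>i\<^sub>k\<^esub>\<close> with \<open>I = {i\<^sub>1 < \<dots> < i\<^sub>k}\<close>; the generators are numbered from \<open>0\<close> to \<open>n - 1\<close>.\<close>

type_synonym 'k grassmann = "nat set \<Rightarrow> 'k"

definition Grass :: "nat \<Rightarrow> 'k::zero grassmann set" where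
  "Grass n = {f. \<forall>I. f I \<noteq> 0 \<longrightarrow> I \<subseteq> {..<n}}"

text \<open>\<open>\<xi>\<^sub>I \<xi>\<^sub>J = \<plusminus> \<xi>\<^bsub>I \<union> J\<^esub>\<close> for disjoint \<open>I\<close>, \<open>J\<close>, the sign being given by the number of inversions.\<close>

definition gmult :: "'k::comm_ring_1 grassmann \<Rightarrow> 'k grassmann \<Rightarrow> 'k grassmann" where
  "gmult f h = (\<lambda>K. \<Sum>I\<in>Pow K. (-1) ^ card {(i, j). i \<in> I \<and> j \<in> K - I \<and> j < i} * f I * h (K - I))"

definition gpart :: "bool \<Rightarrow> 'k::zero grassmann \<Rightarrow> 'k grassmann" where
  "gpart b f = (\<lambda>I. if even (card I) = b then f I else 0)"

text \<open>\<open>gparity n True\<close> and \<open>gparity n False\<close> are the even and the odd part.\<close>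

definition gparity :: "nat \<Rightarrow> bool \<Rightarrow> 'k::zero grassmann set" where
  "gparity n b = {f \<in> Grass n. gpart b f = f}"

text \<open>\<open>\<partial>\<^sub>i \<xi>\<^sub>I = \<plusminus> \<xi>\<^bsub>I - {i}\<^esub>\<close> for \<open>i \<in> I\<close>, the sign being given by the number of elements of \<open>I\<close> below \<open>i\<close>.\<close>

definition gpartial :: "nat \<Rightarrow> 'k::comm_ring_1 grassmann \<Rightarrow> 'k grassmann" where
  "gpartial i f = (\<lambda>I. if i \<in> I then 0 else (-1) ^ card {j \<in> I. j < i} * f (insert i I))"

type_synonym 'k gop = "'k grassmann \<Rightarrow> 'k grassmann"

definition gop_add :: "nat \<Rightarrow> 'k::comm_ring_1 gop \<Rightarrow> 'k gop \<Rightarrow> 'k gop" where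
  "gop_add n D E = (\<lambda>f\<in>Grass n. \<lambda>I. D f I + E f I)"

definition gop_diff :: "nat \<Rightarrow> 'k::comm_ring_1 gop \<Rightarrow> 'k gop \<Rightarrow> 'k gop" where
  "gop_diff n D E = (\<lambda>f\<in>Grass n. \<lambda>I. D f I - E f I)"

definition gop_even :: "nat \<Rightarrow> 'k::comm_ring_1 gop \<Rightarrow> 'k gop" where
  "gop_even n D = (\<lambda>f\<in>Grass n. \<lambda>I. gpart True (D (gpart True f)) I + gpart False (D (gpart False f)) I)"

definition gop_odd :: "nat \<Rightarrow> 'k::comm_ring_1 gop \<Rightarrow> 'k gop" where
  "gop_odd n D = (\<lambda>f\<in>Grass n. \<lambda>I. gpart False (D (gpart True f)) I + gpart True (D (gpart False f)) I)"

definition glinear :: "nat \<Rightarrow> 'k::comm_ring_1 gop set" where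
  "glinear n = {D \<in> Grass n \<rightarrow>\<^sub>E Grass n. \<forall>f\<in>Grass n. \<forall>h\<in>Grass n. \<forall>a b.
     D (\<lambda>I. a * f I + b * h I) = (\<lambda>I. a * D f I + b * D h I)}"

definition der_even :: "nat \<Rightarrow> 'k::comm_ring_1 gop set" where
  "der_even n = {D \<in> glinear n. (\<forall>b. D ` gparity n b \<subseteq> gparity n b) \<and>
     (\<forall>f\<in>Grass n. \<forall>h\<in>Grass n. D (gmult f h) = (\<lambda>I. gmult (D f) h I + gmult f (D h) I))}"

definition der_odd :: "nat \<Rightarrow> 'k::comm_ring_1 gop set" where
  "der_odd n = {D \<in> glinear n. (\<forall>b. D ` gparity n b \<subseteq> gparity n (\<not> b)) \<and>
     (\<forall>f\<in>gparity n True. \<forall>h\<in>Grass n. D (gmult f h) = (\<lambda>I. gmult (D f) h I + gmult f (D h) I)) \<and>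
     (\<forall>f\<in>gparity n False. \<forall>h\<in>Grass n. D (gmult f h) = (\<lambda>I. gmult (D f) h I - gmult f (D h) I))}"

definition der_grass :: "nat \<Rightarrow> ('k::comm_ring_1, 'k gop) superalgebra" where
  "der_grass n =
    \<lparr> sa_carrier = {gop_add n D E | D E. D \<in> der_even n \<and> E \<in> der_odd n},
      sa_zero = (\<lambda>f\<in>Grass n. \<lambda>I. 0),
      sa_add = gop_add n,
      sa_scale = (\<lambda>c D. \<lambda>f\<in>Grass n. \<lambda>I. c * D f I),
      sa_br = supercommutator (\<lambda>D E. \<lambda>f\<in>Grass n. D (E f)) (gop_add n) (gop_diff n)
                (gop_even n) (gop_odd n),
      sa_even = der_even n,
      sa_odd = der_odd n \<rparr>"

text \<open>The operator \<open>\<Sum>\<^sub>i F\<^sub>i \<partial>\<^sub>i\<close>.\<close>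

definition vector_field :: "nat \<Rightarrow> (nat \<Rightarrow> 'k::comm_ring_1 grassmann) \<Rightarrow> 'k gop" where
  "vector_field n F = (\<lambda>h\<in>Grass n. \<lambda>I. \<Sum>i<n. gmult (F i) (gpartial i h) I)"

abbreviation W_complex :: "nat \<Rightarrow> (complex, complex gop) superalgebra" where
  "W_complex \<equiv> der_grass"

definition S_set :: "nat \<Rightarrow> complex gop set" where
  "S_set n = {D \<in> sa_carrier (W_complex n). \<exists>F. (\<forall>i<n. F i \<in> Grass n) \<and> D = vector_field n F \<and>
     (\<forall>I. (\<Sum>i<n. gpartial i (F i) I) = 0)}"

definition S_complex :: "nat \<Rightarrow> (complex, complex gop) superalgebra" where
  "S_complex n = sa_sub (W_complex n) (S_set n)"

definition S_tilde_complex :: "nat \<Rightarrow> (complex, complex gop) superalgebra" where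
  "S_tilde_complex n = sa_sub (W_complex n) {D \<in> sa_carrier (W_complex n).
     (\<lambda>h\<in>Grass n. gmult (\<lambda>I. of_bool (I = {}) + of_bool (I = {..<n})) (D h)) \<in> S_set n}"

definition H_real :: "nat \<Rightarrow> nat \<Rightarrow> (real, real gop) superalgebra" where
  "H_real p q = sa_derived (sa_sub (der_grass (p + q))
     {vector_field (p + q) (\<lambda>i I. (if i < p then 1 else -1) * gpartial i f I) | f. f \<in> Grass (p + q)})"

end

theory Submission
  imports Defs "Jordan_Normal_Form.Char_Poly"
begin

text \<open>For odd \<open>x\<close> and a smooth vector \<open>v\<close>, the real part of \<open>\<langle>-i \<rho>([x, x]) v, v\<rangle>\<close> equals
  \<open>2 \<parallel>\<rho>(x) v\<parallel>\<^sup>2\<close>. If no linear functional \<open>f\<close> makes \<open>f([x, x])\<close> positive for all odd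
  \<open>x \<noteq> 0\<close>, separation of convex sets gives a convex combination of squares \<open>[x, x]\<close> with \<open>x\<close> in the unit sphere
  of the odd part that vanishes. Then \<open>\<rho>(x) = 0\<close> for some odd \<open>x \<noteq> 0\<close>, and by simplicity \<open>\<rho> = 0\<close>.

  It remains to exclude positive functionals. Most of the matrix superalgebras, and \<open>H(p,q)\<close>, contain an odd
  \<open>x \<noteq> 0\<close> with \<open>[x, x] = 0\<close>. For real forms of \<open>P(n)\<close> every form \<open>f([x, y])\<close> is degenerate on the odd part.
  For real forms of \<open>W(n)\<close>, \<open>S(n)\<close> and the deformed \<open>S(n)\<close> there is an even \<open>N\<close>, nilpotent on the odd part, with
  \<open>(ad N)\<^sup>2 = 0\<close> on the even part; the last nonzero \<open>x = (ad N)\<^sup>k X\<close> satisfies \<open>[x, x] = 0\<close>.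
  For \<open>osp\<^sup>*(m|p,q)\<close> one follows \<open>f([x, x])\<close> along the flow of \<open>ad N\<close> with \<open>N\<close> nilpotent in \<open>sp(p,q)\<close>.\<close>

section \<open>Unitary representations and odd squares\<close>

text \<open>The axioms of a representation link \<open>\<rho>\<close> to the bracket only for two
  odd elements. For an even and an odd one they give equivariance under \<open>Ad\<close> and
  derivatives along curves whose choice may vary from one vector to the next. What can be extracted
  is a bracket relation between matrix coefficients, and it suffices to see that brackets with
  kernel elements stay in the kernel. The ideal of the simplicity argument is therefore built from
  odd kernel elements and their brackets with odd elements.

  In a quotient by the center a square-zero matrix must also be noncentral, so each witness there
  comes with a partner that has a nonzero anticommutator with it. For abstract real forms only the
  complexification is known and no witness can be written down; the arguments use data visible after
  complexification, namely the radical of a bilinear form or an abelian ideal of the even part. For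
  \<open>osp^*(m|p,q)\<close> the argument works with the explicit even part, and the odd part
  enters through the fact that its squares span the even part of a simple superalgebra.\<close>

lemma Ck_on_Suc_imp: "Ck_on (Suc k) U f \<Longrightarrow> Ck_on k U f"
proof (induction k arbitrary: f)
  case 0
  then show ?case
    by (auto intro!: continuous_at_imp_continuous_on differentiable_imp_continuous_within)
next
  case (Suc k)
  then show ?case
    by (metis Ck_on.simps(2))
qed

lemma Ck_on_cong:
  assumes "open U" "\<And>x. x \<in> U \<Longrightarrow> f x = g x" "Ck_on k U f"
  shows "Ck_on k U g"
  using assms(2,3)
proof (induction k arbitrary: f g)
  case 0
  then show ?case by (metis Ck_on.simps(1) continuous_on_cong)
next
  case (Suc k)
  have D: "(g has_derivative frechet_derivative f (at x)) (at x)" if "x \<in> U" for x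
  proof -
    have "(f has_derivative frechet_derivative f (at x)) (at x)"
      using Suc.prems that frechet_derivative_works by auto
    then show ?thesis
      by (rule has_derivative_transform_within_open[OF _ assms(1) that]) (use Suc.prems in auto)
  qed
  have "frechet_derivative g (at x) = frechet_derivative f (at x)" if "x \<in> U" for x
    using D[OF that] frechet_derivative_at by metis
  then have "Ck_on k U (\<lambda>x. frechet_derivative g (at x) v)" for v
    using Suc.IH[of "\<lambda>x. frechet_derivative f (at x) v"] Suc.prems by auto
  then show ?case
    using D by (auto simp: differentiable_def)
qed

text \<open>\<open>frechet_derivative f (at x)\<close> depends only on the germ of \<open>f\<close>
  at \<open>x\<close>. This allows a composite through a manifold to be checked near each point, in
  any chart of the middle manifold that contains the image.\<close>

lemma Ck_on_local:
  assumes "\<And>x. x \<in> U \<Longrightarrow> \<exists>V. open V \<and> x \<in> V \<and> Ck_on k V f"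
  shows "Ck_on k U f"
  using assms
proof (induction k arbitrary: f)
  case 0
  have "continuous (at x) f" if "x \<in> U" for x
    using 0[OF that] by (auto simp: continuous_on_eq_continuous_at)
  then show ?case by (simp add: continuous_at_imp_continuous_on)
next
  case (Suc k)
  have "Ck_on k U (\<lambda>x. frechet_derivative f (at x) v)" for v
  proof (rule Suc.IH)
    fix x assume "x \<in> U"
    from Suc.prems[OF this]
    show "\<exists>V. open V \<and> x \<in> V \<and> Ck_on k V (\<lambda>x. frechet_derivative f (at x) v)" by auto
  qed
  then show ?case using Suc.prems by fastforce
qed

lemma Ck_on_Suc_I:
  assumes "open U" "\<And>x. x \<in> U \<Longrightarrow> (f has_derivative f' x) (at x)"
    and "\<And>v. Ck_on k U (\<lambda>x. f' x v)"
  shows "Ck_on (Suc k) U f"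
proof -
  have "f' x = frechet_derivative f (at x)" if "x \<in> U" for x
    using assms(2)[OF that] frechet_derivative_at by metis
  then have "Ck_on k U (\<lambda>x. frechet_derivative f (at x) v)" for v
    using Ck_on_cong[OF assms(1) _ assms(3), where g = "\<lambda>x. frechet_derivative f (at x) v"] by auto
  then show ?thesis using assms(2) by (auto simp: differentiable_def)
qed

lemma Ck_on_Suc_D:
  assumes "Ck_on (Suc k) U f"
  shows "\<And>x. x \<in> U \<Longrightarrow> (f has_derivative frechet_derivative f (at x)) (at x)"
    and "\<And>v. Ck_on k U (\<lambda>x. frechet_derivative f (at x) v)"
  using assms frechet_derivative_works by auto

lemma Ck_on_const: "open U \<Longrightarrow> Ck_on k U (\<lambda>x. c)"
  by (induction k arbitrary: c) (auto intro!: Ck_on_Suc_I[where f' = "\<lambda>x v. 0"])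

lemma Ck_on_linear: "open U \<Longrightarrow> bounded_linear T \<Longrightarrow> Ck_on k U T"
  by (cases k) (auto intro!: Ck_on_Suc_I[where f' = "\<lambda>x. T"] Ck_on_const
      bounded_linear_imp_has_derivative linear_continuous_on simp del: Ck_on.simps(2))

lemma Ck_on_bounded_linear:
  assumes "open U" "bounded_linear T"
  shows "Ck_on k U f \<Longrightarrow> Ck_on k U (\<lambda>x. T (f x))"
proof (induction k arbitrary: f)
  case 0
  then show ?case
    using bounded_linear.continuous_on[OF assms(2)] by auto
next
  case (Suc k)
  note D = Ck_on_Suc_D[OF Suc.prems]
  show ?case
    by (rule Ck_on_Suc_I[OF assms(1) bounded_linear.has_derivative[OF assms(2) D(1)] Suc.IH[OF D(2)]])
qed

lemma Ck_on_add:
  assumes "open U"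
  shows "Ck_on k U f \<Longrightarrow> Ck_on k U g \<Longrightarrow> Ck_on k U (\<lambda>x. f x + g x)"
proof (induction k arbitrary: f g)
  case 0
  then show ?case by (auto intro: continuous_intros)
next
  case (Suc k)
  note D = Ck_on_Suc_D[OF Suc.prems(1)] and E = Ck_on_Suc_D[OF Suc.prems(2)]
  show ?case
    by (rule Ck_on_Suc_I[OF assms(1) has_derivative_add[OF D(1) E(1)] Suc.IH[OF D(2) E(2)]])
qed

lemma Ck_on_sum:
  assumes "open U" "finite S" "\<And>i. i \<in> S \<Longrightarrow> Ck_on k U (f i)"
  shows "Ck_on k U (\<lambda>x. \<Sum>i\<in>S. f i x)"
  using assms(2,3) by (induction S) (auto intro: Ck_on_const Ck_on_add assms(1))

lemma Ck_on_scaleR: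
  fixes f :: "'a::euclidean_space \<Rightarrow> real"
  assumes "open U"
  shows "Ck_on k U f \<Longrightarrow> Ck_on k U g \<Longrightarrow> Ck_on k U (\<lambda>x. f x *\<^sub>R g x)"
proof (induction k arbitrary: f g)
  case 0
  then show ?case by (auto intro: continuous_intros)
next
  case (Suc k)
  note D = Ck_on_Suc_D[OF Suc.prems(1)] and E = Ck_on_Suc_D[OF Suc.prems(2)]
  note L = Suc.prems[THEN Ck_on_Suc_imp]
  show ?case
    by (rule Ck_on_Suc_I[OF assms(1) has_derivative_scaleR[OF D(1) E(1)]])
      (use Ck_on_add[OF assms(1) Suc.IH[OF L(1) E(2)] Suc.IH[OF D(2) L(2)]] in auto)
qed

text \<open>\<open>Ck_on\<close> speaks of derivatives in fixed directions, whereas the chain rule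
  differentiates \<open>f\<close> in the moving direction \<open>g'(x) v\<close>. Expanding that
  direction in \<open>Basis\<close> leaves products of scalar coordinates with derivatives of
  \<open>f\<close> in fixed directions, to which the product rule and the induction hypothesis
  apply.\<close>

lemma Ck_on_compose:
  fixes g :: "'a::euclidean_space \<Rightarrow> 'b::euclidean_space" and f :: "'b \<Rightarrow> 'c::real_normed_vector"
  assumes "open U" "open V" "g ` U \<subseteq> V"
  shows "Ck_on k U g \<Longrightarrow> Ck_on k V f \<Longrightarrow> Ck_on k U (\<lambda>x. f (g x))"
proof (induction k arbitrary: f)
  case 0
  then show ?case using assms(3) by (auto intro: continuous_on_compose2)
next
  case (Suc k)
  note G = Ck_on_Suc_D[OF Suc.prems(1)] and F = Ck_on_Suc_D[OF Suc.prems(2)]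
  have D: "((\<lambda>x. f (g x)) has_derivative (\<lambda>v. \<Sum>b\<in>Basis. (frechet_derivative g (at x) v \<bullet> b)
       *\<^sub>R frechet_derivative f (at (g x)) b)) (at x)" if "x \<in> U" for x
  proof -
    have gx: "g x \<in> V" using that assms(3) by auto
    have lin: "linear (frechet_derivative f (at (g x)))"
      using F(1)[OF gx] has_derivative_linear by blast
    have "frechet_derivative f (at (g x)) (frechet_derivative g (at x) v)
       = (\<Sum>b\<in>Basis. (frechet_derivative g (at x) v \<bullet> b) *\<^sub>R frechet_derivative f (at (g x)) b)" for v
      by (subst euclidean_representation[symmetric], subst linear_sum[OF lin])
         (simp add: linear_scale[OF lin])
    moreover have "((\<lambda>x. f (g x)) has_derivative
        (\<lambda>v. frechet_derivative f (at (g x)) (frechet_derivative g (at x) v))) (at x)"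
      using diff_chain_at[OF G(1)[OF that] F(1)[OF gx]] by (simp add: o_def)
    ultimately show ?thesis by simp
  qed
  show ?case
  proof (rule Ck_on_Suc_I[OF assms(1) D])
    show "Ck_on k U (\<lambda>x. \<Sum>b\<in>Basis. (frechet_derivative g (at x) v \<bullet> b)
       *\<^sub>R frechet_derivative f (at (g x)) b)" for v
    proof (rule Ck_on_sum[OF assms(1) finite_Basis], rule Ck_on_scaleR[OF assms(1)])
      fix b :: 'b assume "b \<in> Basis"
      show "Ck_on k U (\<lambda>x. frechet_derivative g (at x) v \<bullet> b)"
        by (rule Ck_on_bounded_linear[OF assms(1) bounded_linear_inner_left G(2)])
      show "Ck_on k U (\<lambda>x. frechet_derivative f (at (g x)) b)"
        by (rule Suc.IH[OF Ck_on_Suc_imp[OF Suc.prems(1)] F(2)])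
    qed
  qed
qed

section \<open>Smooth maps between manifolds given by atlases\<close>

lemma smooth_map_std_iff:
  "smooth_map A std_atlas F \<longleftrightarrow> continuous_on UNIV F \<and> (\<forall>(U, \<phi>)\<in>A. smooth_on (\<phi> ` U) (F \<circ> inv_into U \<phi>))"
  by (simp add: smooth_map_def std_atlas_def comp_def)

lemma smooth_on_bounded_linear: "bounded_linear T \<Longrightarrow> smooth_on U f \<Longrightarrow> smooth_on U (T \<circ> f)"
  by (auto simp: smooth_on_def o_def intro: Ck_on_bounded_linear)

lemma smooth_map_bounded_linear:
  assumes "smooth_map A std_atlas F" "bounded_linear T"
  shows "smooth_map A std_atlas (\<lambda>g. T (F g))"
proof -
  have "continuous_on UNIV (\<lambda>g. T (F g))"
    using assms bounded_linear.continuous_on smooth_map_std_iff by blast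
  moreover have "(\<lambda>g. T (F g)) \<circ> inv_into U \<phi> = T \<circ> (F \<circ> inv_into U \<phi>)" for U and \<phi> :: "'a \<Rightarrow> 'b"
    by auto
  ultimately show ?thesis
    using assms unfolding smooth_map_std_iff by (auto intro: smooth_on_bounded_linear)
qed

lemma is_chart_inj: "is_chart (U, \<phi>) \<Longrightarrow> inj_on \<phi> U"
  by (force simp: is_chart_def homeomorphism_def intro: inj_on_inverseI)

lemma smooth_atlas_cover:
  assumes "smooth_atlas A"
  obtains U \<phi> where "(U, \<phi>) \<in> A" "x \<in> U"
proof -
  have "x \<in> (\<Union>c\<in>A. fst c)" using assms by (simp add: smooth_atlas_def)
  then obtain c where "c \<in> A" "x \<in> fst c" by blast
  then show thesis using that by (cases c) auto
qed

lemma smooth_map_compose_std: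
  fixes R :: "'g::topological_space \<Rightarrow> 'm::topological_space"
    and A :: "('g, 'e::euclidean_space) chart set" and B :: "('m, 'f::euclidean_space) chart set"
  assumes A: "smooth_atlas A" and B: "smooth_atlas B"
    and R: "smooth_map A B R" and F: "smooth_map B std_atlas F"
  shows "smooth_map A std_atlas (\<lambda>x. F (R x))"
proof -
  have "smooth_on (\<phi> ` U) ((\<lambda>x. F (R x)) \<circ> inv_into U \<phi>)" if U: "(U, \<phi>) \<in> A" for U \<phi>
  proof -
    have chart: "is_chart (U, \<phi>)" using A U by (auto simp: smooth_atlas_def)
    then have op: "open (\<phi> ` U)" by (simp add: is_chart_def)
    have "Ck_on k (\<phi> ` U) ((\<lambda>x. F (R x)) \<circ> inv_into U \<phi>)" for k
    proof (rule Ck_on_local)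
      fix x assume "x \<in> \<phi> ` U"
      then obtain a where a: "a \<in> U" "x = \<phi> a" by auto
      obtain V \<psi> where V: "(V, \<psi>) \<in> B" "R a \<in> V"
        using smooth_atlas_cover[OF B] .
      \<comment> \<open>Near \<open>x\<close> the composite factors through the chart
        \<open>\<psi>\<close>. The openness of this neighbourhood is part of
        \<open>smooth_on\<close> for \<open>R\<close> in the two charts.\<close>
      let ?S = "\<phi> ` (U \<inter> R -` V)"
      have 1: "smooth_on ?S (\<psi> \<circ> R \<circ> inv_into U \<phi>)" using R U V by (auto simp: smooth_map_def)
      have 2: "smooth_on (\<psi> ` V) (F \<circ> inv_into V \<psi>)" using F V by (auto simp: smooth_map_std_iff)
      have inj: "inj_on \<phi> U" "inj_on \<psi> V"
        using chart is_chart_inj B V by (auto simp: smooth_atlas_def)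
      have "Ck_on k ?S (\<lambda>x. (F \<circ> inv_into V \<psi>) ((\<psi> \<circ> R \<circ> inv_into U \<phi>) x))"
        by (rule Ck_on_compose[where V = "\<psi> ` V"]) (use 1 2 inj in \<open>auto simp: smooth_on_def o_def\<close>)
      then have "Ck_on k ?S ((\<lambda>x. F (R x)) \<circ> inv_into U \<phi>)"
        by (rule Ck_on_cong[rotated 2]) (use 1 inj in \<open>auto simp: smooth_on_def o_def\<close>)
      then show "\<exists>V. open V \<and> x \<in> V \<and> Ck_on k V ((\<lambda>x. F (R x)) \<circ> inv_into U \<phi>)"
        using 1 a V by (intro exI[of _ ?S]) (auto simp: smooth_on_def)
    qed
    then show ?thesis using op by (simp add: smooth_on_def)
  qed
  moreover have "continuous_on UNIV (\<lambda>x. F (R x))"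
    using R F by (auto simp: smooth_map_def intro: continuous_on_compose2)
  ultimately show ?thesis by (auto simp: smooth_map_std_iff)
qed

text \<open>In charts the slice is the affine map \<open>x \<mapsto> (x, \<phi>' y)\<close>, along
  which \<open>F\<close> is pulled back. It yields right translations from the multiplication and
  \<open>g \<mapsto> Ad g Y\<close> from the joint smoothness of the action.\<close>

lemma smooth_map_slice:
  fixes F :: "'g::topological_space \<times> 'm::topological_space \<Rightarrow> 'p::topological_space"
    and A :: "('g, 'e::euclidean_space) chart set" and B :: "('m, 'f::euclidean_space) chart set"
    and C :: "('p, 'q::real_normed_vector) chart set"
  assumes A: "smooth_atlas A" and F: "smooth_map (prod_atlas A B) C F"
    and y: "(U', \<phi>') \<in> B" "y \<in> U'" "inj_on \<phi>' U'"
  shows "smooth_map A C (\<lambda>x. F (x, y))"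
proof -
  have "smooth_on (\<phi> ` (U \<inter> (\<lambda>x. F (x, y)) -` V)) (\<psi> \<circ> (\<lambda>x. F (x, y)) \<circ> inv_into U \<phi>)"
    if U: "(U, \<phi>) \<in> A" and V: "(V, \<psi>) \<in> C" for U \<phi> V \<psi>
  proof -
    have inj: "inj_on \<phi> U" using A U is_chart_inj by (auto simp: smooth_atlas_def)
    let ?P = "\<lambda>(x, y). (\<phi> x, \<phi>' y)" and ?s = "\<lambda>x. (x, \<phi>' y)"
    let ?S = "?P ` ((U \<times> U') \<inter> F -` V)" and ?T = "\<phi> ` (U \<inter> (\<lambda>x. F (x, y)) -` V)"
    have injP: "inj_on ?P (U \<times> U')" using inj y(3) by (auto simp: inj_on_def)
    have "(U \<times> U', ?P) \<in> prod_atlas A B" using U y by (auto simp: prod_atlas_def)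
    then have sm: "smooth_on ?S (\<psi> \<circ> F \<circ> inv_into (U \<times> U') ?P)"
      using F V unfolding smooth_map_def by fast
    have T: "?T = ?s -` ?S" 
    proof (intro equalityI subsetI)
      fix x assume "x \<in> ?T"
      then obtain a where a: "a \<in> U" "F (a, y) \<in> V" "x = \<phi> a" by auto
      then have "?P (a, y) \<in> ?S" using y by (intro imageI) auto
      then show "x \<in> ?s -` ?S" using a by simp
    next
      fix x assume "x \<in> ?s -` ?S"
      then obtain a b where ab: "a \<in> U" "b \<in> U'" "F (a, b) \<in> V" "x = \<phi> a" "\<phi>' y = \<phi>' b" by auto
      then have "b = y" using y inj_onD by metis
      then show "x \<in> ?T" using ab by auto
    qed
    have cs: "continuous_on UNIV ?s" by (intro continuous_intros)
    have op: "open ?T" unfolding T using sm cs by (auto simp: smooth_on_def intro: open_vimage)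
    have eq: "inv_into (U \<times> U') ?P (\<phi> a, \<phi>' y) = (a, y)" if "a \<in> U" for a
      using inv_into_f_f[OF injP, of "(a, y)"] that y by auto
    have "Ck_on k ?T (\<psi> \<circ> (\<lambda>x. F (x, y)) \<circ> inv_into U \<phi>)" for k
    proof -
      have lin: "bounded_linear (\<lambda>x. (x, 0::'f))"
        by (rule bounded_linear_Pair[OF bounded_linear_ident bounded_linear_zero])
      have "Ck_on k ?T (\<lambda>x. (x, 0) + (0, \<phi>' y))"
        by (intro Ck_on_add op Ck_on_const Ck_on_linear[OF op lin])
      then have s: "Ck_on k ?T ?s" by simp
      have "Ck_on k ?T (\<lambda>x. (\<psi> \<circ> F \<circ> inv_into (U \<times> U') ?P) (?s x))"
        by (rule Ck_on_compose[OF op, where V = ?S]) (use sm s T in \<open>auto simp: smooth_on_def o_def\<close>)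
      then show ?thesis
        by (rule Ck_on_cong[OF op, rotated]) (auto simp: eq inj)
    qed
    then show ?thesis using op by (simp add: smooth_on_def)
  qed
  moreover have "continuous_on UNIV (\<lambda>x. F (x, y))"
    by (rule continuous_on_compose2[of UNIV F]) (use F in \<open>auto simp: smooth_map_def intro!: continuous_intros\<close>)
  ultimately show ?thesis by (auto simp: smooth_map_def)
qed

lemma (in lie_group) smooth_right_translation: "smooth_map A A (\<lambda>x. x \<otimes> g)"
proof -
  obtain U \<phi> where "(U, \<phi>) \<in> A" "g \<in> U"
    using smooth_atlas_cover[OF atlas] .
  moreover have "inj_on \<phi> U" using calculation atlas is_chart_inj by (auto simp: smooth_atlas_def)
  ultimately show ?thesis
    using smooth_map_slice[OF atlas smooth_mult] by auto
qed

lemma (in lie_supergroup) smooth_Ad: "smooth_map A std_atlas (\<lambda>g. Ad g Y)"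
  using smooth_map_slice[OF atlas Ad_smooth, of UNIV "\<lambda>x. x" Y] by (auto simp: std_atlas_def)

section \<open>Inner products, matrix coefficients and the weak bracket relation\<close>

lemma cinner_add_right: "cinner x (y + z) = cinner x y + cinner x (z::'a::complex_hilbert_space)"
  by (metis cinner_add_left cinner_commute complex_cnj_add)

lemma cinner_scaleR_left: "cinner (r *\<^sub>R x) y = r * cinner x (y::'a::complex_hilbert_space)"
  by (metis cinner_scaleC_left scaleC_of_real)

lemma cinner_scaleR_right: "cinner x (r *\<^sub>R y) = r * cinner x (y::'a::complex_hilbert_space)"
  by (metis cinner_commute cinner_scaleR_left complex_cnj_complex_of_real complex_cnj_mult)

lemma Re_cinner_self: "Re (cinner x x) = (norm (x::'a::complex_hilbert_space))\<^sup>2"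
  by (simp add: cinner_self)

lemma Re_cinner_commute: "Re (cinner x y) = Re (cinner y (x::'a::complex_hilbert_space))"
  by (subst cinner_commute) simp

text \<open>For a unit vector \<open>x\<close> the triangle inequality confines
  \<open>norm (x + w)\<close> between \<open>\<bar>1 - norm w\<bar>\<close> and
  \<open>1 + norm w\<close>; squaring and expanding bounds the mixed term
  \<open>Re (cinner x w)\<close>.\<close>

lemma bounded_linear_Re_cinner: "bounded_linear (\<lambda>x. Re (cinner x (w::'a::complex_hilbert_space)))"
proof (rule bounded_linear_intro)
  have add: "Re (cinner (x + y) (x + y)) = Re (cinner x x) + 2 * Re (cinner x y) + Re (cinner y y)"
    for x y :: 'a
    by (simp add: cinner_add_left cinner_add_right Re_cinner_commute[of y x])
  have scale: "Re (cinner (r *\<^sub>R x) y) = r * Re (cinner x y)" for r x and y :: 'a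
    by (simp add: cinner_scaleR_left)
  have key: "\<bar>Re (cinner x w)\<bar> \<le> 1 + norm w" if "norm x = 1" for x
  proof -
    have "(norm (x + w))\<^sup>2 = 1 + 2 * Re (cinner x w) + (norm w)\<^sup>2"
      using add[of x w] that by (simp add: Re_cinner_self)
    moreover have "norm (x + w) \<le> 1 + norm w" "norm w - 1 \<le> norm (x + w)"
      "1 - norm w \<le> norm (x + w)"
      using that norm_triangle_ineq[of x w] norm_triangle_ineq2[of w "-x"] norm_triangle_ineq2[of x "-w"]
      by (auto simp: add.commute)
    then have "(norm (x + w))\<^sup>2 \<le> (1 + norm w)\<^sup>2" "(1 - norm w)\<^sup>2 \<le> (norm (x + w))\<^sup>2"
      by (auto intro!: power_mono simp: abs_le_square_iff[symmetric])
    ultimately show ?thesis by (auto simp: power2_eq_square algebra_simps)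
  qed
  fix x y r
  show "Re (cinner (x + y) w) = Re (cinner x w) + Re (cinner y w)" by (simp add: cinner_add_left)
  show "Re (cinner (r *\<^sub>R x) w) = r *\<^sub>R Re (cinner x w)" by (simp add: scale)
  show "norm (Re (cinner x w)) \<le> norm x * (1 + norm w)"
  proof (cases "x = 0")
    case True
    then show ?thesis using scale[of 0 x w] by simp
  next
    case False
    have "Re (cinner x w) = norm x * Re (cinner (x /\<^sub>R norm x) w)"
      using False by (simp add: scale)
    then show ?thesis using key[of "x /\<^sub>R norm x"] False by (simp add: abs_mult)
  qed
qed

context real_lie_superalgebra
begin

lemma br_linear: "linear (br x)" "linear (\<lambda>x. br x y)"
  using bilinear by (auto simp: bilinear_def)

lemmas br_simps =
  linear_add[OF br_linear(1)] linear_scale[OF br_linear(1)] linear_0[OF br_linear(1)]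
  linear_add[OF br_linear(2)] linear_scale[OF br_linear(2)] linear_0[OF br_linear(2)]
  linear_diff[OF br_linear(1)] linear_diff[OF br_linear(2)]
  linear_neg[OF br_linear(1)] linear_neg[OF br_linear(2)]

end

context unitary_representation
begin

abbreviation "Hinf \<equiv> smooth_vectors A \<pi>"

lemma pi_inj: "inj (\<pi> g)"
proof (rule injI)
  fix x y assume *: "\<pi> g x = \<pi> g y"
  have "\<pi> g (x - y) + \<pi> g y = \<pi> g x" by (metis diff_add_cancel pi_linear(1))
  then have "\<pi> g (x - y) = 0" using * by simp
  then have "cinner (x - y) (x - y) = cinner 0 (0::'h)" by (metis pi_unitary(2))
  then show "x = y" by (simp add: cinner_self)
qed

text \<open>The orbit map of \<open>\<pi> g v\<close> is the orbit map of \<open>v\<close> after a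
  right translation by \<open>g\<close>.\<close>

lemma smooth_pi: "v \<in> Hinf \<Longrightarrow> \<pi> g v \<in> Hinf"
  using smooth_map_compose_std[OF atlas atlas smooth_right_translation, of "\<lambda>g. \<pi> g v" g]
  by (simp add: smooth_vectors_def pi_hom)

lemma smooth_matrix_coefficient: "v \<in> Hinf \<Longrightarrow> (\<lambda>g. Re (cinner (\<pi> g v) w)) \<in> smooth_fun A"
  unfolding smooth_fun_def smooth_vectors_def
  using smooth_map_bounded_linear[OF _ bounded_linear_Re_cinner] by blast

lemma smooth_Ad_coordinate: "(\<lambda>g. Ad g Y \<bullet> b) \<in> smooth_fun A"
  unfolding smooth_fun_def
  using smooth_map_bounded_linear[OF smooth_Ad bounded_linear_inner_left] by blast

text \<open>The right side is computed along the curve that \<open>rho_even\<close> supplies for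
  \<open>v\<close>, while the left side mentions no curve. The identity can therefore be used along
  any other curve with velocity \<open>\<iota> X\<close>.\<close>

lemma matrix_coefficient_derivative:
  assumes "X \<in> g0" "v \<in> Hinf"
  shows "\<iota> X (\<lambda>g. Re (cinner (\<pi> g v) w)) \<one> = Re (cinner (\<rho> X v) w)"
proof -
  obtain \<gamma> where \<gamma>: "\<forall>f\<in>smooth_fun A. ((\<lambda>t::real. f (\<gamma> t)) has_real_derivative \<iota> X f \<one>) (at 0)"
    "((\<lambda>t. \<pi> (\<gamma> t) v) has_vector_derivative \<rho> X v) (at 0)"
    using rho_even[OF assms] unfolding has_differential_at_one_def by blast
  have "((\<lambda>t. Re (cinner (\<pi> (\<gamma> t) v) w)) has_real_derivative Re (cinner (\<rho> X v) w)) (at 0)"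
    using bounded_linear.has_vector_derivative[OF bounded_linear_Re_cinner \<gamma>(2)]
    by (simp add: has_real_derivative_iff_has_vector_derivative)
  moreover have "((\<lambda>t. Re (cinner (\<pi> (\<gamma> t) v) w)) has_real_derivative
      \<iota> X (\<lambda>g. Re (cinner (\<pi> g v) w)) \<one>) (at 0)"
    using \<gamma>(1)[rule_format, OF smooth_matrix_coefficient[OF assms(2)]] .
  ultimately show ?thesis using DERIV_unique by blast
qed

lemma Ad_coordinate_derivative:
  assumes "X \<in> g0"
  shows "\<iota> X (\<lambda>g. Ad g Y \<bullet> b) \<one> = br X Y \<bullet> b"
proof -
  obtain \<gamma> where \<gamma>: "\<forall>f\<in>smooth_fun A. ((\<lambda>t::real. f (\<gamma> t)) has_real_derivative \<iota> X f \<one>) (at 0)"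
    "((\<lambda>t. Ad (\<gamma> t) Y) has_vector_derivative br X Y) (at 0)"
    using Ad_differential[OF assms] unfolding has_differential_at_one_def by blast
  have "((\<lambda>t. Ad (\<gamma> t) Y \<bullet> b) has_real_derivative br X Y \<bullet> b) (at 0)"
    using bounded_linear.has_vector_derivative[OF bounded_linear_inner_left \<gamma>(2)]
    by (simp add: has_real_derivative_iff_has_vector_derivative)
  moreover have "((\<lambda>t. Ad (\<gamma> t) Y \<bullet> b) has_real_derivative \<iota> X (\<lambda>g. Ad g Y \<bullet> b) \<one>) (at 0)"
    using \<gamma>(1)[rule_format, OF smooth_Ad_coordinate] .
  ultimately show ?thesis using DERIV_unique by blast
qed

lemma rho_zero_left: "v \<in> Hinf \<Longrightarrow> \<rho> 0 v = 0"
  using rho_real_linear[of v 0 0 0 0] by simp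

lemma rho_add_left: "v \<in> Hinf \<Longrightarrow> \<rho> (X + Y) v = \<rho> X v + \<rho> Y v"
  using rho_real_linear[of v 1 X 1 Y] by simp

lemma rho_scale_left: "v \<in> Hinf \<Longrightarrow> \<rho> (a *\<^sub>R X) v = a *\<^sub>R \<rho> X v"
  using rho_real_linear[of v a X 0 X] by simp

lemma rho_sum_left:
  assumes v: "v \<in> Hinf"
  shows "finite S \<Longrightarrow> \<rho> (\<Sum>i\<in>S. a i *\<^sub>R X i) v = (\<Sum>i\<in>S. a i *\<^sub>R \<rho> (X i) v)"
proof (induction S rule: finite_induct)
  case empty
  show ?case by (simp add: rho_zero_left v)
next
  case (insert x S)
  then show ?case by (simp add: rho_add_left rho_scale_left v)
qed

text \<open>This isolates the dependence on \<open>Y\<close> in finitely many scalar coordinates.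
  With \<open>Y = Ad g Z\<close> a function of \<open>g\<close> becomes a finite sum of products of
  smooth functions, and no continuity of \<open>\<rho>\<close> is involved.\<close>

lemma Re_cinner_rho_expand:
  assumes "w \<in> Hinf"
  shows "Re (cinner u (\<rho> Y w)) = (\<Sum>b\<in>Basis. (Y \<bullet> b) * Re (cinner u (\<rho> b w)))"
proof -
  have "\<rho> Y w = (\<Sum>b\<in>Basis. (Y \<bullet> b) *\<^sub>R \<rho> b w)"
    using rho_sum_left[OF assms finite_Basis, of "\<lambda>b. Y \<bullet> b" "\<lambda>b. b"] by (simp add: euclidean_representation)
  then show ?thesis
    by (simp add: Re_cinner_commute[of u] linear_sum[OF bounded_linear.linear[OF bounded_linear_Re_cinner]]
        cinner_scaleR_left)
qed

text \<open>Differentiate \<open>\<langle>\<pi>(g)v, \<rho>(Ad(g)Z)w\<rangle> = \<langle>\<pi>(g)\<rho>(Z)v, w\<rangle>\<close> at the identity. Working with scalar smooth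
  functions on \<open>G\<close> makes the derivative independent of the curve.\<close>

lemma rho_bracket_weak:
  assumes X: "X \<in> g0" and Z: "Z \<in> g1" and v: "v \<in> Hinf" and w: "w \<in> Hinf"
  shows "Re (cinner v (\<rho> (br X Z) w)) + Re (cinner (\<rho> X v) (\<rho> Z w)) = Re (cinner (\<rho> X (\<rho> Z v)) w)"
proof -
  obtain \<gamma> where \<gamma>: "\<gamma> 0 = \<one>"
    "\<And>f. f \<in> smooth_fun A \<Longrightarrow> ((\<lambda>t::real. f (\<gamma> t)) has_real_derivative \<iota> X f \<one>) (at 0)"
    using Ad_differential[OF X] unfolding has_differential_at_one_def by blast
  \<comment> \<open>This is \<open>Re \<langle>\<pi>(g) v, \<rho>(Ad g Z) w\<rangle>\<close>,
    written so that the product rule applies: each factor is a smooth scalar function of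
    \<open>g\<close>, and the vectors \<open>\<rho> b w\<close> are fixed.\<close>
  let ?F = "\<lambda>g. \<Sum>b\<in>Basis. (Ad g Z \<bullet> b) * Re (cinner (\<pi> g v) (\<rho> b w))"
  have F: "?F g = Re (cinner (\<pi> g (\<rho> Z v)) w)" for g
  proof -
    have gZ: "Ad g Z \<in> g1" using Z Ad_graded by blast
    have "?F g = Re (cinner (\<pi> g v) (\<rho> (Ad g Z) w))" by (rule Re_cinner_rho_expand[OF w, symmetric])
    also have "\<dots> = Re (cinner (\<rho> (Ad g Z) (\<pi> g v)) w)"
      by (simp add: rho_symmetric[OF gZ smooth_pi[OF v] w])
    also have "\<rho> (Ad g Z) (\<pi> g v) = \<pi> g (\<rho> Z v)"
      using rho_Ad[OF smooth_pi[OF v], of g Z g] pi_inj by simp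
    finally show ?thesis .
  qed
  have "((\<lambda>t. ?F (\<gamma> t)) has_real_derivative (\<Sum>b\<in>Basis.
      (br X Z \<bullet> b) * Re (cinner v (\<rho> b w)) + Re (cinner (\<rho> X v) (\<rho> b w)) * (Z \<bullet> b))) (at 0)"
  proof (rule DERIV_sum)
    fix b
    have "((\<lambda>t. Ad (\<gamma> t) Z \<bullet> b) has_real_derivative br X Z \<bullet> b) (at 0)"
      using \<gamma>(2)[OF smooth_Ad_coordinate] Ad_coordinate_derivative[OF X] by simp
    moreover have "((\<lambda>t. Re (cinner (\<pi> (\<gamma> t) v) (\<rho> b w))) has_real_derivative
        Re (cinner (\<rho> X v) (\<rho> b w))) (at 0)"
      using \<gamma>(2)[OF smooth_matrix_coefficient[OF v]] matrix_coefficient_derivative[OF X v] by simp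
    from DERIV_mult[OF calculation this] show "((\<lambda>t. (Ad (\<gamma> t) Z \<bullet> b) * Re (cinner (\<pi> (\<gamma> t) v) (\<rho> b w))) has_real_derivative
      (br X Z \<bullet> b) * Re (cinner v (\<rho> b w)) + Re (cinner (\<rho> X v) (\<rho> b w)) * (Z \<bullet> b)) (at 0)"
      by (simp add: \<gamma>(1) Ad_one pi_hom)
  qed
  moreover have "((\<lambda>t. ?F (\<gamma> t)) has_real_derivative Re (cinner (\<rho> X (\<rho> Z v)) w)) (at 0)"
    unfolding F
    using \<gamma>(2)[OF smooth_matrix_coefficient[OF rho_closed[OF v]]]
      matrix_coefficient_derivative[OF X rho_closed[OF v]] by simp
  ultimately have "(\<Sum>b\<in>Basis. (br X Z \<bullet> b) * Re (cinner v (\<rho> b w)) + Re (cinner (\<rho> X v) (\<rho> b w)) * (Z \<bullet> b))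
      = Re (cinner (\<rho> X (\<rho> Z v)) w)"
    using DERIV_unique by blast
  then show ?thesis
    by (simp add: sum.distrib Re_cinner_rho_expand[OF w, of _ "br X Z"] Re_cinner_rho_expand[OF w, of _ Z]
        mult.commute)
qed

section \<open>Kernel elements and the ideal they generate\<close>

definition ker :: "'a \<Rightarrow> bool" where "ker X \<longleftrightarrow> (\<forall>v\<in>Hinf. \<rho> X v = 0)"

lemma rho_zero_right: "\<rho> X 0 = 0" if "v \<in> Hinf"
proof -
  have z: "(0::complex) *\<^sub>C x = 0" for x :: 'h using scaleC_of_real[of 0 x] by simp
  show ?thesis using rho_complex_linear(2)[OF that, of X 0] by (simp add: z)
qed

lemma cinner_zero_left [simp]: "cinner 0 (x::'h) = 0"
  using cinner_scaleR_left[of 0 0 x] by simp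

lemma cinner_zero_right [simp]: "cinner (x::'h) 0 = 0"
  using cinner_scaleR_right[of x 0 0] by simp

text \<open>In the weak relation take \<open>v = \<rho>([X, Z]) w\<close>. If \<open>X\<close> or
  \<open>Z\<close> is in the kernel, the other two terms vanish and the norm of \<open>v\<close> is
  zero.\<close>

lemma ker_bracket:
  assumes "X \<in> g0" "Z \<in> g1" "ker X \<or> ker Z"
  shows "ker (br X Z)"
  unfolding ker_def
proof
  fix w assume w: "w \<in> Hinf"
  let ?v = "\<rho> (br X Z) w"
  have v: "?v \<in> Hinf" by (rule rho_closed[OF w])
  have "Re (cinner ?v ?v) = 0"
    using rho_bracket_weak[OF assms(1,2) v w] assms(3) v w rho_closed[OF v] rho_zero_right[OF v]
    by (auto simp: ker_def)
  then show "?v = 0" by (simp add: Re_cinner_self)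
qed

lemma rho_odd_bracket:
  assumes "X \<in> g1" "Y \<in> g1" "v \<in> Hinf"
  shows "\<rho> (br X Y) v = \<i> *\<^sub>C (\<rho> X (\<rho> Y v) + \<rho> Y (\<rho> X v))"
proof -
  have "1 *\<^sub>C x = x" for x :: 'h using scaleC_of_real[of 1 x] by simp
  then show ?thesis by (simp add: rho_odd[OF assms] scaleC_scaleC)
qed

lemma ker_odd_bracket:
  assumes "X \<in> g1" "Y \<in> g1" "ker X"
  shows "ker (br X Y)"
  unfolding ker_def
proof
  fix v assume v: "v \<in> Hinf"
  have z: "\<i> *\<^sub>C 0 = (0::'h)" using scaleC_add_right[of \<i> "0::'h" 0] by simp
  show "\<rho> (br X Y) v = 0"
    unfolding rho_odd_bracket[OF assms(1,2) v]
    using assms(3) v rho_closed[OF v] rho_zero_right[OF v] by (simp add: ker_def z)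
qed

lemma subspace_ker: "subspace {X. ker X}"
  by (auto simp: subspace_def ker_def rho_zero_left rho_add_left rho_scale_left)

text \<open>The odd kernel elements \<open>K\<close> generate the ideal \<open>S + K\<close>, where
  \<open>S\<close> is spanned by the brackets of \<open>K\<close> with odd elements: brackets of
  \<open>g0\<close> with \<open>K\<close> and of \<open>S\<close> with \<open>g1\<close> fall into
  \<open>K\<close> by \<open>ker_bracket\<close>, and those of \<open>g0\<close> with
  \<open>S\<close> stay in \<open>S\<close>. Using all even kernel elements in place of
  \<open>S\<close> would call for a bracket relation between two even operators.\<close>

lemma rho_trivial:
  assumes simple: "simple_superalgebra g0 g1 br" and x: "x \<in> g1" "x \<noteq> 0" "ker x"
  shows "ker X"
proof -
  define K where "K = {X \<in> g1. ker X}"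
  define S where "S = span {br k z | k z. k \<in> K \<and> z \<in> g1}"
  define I where "I = {a + b | a b. a \<in> S \<and> b \<in> K}"
  have K: "subspace K"
    unfolding K_def using subspace_inter[OF subspace_odd subspace_ker] by (simp add: Int_def)
  have gen: "br k z \<in> g0 \<inter> {X. ker X}" if "k \<in> K" "z \<in> g1" for k z
    using that ker_odd_bracket graded by (auto simp: K_def)
  have S: "S \<subseteq> g0 \<inter> {X. ker X}"
    unfolding S_def by (rule span_minimal) (use gen subspace_even subspace_ker subspace_inter in blast)+
  have sS: "subspace S" by (simp add: S_def)
  \<comment> \<open>The Jacobi identity moves \<open>y\<close> into one of the two factors of
    \<open>[k, z]\<close>; one summand has its first factor replaced by \<open>[y, k]\<close>, again
    in \<open>K\<close>, the other has \<open>[y, z]\<close>, again odd.\<close>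
  have Sg0: "br y s \<in> S" if "s \<in> S" "y \<in> g0" for s y
    using that(1) unfolding S_def
  proof (induction rule: span_induct_alt)
    case base
    then show ?case using br_simps by (simp add: span_zero)
  next
    case (step c u s)
    then obtain k z where kz: "k \<in> K" "z \<in> g1" "u = br k z" by auto
    have k: "k \<in> g1" using kz K_def by auto
    have "br y k \<in> K" using kz(1) that(2) graded ker_bracket by (auto simp: K_def)
    moreover have "br y z \<in> g1" using that(2) kz(2) graded by auto
    ultimately have "br (br y k) z \<in> span {br k z | k z. k \<in> K \<and> z \<in> g1}"
      "br k (br y z) \<in> span {br k z | k z. k \<in> K \<and> z \<in> g1}"
      using kz by (auto intro!: span_base)
    then have "br y u \<in> span {br k z | k z. k \<in> K \<and> z \<in> g1}"
      using super_jacobi(1)[OF that(2), of k z] kz k by (simp add: span_add)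
    then show ?case using step by (auto simp: br_simps intro!: span_add span_scale)
  qed
  have Sg1: "br s z \<in> K \<and> br z s \<in> K" if "s \<in> S" "z \<in> g1" for s z
  proof -
    have "s \<in> g0" "ker s" using that S by auto
    then have "br s z \<in> K" using that ker_bracket graded(2) by (simp add: K_def)
    moreover have "br z s = - br s z" using super_antisym(1)[of s z] that S by auto
    ultimately show ?thesis using subspace_neg[OF K] by auto
  qed
  have inI: "a \<in> I" if "a \<in> S \<or> a \<in> K" for a
    using that subspace_0[OF K] subspace_0[OF sS] unfolding I_def by force
  have I: "subspace I" unfolding I_def by (rule subspace_sums[OF sS K])
  have hom: "br y u \<in> I \<and> br u y \<in> I" if yu: "y \<in> g0 \<union> g1" "u \<in> S \<or> u \<in> K" for y u
  proof -
    consider "y \<in> g0" "u \<in> S" | "y \<in> g0" "u \<in> K" | "y \<in> g1" "u \<in> S" | "y \<in> g1" "u \<in> K"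
      using yu by blast
    then show ?thesis
    proof cases
      case 1
      then show ?thesis using Sg0[of u y] inI super_antisym(1)[of u y] S subspace_neg[OF I] by (metis IntE UnI1 subsetD)
    next
      case 2
      then have "br y u \<in> K" using graded ker_bracket by (auto simp: K_def)
      moreover have "br u y = - br y u" using super_antisym(1)[of y u] 2 by (auto simp: K_def)
      ultimately show ?thesis using inI subspace_neg[OF I] by auto
    next
      case 3
      then show ?thesis using Sg1 inI by blast
    next
      case 4
      then have "br u y \<in> S" unfolding S_def by (auto intro!: span_base)
      moreover have "br y u = br u y" using super_antisym(2) 4 by (auto simp: K_def)
      ultimately show ?thesis using inI by auto
    qed
  qed
  have "super_ideal g0 g1 br I"
    unfolding super_ideal_def
  proof (intro conjI allI ballI)
    show "subspace I" by (rule I)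
    show "I = {x + y | x y. x \<in> I \<inter> g0 \<and> y \<in> I \<inter> g1}"
    proof (intro equalityI subsetI)
      fix z assume "z \<in> I"
      then obtain a b where "a \<in> S" "b \<in> K" "z = a + b" unfolding I_def by auto
      then show "z \<in> {x + y | x y. x \<in> I \<inter> g0 \<and> y \<in> I \<inter> g1}" using inI S K_def by blast
    next
      fix z assume "z \<in> {x + y | x y. x \<in> I \<inter> g0 \<and> y \<in> I \<inter> g1}"
      then show "z \<in> I" using subspace_add[OF I] by auto
    qed
    fix x y assume "y \<in> I"
    then obtain a b where ab: "a \<in> S" "b \<in> K" "y = a + b" unfolding I_def by auto
    obtain p q where pq: "p \<in> g0" "q \<in> g1" "x = p + q" using direct_sum(2) by blast
    show "br x y \<in> I"
      using hom ab pq by (auto simp: br_simps intro!: subspace_add[OF I])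
    show "br y x \<in> I"
      using hom ab pq by (auto simp: br_simps intro!: subspace_add[OF I])
  qed
  moreover have "x \<in> I" using x inI by (auto simp: K_def)
  ultimately have "I = UNIV" using simple x(2) unfolding simple_superalgebra_def by blast
  then have "X \<in> I" by simp
  then obtain a b where "a \<in> S" "b \<in> K" "X = a + b" unfolding I_def by auto
  then show ?thesis using S subspace_add[OF subspace_ker] by (auto simp: K_def)
qed

text \<open>Pairing \<open>-\<i> \<rho>(0) v = 0\<close> with \<open>v\<close> gives
  \<open>\<Sum> 2 u_i \<parallel>\<rho>(x_i) v\<parallel>^2 = 0\<close>. All summands are
  nonnegative, so each one with positive weight forces \<open>\<rho>(x_i) v = 0\<close>.\<close>

lemma rho_square_convex:
  assumes "finite S" "\<And>i. i \<in> S \<Longrightarrow> x i \<in> g1 \<and> 0 \<le> u i" "(\<Sum>i\<in>S. u i *\<^sub>R br (x i) (x i)) = 0" "j \<in> S" "u j > 0"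
  shows "ker (x j)"
  unfolding ker_def
proof
  fix v assume v: "v \<in> Hinf"
  have "Re (cinner ((-\<i>) *\<^sub>C \<rho> (br (x i) (x i)) v) v) = 2 * (norm (\<rho> (x i) v))\<^sup>2" if "i \<in> S" for i
  proof -
    have xi: "x i \<in> g1" using assms(2)[OF that] by simp
    show ?thesis
      unfolding rho_odd[OF xi xi v, symmetric]
      using rho_symmetric[OF xi rho_closed[OF v] v] by (simp add: cinner_add_left Re_cinner_self cinner_self)
  qed
  moreover have "(\<Sum>i\<in>S. u i * Re (cinner ((-\<i>) *\<^sub>C \<rho> (br (x i) (x i)) v) v)) = 0"
  proof -
    have "0 = Re (cinner ((-\<i>) *\<^sub>C (\<Sum>i\<in>S. u i *\<^sub>R \<rho> (br (x i) (x i)) v)) v)"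
      using rho_sum_left[OF v assms(1), of u "\<lambda>i. br (x i) (x i)"] assms(3) v
      by (simp add: rho_zero_left cinner_scaleC_left)
    also have "\<dots> = (\<Sum>i\<in>S. u i * Re (cinner ((-\<i>) *\<^sub>C \<rho> (br (x i) (x i)) v) v))"
      using assms(1)
      by (induction S rule: finite_induct)
        (simp_all add: cinner_scaleC_left cinner_add_left cinner_scaleR_left algebra_simps)
    finally show ?thesis by simp
  qed
  ultimately have "(\<Sum>i\<in>S. u i * (2 * (norm (\<rho> (x i) v))\<^sup>2)) = 0" by simp
  then have "u j * (2 * (norm (\<rho> (x j) v))\<^sup>2) = 0"
    using sum_nonneg_0[OF assms(1) _ _ assms(4), of "\<lambda>i. u i * (2 * (norm (\<rho> (x i) v))\<^sup>2)"] assms(2) by simp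
  then show "\<rho> (x j) v = 0" using assms(5) by simp
qed

end

text \<open>The unit sphere of the odd part is compact, hence so is the convex hull of the squares
  of its elements. Were \<open>0\<close> outside, a hyperplane would separate it strictly, and its
  normal vector would be a functional positive on all odd squares, by homogeneity. Closedness puts
  \<open>0\<close> into the hull itself, so that a finite convex combination is available.\<close>

lemma zero_in_square_hull:
  fixes br :: "'a::euclidean_space \<Rightarrow> 'a \<Rightarrow> 'a"
  assumes "subspace g1" "bilinear br" "\<And>f. linear f \<Longrightarrow> \<exists>x\<in>g1. x \<noteq> 0 \<and> f (br x x) \<le> (0::real)"
  shows "0 \<in> convex hull ((\<lambda>x. br x x) ` (g1 \<inter> sphere 0 1))"
proof (rule ccontr)
  let ?K = "(\<lambda>x. br x x) ` (g1 \<inter> sphere 0 1)"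
  assume 0: "0 \<notin> convex hull ?K"
  have lin: "linear (br x)" "linear (\<lambda>x. br x y)" for x y using assms(2) by (auto simp: bilinear_def)
  have bb: "bounded_bilinear br" using assms(2) by (simp add: bilinear_conv_bounded_bilinear)
  have "continuous_on (g1 \<inter> sphere 0 1) (\<lambda>x. br x x)"
    by (rule bounded_bilinear.continuous_on[OF bb continuous_on_id continuous_on_id])
  moreover have "compact (g1 \<inter> sphere (0::'a) 1)"
    using closed_subspace[OF assms(1)] by (intro closed_Int_compact) auto
  ultimately have "compact (convex hull ?K)"
    by (intro compact_convex_hull compact_continuous_image)
  then obtain a b where ab: "0 < b" "\<And>x. x \<in> convex hull ?K \<Longrightarrow> b < inner a x"
    using separating_hyperplane_closed_0[OF convex_convex_hull compact_imp_closed 0] by blast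
  obtain x where x: "x \<in> g1" "x \<noteq> 0" "a \<bullet> br x x \<le> 0"
    using assms(3)[OF bounded_linear.linear[OF bounded_linear_inner_right[of a]]] by auto
  have "br (x /\<^sub>R norm x) (x /\<^sub>R norm x) \<in> convex hull ?K"
    using x assms(1) by (intro hull_inc imageI) (simp add: subspace_scale)
  then have "0 < a \<bullet> br (x /\<^sub>R norm x) (x /\<^sub>R norm x)" using ab by fastforce
  also have "\<dots> = (inverse (norm x))\<^sup>2 * (a \<bullet> br x x)"
    by (simp add: linear_scale[OF lin(1)] linear_scale[OF lin(2)] power2_eq_square)
  also have "\<dots> \<le> 0" using x by (simp add: mult_nonneg_nonpos)
  finally show False by simp
qed

text \<open>The interface between the analysis and the structure theory: it involves only the odd
  part and the bracket. Its negation provides a functional \<open>f\<close> for which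
  \<open>f([x, y])\<close> is a positive definite symmetric form on the odd part.\<close>

definition nondefinite :: "'a::euclidean_space set \<Rightarrow> ('a \<Rightarrow> 'a \<Rightarrow> 'a) \<Rightarrow> bool" where
  "nondefinite g1 br \<longleftrightarrow> (\<forall>f. linear f \<longrightarrow> (\<exists>x\<in>g1. x \<noteq> 0 \<and> f (br x x) \<le> (0::real)))"

lemma (in unitary_representation) rho_trivial_if_nondefinite:
  assumes simple: "simple_superalgebra g0 g1 br"
    and nondef: "nondefinite g1 br"
  shows "\<forall>X. \<forall>v\<in>smooth_vectors A \<pi>. \<rho> X v = 0"
proof -
  from zero_in_square_hull[OF subspace_odd bilinear nondef[unfolded nondefinite_def, rule_format]]
  obtain S u where S: "finite S" "S \<subseteq> (\<lambda>x. br x x) ` (g1 \<inter> sphere 0 1)" "\<And>y. y \<in> S \<Longrightarrow> 0 \<le> u y"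
    "sum u S = 1" "(\<Sum>y\<in>S. u y *\<^sub>R y) = 0"
    unfolding convex_hull_explicit mem_Collect_eq by blast
  have "\<forall>y\<in>S. \<exists>x. x \<in> g1 \<inter> sphere 0 1 \<and> br x x = y" using S(2) by fast
  then obtain x where x: "\<And>y. y \<in> S \<Longrightarrow> x y \<in> g1 \<inter> sphere 0 1 \<and> br (x y) (x y) = y"
    by (auto dest!: bchoice)
  obtain j where j: "j \<in> S" "u j > 0"
    using S(3,4) by (metis less_eq_real_def sum.neutral zero_neq_one)
  have "ker (x j)"
    using rho_square_convex[of S x u j] x S j by simp
  moreover have "x j \<in> g1" "x j \<noteq> 0" using x[OF j(1)] by auto
  ultimately show ?thesis using rho_trivial[OF simple] unfolding ker_def by blast
qed

lemma nondefinite_if_square_zero: "x \<in> g1 \<Longrightarrow> x \<noteq> 0 \<Longrightarrow> br x x = 0 \<Longrightarrow> nondefinite g1 br"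
  unfolding nondefinite_def by (metis linear_0 order_refl)

section \<open>Matrix superalgebras\<close>

lemma mat_even_carrier [simp]: "mat_even m n X \<in> carrier_mat (m + n) (m + n)"
  and mat_odd_carrier [simp]: "mat_odd m n X \<in> carrier_mat (m + n) (m + n)"
  by (simp_all add: mat_even_def mat_odd_def)

lemma mat_even_odd_dim [simp]:
  "dim_row (mat_even m n X) = m + n" "dim_col (mat_even m n X) = m + n"
  "dim_row (mat_odd m n X) = m + n" "dim_col (mat_odd m n X) = m + n"
  by (simp_all add: mat_even_def mat_odd_def)

lemma mat_even_add:
  "X \<in> carrier_mat (m + n) (m + n) \<Longrightarrow> Y \<in> carrier_mat (m + n) (m + n) \<Longrightarrow>
    mat_even m n (X + Y) = mat_even m n X + mat_even m n (Y :: 'k::ring_1 mat)"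
  by (rule eq_matI) (auto simp: mat_even_def)

lemma mat_odd_add:
  "X \<in> carrier_mat (m + n) (m + n) \<Longrightarrow> Y \<in> carrier_mat (m + n) (m + n) \<Longrightarrow>
    mat_odd m n (X + Y) = mat_odd m n X + mat_odd m n (Y :: 'k::ring_1 mat)"
  by (rule eq_matI) (auto simp: mat_odd_def)

lemma mat_odd_entry:
  assumes "mat_odd m n X = X" "i < m + n" "j < m + n" "(i < m) = (j < m)"
  shows "X $$ (i, j) = 0"
proof -
  have "mat_odd m n X $$ (i, j) = 0" using assms(2-4) by (simp add: mat_odd_def)
  then show ?thesis by (simp only: assms(1))
qed

lemma mat_even_entry:
  assumes "mat_even m n X = X" "i < m + n" "j < m + n" "(i < m) \<noteq> (j < m)"
  shows "X $$ (i, j) = 0"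
proof -
  have "mat_even m n X $$ (i, j) = 0" using assms(2-4) by (simp add: mat_even_def)
  then show ?thesis by (simp only: assms(1))
qed

lemma mat_even_of_odd: "mat_odd m n X = X \<Longrightarrow> mat_even m n X = 0\<^sub>m (m + n) (m + n)"
  by (rule eq_matI) (auto simp: mat_even_def mat_odd_entry)

lemma supercommutator_odd:
  fixes X :: "'k::ring_1 mat"
  assumes "mat_odd m n X = X" "mat_odd m n Y = Y"
  shows "supercommutator (*) (+) (-) (mat_even m n) (mat_odd m n) X Y = X * Y + Y * X"
proof -
  have "X \<in> carrier_mat (m + n) (m + n)" "Y \<in> carrier_mat (m + n) (m + n)"
    using assms mat_odd_carrier by metis+
  then show ?thesis
    by (intro eq_matI) (simp_all add: supercommutator_def assms mat_even_of_odd left_mult_zero_mat[where n = "m + n" and nc = "m + n"] right_mult_zero_mat[where n = "m + n" and nr = "m + n"] del: index_mult_mat(1))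
qed

text \<open>Central elements need not be homogeneous. Comparing diagonal and off-diagonal blocks in
  \<open>[z, X] = 0\<close> shows that the even part of \<open>z\<close> commutes with
  \<open>X\<close> and the odd part anticommutes with it; then all mixed terms of
  \<open>[X + z, X + z']\<close> cancel.\<close>

lemma supercommutator_central:
  fixes X z z' :: "'k::ring_1 mat" and m n :: nat
  defines "sc \<equiv> supercommutator (*) (+) (-) (mat_even m n) (mat_odd m n)"
  assumes X: "mat_odd m n X = X" "X * X = 0\<^sub>m (m + n) (m + n)"
    and z: "z \<in> carrier_mat (m + n) (m + n)" "z' \<in> carrier_mat (m + n) (m + n)"
    and c: "sc z X = 0\<^sub>m (m + n) (m + n)" "sc z' X = 0\<^sub>m (m + n) (m + n)" "sc z z' = 0\<^sub>m (m + n) (m + n)"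
  shows "sc (X + z) (X + z') = 0\<^sub>m (m + n) (m + n)"
proof -
  let ?d = "m + n" let ?e = "mat_even m n" let ?o = "mat_odd m n"
  have Xc: "X \<in> carrier_mat ?d ?d" using X mat_odd_carrier by metis
  have X0: "?e X = 0\<^sub>m ?d ?d" by (rule mat_even_of_odd[OF X(1)])
  have ee: "?e (?e w) = ?e w" and oo: "?o (?o w) = ?o w" for w :: "'k mat"
    by (auto intro!: eq_matI simp: mat_even_def mat_odd_def)
  have comm: "(?e w * X) $$ (i, j) = (X * ?e w) $$ (i, j) \<and> (?o w * X) $$ (i, j) = - (X * ?o w) $$ (i, j)"
    if w: "w \<in> carrier_mat ?d ?d" "sc w X = 0\<^sub>m ?d ?d" and ij: "i < ?d" "j < ?d" for w i j
  proof -
    have eq: "(?e w * X) $$ (i, j) - (X * ?e w) $$ (i, j) + ((?o w * X) $$ (i, j) + (X * ?o w) $$ (i, j)) = 0"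
      using arg_cong[OF w(2), of "\<lambda>M. M $$ (i, j)"] ij Xc X0 w(1)
      by (simp add: sc_def supercommutator_def X(1) left_mult_zero_mat[where n = "m + n" and nc = "m + n"] right_mult_zero_mat[where n = "m + n" and nr = "m + n"] del: index_mult_mat(1))
    show ?thesis
    \<comment> \<open>The product of an even and an odd matrix has zero diagonal blocks, the product
      of two odd ones zero off-diagonal blocks, so only one half of \<open>eq\<close> survives at a
      given entry.\<close>
    proof (cases "(i < m) = (j < m)")
      case True
      have "?e w $$ (i, k) * X $$ (k, j) = 0" "X $$ (i, k) * ?e w $$ (k, j) = 0" if "k < ?d" for k
        using mat_odd_entry[OF X(1)] mat_even_entry[OF ee] ij that True by (metis mult_zero_left mult_zero_right)+
      then have "(?e w * X) $$ (i, j) = 0" "(X * ?e w) $$ (i, j) = 0"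
        using ij Xc by (auto simp: scalar_prod_def intro!: sum.neutral)
      then show ?thesis using eq by (simp add: eq_neg_iff_add_eq_0 del: index_mult_mat(1))
    next
      case False
      have "?o w $$ (i, k) * X $$ (k, j) = 0" "X $$ (i, k) * ?o w $$ (k, j) = 0" if "k < ?d" for k
        using mat_odd_entry[OF X(1)] mat_odd_entry[OF oo] ij that False by (metis mult_zero_left mult_zero_right)+
      then have "(?o w * X) $$ (i, j) = 0" "(X * ?o w) $$ (i, j) = 0"
        using ij Xc by (auto simp: scalar_prod_def intro!: sum.neutral)
      then show ?thesis using eq by (simp add: eq_neg_iff_add_eq_0 del: index_mult_mat(1))
    qed
  qed
  have e: "?e (X + w) = ?e w" and o: "?o (X + w) = X + ?o w" if "w \<in> carrier_mat ?d ?d" for w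
    using that Xc by (simp_all add: mat_even_add mat_odd_add X0 X(1) left_add_zero_mat)
  show ?thesis
  proof (rule eq_matI)
    fix i j assume "i < dim_row (0\<^sub>m ?d ?d :: 'k mat)" "j < dim_col (0\<^sub>m ?d ?d :: 'k mat)"
    then have ij: "i < ?d" "j < ?d" by auto
    have zz: "(?e z * ?e z') $$ (i, j) - (?e z' * ?e z) $$ (i, j) + ((?e z * ?o z') $$ (i, j) - (?o z' * ?e z) $$ (i, j))
      + ((?o z * ?e z') $$ (i, j) - (?e z' * ?o z) $$ (i, j) + ((?o z * ?o z') $$ (i, j) + (?o z' * ?o z) $$ (i, j))) = 0"
      using arg_cong[OF c(3), of "\<lambda>M. M $$ (i, j)"] ij
      by (simp add: sc_def supercommutator_def left_mult_zero_mat[where n = "m + n" and nc = "m + n"] right_mult_zero_mat[where n = "m + n" and nr = "m + n"] del: index_mult_mat(1))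
    have D: "(A * (X + B)) $$ (i, j) = (A * X) $$ (i, j) + (A * B) $$ (i, j)"
      "((X + B) * A) $$ (i, j) = (X * A) $$ (i, j) + (B * A) $$ (i, j)"
      if "A \<in> carrier_mat ?d ?d" "B \<in> carrier_mat ?d ?d" for A B :: "'k mat"
      using that Xc ij by (simp_all add: mult_add_distrib_mat[of _ ?d ?d _ ?d] add_mult_distrib_mat[of _ ?d ?d _ _ ?d] left_mult_zero_mat[where n = "m + n" and nc = "m + n"] right_mult_zero_mat[where n = "m + n" and nr = "m + n"] del: index_mult_mat(1))
    show "sc (X + z) (X + z') $$ (i, j) = 0\<^sub>m ?d ?d $$ (i, j)"
      using comm[OF z(1) c(1) ij] comm[OF z(2) c(2) ij] zz ij z
      by (simp add: sc_def supercommutator_def e o D Xc X(2) left_mult_zero_mat[where n = "m + n" and nc = "m + n"] right_mult_zero_mat[where n = "m + n" and nr = "m + n"] del: index_mult_mat(1))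
  qed (use Xc z in \<open>simp_all add: sc_def supercommutator_def\<close>)
qed

text \<open>\<open>X\<close> represents an odd element of square zero in the quotient. It is nonzero
  there because \<open>Y\<close> shows that \<open>X\<close> is not central.\<close>

lemma iso_mod_center_square_zero:
  fixes g0 g1 :: "'a::euclidean_space set" and S :: "'k::real_algebra_1 mat set"
  assumes iso: "superalgebra_of g0 g1 br \<cong>\<^sub>s sa_mod_center (sa_sub (gl_real m n) S)"
    and S: "S \<subseteq> carrier_mat (m + n) (m + n)" "0\<^sub>m (m + n) (m + n) \<in> S"
    and X: "X \<in> S" "mat_odd m n X = X" "X * X = 0\<^sub>m (m + n) (m + n)"
    and Y: "Y \<in> S" "mat_odd m n Y = Y" "X * Y + Y * X \<noteq> 0\<^sub>m (m + n) (m + n)"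
  shows "nondefinite g1 br"
proof -
  let ?d = "m + n"
  let ?sc = "supercommutator (*) (+) (-) (mat_even m n) (mat_odd m n) :: 'k mat \<Rightarrow> _"
  let ?N = "sa_sub (gl_real m n) S"
  define Z where "Z = sa_center ?N"
  define coset where "coset = (\<lambda>x. (+) x ` Z)"
  have Z: "z \<in> Z \<longleftrightarrow> z \<in> S \<and> (\<forall>x\<in>S. ?sc z x = 0\<^sub>m ?d ?d)" for z
    by (simp add: Z_def sa_center_def sa_sub_def gl_super_def)
  have M: "sa_odd (sa_mod_center ?N) = coset ` (S \<inter> {X \<in> carrier_mat ?d ?d. mat_odd m n X = X})"
    "sa_scale (sa_mod_center ?N) c P = (\<Union>x\<in>P. coset (of_real c \<cdot>\<^sub>m x))"
    "sa_br (sa_mod_center ?N) P Q = (\<Union>x\<in>P. \<Union>y\<in>Q. coset (?sc x y))" for c P Q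
    unfolding Z_def coset_def by (simp_all add: sa_mod_center_def sa_sub_def gl_super_def)
  obtain \<phi> where \<phi>: "sa_iso (superalgebra_of g0 g1 br) (sa_mod_center ?N) \<phi>"
    using iso unfolding sa_isomorphic_def by blast
  then have inj: "inj \<phi>" and scale: "\<And>c x. \<phi> (c *\<^sub>R x) = sa_scale (sa_mod_center ?N) c (\<phi> x)"
    and brk: "\<And>x y. \<phi> (br x y) = sa_br (sa_mod_center ?N) (\<phi> x) (\<phi> y)"
    and odd: "\<phi> ` g1 = sa_odd (sa_mod_center ?N)"
    by (auto simp: sa_iso_def superalgebra_of_def bij_betw_def)
  have 0: "0\<^sub>m ?d ?d \<in> Z"
  proof -
    have "?sc (0\<^sub>m ?d ?d) x = 0\<^sub>m ?d ?d" if "x \<in> S" for x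
    proof -
      have "mat_even m n (0\<^sub>m ?d ?d :: 'k mat) = 0\<^sub>m ?d ?d" "mat_odd m n (0\<^sub>m ?d ?d :: 'k mat) = 0\<^sub>m ?d ?d"
        by (auto intro!: eq_matI simp: mat_even_def mat_odd_def)
      then show ?thesis by (intro eq_matI) (simp_all add: supercommutator_def left_mult_zero_mat[where n = "m + n" and nc = "m + n"] right_mult_zero_mat[where n = "m + n" and nr = "m + n"] del: index_mult_mat(1))
    qed
    then show ?thesis using S by (simp add: Z)
  qed
  have Xc: "X \<in> carrier_mat ?d ?d" using X S by auto
  obtain x where x: "x \<in> g1" "\<phi> x = coset X"
  proof -
    have "coset X \<in> \<phi> ` g1" unfolding odd M using X Xc by blast
    then show thesis using that by blast
  qed
  have Xin: "X \<in> coset X" using imageI[OF 0, of "(+) X"] Xc by (simp add: coset_def right_add_zero_mat)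
  have "\<phi> 0 = coset (0\<^sub>m ?d ?d)"
  proof -
    have "of_real 0 \<cdot>\<^sub>m a = 0\<^sub>m ?d ?d" if "a \<in> coset X" for a
      using that Xc S Z unfolding coset_def by (intro eq_matI) auto
    then show ?thesis using scale[of 0 x] Xin unfolding M x by auto
  qed
  moreover have "\<phi> (br x x) = coset (0\<^sub>m ?d ?d)"
  proof -
    \<comment> \<open>The bracket of two cosets is a union over all pairs of representatives, so
      each pair has to give zero, not only \<open>X\<close> with itself.\<close>
    have "?sc a b = 0\<^sub>m ?d ?d" if "a \<in> coset X" "b \<in> coset X" for a b
    proof -
      obtain z z' where "z \<in> Z" "z' \<in> Z" "a = X + z" "b = X + z'" using \<open>a \<in> _\<close> \<open>b \<in> _\<close> unfolding coset_def by auto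
      then show ?thesis using supercommutator_central[OF X(2,3)] X(1) S(1) unfolding Z by blast
    qed
    then show ?thesis unfolding brk M x using Xin by auto
  qed
  ultimately have "br x x = 0" using inj by (metis injD)
  moreover have "x \<noteq> 0"
  proof
    assume "x = 0"
    then have "X \<in> coset (0\<^sub>m ?d ?d)" using x Xin \<open>\<phi> 0 = _\<close> by simp
    then have "X \<in> Z" using Z S unfolding coset_def by (auto simp: left_add_zero_mat)
    then show False using Y supercommutator_odd[OF X(2) Y(2)] by (simp add: Z)
  qed
  ultimately show ?thesis using x nondefinite_if_square_zero by blast
qed

lemma iso_sub_square_zero:
  fixes g0 g1 :: "'a::euclidean_space set" and S :: "'k::real_algebra_1 mat set"
  assumes iso: "superalgebra_of g0 g1 br \<cong>\<^sub>s sa_sub (gl_real m n) S"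
    and X: "X \<in> S" "mat_odd m n X = X" "X * X = 0\<^sub>m (m + n) (m + n)" "X \<noteq> 0\<^sub>m (m + n) (m + n)"
  shows "nondefinite g1 br"
proof -
  have Xc: "X \<in> carrier_mat (m + n) (m + n)" using X mat_odd_carrier by metis
  obtain \<phi> where \<phi>: "sa_iso (superalgebra_of g0 g1 br) (sa_sub (gl_real m n) S) \<phi>"
    using iso unfolding sa_isomorphic_def by blast
  then have inj: "inj \<phi>" and scale: "\<And>c x. \<phi> (c *\<^sub>R x) = of_real c \<cdot>\<^sub>m \<phi> x"
    and brk: "\<And>x y. \<phi> (br x y) = supercommutator (*) (+) (-) (mat_even m n) (mat_odd m n) (\<phi> x) (\<phi> y)"
    and odd: "\<phi> ` g1 = S \<inter> {X \<in> carrier_mat (m + n) (m + n). mat_odd m n X = X}"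
    by (auto simp: sa_iso_def superalgebra_of_def bij_betw_def sa_sub_def gl_super_def)
  have "X \<in> \<phi> ` g1" unfolding odd using X Xc by blast
  then obtain x where x: "x \<in> g1" "\<phi> x = X" by blast
  have "\<phi> 0 = 0\<^sub>m (m + n) (m + n)"
    using scale[of 0 x] Xc by (auto simp: x intro!: eq_matI)
  note zero = this
  have "\<phi> (br x x) = 0\<^sub>m (m + n) (m + n)"
    using X by (simp add: brk x supercommutator_odd)
  then have "br x x = 0" using injD[OF inj, of "br x x" 0] zero by simp
  moreover have "x \<noteq> 0" using x(2) X(4) zero by auto
  ultimately show ?thesis using nondefinite_if_square_zero[OF x(1)] by blast
qed

section \<open>Off-diagonal block matrices of square zero\<close>

definition odd_block :: "nat \<Rightarrow> nat \<Rightarrow> 'k::ring_1 mat \<Rightarrow> 'k mat \<Rightarrow> 'k mat" where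
  "odd_block m n B C = four_block_mat (0\<^sub>m m m) B C (0\<^sub>m n n)"

lemma odd_block_odd:
  assumes "B \<in> carrier_mat m n" "C \<in> carrier_mat n m"
  shows "mat_odd m n (odd_block m n B C) = odd_block m n B C"
  using assms by (intro eq_matI) (auto simp: mat_odd_def odd_block_def)

lemma odd_block_mult:
  assumes "B \<in> carrier_mat m n" "C \<in> carrier_mat n m" "B' \<in> carrier_mat m n" "C' \<in> carrier_mat n m"
  shows "odd_block m n B C * odd_block m n B' C' = four_block_mat (B * C') (0\<^sub>m m n) (0\<^sub>m n m) (C * B')"
  unfolding odd_block_def using assms
  by (subst mult_four_block_mat[of _ m m _ n _ n _ _ m _ n]) auto

lemma odd_block_zero: "odd_block m n (0\<^sub>m m n) (0\<^sub>m n m) = 0\<^sub>m (m + n) (m + n)"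
  by (simp add: odd_block_def)

lemma odd_block_square_zero:
  assumes "B \<in> carrier_mat m n" "C \<in> carrier_mat n m" "B * C = 0\<^sub>m m m" "C * B = 0\<^sub>m n n"
  shows "odd_block m n B C * odd_block m n B C = 0\<^sub>m (m + n) (m + n)"
  by (simp add: odd_block_mult[OF assms(1,2,1,2)] assms(3,4))

text \<open>In terms of the two off-diagonal blocks, square zero means that both products of
  \<open>B\<close> and \<open>C\<close> vanish. Noncentrality is read off a single entry of the
  upper left block of the anticommutator with the partner.\<close>

lemma iso_mod_center_odd_block:
  fixes S :: "'k::real_algebra_1 mat set"
  assumes iso: "superalgebra_of g0 g1 br \<cong>\<^sub>s sa_mod_center (sa_sub (gl_real m n) S)"
    and S: "S \<subseteq> carrier_mat (m + n) (m + n)" "odd_block m n (0\<^sub>m m n) (0\<^sub>m n m) \<in> S"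
      "odd_block m n B C \<in> S" "odd_block m n B' C' \<in> S"
    and carr: "B \<in> carrier_mat m n" "C \<in> carrier_mat n m" "B' \<in> carrier_mat m n" "C' \<in> carrier_mat n m"
    and sq: "B * C = 0\<^sub>m m m" "C * B = 0\<^sub>m n n"
    and ij: "i < m" "j < m" "(B * C') $$ (i, j) + (B' * C) $$ (i, j) \<noteq> 0"
  shows "nondefinite g1 br"
proof (rule iso_mod_center_square_zero[OF iso S(1) _ S(3) _ _ S(4)])
  show "0\<^sub>m (m + n) (m + n) \<in> S" using S(2) by (simp add: odd_block_zero)
  show "mat_odd m n (odd_block m n B C) = odd_block m n B C"
    "mat_odd m n (odd_block m n B' C') = odd_block m n B' C'"
    using carr odd_block_odd by blast+
  show "odd_block m n B C * odd_block m n B C = 0\<^sub>m (m + n) (m + n)"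
    using carr sq by (intro odd_block_square_zero)
  have "(odd_block m n B C * odd_block m n B' C' + odd_block m n B' C' * odd_block m n B C) $$ (i, j)
      = (B * C') $$ (i, j) + (B' * C) $$ (i, j)"
    using carr ij(1,2) by (simp add: odd_block_mult del: index_mult_mat(1))
  then show "odd_block m n B C * odd_block m n B' C' + odd_block m n B' C' * odd_block m n B C \<noteq> 0\<^sub>m (m + n) (m + n)"
    using ij by auto
qed

text \<open>The rank one matrix \<open>a b^t\<close>. In a product only the pairing of the two inner
  vectors matters, so isotropic vectors produce vanishing products.\<close>

definition outer :: "nat \<Rightarrow> nat \<Rightarrow> (nat \<Rightarrow> 'k) \<Rightarrow> (nat \<Rightarrow> 'k) \<Rightarrow> 'k::comm_ring_1 mat" where
  "outer m n a b = mat m n (\<lambda>(i, j). a i * b j)"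

lemma outer_carrier [simp]: "outer m n a b \<in> carrier_mat m n"
  and outer_entry [simp]: "i < m \<Longrightarrow> j < n \<Longrightarrow> outer m n a b $$ (i, j) = a i * b j"
  and outer_dim [simp]: "dim_row (outer m n a b) = m" "dim_col (outer m n a b) = n"
  by (simp_all add: outer_def)

lemma outer_mult:
  "outer m n a b * outer n k c d = outer m k (\<lambda>i. a i * (\<Sum>j<n. b j * c j)) d"
  by (rule eq_matI)
    (simp_all add: scalar_prod_def sum_distrib_left sum_distrib_right atLeast0LessThan mult.assoc)

definition sg :: "nat \<Rightarrow> nat \<Rightarrow> 'k::comm_ring_1" where "sg p i = (if i < p then 1 else -1)"

lemma Ipq_carrier [simp]: "Ipq p q \<in> carrier_mat (p + q) (p + q)"
  and Ipq_dim [simp]: "dim_row (Ipq p q) = p + q" "dim_col (Ipq p q) = p + q"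
  by (auto simp: Ipq_def diag_block_def)

lemma Ipq_mult_left: "dim_row M = p + q \<Longrightarrow> Ipq p q * M = mat (p + q) (dim_col M) (\<lambda>(i, j). sg p i * M $$ (i, j))"
proof (rule eq_matI)
  fix i j assume M: "dim_row M = p + q"
    and ij: "i < dim_row (mat (p + q) (dim_col M) (\<lambda>(i, j). sg p i * M $$ (i, j)))"
      "j < dim_col (mat (p + q) (dim_col M) (\<lambda>(i, j). sg p i * M $$ (i, j)))"
  have "(Ipq p q * M) $$ (i, j) = (\<Sum>l<p + q. (if l = i then sg p i else 0) * M $$ (l, j))"
    using M ij by (auto simp: scalar_prod_def Ipq_def diag_block_def sg_def atLeast0LessThan intro!: sum.cong)
  also have "\<dots> = sg p i * M $$ (i, j)"
    using ij by (subst sum.remove[of _ i]) auto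
  finally show "(Ipq p q * M) $$ (i, j) = mat (p + q) (dim_col M) (\<lambda>(i, j). sg p i * M $$ (i, j)) $$ (i, j)"
    using ij by simp
qed (auto simp: Ipq_def diag_block_def)

lemma Ipq_mult_right: "dim_col M = p + q \<Longrightarrow> M * Ipq p q = mat (dim_row M) (p + q) (\<lambda>(i, j). M $$ (i, j) * sg p j)"
proof (rule eq_matI)
  fix i j assume M: "dim_col M = p + q"
    and ij: "i < dim_row (mat (dim_row M) (p + q) (\<lambda>(i, j). M $$ (i, j) * sg p j))"
      "j < dim_col (mat (dim_row M) (p + q) (\<lambda>(i, j). M $$ (i, j) * sg p j))"
  have "(M * Ipq p q) $$ (i, j) = (\<Sum>l<p + q. M $$ (i, l) * (if l = j then sg p j else 0))"
    using M ij by (auto simp: scalar_prod_def Ipq_def diag_block_def sg_def atLeast0LessThan intro!: sum.cong)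
  also have "\<dots> = M $$ (i, j) * sg p j"
    using ij by (subst sum.remove[of _ j]) auto
  finally show "(M * Ipq p q) $$ (i, j) = mat (dim_row M) (p + q) (\<lambda>(i, j). M $$ (i, j) * sg p j) $$ (i, j)"
    using ij by simp
qed (auto simp: Ipq_def diag_block_def)

lemma Jmat_carrier [simp]: "Jmat n \<in> carrier_mat (2 * n) (2 * n)"
  and Jmat_dim [simp]: "dim_row (Jmat n) = 2 * n" "dim_col (Jmat n) = 2 * n"
  unfolding Jmat_def by (simp_all add: mult_2)

lemma Jmat_entry: "i < 2 * n \<Longrightarrow> j < 2 * n \<Longrightarrow>
    Jmat n $$ (i, j) = (if i < n then of_bool (j = i + n) else - of_bool (i = j + n))"
  unfolding Jmat_def by (auto simp: mult_2)

lemma Jmat_mult_left: "dim_row M = 2 * n \<Longrightarrow>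
    Jmat n * M = mat (2 * n) (dim_col M) (\<lambda>(i, j). if i < n then M $$ (i + n, j) else - M $$ (i - n, j))"
proof (rule eq_matI)
  let ?R = "mat (2 * n) (dim_col M) (\<lambda>(i, j). if i < n then M $$ (i + n, j) else - M $$ (i - n, j))"
  fix i j assume M: "dim_row M = 2 * n" and ij: "i < dim_row ?R" "j < dim_col ?R"
  let ?l = "if i < n then i + n else i - n"
  have "(Jmat n * M) $$ (i, j) = (\<Sum>l<2 * n. Jmat n $$ (i, l) * M $$ (l, j))"
    using M ij by (simp add: scalar_prod_def atLeast0LessThan)
  also have "\<dots> = Jmat n $$ (i, ?l) * M $$ (?l, j)"
    using ij by (subst sum.remove[of _ ?l]) (auto simp: Jmat_entry of_bool_def intro!: sum.neutral split: if_splits)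
  finally show "(Jmat n * M) $$ (i, j) = ?R $$ (i, j)"
    using ij by (auto simp: Jmat_entry)
qed auto

lemma Jmat_mult_right: "dim_col M = 2 * n \<Longrightarrow>
    M * Jmat n = mat (dim_row M) (2 * n) (\<lambda>(i, j). if j < n then - M $$ (i, j + n) else M $$ (i, j - n))"
proof (rule eq_matI)
  let ?R = "mat (dim_row M) (2 * n) (\<lambda>(i, j). if j < n then - M $$ (i, j + n) else M $$ (i, j - n))"
  fix i j assume M: "dim_col M = 2 * n" and ij: "i < dim_row ?R" "j < dim_col ?R"
  let ?l = "if j < n then j + n else j - n"
  have "(M * Jmat n) $$ (i, j) = (\<Sum>l<2 * n. M $$ (i, l) * Jmat n $$ (l, j))"
    using M ij by (simp add: scalar_prod_def atLeast0LessThan)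
  also have "\<dots> = M $$ (i, ?l) * Jmat n $$ (?l, j)"
    using ij by (subst sum.remove[of _ ?l]) (auto simp: Jmat_entry of_bool_def intro!: sum.neutral split: if_splits)
  finally show "(M * Jmat n) $$ (i, j) = ?R $$ (i, j)"
    using ij by (auto simp: Jmat_entry)
qed auto

lemma is_blocks_odd_block:
  "B \<in> carrier_mat m n \<Longrightarrow> C \<in> carrier_mat n m \<Longrightarrow> is_blocks m n (odd_block m n B C) (0\<^sub>m m m) B C (0\<^sub>m n n)"
  by (simp add: is_blocks_def odd_block_def)

lemma mtrace_zero [simp]: "mtrace (0\<^sub>m m m) = 0"
  by (simp add: mtrace_def)

lemma odd_block_in_sl_set:
  "B \<in> carrier_mat m n \<Longrightarrow> C \<in> carrier_mat n m \<Longrightarrow> odd_block m n B C \<in> sl_set m n"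
  unfolding sl_set_def mem_Collect_eq
  by (rule exI[of _ "0\<^sub>m m m"], rule exI[of _ B], rule exI[of _ C], rule exI[of _ "0\<^sub>m n n"])
    (simp add: is_blocks_odd_block)

lemma sl_set_carrier: "sl_set m n \<subseteq> carrier_mat (m + n) (m + n)"
  unfolding sl_set_def is_blocks_def using four_block_carrier_mat by blast

lemma smult_outer: "c \<cdot>\<^sub>m outer m n a b = outer m n (\<lambda>i. c * a i) b"
  by (rule eq_matI) (auto simp: mult.assoc)

lemma outer_zero_left: "(\<And>i. i < m \<Longrightarrow> a i = 0) \<Longrightarrow> outer m n a b = 0\<^sub>m m n"
  by (rule eq_matI) auto

lemma sum_two_points:
  fixes f :: "nat \<Rightarrow> 'k::comm_ring_1"
  assumes "a < n" "b < n" "a \<noteq> b" "\<And>i. i \<noteq> a \<Longrightarrow> i \<noteq> b \<Longrightarrow> f i = 0"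
  shows "(\<Sum>i<n. f i) = f a + f b"
proof -
  have "(\<Sum>i<n. f i) = (\<Sum>i\<in>{a, b}. f i)"
    by (rule sum.mono_neutral_right) (use assms in auto)
  then show ?thesis using assms(3) by simp
qed

lemma sum_one_point:
  fixes f :: "nat \<Rightarrow> 'k::comm_ring_1"
  assumes "a < n" "\<And>i. i \<noteq> a \<Longrightarrow> f i = 0"
  shows "(\<Sum>i<n. f i) = f a"
proof -
  have "(\<Sum>i<n. f i) = (\<Sum>i\<in>{a}. f i)"
    by (rule sum.mono_neutral_right) (use assms in auto)
  then show ?thesis by simp
qed

abbreviation unit_at :: "nat \<Rightarrow> nat \<Rightarrow> 'k::comm_ring_1" where "unit_at k i \<equiv> of_bool (i = k)"

lemma sum_unit_unit: "(\<Sum>j<n. of_bool (j = a) * of_bool (j = b)) = (of_bool (a = b \<and> a < n) :: 'k::comm_ring_1)" for a b n :: nat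
proof (cases "a = b \<and> a < n")
  case True
  then show ?thesis using sum_one_point[of a n "\<lambda>j. of_bool (j = a) * of_bool (j = b)"] by auto
next
  case False
  then show ?thesis by (auto intro!: sum.neutral)
qed

section \<open>Square-zero odd elements in the matrix families\<close>

lemma nondefinite_sl_real:
  assumes "superalgebra_of g0 g1 br \<cong>\<^sub>s sl_real m n" "0 < m" "0 < n"
  shows "nondefinite g1 br"
  using assms(1) unfolding sl_real_def
proof (rule iso_mod_center_odd_block[OF _ sl_set_carrier])
  \<comment> \<open>Nothing ties the two off-diagonal blocks together here: an element living in the
    upper right block squares to zero, and one in the lower left block shows that it is not
    central.\<close>
  show "odd_block m n (0\<^sub>m m n) (0\<^sub>m n m) \<in> sl_set m n"
    "odd_block m n (outer m n (unit_at 0) (unit_at 0)) (0\<^sub>m n m) \<in> sl_set m n"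
    "odd_block m n (0\<^sub>m m n) (outer n m (unit_at 0) (unit_at 0)) \<in> sl_set m n"
    by (simp_all add: odd_block_in_sl_set)
  show "0 < m" "0 < m" by fact+
  show "(outer m n (unit_at 0) (unit_at 0) * outer n m (unit_at 0) (unit_at 0)) $$ (0, 0)
      + (0\<^sub>m m n * 0\<^sub>m n m) $$ (0, 0) \<noteq> (0 :: real)"
    using assms by (simp add: outer_mult sum_unit_unit del: index_mult_mat(1))
qed simp_all

lemma nondefinite_su:
  assumes "superalgebra_of g0 g1 br \<cong>\<^sub>s su p q r s" "0 < p" "0 < q" "0 < r" "0 < s"
  shows "nondefinite g1 br"
proof -
  let ?m = "p + q" and ?n = "r + s"
  let ?S = "{X \<in> sl_set (p + q) (r + s). \<exists>A B C D. is_blocks (p + q) (r + s) X A B C D \<and>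
        A = - (Ipq p q * mstar A * Ipq p q) \<and> D = - (Ipq r s * mstar D * Ipq r s) \<and>
        B = \<i> \<cdot>\<^sub>m (Ipq p q * mstar C * Ipq r s) \<and> C = \<i> \<cdot>\<^sub>m (Ipq r s * mstar B * Ipq p q)}"
  \<comment> \<open>For \<open>e = 1\<close> and \<open>e = -1\<close> these vectors are isotropic
    for the forms of signature \<open>(p,q)\<close> and \<open>(r,s)\<close>, and vectors with
    opposite signs pair to \<open>2\<close>. So \<open>e = 1\<close> gives the square-zero element
    and \<open>e = -1\<close> its partner; the factor \<open>\<i>\<close> in \<open>C\<close> is the
    one from the definition of the real form.\<close>
  define a :: "complex \<Rightarrow> nat \<Rightarrow> complex" where "a = (\<lambda>e i. of_bool (i = 0) + e * of_bool (i = p))"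
  define b :: "complex \<Rightarrow> nat \<Rightarrow> complex" where "b = (\<lambda>e i. of_bool (i = 0) + e * of_bool (i = r))"
  define B where "B = (\<lambda>e. outer ?m ?n (a e) (b e))"
  define C where "C = (\<lambda>e. outer ?n ?m (\<lambda>j. \<i> * sg r j * b e j) (\<lambda>i. sg p i * a e i))"
  have S0: "odd_block ?m ?n B C \<in> ?S" if carr: "B \<in> carrier_mat ?m ?n" "C \<in> carrier_mat ?n ?m"
    and eq: "B = \<i> \<cdot>\<^sub>m (Ipq p q * mstar C * Ipq r s)" "C = \<i> \<cdot>\<^sub>m (Ipq r s * mstar B * Ipq p q)" for B C
  proof -
    have "0\<^sub>m k k = - (M * mstar (0\<^sub>m k k) * M)" if "M \<in> carrier_mat k k" for k and M :: "complex mat"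
      using that by (intro eq_matI) (auto simp: scalar_prod_def)
    moreover have "Ipq k l \<in> carrier_mat (k + l) (k + l)" for k l
      by (auto simp: Ipq_def diag_block_def)
    ultimately show ?thesis
      using is_blocks_odd_block[OF carr] odd_block_in_sl_set[OF carr] eq by blast
  qed
  have sg: "sg k i * (sg k i * x) = x" "cnj (sg k i) = sg k i" for k i x
    by (auto simp: sg_def)
  have S: "odd_block ?m ?n (B e) (C e) \<in> ?S" if "cnj e = e" for e
    using that
    by (intro S0 eq_matI)
      (auto simp: B_def C_def a_def b_def Ipq_mult_left Ipq_mult_right mult_ac sg)
  have Sz: "odd_block ?m ?n (0\<^sub>m ?m ?n) (0\<^sub>m ?n ?m) \<in> ?S"
    by (intro S0 eq_matI) (auto simp: Ipq_mult_left Ipq_mult_right)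
  have suma: "(\<Sum>i<?m. sg p i * a e i * a e' i) = 1 - e * e'" for e e'
    by (subst sum_two_points[of 0 _ p]) (use assms in \<open>auto simp: a_def sg_def\<close>)
  have sumb: "(\<Sum>i<?n. b e i * (\<i> * sg r i * b e' i)) = \<i> * (1 - e * e')" for e e'
    by (subst sum_two_points[of 0 _ r]) (use assms in \<open>auto simp: b_def sg_def algebra_simps\<close>)
  show ?thesis
    using assms(1) unfolding su_def
  proof (rule iso_mod_center_odd_block[OF _ _ Sz S S])
    show "B 1 \<in> carrier_mat ?m ?n" "C 1 \<in> carrier_mat ?n ?m" "B (-1) \<in> carrier_mat ?m ?n"
      "C (-1) \<in> carrier_mat ?n ?m" by (simp_all add: B_def C_def)
    show "B 1 * C 1 = 0\<^sub>m ?m ?m"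
      by (simp add: B_def C_def outer_mult sumb outer_zero_left)
    show "C 1 * B 1 = 0\<^sub>m ?n ?n"
      by (simp add: B_def C_def outer_mult suma outer_zero_left)
    show "(B 1 * C (-1)) $$ (0, 0) + (B (-1) * C 1) $$ (0, 0) \<noteq> 0"
    proof -
      have "sg p 0 = (1 :: complex)" using assms by (simp add: sg_def)
      then show ?thesis using assms by (simp add: B_def C_def outer_mult sumb a_def del: index_mult_mat(1))
    qed
  qed (use assms sl_set_carrier in auto)
qed

text \<open>The matrix unit \<open>E\<^sub>i\<^sub>j\<close> of the quaternions, as a complex matrix.\<close>

definition quaternion_unit :: "nat \<Rightarrow> nat \<Rightarrow> nat \<Rightarrow> nat \<Rightarrow> complex mat" where
  "quaternion_unit p q i j = mat (2 * p) (2 * q) (\<lambda>(k, l). of_bool ((k = i \<and> l = j) \<or> (k = p + i \<and> l = q + j)))"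

lemma quaternion_unit_carrier [simp]: "quaternion_unit p q i j \<in> carrier_mat (2 * p) (2 * q)"
  by (simp add: quaternion_unit_def)

lemma quaternion_unit_Jmat:
  assumes "i < p" "j < q"
  shows "quaternion_unit p q i j * Jmat q = Jmat p * mcnj (quaternion_unit p q i j)"
  using assms
  by (intro eq_matI) (auto simp: quaternion_unit_def Jmat_mult_left Jmat_mult_right)

lemma quaternion_unit_mult:
  assumes "i < p" "j < q" "k < q" "l < r"
  shows "quaternion_unit p q i j * quaternion_unit q r k l =
    (if j = k then quaternion_unit p r i l else 0\<^sub>m (2 * p) (2 * r))"
proof (rule eq_matI)
  let ?R = "if j = k then quaternion_unit p r i l else 0\<^sub>m (2 * p) (2 * r)"
  fix a b assume "a < dim_row ?R" "b < dim_col ?R"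
  then have ab: "a < 2 * p" "b < 2 * r" by (auto simp: quaternion_unit_def split: if_splits)
  have "(quaternion_unit p q i j * quaternion_unit q r k l) $$ (a, b) =
    (\<Sum>c<2 * q. of_bool ((a = i \<and> c = j) \<or> (a = p + i \<and> c = q + j)) *
      of_bool ((c = k \<and> b = l) \<or> (c = q + k \<and> b = r + l)))"
    using ab by (simp add: quaternion_unit_def scalar_prod_def atLeast0LessThan)
  also have "\<dots> = of_bool ((a = i \<and> j = k \<and> b = l) \<or> (a = p + i \<and> j = k \<and> b = r + l))"
    by (subst sum_two_points[of j _ "q + j"]) (use assms in auto)
  finally show "(quaternion_unit p q i j * quaternion_unit q r k l) $$ (a, b) = ?R $$ (a, b)"
    using ab by (auto simp: quaternion_unit_def)
qed (auto simp: quaternion_unit_def)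

text \<open>The quaternionic structure is block diagonal and constrains each off-diagonal block
  separately. The witness thus sits in one block, as over the reals, with a quaternionic matrix unit
  instead of a real one.\<close>

lemma nondefinite_su_star:
  assumes "superalgebra_of g0 g1 br \<cong>\<^sub>s su_star p q" "0 < p" "0 < q"
  shows "nondefinite g1 br"
proof -
  let ?m = "2 * p" and ?n = "2 * q"
  let ?S = "{X \<in> sl_set ?m ?n. X * diag_block (Jmat p) (Jmat q) = diag_block (Jmat p) (Jmat q) * mcnj X}"
  have S: "odd_block ?m ?n B C \<in> ?S" if carr: "B \<in> carrier_mat ?m ?n" "C \<in> carrier_mat ?n ?m"
    and eq: "B * Jmat q = Jmat p * mcnj B" "C * Jmat p = Jmat q * mcnj C" for B C
  proof -
    have d: "diag_block (Jmat p) (Jmat q) = four_block_mat (Jmat p) (0\<^sub>m ?m ?n) (0\<^sub>m ?n ?m) (Jmat q)"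
      by (simp add: diag_block_def)
    have c: "mcnj (odd_block ?m ?n B C) = odd_block ?m ?n (mcnj B) (mcnj C)"
      using carr by (intro eq_matI) (auto simp: odd_block_def)
    have "odd_block ?m ?n B C * diag_block (Jmat p) (Jmat q) = odd_block ?m ?n (B * Jmat q) (C * Jmat p)"
      unfolding d odd_block_def using carr
      by (subst mult_four_block_mat[of _ ?m ?m _ ?n _ ?n _ _ ?m _ ?n]) (auto simp: right_mult_zero_mat)
    moreover have "diag_block (Jmat p) (Jmat q) * mcnj (odd_block ?m ?n B C) = odd_block ?m ?n (Jmat p * mcnj B) (Jmat q * mcnj C)"
      unfolding d c unfolding odd_block_def using carr
      by (subst mult_four_block_mat[of _ ?m ?m _ ?n _ ?n _ _ ?m _ ?n]) (auto simp: left_mult_zero_mat)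
    ultimately show ?thesis using odd_block_in_sl_set[OF carr] eq by simp
  qed
  have J0: "0\<^sub>m (2 * k) (2 * l) * Jmat l = Jmat k * mcnj (0\<^sub>m (2 * k) (2 * l))" for k l
    by (rule eq_matI) (auto simp: scalar_prod_def)
  show ?thesis
    using assms(1) unfolding su_star_def
  proof (rule iso_mod_center_odd_block)
    show "?S \<subseteq> carrier_mat (?m + ?n) (?m + ?n)" using sl_set_carrier by blast
    show "odd_block ?m ?n (0\<^sub>m ?m ?n) (0\<^sub>m ?n ?m) \<in> ?S" by (rule S) (auto simp: J0)
    show "odd_block ?m ?n (quaternion_unit p q 0 0) (0\<^sub>m ?n ?m) \<in> ?S"
      by (rule S) (use assms in \<open>auto simp: J0 quaternion_unit_Jmat\<close>)
    show "odd_block ?m ?n (0\<^sub>m ?m ?n) (quaternion_unit q p 0 0) \<in> ?S"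
      by (rule S) (use assms in \<open>auto simp: J0 quaternion_unit_Jmat\<close>)
    show "(quaternion_unit p q 0 0 * quaternion_unit q p 0 0) $$ (0, 0) + (0\<^sub>m ?m ?n * 0\<^sub>m ?n ?m) $$ (0, 0) \<noteq> 0"
      using assms by (simp add: quaternion_unit_mult del: index_mult_mat(1)) (simp add: quaternion_unit_def)
  qed (use assms in \<open>auto simp: right_mult_zero_mat[OF quaternion_unit_carrier] left_mult_zero_mat[OF quaternion_unit_carrier]\<close>)
qed

text \<open>As \<open>B\<close> is the conjugate of \<open>C\<close>, neither block can vanish
  alone. A real nilpotent matrix unit \<open>E_01\<close>, which exists since \<open>m > 1\<close>,
  is put into both blocks; its transpose gives the partner.\<close>

lemma nondefinite_pqbar:
  assumes "superalgebra_of g0 g1 br \<cong>\<^sub>s pqbar m" "1 < m"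
  shows "nondefinite g1 br"
proof -
  let ?S = "{X \<in> sl_set m m. \<exists>A B C D. is_blocks m m X A B C D \<and> A = mcnj D \<and> B = mcnj C}"
  have S: "odd_block m m B C \<in> ?S" if carr: "B \<in> carrier_mat m m" "C \<in> carrier_mat m m" and eq: "B = mcnj C" for B C
  proof -
    have "0\<^sub>m m m = mcnj (0\<^sub>m m m)" by (rule eq_matI) auto
    then show ?thesis using is_blocks_odd_block[OF carr] odd_block_in_sl_set[OF carr] eq by blast
  qed
  let ?E = "\<lambda>i j. outer m m (unit_at i) (unit_at j)"
  have c: "?E i j = mcnj (?E i j)" for i j by (rule eq_matI) auto
  show ?thesis
    using assms(1) unfolding pqbar_def
  proof (rule iso_mod_center_odd_block)
    show "?S \<subseteq> carrier_mat (m + m) (m + m)" using sl_set_carrier by blast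
    show "odd_block m m (0\<^sub>m m m) (0\<^sub>m m m) \<in> ?S" by (rule S) auto
    show "odd_block m m (?E 0 1) (?E 0 1) \<in> ?S" "odd_block m m (?E 1 0) (?E 1 0) \<in> ?S"
      by (rule S[OF _ _ c]; simp)+
    show "?E 0 1 * ?E 0 1 = 0\<^sub>m m m" "?E 0 1 * ?E 0 1 = 0\<^sub>m m m"
      by (simp_all add: outer_mult sum_unit_unit outer_zero_left)
    show "(?E 0 1 * ?E 1 0) $$ (0, 0) + (?E 1 0 * ?E 0 1) $$ (0, 0) \<noteq> 0"
      using assms by (simp add: outer_mult sum_unit_unit del: index_mult_mat(1))
  qed (use assms in auto)
qed

text \<open>The Hermitian block \<open>B\<close> and the skew-Hermitian block \<open>C\<close> are
  independent of each other, so \<open>B = E_00\<close>, \<open>C = 0\<close> squares to zero; the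
  partner has \<open>C = \<i> E_00\<close>.\<close>

lemma nondefinite_usp:
  assumes "superalgebra_of g0 g1 br \<cong>\<^sub>s usp m" "1 < m"
  shows "nondefinite g1 br"
proof -
  let ?S = "{X \<in> sl_set m m. \<exists>A B C D. is_blocks m m X A B C D \<and> A = - mstar D \<and> B = mstar B \<and> C = - mstar C}"
  have S: "odd_block m m B C \<in> ?S" if carr: "B \<in> carrier_mat m m" "C \<in> carrier_mat m m"
    and eq: "B = mstar B" "C = - mstar C" for B C
  proof -
    have "0\<^sub>m m m = - mstar (0\<^sub>m m m)" by (rule eq_matI) auto
    then show ?thesis using is_blocks_odd_block[OF carr] odd_block_in_sl_set[OF carr] eq by blast
  qed
  let ?E = "outer m m (unit_at 0) (unit_at 0)"
  have z: "0\<^sub>m m m = mstar (0\<^sub>m m m)" "0\<^sub>m m m = - mstar (0\<^sub>m m m)" by (rule eq_matI; auto)+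
  show ?thesis
    using assms(1) unfolding usp_def
  proof (rule iso_mod_center_odd_block)
    show "?S \<subseteq> carrier_mat (m + m) (m + m)" using sl_set_carrier by blast
    show "odd_block m m (0\<^sub>m m m) (0\<^sub>m m m) \<in> ?S" by (rule S[OF _ _ z]) auto
    show "odd_block m m ?E (0\<^sub>m m m) \<in> ?S"
      by (rule S[OF _ _ _ z(2)]) (auto intro!: eq_matI)
    show "odd_block m m (0\<^sub>m m m) (\<i> \<cdot>\<^sub>m ?E) \<in> ?S"
      by (rule S[OF _ _ z(1)]) (auto intro!: eq_matI)
    show "?E * 0\<^sub>m m m = 0\<^sub>m m m" "0\<^sub>m m m * ?E = 0\<^sub>m m m" by auto
    show "(?E * (\<i> \<cdot>\<^sub>m ?E)) $$ (0, 0) + (0\<^sub>m m m * 0\<^sub>m m m) $$ (0, 0) \<noteq> 0"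
      using assms by (simp add: smult_outer outer_mult sum_distrib_left[symmetric] mult.left_commute[of _ \<i>] sum_unit_unit del: index_mult_mat(1))
  qed (use assms in auto)
qed

lemma nondefinite_osp:
  assumes "superalgebra_of g0 g1 br \<cong>\<^sub>s osp p q n" "0 < p" "0 < q" "0 < n"
  shows "nondefinite g1 br"
proof -
  let ?m = "p + q" and ?n = "2 * n"
  \<comment> \<open>A real isotropic vector of signature \<open>(p,q)\<close>: the factor
    \<open>\<i>\<close> turns the difference of squares into the standard bilinear form and makes
    \<open>u\<close> fixed under conjugation followed by \<open>I_{p,q}\<close>. The indices
    \<open>0\<close> and \<open>n\<close> in \<open>B\<close> and \<open>C\<close> are dual for the
    symplectic form, but the unit vectors at \<open>0\<close> and \<open>n\<close> have zero pairing
    in the product \<open>B * C\<close>.\<close>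
  define u :: "nat \<Rightarrow> complex" where "u = (\<lambda>i. of_bool (i = 0) + \<i> * of_bool (i = p))"
  define B where "B = outer ?m ?n u (unit_at 0)"
  define C where "C = outer ?n ?m (unit_at n) u"
  have carr: "B \<in> carrier_mat ?m ?n" "C \<in> carrier_mat ?n ?m" by (simp_all add: B_def C_def)
  let ?X = "odd_block ?m ?n B C"
  have bl: "is_blocks ?m ?n ?X (0\<^sub>m ?m ?m) B C (0\<^sub>m ?n ?n)" by (rule is_blocks_odd_block[OF carr])
  have "B = - (transpose_mat C * Jmat n)" "C = - (Jmat n * transpose_mat B)"
    unfolding B_def C_def using assms(4)
    by (auto intro!: eq_matI simp: Jmat_mult_left Jmat_mult_right)
  moreover have "0\<^sub>m ?m ?m = - transpose_mat (0\<^sub>m ?m ?m :: complex mat)"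
    "0\<^sub>m ?n ?n = Jmat n * transpose_mat (0\<^sub>m ?n ?n) * (Jmat n :: complex mat)"
    by (auto intro!: eq_matI simp: Jmat_mult_left Jmat_mult_right)
  ultimately have osp: "?X \<in> osp_set ?m n"
    using bl odd_block_in_sl_set[OF carr] unfolding osp_set_def by blast
  have I: "Ipq p q * mcnj (0\<^sub>m ?m ?m) * Ipq p q = 0\<^sub>m ?m ?m" "mcnj (0\<^sub>m ?n ?n) = 0\<^sub>m ?n ?n"
    by (auto intro!: eq_matI simp: Ipq_mult_left Ipq_mult_right)
  have "Ipq p q * mcnj B = B" "mcnj C * Ipq p q = C"
    unfolding B_def C_def using assms
    by (auto intro!: eq_matI simp: Ipq_mult_left Ipq_mult_right u_def sg_def)
  then have "?X = four_block_mat (Ipq p q * mcnj (0\<^sub>m ?m ?m) * Ipq p q) (Ipq p q * mcnj B) (mcnj C * Ipq p q) (mcnj (0\<^sub>m ?n ?n))"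
    by (simp add: odd_block_def I)
  then have X: "?X \<in> {X \<in> osp_set ?m n. \<exists>A B C D. is_blocks ?m ?n X A B C D \<and>
        X = four_block_mat (Ipq p q * mcnj A * Ipq p q) (Ipq p q * mcnj B) (mcnj C * Ipq p q) (mcnj D)}"
    using bl osp by blast
  have uu: "(\<Sum>i<?m. u i * u i) = 0"
    by (subst sum_two_points[of 0 _ p]) (use assms in \<open>auto simp: u_def\<close>)
  have sq: "?X * ?X = 0\<^sub>m (?m + ?n) (?m + ?n)"
    using carr by (rule odd_block_square_zero)
      (use assms in \<open>simp_all add: B_def C_def outer_mult sum_unit_unit uu outer_zero_left\<close>)
  have "?X $$ (0, ?m) = 1" using assms carr by (simp add: odd_block_def B_def u_def)
  then have "?X \<noteq> 0\<^sub>m (?m + ?n) (?m + ?n)" using assms by auto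
  then show ?thesis
    using iso_sub_square_zero[OF _ X odd_block_odd[OF carr] sq] assms(1) unfolding osp_def by blast
qed

lemma q_set_odd_block:
  assumes "B \<in> carrier_mat n n" "mtrace B = 0" "P (0\<^sub>m n n) B"
  shows "odd_block n n B B \<in> q_set n P"
  unfolding q_set_def mem_Collect_eq
  by (rule exI[of _ "0\<^sub>m n n"], rule exI[of _ B]) (use assms in \<open>simp add: is_blocks_def odd_block_def\<close>)

lemma q_set_carrier: "q_set n P \<subseteq> carrier_mat (n + n) (n + n)"
  unfolding q_set_def is_blocks_def using four_block_carrier_mat by blast

text \<open>An odd element carries the same block \<open>B\<close> twice, so what is needed is a
  trace-free \<open>B\<close> with \<open>B^2 = 0\<close>.\<close>

lemma iso_q_set_square_zero:
  fixes B :: "'k::{real_algebra_1,comm_ring_1} mat"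
  assumes "superalgebra_of g0 g1 br \<cong>\<^sub>s sa_mod_center (sa_sub (gl_real n n) (q_set n P))"
    and "P (0\<^sub>m n n) (0\<^sub>m n n)" "P (0\<^sub>m n n) B" "P (0\<^sub>m n n) B'"
    and carr: "B \<in> carrier_mat n n" "B' \<in> carrier_mat n n"
    and "mtrace B = 0" "mtrace B' = 0" "B * B = 0\<^sub>m n n"
    and "i < n" "j < n" "(B * B') $$ (i, j) + (B' * B) $$ (i, j) \<noteq> 0"
  shows "nondefinite g1 br"
  using assms(1)
  by (rule iso_mod_center_odd_block[OF _ q_set_carrier q_set_odd_block q_set_odd_block q_set_odd_block carr(1,1,2,2), where i = i and j = j])
    (use assms in auto)

lemma nondefinite_psq_real:
  assumes "superalgebra_of g0 g1 br \<cong>\<^sub>s psq_real n" "2 < n"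
  shows "nondefinite g1 br"
proof -
  let ?E = "\<lambda>i j. outer n n (unit_at i) (unit_at j)"
  show ?thesis
    using assms(1) unfolding psq_real_def
  proof (rule iso_q_set_square_zero)
    show "mtrace (?E 0 1) = 0" "mtrace (?E 1 0) = 0" by (auto simp: mtrace_def intro!: sum.neutral)
    show "?E 0 1 * ?E 0 1 = 0\<^sub>m n n" by (simp_all add: outer_mult sum_unit_unit outer_zero_left)
    show "(?E 0 1 * ?E 1 0) $$ (0, 0) + (?E 1 0 * ?E 0 1) $$ (0, 0) \<noteq> 0"
      using assms by (simp add: outer_mult sum_unit_unit del: index_mult_mat(1))
  qed (use assms in auto)
qed

lemma nondefinite_psq_star:
  assumes "superalgebra_of g0 g1 br \<cong>\<^sub>s psq_star n" "2 < n" "even n"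
  shows "nondefinite g1 br"
proof -
  obtain h where n: "n = 2 * h" and h: "1 < h" using assms by (elim evenE) auto
  let ?E = "quaternion_unit h h"
  have J0: "0\<^sub>m n n * Jmat h = Jmat h * mcnj (0\<^sub>m n n)"
    by (rule eq_matI) (auto simp: n scalar_prod_def)
  show ?thesis
    using assms(1) unfolding psq_star_def
  proof (rule iso_q_set_square_zero)
    show "mtrace (?E 0 1) = 0" "mtrace (?E 1 0) = 0" 
      by (auto simp: mtrace_def quaternion_unit_def intro!: sum.neutral)
    show "?E 0 1 * ?E 0 1 = 0\<^sub>m n n" using h by (simp add: quaternion_unit_mult n)
    show "(?E 0 1 * ?E 1 0) $$ (0, 0) + (?E 1 0 * ?E 0 1) $$ (0, 0) \<noteq> 0"
      using h by (simp add: quaternion_unit_mult del: index_mult_mat(1)) (simp add: quaternion_unit_def)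
  qed (use assms h J0 in \<open>auto simp: n quaternion_unit_Jmat\<close>)
qed

lemma nondefinite_psq:
  assumes "superalgebra_of g0 g1 br \<cong>\<^sub>s psq p q" "0 < p" "0 < q"
  shows "nondefinite g1 br"
proof -
  let ?n = "p + q"
  let ?P = "\<lambda>A B. A = - (Ipq p q * mstar A * Ipq p q) \<and> B = \<i> \<cdot>\<^sub>m (Ipq p q * mstar B * Ipq p q)"
  define u :: "complex \<Rightarrow> nat \<Rightarrow> complex" where "u = (\<lambda>e i. of_bool (i = 0) + e * of_bool (i = p))"
  \<comment> \<open>The factor \<open>c = 1 + \<i>\<close> solves \<open>c = \<i> * cnj c\<close>,
    which is what the reality condition on \<open>B\<close> asks of a multiple of
    \<open>u u^t I_{p,q}\<close>. For \<open>e = 1\<close> and \<open>e = -1\<close> the vector is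
    isotropic, which makes both the trace and the square of the matrix vanish.\<close>
  define B where "B = (\<lambda>e. outer ?n ?n (\<lambda>i. (1 + \<i>) * u e i) (\<lambda>i. sg p i * u e i))"
  have sg: "sg k i * (sg k i * x) = x" "cnj (sg k i) = sg k i" for k i and x :: complex
    by (auto simp: sg_def)
  have A: "0\<^sub>m ?n ?n = - (Ipq p q * mstar (0\<^sub>m ?n ?n) * Ipq p q)"
    by (rule eq_matI) (auto simp: Ipq_mult_left Ipq_mult_right)
  have P: "?P (0\<^sub>m ?n ?n) (B e)" if "cnj e = e" for e
  proof -
    have "\<i> * (1 - \<i>) = 1 + \<i>" by (simp add: algebra_simps)
    then have "\<i> * ((1 - \<i>) * x) = (1 + \<i>) * x" for x by (metis mult.assoc)
    then have "B e = \<i> \<cdot>\<^sub>m (Ipq p q * mstar (B e) * Ipq p q)"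
      using that
      by (intro eq_matI) (auto simp: B_def u_def Ipq_mult_left Ipq_mult_right mult_ac sg)
    then show ?thesis using A by simp
  qed
  have P0: "?P (0\<^sub>m ?n ?n) (0\<^sub>m ?n ?n)"
  proof -
    have "0\<^sub>m ?n ?n = \<i> \<cdot>\<^sub>m (Ipq p q * mstar (0\<^sub>m ?n ?n) * Ipq p q)"
      by (rule eq_matI) (auto simp: Ipq_mult_left Ipq_mult_right)
    then show ?thesis using A by simp
  qed
  have sumu: "(\<Sum>i<?n. sg p i * u e i * ((1 + \<i>) * u e' i)) = (1 + \<i>) * (1 - e * e')" for e e'
    by (subst sum_two_points[of 0 _ p]) (use assms in \<open>auto simp: u_def sg_def algebra_simps\<close>)
  have tr: "mtrace (B e) = (1 + \<i>) * (1 - e * e)" for e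
    using sumu[of e e] by (simp add: mtrace_def B_def mult_ac)
  show ?thesis
    using assms(1) unfolding psq_def
  proof (rule iso_q_set_square_zero[where P = ?P and B = "B 1" and B' = "B (-1)"])
    show "?P (0\<^sub>m ?n ?n) (0\<^sub>m ?n ?n)" by (rule P0)
    show "?P (0\<^sub>m ?n ?n) (B 1)" "?P (0\<^sub>m ?n ?n) (B (-1))" by (rule P, simp)+
    show "B 1 * B 1 = 0\<^sub>m ?n ?n" unfolding B_def outer_mult sumu by (simp add: outer_zero_left)
    show "(B 1 * B (-1)) $$ (0, 0) + (B (-1) * B 1) $$ (0, 0) \<noteq> 0"
      unfolding B_def outer_mult sumu using assms by (simp add: u_def sg_def complex_eq_iff)
    show "mtrace (B 1) = 0" "mtrace (B (-1)) = 0" by (simp_all add: tr)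
  qed (use assms in \<open>auto simp: B_def\<close>)
qed

section \<open>Real forms\<close>

text \<open>A definite form stays nondegenerate after complexification: for
  \<open>X = x + \<i> y\<close> its conjugate \<open>Y = x - \<i> y\<close> gives
  \<open>f([x, x]) + f([y, y]) > 0\<close>. Hence a radical in the complex algebra excludes positive
  functionals on every real form. \<open>sa_iso\<close> does not mention \<open>sa_zero\<close>, so
  \<open>X\<close> being nonzero is expressed by \<open>X \<noteq> sa_scale M 0 X\<close>.\<close>

lemma real_form_nondegenerate:
  fixes g0 g1 :: "'a::euclidean_space set" and M :: "(complex, 'w) superalgebra"
  assumes alg: "real_lie_superalgebra g0 g1 br"
    and rf: "real_form_of (superalgebra_of g0 g1 br) M" and pos: "\<not> nondefinite g1 br"
  obtains l where "\<And>x y. x \<in> sa_carrier M \<Longrightarrow> y \<in> sa_carrier M \<Longrightarrow> l (sa_add M x y) = l x + (l y :: complex)"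
    and "\<And>c x. x \<in> sa_carrier M \<Longrightarrow> l (sa_scale M c x) = c * l x"
    and "\<And>X. X \<in> sa_odd M \<Longrightarrow> X \<noteq> sa_scale M 0 X \<Longrightarrow> \<exists>Y\<in>sa_odd M. l (sa_br M X Y) \<noteq> 0"
proof -
  interpret real_lie_superalgebra g0 g1 br by (rule alg)
  obtain f :: "'a \<Rightarrow> real" where f: "linear f" and fpos: "\<And>x. x \<in> g1 \<Longrightarrow> x \<noteq> 0 \<Longrightarrow> 0 < f (br x x)"
    using pos unfolding nondefinite_def by (auto simp: not_le)
  obtain \<phi> where \<phi>: "sa_iso (complexification (superalgebra_of g0 g1 br)) M \<phi>"
    using rf unfolding real_form_of_def sa_isomorphic_def by blast
  have bij: "bij_betw \<phi> UNIV (sa_carrier M)"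
    and add: "\<And>x y u v. \<phi> (x + u, y + v) = sa_add M (\<phi> (x, y)) (\<phi> (u, v))"
    and scale: "\<And>c x y. \<phi> (Re c *\<^sub>R x - Im c *\<^sub>R y, Re c *\<^sub>R y + Im c *\<^sub>R x) = sa_scale M c (\<phi> (x, y))"
    and brk: "\<And>x y u v. \<phi> (br x u - br y v, br x v + br y u) = sa_br M (\<phi> (x, y)) (\<phi> (u, v))"
    and odd: "\<phi> ` (g1 \<times> g1) = sa_odd M"
    using \<phi> by (auto simp: sa_iso_def complexification_def superalgebra_of_def)
  define \<psi> where "\<psi> = inv_into UNIV \<phi>"
  define l where "l T = Complex (f (fst (\<psi> T))) (f (snd (\<psi> T)))" for T
  have \<psi>: "\<psi> (\<phi> z) = z" for z using bij by (simp add: \<psi>_def bij_betw_def)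
  have l: "l (\<phi> (x, y)) = Complex (f x) (f y)" for x y by (simp add: l_def \<psi>)
  have surj: "\<exists>x y. T = \<phi> (x, y)" if "T \<in> sa_carrier M" for T
    using that bij unfolding bij_betw_def by (metis imageE surj_pair)
  have br0: "br y (- z) = - br y z" for y z
    using bilinear by (simp add: bilinear_rneg)
  have flin: "f (x + y) = f x + f y" "f (a *\<^sub>R x) = a * f x" "f (x - y) = f x - f y" for x y a
    using f by (simp_all add: linear_add linear_scale linear_diff)
  show thesis
  proof (rule that[of l])
    fix x y assume x: "x \<in> sa_carrier M" and y: "y \<in> sa_carrier M"
    obtain a b where "x = \<phi> (a, b)" using surj[OF x] by blast
    moreover obtain c d where "y = \<phi> (c, d)" using surj[OF y] by blast
    ultimately show "l (sa_add M x y) = l x + l y"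
      using add[of a c b d, symmetric] by (simp add: l flin complex_eq_iff)
  next
    fix c x assume x: "x \<in> sa_carrier M"
    obtain a b where "x = \<phi> (a, b)" using surj[OF x] by blast
    then show "l (sa_scale M c x) = c * l x"
      using scale[of c a b, symmetric] by (simp add: l flin complex_eq_iff)
  next
    fix X assume X: "X \<in> sa_odd M" "X \<noteq> sa_scale M 0 X"
    then obtain x y where xy: "x \<in> g1" "y \<in> g1" "X = \<phi> (x, y)" unfolding odd[symmetric] by blast
    have nz: "\<not> (x = 0 \<and> y = 0)" using X(2) scale[of 0 x y] xy(3) by auto
    have "br x (- y) + br y x = 0"
      using super_antisym(2)[OF xy(1,2)] by (simp add: br0)
    then have "l (sa_br M X (\<phi> (x, - y))) = f (br x x + br y y)"
      using brk[of x x y "- y", symmetric] linear_0[OF f] by (simp add: xy(3) l br0 complex_eq_iff)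
    moreover
    have "0 \<le> f (br x x)" "0 \<le> f (br y y)" "0 < f (br x x) \<or> 0 < f (br y y)"
      using fpos[OF xy(1)] fpos[OF xy(2)] nz linear_0[OF f] bilinear_lzero[OF bilinear]
      by (cases "x = 0"; cases "y = 0"; force)+
    then have "0 < f (br x x + br y y)" by (auto simp: flin)
    ultimately have "l (sa_br M X (\<phi> (x, - y))) \<noteq> 0" by (metis less_irrefl of_real_eq_0_iff)
    moreover have "\<phi> (x, - y) \<in> sa_odd M"
      using odd xy subspace_neg[OF subspace_odd] by blast
    ultimately show "\<exists>Y\<in>sa_odd M. l (sa_br M X Y) \<noteq> 0" by blast
  qed
qed

section \<open>Functionals on matrices and real forms of \<open>P(n)\<close>\<close>

lemma matrix_functional:
  assumes add: "\<And>A B. A \<in> carrier_mat n n \<Longrightarrow> B \<in> carrier_mat n n \<Longrightarrow> h (A + B) = h A + (h B :: complex)"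
    and scale: "\<And>c A. A \<in> carrier_mat n n \<Longrightarrow> h (c \<cdot>\<^sub>m A) = c * h A"
    and A: "A \<in> carrier_mat n n"
  shows "h A = (\<Sum>(i, j)\<in>{..<n} \<times> {..<n}. A $$ (i, j) * h (mat n n (\<lambda>k. of_bool (k = (i, j)))))"
proof -
  have "h (mat n n (\<lambda>k. if k \<in> P then A $$ k else 0)) =
      (\<Sum>(i, j)\<in>P. A $$ (i, j) * h (mat n n (\<lambda>k. of_bool (k = (i, j)))))" if "finite P" for P
    using that
  proof (induction P rule: finite_induct)
    case empty
    have "h (0 \<cdot>\<^sub>m A) = 0" using scale[OF A, of 0] by simp
    moreover have "mat n n (\<lambda>k. if k \<in> {} then A $$ k else 0) = 0 \<cdot>\<^sub>m A"
      using A by (intro eq_matI) auto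
    ultimately show ?case by simp
  next
    case (insert p P)
    have "mat n n (\<lambda>k. if k \<in> insert p P then A $$ k else 0) =
      mat n n (\<lambda>k. if k \<in> P then A $$ k else 0) + A $$ p \<cdot>\<^sub>m mat n n (\<lambda>k. of_bool (k = p))"
      using insert by (intro eq_matI) auto
    then show ?case
      using insert by (simp add: add scale case_prod_beta)
  qed
  from this[of "{..<n} \<times> {..<n}"]
  have "h (mat n n (\<lambda>k. if k \<in> {..<n} \<times> {..<n} then A $$ k else 0)) =
      (\<Sum>(i, j)\<in>{..<n} \<times> {..<n}. A $$ (i, j) * h (mat n n (\<lambda>k. of_bool (k = (i, j)))))" by simp
  moreover have "mat n n (\<lambda>k. if k \<in> {..<n} \<times> {..<n} then A $$ k else 0) = A"
    using A by (intro eq_matI) auto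
  ultimately show ?thesis by simp
qed

lemma complex_eigenvector:
  fixes M :: "nat \<Rightarrow> nat \<Rightarrow> complex"
  assumes "0 < n"
  obtains u \<mu> where "\<And>i. i < n \<Longrightarrow> (\<Sum>j<n. M i j * u j) = \<mu> * u i" "\<exists>i<n. u i \<noteq> 0"
proof -
  let ?A = "mat n n (\<lambda>(i, j). M i j)"
  have A: "?A \<in> carrier_mat n n" by simp
  have "\<not> constant (poly (char_poly ?A))"
    using degree_monic_char_poly[OF A] assms by (simp add: constant_degree)
  then obtain \<mu> where "poly (char_poly ?A) \<mu> = 0" using fundamental_theorem_of_algebra by blast
  then obtain v where v: "eigenvector ?A v \<mu>"
    using eigenvalue_root_char_poly[OF A] unfolding eigenvalue_def by blast
  then have c: "v \<in> carrier_vec n" "v \<noteq> 0\<^sub>v n" and e: "mat n n (\<lambda>(i, j). M i j) *\<^sub>v v = \<mu> \<cdot>\<^sub>v v"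
    by (simp_all add: eigenvector_def)
  have "(\<Sum>j<n. M i j * v $ j) = \<mu> * v $ i" if "i < n" for i
    using arg_cong[OF e, of "\<lambda>w. w $ i"] that c
    by (simp add: scalar_prod_def atLeast0LessThan)
  moreover have "\<exists>i<n. v $ i \<noteq> 0" using c by (metis carrier_vecD eq_vecI index_zero_vec)
  ultimately show thesis using that by blast
qed

text \<open>If \<open>M u = \<mu> u\<close> for the matrix \<open>M\<close> representing the functional \<open>l\<close> on the even part, then the symmetric matrix
  \<open>u u\<^sup>t\<close> lies in the radical of \<open>l([\<cdot>,\<cdot>])\<close>.\<close>

lemma nondefinite_P:
  fixes g0 g1 :: "'a::euclidean_space set"
  assumes alg: "real_lie_superalgebra g0 g1 br"
    and rf: "real_form_of (superalgebra_of g0 g1 br) (P_complex n)"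
  shows "nondefinite g1 br"
proof (rule ccontr)
  assume "\<not> nondefinite g1 br"
  from real_form_nondegenerate[OF alg rf this]
  obtain l where l: "\<And>x y. x \<in> sa_carrier (P_complex n) \<Longrightarrow> y \<in> sa_carrier (P_complex n) \<Longrightarrow>
        l (sa_add (P_complex n) x y) = l x + (l y :: complex)"
      "\<And>c x. x \<in> sa_carrier (P_complex n) \<Longrightarrow> l (sa_scale (P_complex n) c x) = c * l x"
    and nd: "\<And>X. X \<in> sa_odd (P_complex n) \<Longrightarrow> X \<noteq> sa_scale (P_complex n) 0 X \<Longrightarrow>
        \<exists>Y\<in>sa_odd (P_complex n). l (sa_br (P_complex n) X Y) \<noteq> 0" by metis
  obtain N where N: "n + 1 = N" by simp
  then have N0: "0 < N" by simp
  let ?S = "{X \<in> sl_set N N. \<exists>A B C. is_blocks N N X A B C (- transpose_mat A) \<and>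
        mtrace A = 0 \<and> B = transpose_mat B \<and> C = - transpose_mat (C :: complex mat)}"
  have PN: "P_complex n = sa_sub (gl_complex N N) ?S" unfolding P_complex_def N by (rule refl)
  have P: "sa_carrier (P_complex n) = ?S" "sa_add (P_complex n) = (+)" "sa_scale (P_complex n) = (\<lambda>c X. c \<cdot>\<^sub>m X)"
    "sa_odd (P_complex n) = ?S \<inter> {X \<in> carrier_mat (N + N) (N + N). mat_odd N N X = X}"
    "sa_br (P_complex n) = supercommutator (*) (+) (-) (mat_even N N) (mat_odd N N)"
    by (simp_all add: PN sa_sub_def gl_super_def)
  define blk :: "complex mat \<Rightarrow> complex mat" where
    "blk A = four_block_mat A (0\<^sub>m N N) (0\<^sub>m N N) (- transpose_mat A)" for A
  \<comment> \<open>\<open>l\<close> is given only on trace-free \<open>A\<close>. Composing it with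
    the trace-free projection extends it to all \<open>N \<times> N\<close> matrices, where it has
    the coordinate matrix \<open>m\<close>.\<close>
  define pr :: "complex mat \<Rightarrow> complex mat" where
    "pr A = mat N N (\<lambda>(i, j). A $$ (i, j) - of_bool (i = j) * (mtrace A / of_nat N))" for A
  have prc: "pr A \<in> carrier_mat N N" for A by (simp add: pr_def)
  have blkS: "blk A \<in> ?S" if "A \<in> carrier_mat N N" "mtrace A = 0" for A
  proof -
    have isb: "is_blocks N N (blk A) A (0\<^sub>m N N) (0\<^sub>m N N) (- transpose_mat A)"
      using that by (simp add: is_blocks_def blk_def)
    have "mtrace (- transpose_mat A) = 0" using that by (simp add: mtrace_def sum_negf)
    then have sl: "blk A \<in> sl_set N N"
      unfolding sl_set_def mem_Collect_eq
      by (intro exI[of _ A] exI[of _ "0\<^sub>m N N"] exI[of _ "- transpose_mat A"]) (simp add: isb that(2))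
    have "0\<^sub>m N N = transpose_mat (0\<^sub>m N N :: complex mat)" "0\<^sub>m N N = - transpose_mat (0\<^sub>m N N :: complex mat)"
      by (auto intro!: eq_matI)
    then show ?thesis
      unfolding mem_Collect_eq
      by (intro conjI[OF sl] exI[of _ A] exI[of _ "0\<^sub>m N N"] conjI isb that(2))
  qed
  have trpr: "mtrace (pr A) = 0" if "A \<in> carrier_mat N N" for A
  proof -
    have "mtrace (pr A) = (\<Sum>i<N. A $$ (i, i) - mtrace A / of_nat N)"
      unfolding mtrace_def[of "pr A"] by (rule sum.cong) (auto simp: pr_def)
    also have "\<dots> = mtrace A - of_nat N * (mtrace A / of_nat N)"
      using that by (simp only: sum_subtractf sum_constant card_lessThan mtrace_def[of A]) simp
    also have "\<dots> = 0" using N0 by simp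
    finally show ?thesis .
  qed
  define h where "h A = l (blk (pr A))" for A
  have tr: "mtrace (A + B) = mtrace A + mtrace B" "mtrace (c \<cdot>\<^sub>m A) = c * mtrace A"
    if "A \<in> carrier_mat N N" "B \<in> carrier_mat N N" for A B :: "complex mat" and c
    using that by (auto simp: mtrace_def sum.distrib sum_distrib_left)
  have hadd: "h (A + B) = h A + h B" if "A \<in> carrier_mat N N" "B \<in> carrier_mat N N" for A B
  proof -
    have "blk (pr (A + B)) = blk (pr A) + blk (pr B)"
      using that by (intro eq_matI) (auto simp: blk_def pr_def tr[OF that] add_divide_distrib algebra_simps)
    then show ?thesis
      using l(1)[unfolded P, OF blkS[OF prc trpr[OF that(1)]] blkS[OF prc trpr[OF that(2)]]] by (simp add: h_def)
  qed
  have hscale: "h (c \<cdot>\<^sub>m A) = c * h A" if "A \<in> carrier_mat N N" for A c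
  proof -
    have "blk (pr (c \<cdot>\<^sub>m A)) = c \<cdot>\<^sub>m blk (pr A)"
      using that by (intro eq_matI) (auto simp: blk_def pr_def tr(2)[OF that that] algebra_simps)
    then show ?thesis
      using l(2)[unfolded P, OF blkS[OF prc trpr[OF that]], of c] by (simp add: h_def)
  qed
  define m where "m i j = h (mat N N (\<lambda>k. of_bool (k = (i, j))))" for i j
  \<comment> \<open>The eigenvector is taken for the transpose of \<open>m\<close>, since the row
    index of \<open>u u^t C\<close> carries the factor \<open>u i\<close>.\<close>
  obtain u \<mu> where u: "\<And>j. j < N \<Longrightarrow> (\<Sum>i<N. m i j * u i) = \<mu> * u j" "\<exists>i<N. u i \<noteq> 0"
    using complex_eigenvector[OF N0, of "\<lambda>i j. m j i"] by auto
  \<comment> \<open>By the eigenvector equation the value is \<open>\<mu> * (u^t C u)\<close>, and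
    \<open>u^t C u = 0\<close> for skew \<open>C\<close>.\<close>
  have key: "h (outer N N u u * C) = 0" if C: "C \<in> carrier_mat N N" "C = - transpose_mat C" for C
  proof -
    define w where "w j = (\<Sum>k<N. u k * C $$ (k, j))" for j
    have Cs: "C $$ (k, j) = - C $$ (j, k)" if "k < N" "j < N" for k j
      using arg_cong[OF C(2), of "\<lambda>M. M $$ (k, j)"] that C(1) by simp
    have ent: "(outer N N u u * C) $$ (i, j) = u i * w j" if "i < N" "j < N" for i j
      using that C(1) by (simp add: w_def scalar_prod_def atLeast0LessThan sum_distrib_left mult.assoc)
    have mc: "outer N N u u * C \<in> carrier_mat N N" by (rule mult_carrier_mat[OF outer_carrier C(1)])
    have "h (outer N N u u * C) = (\<Sum>(i, j)\<in>{..<N} \<times> {..<N}. (outer N N u u * C) $$ (i, j) * m i j)"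
      unfolding m_def by (rule matrix_functional[OF hadd hscale mc])
    also have "\<dots> = (\<Sum>(i, j)\<in>{..<N} \<times> {..<N}. u i * w j * m i j)"
      by (rule sum.cong) (auto simp: ent simp del: index_mult_mat(1))
    also have "\<dots> = (\<Sum>j<N. \<Sum>i<N. u i * w j * m i j)"
      by (subst sum.swap) (simp add: sum.cartesian_product)
    also have "\<dots> = (\<Sum>j<N. w j * (\<Sum>i<N. m i j * u i))"
      by (simp add: sum_distrib_left mult_ac)
    also have "\<dots> = (\<Sum>j<N. w j * (\<mu> * u j))"
      by (rule sum.cong) (simp_all add: u(1))
    also have "\<dots> = \<mu> * (\<Sum>j<N. w j * u j)"
      by (simp add: sum_distrib_left mult_ac)
    also have "(\<Sum>j<N. w j * u j) = 0"
    proof -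
      have "(\<Sum>j<N. w j * u j) = (\<Sum>j<N. \<Sum>k<N. u k * C $$ (k, j) * u j)"
        by (simp add: w_def sum_distrib_right)
      also have "\<dots> = (\<Sum>j<N. \<Sum>k<N. - (u k * C $$ (j, k) * u j))"
        by (intro sum.cong refl) (subst Cs, simp_all)
      also have "\<dots> = - (\<Sum>k<N. \<Sum>j<N. u k * C $$ (j, k) * u j)"
        by (subst sum.swap) (simp add: sum_negf)
      also have "\<dots> = - (\<Sum>j<N. w j * u j)"
        by (simp add: w_def sum_distrib_left mult_ac)
      finally show ?thesis by simp
    qed
    finally show ?thesis by simp
  qed
  let ?X = "odd_block N N (outer N N u u) (0\<^sub>m N N)"
  have bl: "is_blocks N N ?X (0\<^sub>m N N) (outer N N u u) (0\<^sub>m N N) (- transpose_mat (0\<^sub>m N N))"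
    by (auto simp: is_blocks_def odd_block_def intro!: cong_four_block_mat eq_matI)
  have XS: "?X \<in> ?S"
  proof -
    have "outer N N u u = transpose_mat (outer N N u u)" "0\<^sub>m N N = - transpose_mat (0\<^sub>m N N :: complex mat)"
      by (auto intro!: eq_matI simp: mult.commute)
    then show ?thesis
      unfolding mem_Collect_eq
      by (intro conjI odd_block_in_sl_set exI[of _ "0\<^sub>m N N"] exI[of _ "outer N N u u"] bl) simp_all
  qed
  have Xo: "mat_odd N N ?X = ?X" by (rule odd_block_odd) auto
  obtain i where i: "i < N" "u i \<noteq> 0" using u(2) by blast
  have "?X $$ (i, N + i) \<noteq> (0 \<cdot>\<^sub>m ?X) $$ (i, N + i)" using i by (simp add: odd_block_def)
  then have "?X \<noteq> 0 \<cdot>\<^sub>m ?X" by metis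
  moreover have "?X \<in> carrier_mat (N + N) (N + N)" using XS sl_set_carrier by blast
  ultimately obtain Y where Y: "Y \<in> ?S" "mat_odd N N Y = Y" 
    and Ynz: "l (supercommutator (*) (+) (-) (mat_even N N) (mat_odd N N) ?X Y) \<noteq> 0"
    using nd[of ?X] XS Xo unfolding P by blast
  obtain A B C where bY: "is_blocks N N Y A B C (- transpose_mat A)" "C = - transpose_mat C"
    using Y(1) by blast
  then have carr: "A \<in> carrier_mat N N" "B \<in> carrier_mat N N" "C \<in> carrier_mat N N"
    and Yeq: "Y = four_block_mat A B C (- transpose_mat A)" by (simp_all add: is_blocks_def)
  have "A $$ (i, j) = 0" if "i < N" "j < N" for i j
    using mat_odd_entry[OF Y(2), of i j] that carr by (simp add: Yeq)
  then have "A = 0\<^sub>m N N" using carr by (intro eq_matI) auto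
  then have Yo: "Y = odd_block N N B C"
    unfolding Yeq odd_block_def by (intro cong_four_block_mat) (auto intro!: eq_matI)
  have "?X * Y + Y * ?X = four_block_mat (outer N N u u * C) (0\<^sub>m N N) (0\<^sub>m N N) (C * outer N N u u)"
    unfolding Yo using carr
    by (subst (1 2) odd_block_mult) (auto intro!: eq_matI simp: scalar_prod_def)
  also have "\<dots> = blk (outer N N u u * C)"
  proof -
    have ut: "transpose_mat (outer N N u u) = outer N N u u" by (auto intro!: eq_matI simp: mult.commute)
    have "- transpose_mat (outer N N u u * C) = - (transpose_mat C * outer N N u u)"
      using carr by (subst transpose_mult[of _ N N _ N]) (auto simp: ut)
    also have "\<dots> = - transpose_mat C * outer N N u u"
      using carr by (auto intro!: eq_matI)
    also have "\<dots> = C * outer N N u u" using bY(2) by simp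
    finally show ?thesis by (simp add: blk_def)
  qed
  \<comment> \<open>Here the trace is \<open>u^t C u\<close>, which vanishes for skew
    \<open>C\<close>, so the projection does not change the matrix.\<close>
  also have "\<dots> = blk (pr (outer N N u u * C))"
  proof -
    have "C $$ (k, j) = - C $$ (j, k)" if "k < N" "j < N" for k j
      using arg_cong[OF bY(2), of "\<lambda>M. M $$ (k, j)"] that carr by simp
    note Cs = this
    have "mtrace (outer N N u u * C) = (\<Sum>j<N. \<Sum>k<N. u j * (u k * C $$ (k, j)))" 
      using carr by (auto simp: mtrace_def scalar_prod_def atLeast0LessThan mult.assoc intro!: sum.cong)
    also have "\<dots> = (\<Sum>j<N. \<Sum>k<N. - (u j * (u k * C $$ (j, k))))"
      by (intro sum.cong refl) (subst Cs, simp_all)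
    also have "\<dots> = - (\<Sum>k<N. \<Sum>j<N. u j * (u k * C $$ (j, k)))"
      by (subst sum.swap) (simp add: sum_negf)
    also have "\<dots> = - mtrace (outer N N u u * C)"
      using carr by (auto simp: mtrace_def scalar_prod_def atLeast0LessThan mult_ac intro!: sum.cong)
    finally have "mtrace (outer N N u u * C) = 0" by simp
    then have "pr (outer N N u u * C) = outer N N u u * C"
      using carr by (intro eq_matI) (auto simp: pr_def)
    then show ?thesis by simp
  qed
  finally have "l (?X * Y + Y * ?X) = 0"
    using key[OF carr(3) bY(2)] by (simp add: h_def)
  then show False using Ynz unfolding supercommutator_odd[OF Xo Y(2)] by blast
qed

section \<open>Nilpotent even elements and abelian ideals of the even part\<close>

context real_lie_superalgebra
begin

text \<open>If \<open>[N, [N, x]] = 0\<close>, two applications of the Jacobi identity give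
  \<open>[N, [N, [x, x]]] = 2 [[N, x], [N, x]]\<close>, and the left side vanishes because
  \<open>[x, x]\<close> is even.\<close>

lemma nondefinite_if_nilpotent:
  assumes N: "N \<in> g0" "\<And>Y. Y \<in> g0 \<Longrightarrow> br N (br N Y) = 0"
    and X: "X \<in> g1" "br N X \<noteq> 0" and nil: "(br N ^^ k) X = 0"
  shows "nondefinite g1 br"
proof -
  have odd: "(br N ^^ j) X \<in> g1" for j
    by (induction j) (use X N graded in auto)
  define j where "j = (LEAST j. (br N ^^ j) X = 0)"
  have j: "(br N ^^ j) X = 0" unfolding j_def using nil by (rule LeastI[of "\<lambda>j. (br N ^^ j) X = 0"])
  have min: "(br N ^^ i) X \<noteq> 0" if "i < j" for i using not_less_Least that unfolding j_def by blast
  \<comment> \<open>Both \<open>X\<close> and \<open>[N, X]\<close> are nonzero, so at least two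
    steps precede the first zero iterate and the element two steps back exists.\<close>
  have "j \<noteq> 0" using j X br_simps by (intro notI) auto
  moreover have "j \<noteq> 1" using j X by (intro notI) auto
  ultimately obtain i where i: "j = Suc (Suc i)" by (metis One_nat_def not0_implies_Suc)
  let ?X = "(br N ^^ i) X"
  have NX: "br N ?X \<noteq> 0" "br N (br N ?X) = 0" "?X \<in> g1" "br N ?X \<in> g1"
    using min[of "Suc i"] j odd[of i] odd[of "Suc i"] by (simp_all add: i)
  have jac: "br N (br u v) = br (br N u) v + br u (br N v)" if "u \<in> g1" "v \<in> g1" for u v
    using super_jacobi(1)[OF N(1)] that by simp
  have "br N (br N (br ?X ?X)) = 2 *\<^sub>R br (br N ?X) (br N ?X)"
    using NX by (simp add: jac br_simps scaleR_2)
  then have "br (br N ?X) (br N ?X) = 0"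
    using N(2)[OF graded(4)[OF NX(3,3)]] by simp
  then show ?thesis using nondefinite_if_square_zero[OF NX(4,1)] by blast
qed

text \<open>The even elements that annihilate the odd part form an ideal by the Jacobi identity. It
  is not everything because the odd part is nonzero, hence it is zero.\<close>

lemma even_faithful:
  assumes simple: "simple_superalgebra g0 g1 br" and "g1 \<noteq> {0}" and N: "N \<in> g0" "N \<noteq> 0"
  shows "\<exists>X\<in>g1. br N X \<noteq> 0"
proof (rule ccontr)
  assume *: "\<not> ?thesis"
  define I where "I = {N \<in> g0. \<forall>X\<in>g1. br N X = 0}"
  have I: "subspace I"
    using subspace_even by (auto simp: I_def subspace_def br_simps)
  have step: "br y u \<in> I \<and> br u y \<in> I" if "y \<in> g0 \<union> g1" "u \<in> I" for y u
  proof (cases "y \<in> g0")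
    case True
    have "br (br y u) X = 0" if "X \<in> g1" for X
      using super_jacobi(1)[OF True, of u X] that \<open>u \<in> I\<close> graded(2)[OF True that] by (auto simp: I_def br_simps)
    then have "br y u \<in> I" using True that(2) graded(1) by (auto simp: I_def)
    moreover have "br u y = - br y u" using True that super_antisym(1)[of u y] by (auto simp: I_def)
    ultimately show ?thesis using subspace_neg[OF I] by auto
  next
    case False
    then have "br u y = 0" using that by (auto simp: I_def)
    moreover have "br u y = - br y u" using that super_antisym(1)[of u y] by (auto simp: I_def)
    ultimately show ?thesis using subspace_0[OF I] by simp
  qed
  have "super_ideal g0 g1 br I"
    unfolding super_ideal_def
  proof (intro conjI allI ballI)
    show "subspace I" by (rule I)
    show "I = {x + y | x y. x \<in> I \<inter> g0 \<and> y \<in> I \<inter> g1}"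
    proof (intro equalityI subsetI)
      fix z assume "z \<in> I"
      then have "z + 0 \<in> {x + y | x y. x \<in> I \<inter> g0 \<and> y \<in> I \<inter> g1}"
        using subspace_0[OF I] subspace_0[OF subspace_odd] I_def by blast
      then show "z \<in> {x + y | x y. x \<in> I \<inter> g0 \<and> y \<in> I \<inter> g1}" by simp
    next
      fix z assume "z \<in> {x + y | x y. x \<in> I \<inter> g0 \<and> y \<in> I \<inter> g1}"
      then show "z \<in> I" using subspace_add[OF I] by auto
    qed
    fix x y assume y: "y \<in> I"
    obtain p q where pq: "p \<in> g0" "q \<in> g1" "x = p + q" using direct_sum(2) by blast
    show "br x y \<in> I" "br y x \<in> I"
      using step[of p y] step[of q y] pq y by (auto simp: br_simps intro!: subspace_add[OF I])
  qed
  moreover have "N \<in> I" using * N by (auto simp: I_def)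
  ultimately have "I = UNIV" using simple N(2) unfolding simple_superalgebra_def by blast
  then have "g1 \<subseteq> g0 \<inter> g1" unfolding I_def by blast
  then show False using direct_sum(1) subspace_0[OF subspace_odd] assms(2) by auto
qed

end

text \<open>Writing \<open>(f + g)^(n+1) x\<close> as
  \<open>(f + g)^n (f x) + (f + g)^n (g x)\<close> lowers one of the two exponents in each summand,
  so induction on \<open>i + j\<close> takes the place of a binomial expansion. Commutation is asked
  for only on the invariant set \<open>S\<close>, later the pairs of odd elements.\<close>

lemma commuting_nilpotent:
  fixes f g :: "'a::ab_group_add \<Rightarrow> 'a"
  assumes f: "\<And>x y. f (x + y) = f x + f y" and g: "\<And>x y. g (x + y) = g x + g y"
    and comm: "\<And>x. x \<in> S \<Longrightarrow> f (g x) = g (f x)" "f ` S \<subseteq> S" "g ` S \<subseteq> S"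
  shows "x \<in> S \<Longrightarrow> (f ^^ i) x = 0 \<Longrightarrow> (g ^^ j) x = 0 \<Longrightarrow> ((\<lambda>x. f x + g x) ^^ (i + j)) x = 0"
proof (induction "i + j" arbitrary: i j x)
  case 0
  then show ?case by simp
next
  case (Suc n)
  let ?h = "\<lambda>x. f x + g x"
  have f0: "f 0 = 0" and g0: "g 0 = 0" using f[of 0 0] g[of 0 0] by simp_all
  have h0: "(?h ^^ m) 0 = 0" for m by (induction m) (simp_all add: f0 g0)
  have hadd: "(?h ^^ m) (x + y) = (?h ^^ m) x + (?h ^^ m) y" for m x y
    by (induction m arbitrary: x y) (simp_all add: f g algebra_simps)
  have fg: "(f ^^ m) (g x) = g ((f ^^ m) x)" "(g ^^ m) (f x) = f ((g ^^ m) x)" "(f ^^ m) x \<in> S" "(g ^^ m) x \<in> S"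
    if "x \<in> S" for m x
  proof -
    show S: "(f ^^ m) x \<in> S" "(g ^^ m) x \<in> S" for m
      by (induction m) (use that comm in auto)
    show "(f ^^ m) (g x) = g ((f ^^ m) x)" by (induction m) (use comm(1)[OF S(1)] in auto)
    show "(g ^^ m) (f x) = f ((g ^^ m) x)" by (induction m) (use comm(1)[OF S(2)] in auto)
  qed
  show ?case
  proof (cases "i = 0 \<or> j = 0")
    case True
    then have "x = 0" using Suc.prems by auto
    then show ?thesis by (simp add: h0)
  next
    case False
    then obtain i' j' where ij: "i = Suc i'" "j = Suc j'" by (metis not0_implies_Suc)
    have S: "f x \<in> S" "g x \<in> S" using Suc.prems(1) comm by auto
    have n: "n = i' + j" "n = i + j'" using Suc.hyps(2) ij by auto
    have "(f ^^ i') (f x) = 0" "(g ^^ j') (g x) = 0" using Suc.prems(2,3) by (simp_all add: ij funpow_swap1)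
    moreover have "(g ^^ j) (f x) = 0" "(f ^^ i) (g x) = 0"
      using fg(1,2)[OF Suc.prems(1)] Suc.prems(2,3) f0 g0 by metis+
    ultimately have "(?h ^^ (i' + j)) (f x) = 0" "(?h ^^ (i + j')) (g x) = 0"
      using Suc.hyps(1)[OF n(1) S(1)] Suc.hyps(1)[OF n(2) S(2)] by blast+
    moreover have "(?h ^^ (i + j)) x = (?h ^^ n) (f x) + (?h ^^ n) (g x)"
      using Suc.hyps(2) by (metis funpow_Suc_right hadd o_apply)
    ultimately show ?thesis using n by simp
  qed
qed

text \<open>An abelian ideal \<open>\<aa>\<close> of the even part of the complex algebra need not be defined over the reals, but either
  \<open>\<aa>\<close> meets its conjugate or the two commute; both cases produce a real element \<open>N\<close> with \<open>(ad N)\<^sup>2 = 0\<close> on the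
  even part.\<close>

lemma nondefinite_if_abelian_ideal:
  fixes g0 g1 :: "'a::euclidean_space set" and M :: "(complex, 'w) superalgebra"
  assumes alg: "real_lie_superalgebra g0 g1 br"
    and simple: "simple_superalgebra g0 g1 br" "g1 \<noteq> {0}"
    and rf: "real_form_of (superalgebra_of g0 g1 br) M"
    and zero: "\<And>x. x \<in> sa_carrier M \<Longrightarrow> sa_scale M 0 x = sa_zero M"
    and sub: "\<aa> \<subseteq> sa_even M" "\<And>a b. a \<in> \<aa> \<Longrightarrow> b \<in> \<aa> \<Longrightarrow> sa_add M a b \<in> sa_even M \<Longrightarrow> sa_add M a b \<in> \<aa>"
      "\<And>c a. a \<in> \<aa> \<Longrightarrow> sa_scale M c a \<in> sa_even M \<Longrightarrow> sa_scale M c a \<in> \<aa>"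
    and ideal: "\<And>a x. a \<in> \<aa> \<Longrightarrow> x \<in> sa_even M \<Longrightarrow> sa_br M a x \<in> sa_even M \<Longrightarrow> sa_br M a x \<in> \<aa>"
    and abelian: "\<And>a b. a \<in> \<aa> \<Longrightarrow> b \<in> \<aa> \<Longrightarrow> sa_br M a b \<in> sa_even M \<Longrightarrow> sa_br M a b = sa_zero M"
    and nil: "\<And>a x. a \<in> \<aa> \<Longrightarrow> x \<in> sa_odd M \<Longrightarrow> (\<And>j. (sa_br M a ^^ j) x \<in> sa_odd M) \<Longrightarrow> (sa_br M a ^^ k) x = sa_zero M"
    and nonzero: "\<exists>a\<in>\<aa>. a \<noteq> sa_zero M"
  shows "nondefinite g1 br"
proof -
  interpret real_lie_superalgebra g0 g1 br by (rule alg)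
  obtain \<phi> where \<phi>: "sa_iso (complexification (superalgebra_of g0 g1 br)) M \<phi>"
    using rf unfolding real_form_of_def sa_isomorphic_def by blast
  have bij: "bij_betw \<phi> UNIV (sa_carrier M)"
    and add: "\<And>x y u v. \<phi> (x + u, y + v) = sa_add M (\<phi> (x, y)) (\<phi> (u, v))"
    and scale: "\<And>c x y. \<phi> (Re c *\<^sub>R x - Im c *\<^sub>R y, Re c *\<^sub>R y + Im c *\<^sub>R x) = sa_scale M c (\<phi> (x, y))"
    and brk: "\<And>x y u v. \<phi> (br x u - br y v, br x v + br y u) = sa_br M (\<phi> (x, y)) (\<phi> (u, v))"
    and even: "\<phi> ` (g0 \<times> g0) = sa_even M" and odd: "\<phi> ` (g1 \<times> g1) = sa_odd M"
    using \<phi> by (auto simp: sa_iso_def complexification_def superalgebra_of_def)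
  have inj: "\<phi> z = \<phi> z' \<Longrightarrow> z = z'" for z z' using bij injD[of \<phi> z z'] by (auto simp: bij_betw_def)
  have "\<phi> (0, 0) \<in> sa_carrier M" using bij by (auto simp: bij_betw_def)
  then have z: "\<phi> (0, 0) = sa_zero M" using scale[of 0 0 0] zero by simp
  \<comment> \<open>The pair \<open>(x, y)\<close> stands for \<open>x + \<i> y\<close>, and
    conjugation is \<open>(x, y) \<mapsto> (x, - y)\<close>. \<open>B\<close> is the given ideal
    transported to such pairs, and \<open>bc\<close> is the complexified bracket.\<close>
  define B where "B = {p. \<phi> p \<in> \<aa>}"
  define bc where "bc p = (\<lambda>w. (br (fst p) (fst w) - br (snd p) (snd w), br (fst p) (snd w) + br (snd p) (fst w)))" for p
  have bc: "\<phi> (bc p w) = sa_br M (\<phi> p) (\<phi> w)" for p w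
    using brk[of "fst p" "fst w" "snd p" "snd w"] by (simp add: bc_def)
  have bcpow: "\<phi> ((bc p ^^ j) w) = (sa_br M (\<phi> p) ^^ j) (\<phi> w)" for p w j
    by (induction j) (simp_all add: bc)
  have bce: "bc p w \<in> g0 \<times> g0" if "p \<in> g0 \<times> g0" "w \<in> g0 \<times> g0" for p w
    using that graded(1) subspace_diff[OF subspace_even] subspace_add[OF subspace_even]
    by (auto simp: bc_def)
  have bco: "bc p w \<in> g1 \<times> g1" if "p \<in> g0 \<times> g0" "w \<in> g1 \<times> g1" for p w
    using that graded(2) subspace_diff[OF subspace_odd] subspace_add[OF subspace_odd]
    by (auto simp: bc_def)
  have B0: "p \<in> g0 \<times> g0" if "p \<in> B" for p
  proof -
    have "\<phi> p \<in> \<phi> ` (g0 \<times> g0)" using that sub(1) unfolding B_def even by blast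
    then show ?thesis using inj by blast
  qed
  \<comment> \<open>The closure hypotheses on \<open>\<aa>\<close> ask that the result lie in
    \<open>sa_even M\<close>. This is supplied by the isomorphism, since the real even part is
    closed under the operations.\<close>
  have Badd: "(x + u, y + v) \<in> B" if "(x, y) \<in> B" "(u, v) \<in> B" for x y u v
  proof -
    have "(x + u, y + v) \<in> g0 \<times> g0" using B0[OF that(1)] B0[OF that(2)] subspace_add[OF subspace_even] by auto
    then have "\<phi> (x + u, y + v) \<in> sa_even M" unfolding even[symmetric] by (rule imageI)
    then show ?thesis using that sub(2) by (simp add: B_def add)
  qed
  have Bscale: "(Re c *\<^sub>R x - Im c *\<^sub>R y, Re c *\<^sub>R y + Im c *\<^sub>R x) \<in> B" if "(x, y) \<in> B" for c x y
  proof -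
    let ?z = "(Re c *\<^sub>R x - Im c *\<^sub>R y, Re c *\<^sub>R y + Im c *\<^sub>R x)"
    have "?z \<in> g0 \<times> g0"
      using B0[OF that] subspace_add[OF subspace_even] subspace_diff[OF subspace_even] subspace_scale[OF subspace_even] by auto
    then have "\<phi> ?z \<in> sa_even M" unfolding even[symmetric] by (rule imageI)
    then show ?thesis using that sub(3) by (simp add: B_def scale)
  qed
  have Bideal: "bc p w \<in> B" if "p \<in> B" "w \<in> g0 \<times> g0" for p w
  proof -
    have "\<phi> w \<in> sa_even M" "\<phi> (bc p w) \<in> sa_even M"
      unfolding even[symmetric] using that bce[OF B0] by blast+
    then show ?thesis using that ideal by (simp add: B_def bc)
  qed
  have Babel: "bc p w = 0" if "p \<in> B" "w \<in> B" for p w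
  proof -
    have "\<phi> (bc p w) \<in> sa_even M" unfolding even[symmetric] using that bce[OF B0 B0] by blast
    then have "\<phi> (bc p w) = \<phi> (0, 0)" using that abelian unfolding z by (simp add: B_def bc)
    then show ?thesis using inj by (metis zero_prod_def)
  qed
  have oddpow: "(bc p ^^ j) w \<in> g1 \<times> g1" if "p \<in> g0 \<times> g0" "w \<in> g1 \<times> g1" for p w j
    using that by (induction j) (use bco in auto)
  have Bnil: "(bc p ^^ k) w = 0" if "p \<in> B" "w \<in> g1 \<times> g1" for p w
  proof -
    have *: "\<phi> ((bc p ^^ j) w) \<in> sa_odd M" for j
      unfolding odd[symmetric] using oddpow[OF B0] that by blast
    have "\<phi> ((bc p ^^ k) w) = \<phi> (0, 0)"
      unfolding z bcpow by (rule nil) (use that * *[of 0] in \<open>auto simp: B_def bcpow\<close>)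
    then show ?thesis using inj by (metis zero_prod_def)
  qed
  have concl: "nondefinite g1 br"
    if N: "N \<in> g0" "N \<noteq> 0" "\<And>Y. Y \<in> g0 \<Longrightarrow> br N (br N Y) = 0" "\<And>X. X \<in> g1 \<Longrightarrow> (br N ^^ m) X = 0" for N m
  proof -
    obtain X where "X \<in> g1" "br N X \<noteq> 0" using even_faithful[OF simple N(1,2)] by blast
    then show ?thesis using nondefinite_if_nilpotent[OF N(1,3)] N(4) by blast
  qed
  have real: "nondefinite g1 br" if N: "(N, 0) \<in> B" "N \<noteq> 0" for N
  proof (rule concl[of N k])
    show N0: "N \<in> g0" "N \<noteq> 0" using B0 N by auto
    have b: "bc (N, 0) (Y, 0) = (br N Y, 0)" for Y by (simp add: bc_def br_simps)
    show "br N (br N Y) = 0" if "Y \<in> g0" for Y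
    proof -
      have "bc (N, 0) (Y, 0) \<in> B" by (rule Bideal) (use N that subspace_0[OF subspace_even] in auto)
      from Babel[OF N(1) this] show ?thesis by (simp add: b zero_prod_def)
    qed
    show "(br N ^^ k) X = 0" if "X \<in> g1" for X
    proof -
      have "(bc (N, 0) ^^ j) (X, 0) = ((br N ^^ j) X, 0)" for j by (induction j) (simp_all add: b)
      then show ?thesis using Bnil[OF N(1), of "(X, 0)"] that subspace_0[OF subspace_odd] by (simp add: zero_prod_def)
    qed
  qed
  show ?thesis
  proof (cases "\<exists>x y. (x, y) \<in> B \<and> (x, - y) \<in> B \<and> (x, y) \<noteq> (0, 0)")
    case True
    then obtain x y where xy: "(x, y) \<in> B" "(x, - y) \<in> B" "x \<noteq> 0 \<or> y \<noteq> 0" by auto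
    have "(x + x, 0) \<in> B" using Badd[OF xy(1,2)] by simp
    \<comment> \<open>The difference of the element and its conjugate is purely imaginary;
      multiplication by \<open>\<i>\<close> makes it real.\<close>
    moreover have "(- (y + y), 0) \<in> B"
      using Bscale[OF Badd[OF xy(1) Bscale[OF xy(2), of "-1"]], of \<i>] by simp
    moreover have "x + x \<noteq> 0" if "x \<noteq> 0" for x :: 'a using that by (simp flip: scaleR_2)
    ultimately show ?thesis using real xy(3) by (metis neg_equal_0_iff_equal)
  next
    case False
    obtain p where p: "p \<in> B" "p \<noteq> (0, 0)"
    proof -
      obtain a where a: "a \<in> \<aa>" "a \<noteq> sa_zero M" using nonzero by blast
      then obtain p where "a = \<phi> p" using sub(1) even by blast
      then show thesis using that[of p] a z by (auto simp: B_def)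
    qed
    \<comment> \<open>If the real part is zero, multiplication by \<open>\<i>\<close> moves the
      imaginary part there.\<close>
    obtain x y where xy: "(x, y) \<in> B" "x \<noteq> 0"
    proof (cases "fst p = 0")
      case True
      then show thesis using that[of "- snd p" 0] p Bscale[of "fst p" "snd p" \<i>] by (cases p) auto
    next
      case False
      then show thesis using that[of "fst p" "snd p"] p by simp
    qed
    have x: "x \<in> g0" and y: "y \<in> g0" using B0[OF xy(1)] by auto
    have conj: "bc (x, - y) (u, - v) = (fst (bc (x, y) (u, v)), - snd (bc (x, y) (u, v)))" for u v
      by (simp add: bc_def br_simps)
    \<comment> \<open>The bracket of an element of \<open>B\<close> with a conjugate of another lies
      in \<open>B\<close> and in its conjugate, as both are ideals; in this case they meet only in
      zero.\<close>
    have cB: "bc (x, y) (u, - v) = 0" if uv: "(u, v) \<in> B" for u v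
    proof -
      have uv0: "u \<in> g0" "v \<in> g0" using B0[OF uv] by auto
      let ?w = "bc (x, y) (u, - v)"
      have 1: "?w \<in> B" by (rule Bideal[OF xy(1)]) (use uv0 subspace_neg[OF subspace_even] in auto)
      have "bc (u, v) (x, - y) \<in> B" by (rule Bideal[OF uv]) (use x y subspace_neg[OF subspace_even] in auto)
      then have "(- fst (bc (u, v) (x, - y)), - snd (bc (u, v) (x, - y))) \<in> B"
        using Bscale[of "fst (bc (u, v) (x, - y))" "snd (bc (u, v) (x, - y))" "-1"] by simp
      moreover have "fst ?w = - fst (bc (u, v) (x, - y))" "- snd ?w = - snd (bc (u, v) (x, - y))"
        using super_antisym(1)[OF x, of u] super_antisym(1)[OF x, of v] super_antisym(1)[OF y, of u] super_antisym(1)[OF y, of v] uv0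
        by (simp_all add: bc_def br_simps)
      ultimately have 2: "(fst ?w, - snd ?w) \<in> B" by simp
      show ?thesis using False 1 2 by (metis prod.collapse zero_prod_def)
    qed
    have comm: "br x y = 0" 
    proof -
      have "br y x - br x y = 0" using cB[OF xy(1)] by (simp add: bc_def br_simps zero_prod_def)
      moreover have "br y x = - br x y" using super_antisym(1)[OF y] x by simp
      ultimately have "br x y = - br x y" by simp
      then have "br x y + br x y = 0" unfolding eq_neg_iff_add_eq_0 .
      then have "2 *\<^sub>R br x y = 0" by (simp only: scaleR_2)
      then show ?thesis by simp
    qed
    show ?thesis
    proof (rule concl[OF x xy(2)])
      \<comment> \<open>With \<open>P = x + \<i> y\<close> both \<open>[P, [P, Y]]\<close> and the
        bracket of \<open>P\<close> with the conjugate of \<open>[P, Y]\<close> vanish. Their real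
        parts are \<open>[x,[x,Y]] - [y,[y,Y]]\<close> and
        \<open>[x,[x,Y]] + [y,[y,Y]]\<close>.\<close>
      show "br x (br x Y) = 0" if Y: "Y \<in> g0" for Y
      proof -
        have Y2: "(Y, 0) \<in> g0 \<times> g0" using Y subspace_0[OF subspace_even] by auto
        have b: "bc (x, y) (Y, 0) = (br x Y, br y Y)" by (simp add: bc_def br_simps)
        have "bc (x, y) (br x Y, br y Y) = 0" using Babel[OF xy(1) Bideal[OF xy(1) Y2]] by (simp add: b)
        moreover have "bc (x, y) (br x Y, - br y Y) = 0" using cB Bideal[OF xy(1) Y2] by (simp add: b)
        ultimately have "br x (br x Y) - br y (br y Y) = 0" "br x (br x Y) + br y (br y Y) = 0"
          by (simp_all add: bc_def br_simps zero_prod_def)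
        then have "2 *\<^sub>R br x (br x Y) = 0" by (simp add: scaleR_2 add_eq_0_iff)
        then show ?thesis by simp
      qed
      \<comment> \<open>\<open>2 x\<close> is the sum of \<open>x + \<i> y\<close> and its
        conjugate. Both act on the odd part with vanishing \<open>k\<close>-th power, and they
        commute because \<open>[x, y] = 0\<close>.\<close>
      show "(br x ^^ (k + k)) X = 0" if X: "X \<in> g1" for X
      proof -
        have g0': "(x, - y) \<in> g0 \<times> g0" using x y subspace_neg[OF subspace_even] by auto
        have cm: "br x (br y u) = br y (br x u)" if "u \<in> g1" for u
          using super_jacobi(1)[OF x, of y u] y that comm by (simp add: br_simps)
        have flip: "(bc (x, - y) ^^ j) (u, - v) = (fst ((bc (x, y) ^^ j) (u, v)), - snd ((bc (x, y) ^^ j) (u, v)))" for j u v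
          by (induction j) (simp_all add: conj)
        have X2: "(X, 0) \<in> g1 \<times> g1" using X subspace_0[OF subspace_odd] by auto
        have n2: "(bc (x, - y) ^^ k) (X, 0) = 0"
          using flip[of k X 0] Bnil[OF xy(1) X2] by (simp add: zero_prod_def)
        have "((\<lambda>w. bc (x, y) w + bc (x, - y) w) ^^ (k + k)) (X, 0) = 0"
          by (rule commuting_nilpotent[where S = "g1 \<times> g1", OF _ _ _ _ _ X2 Bnil[OF xy(1) X2] n2])
            (use bco B0[OF xy(1)] g0' in \<open>auto simp: bc_def br_simps cm algebra_simps\<close>)
        moreover have "((\<lambda>w. bc (x, y) w + bc (x, - y) w) ^^ j) (X, 0) = (2 ^ j *\<^sub>R (br x ^^ j) X, 0)" for j
          by (induction j) (simp_all add: bc_def br_simps scaleR_2[symmetric])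
        ultimately show ?thesis by (simp add: zero_prod_def)
      qed
    qed
  qed
qed

section \<open>Nilpotent elements of \<open>sp(p,q)\<close>\<close>

text \<open>The curve is \<open>exp(t A) X\<close>, differentiated coordinate by coordinate as a
  real power series. The last clause holds because the partial sums stay in an invariant subspace
  and the subspace is closed.\<close>

lemma linear_flow:
  fixes A :: "'a::euclidean_space \<Rightarrow> 'a"
  assumes A: "linear A"
  obtains x :: "real \<Rightarrow> 'a" where "x 0 = X" "\<And>t. (x has_vector_derivative A (x t)) (at t)"
    and "\<And>S. closed S \<Longrightarrow> subspace S \<Longrightarrow> X \<in> S \<Longrightarrow> A ` S \<subseteq> S \<Longrightarrow> \<forall>t. x t \<in> S"
proof -
  have bA: "bounded_linear A" using A by (simp add: linear_conv_bounded_linear)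
  obtain K where K: "0 \<le> K" "\<And>x. norm (A x) \<le> norm x * K" using bounded_linear.nonneg_bounded[OF bA] by blast
  have pow: "norm ((A ^^ n) Y) \<le> norm Y * K ^ n" for n Y
  proof (induction n)
    case (Suc n)
    have "norm ((A ^^ Suc n) Y) \<le> norm ((A ^^ n) Y) * K" using K(2) by simp
    also have "\<dots> \<le> (norm Y * K ^ n) * K" using Suc K(1) by (rule mult_right_mono)
    finally show ?case by (simp add: mult_ac)
  qed simp
  have summ: "summable (\<lambda>n. (t ^ n / fact n) *\<^sub>R (A ^^ n) Y)" for t Y
  proof (rule summable_comparison_test)
    have "norm ((t ^ n / fact n) *\<^sub>R (A ^^ n) Y) \<le> norm Y * ((\<bar>t\<bar> * K) ^ n /\<^sub>R fact n)" for n
    proof -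
      have "norm ((t ^ n / fact n) *\<^sub>R (A ^^ n) Y) = (\<bar>t\<bar> ^ n / fact n) * norm ((A ^^ n) Y)"
        by (simp add: power_abs)
      also have "\<dots> \<le> (\<bar>t\<bar> ^ n / fact n) * (norm Y * K ^ n)" by (rule mult_left_mono[OF pow]) simp
      finally show ?thesis by (simp add: power_mult_distrib divide_inverse mult_ac)
    qed
    then show "\<exists>N. \<forall>n\<ge>N. norm ((t ^ n / fact n) *\<^sub>R (A ^^ n) Y) \<le> norm Y * ((\<bar>t\<bar> * K) ^ n /\<^sub>R fact n)" by blast
    show "summable (\<lambda>n. norm Y * ((\<bar>t\<bar> * K) ^ n /\<^sub>R fact n))" by (intro summable_mult summable_exp_generic)
  qed
  define x where "x t = (\<Sum>n. (t ^ n / fact n) *\<^sub>R (A ^^ n) X)" for t :: real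
  have Ax: "A (x t) = (\<Sum>n. (t ^ n / fact n) *\<^sub>R (A ^^ n) (A X))" for t
    unfolding x_def bounded_linear.suminf[OF bA summ]
    by (simp add: linear_scale[OF A] funpow_swap1)
  show thesis
  proof (rule that[of x])
    have "(\<lambda>n. ((0::real) ^ n / fact n) *\<^sub>R (A ^^ n) X) sums ((0 ^ 0 / fact 0) *\<^sub>R (A ^^ 0) X)"
      using sums_finite[of "{0::nat}" "\<lambda>n. ((0::real) ^ n / fact n) *\<^sub>R (A ^^ n) X"] by simp
    then show "x 0 = X" unfolding x_def by (simp add: sums_iff)
  next
    fix t
    have "((\<lambda>t. x t \<bullet> b) has_derivative (\<lambda>h. (h *\<^sub>R A (x t)) \<bullet> b)) (at t)" for b
    proof -
      define c where "c n = ((A ^^ n) X \<bullet> b) / fact n" for n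
      have comp: "(\<Sum>n. (t ^ n / fact n) *\<^sub>R (A ^^ n) Y) \<bullet> b = (\<Sum>n. ((A ^^ n) Y \<bullet> b) / fact n * t ^ n)" for t Y
        unfolding bounded_linear.suminf[OF bounded_linear_inner_left summ] by (simp add: mult_ac)
      have sc: "summable (\<lambda>n. c n * y ^ n)" for y
        using bounded_linear.summable[OF bounded_linear_inner_left summ[of y X], of b]
        by (simp add: c_def mult_ac)
      have "((\<lambda>t. \<Sum>n. c n * t ^ n) has_real_derivative (\<Sum>n. diffs c n * t ^ n)) (at t)"
        by (rule termdiffs_strong_converges_everywhere[OF sc])
      moreover have "diffs c n = ((A ^^ n) (A X) \<bullet> b) / fact n" for n
      proof -
        have "diffs c n = real (Suc n) * (((A ^^ n) (A X) \<bullet> b) / (real (Suc n) * fact n))"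
          unfolding diffs_def c_def fact_Suc by (simp only: funpow_Suc_right o_apply of_nat_id of_nat_mult)
        then show ?thesis by (simp del: of_nat_Suc)
      qed
      moreover have "x t \<bullet> b = (\<Sum>n. c n * t ^ n)" for t
        unfolding x_def comp c_def by simp
      ultimately have "((\<lambda>t. x t \<bullet> b) has_real_derivative (A (x t) \<bullet> b)) (at t)"
        unfolding Ax comp by simp
      then show ?thesis by (simp add: has_field_derivative_def mult_commute_abs)
    qed
    then show "(x has_vector_derivative A (x t)) (at t)"
      unfolding has_vector_derivative_def has_derivative_componentwise_within[of x] by blast
  next
    fix S assume S: "closed S" "subspace S" "X \<in> S" "A ` S \<subseteq> S"
    have p: "(A ^^ n) X \<in> S" for n by (induction n) (use S in auto)
    show "\<forall>t. x t \<in> S"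
    proof
      fix t
      have "(\<lambda>m. \<Sum>n<m. (t ^ n / fact n) *\<^sub>R (A ^^ n) X) \<longlonglongrightarrow> x t"
        unfolding x_def by (rule summable_LIMSEQ[OF summ])
      moreover have "(\<Sum>n<m. (t ^ n / fact n) *\<^sub>R (A ^^ n) X) \<in> S" for m
        by (intro subspace_sum[OF S(2)] subspace_scale[OF S(2)] p)
      ultimately show "x t \<in> S" using closed_sequentially[OF S(1), of "\<lambda>m. \<Sum>n<m. (t ^ n / fact n) *\<^sub>R (A ^^ n) X" "x t"] by blast
    qed
  qed
qed

lemma quadratic_nonneg_leading:
  fixes a b c :: real
  assumes "\<And>t. 0 \<le> a + b * t + c * t\<^sup>2"
  shows "0 \<le> c"
proof (rule ccontr)
  assume c: "\<not> 0 \<le> c"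
  \<comment> \<open>Chosen so that \<open>t \<ge> 1\<close> and \<open>- c * t\<close> exceeds
    \<open>\<bar>a\<bar> + \<bar>b\<bar>\<close> by at least \<open>1\<close>, which makes the
    polynomial negative at \<open>t\<close>.\<close>
  define t where "t = (1 + \<bar>a\<bar> + \<bar>b\<bar>) / (- c) + 1"
  have t: "1 \<le> t" using c divide_nonneg_pos[of "1 + \<bar>a\<bar> + \<bar>b\<bar>" "- c"] by (simp add: t_def)
  have ct: "- c * t \<ge> 1 + \<bar>a\<bar> + \<bar>b\<bar>"
    using c by (simp add: t_def field_simps)
  have "a + b * t + c * t\<^sup>2 = a + t * (b - (- c * t))" by (simp add: power2_eq_square algebra_simps)
  also have "\<dots> \<le> a + t * (- 1 - \<bar>a\<bar>)" using ct t by (intro add_left_mono mult_left_mono) auto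
  also have "\<dots> \<le> a - (1 + \<bar>a\<bar>)"
    using mult_right_mono[of 1 t "1 + \<bar>a\<bar>"] t by (simp add: algebra_simps)
  also have "\<dots> < 0" by simp
  finally show False using assms[of t] by simp
qed

section \<open>Semidefinite forms and the flow of an even element\<close>

context real_lie_superalgebra
begin

text \<open>Along the flow \<open>x' = [N, x]\<close> the function \<open>f([x, x])\<close> is a nonnegative quadratic polynomial
  with leading coefficient \<open>f([N, [N, [X, X]]]) / 2\<close>.\<close>

lemma semidefinite_second_derivative:
  assumes f: "linear f" "\<And>x. x \<in> g1 \<Longrightarrow> (0::real) \<le> f (br x x)"
    and N: "N \<in> g0" "\<And>Y. Y \<in> g0 \<Longrightarrow> br N (br N (br N Y)) = 0" and X: "X \<in> g1"
  shows "0 \<le> f (br N (br N (br X X)))"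
proof -
  obtain x where x: "x 0 = X" "\<And>t. (x has_vector_derivative br N (x t)) (at t)"
    and xs: "\<And>S. closed S \<Longrightarrow> subspace S \<Longrightarrow> X \<in> S \<Longrightarrow> br N ` S \<subseteq> S \<Longrightarrow> \<forall>t. x t \<in> S"
    by (rule linear_flow[OF br_linear(1)[of N], of X]) (rule that, assumption+)
  have x1: "x t \<in> g1" for t
    using xs[OF closed_subspace[OF subspace_odd] subspace_odd X] graded(2)[OF N(1)] by auto
  have bb: "bounded_bilinear br" using bilinear by (simp add: bilinear_conv_bounded_bilinear)
  define q where "q t = br (x t) (x t)" for t
  have q0: "q t \<in> g0" for t using graded(4)[OF x1 x1] by (simp add: q_def)
  have q: "(q has_vector_derivative br N (q t)) (at t)" for t
  proof -
    have "(q has_vector_derivative br (x t) (br N (x t)) + br (br N (x t)) (x t)) (at t)"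
      unfolding q_def by (rule bounded_bilinear.has_vector_derivative[OF bb x(2) x(2)])
    then show ?thesis using super_jacobi(1)[OF N(1), of "x t" "x t"] x1 by (simp add: q_def add.commute)
  qed
  have d: "((\<lambda>t. l (q t)) has_real_derivative l (br N (q t))) (at t)" if "linear l" for l :: "'a \<Rightarrow> real" and t
  proof -
    have "bounded_linear l" using that by (simp add: linear_conv_bounded_linear)
    from bounded_linear.has_vector_derivative[OF this q] show ?thesis
      by (simp add: has_real_derivative_iff_has_vector_derivative)
  qed
  have l1: "linear (\<lambda>y. f (br N y))" using linear_compose[OF br_linear(1) f(1)] by (simp add: o_def)
  have l2: "linear (\<lambda>y. f (br N (br N y)))" using linear_compose[OF br_linear(1) l1] by (simp add: o_def)
  define a b c where "a = f (q 0)" and "b = f (br N (q 0))" and "c = f (br N (br N (q 0)))"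
  \<comment> \<open>The third power of \<open>ad N\<close> vanishes on the even part, so this second
    derivative is constant; integrating twice gives the polynomial.\<close>
  have q2: "f (br N (br N (q t))) = c" for t
  proof -
    have "((\<lambda>t. f (br N (br N (q t)))) has_real_derivative 0) (at t)" for t
      using d[OF l2, of t] N(2)[OF q0] linear_0[OF f(1)] by simp
    then show ?thesis unfolding c_def by (rule DERIV_isconst_all[rule_format])
  qed
  have q1: "f (br N (q t)) = b + c * t" for t
  proof -
    have "((\<lambda>t. f (br N (q t)) - c * t) has_real_derivative 0) (at t)" for t
      using d[OF l1, of t] by (auto intro!: derivative_eq_intros simp: q2)
    then have "f (br N (q t)) - c * t = f (br N (q 0)) - c * 0" by (rule DERIV_isconst_all[rule_format])
    then show ?thesis by (simp add: b_def)
  qed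
  have "f (q t) = a + b * t + (c / 2) * t\<^sup>2" for t
  proof -
    have "((\<lambda>t. f (q t) - (b * t + (c / 2) * t\<^sup>2)) has_real_derivative 0) (at t)" for t
      using d[OF f(1), of t] by (auto intro!: derivative_eq_intros simp: q1)
    then have "f (q t) - (b * t + (c / 2) * t\<^sup>2) = f (q 0) - (b * 0 + (c / 2) * 0\<^sup>2)" by (rule DERIV_isconst_all[rule_format])
    then show ?thesis by (simp add: a_def)
  qed
  then have "0 \<le> a + b * t + (c / 2) * t\<^sup>2" for t using f(2)[OF x1, of t] by (simp add: q_def)
  then have "0 \<le> c / 2" by (rule quadratic_nonneg_leading)
  then show ?thesis by (simp add: c_def q_def x(1))
qed

text \<open>A definite \<open>f\<close> is an interior point of the cone of semidefinite
  functionals: by compactness of the unit sphere \<open>f + e (v \<bullet> _)\<close> is still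
  semidefinite for small \<open>e > 0\<close>. If all of these vanish at \<open>v\<close>, then
  \<open>e (v \<bullet> v) = 0\<close>.\<close>

lemma semidefinite_forms_separate:
  assumes pos: "\<not> nondefinite g1 br" "g1 \<noteq> {0}"
    and v: "\<And>f. linear f \<Longrightarrow> (\<And>x. x \<in> g1 \<Longrightarrow> (0::real) \<le> f (br x x)) \<Longrightarrow> f v = 0"
  shows "v = 0"
proof (rule ccontr)
  assume "v \<noteq> 0"
  obtain f :: "'a \<Rightarrow> real" where f: "linear f" and fpos: "\<And>x. x \<in> g1 \<Longrightarrow> x \<noteq> 0 \<Longrightarrow> 0 < f (br x x)"
    using pos unfolding nondefinite_def by (auto simp: not_le)
  let ?S = "g1 \<inter> sphere 0 1"
  have bb: "bounded_bilinear br" using bilinear by (simp add: bilinear_conv_bounded_bilinear)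
  have bf: "bounded_linear f" using f by (simp add: linear_conv_bounded_linear)
  have S: "compact ?S" using closed_subspace[OF subspace_odd] by (intro closed_Int_compact) auto
  obtain y where y: "y \<in> g1" "y \<noteq> 0" using pos(2) subspace_0[OF subspace_odd] by auto
  then have "y /\<^sub>R norm y \<in> ?S" using subspace_scale[OF subspace_odd] by simp
  then have ne: "?S \<noteq> {}" by blast
  have cq: "continuous_on ?S (\<lambda>x. br x x)"
    by (rule bounded_bilinear.continuous_on[OF bb continuous_on_id continuous_on_id])
  have cf: "continuous_on ?S (\<lambda>x. f (br x x))"
    by (rule bounded_linear.continuous_on[OF bf cq])
  have cv: "continuous_on ?S (\<lambda>x. v \<bullet> br x x)"
    by (rule bounded_linear.continuous_on[OF bounded_linear_inner_right cq])
  obtain m where m: "m \<in> ?S" "\<And>x. x \<in> ?S \<Longrightarrow> f (br m m) \<le> f (br x x)"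
    using continuous_attains_inf[OF S ne cf] by blast
  obtain k where k: "k \<in> ?S" "\<And>x. x \<in> ?S \<Longrightarrow> v \<bullet> br k k \<le> v \<bullet> br x x"
    using continuous_attains_inf[OF S ne cv] by blast
  define d where "d = f (br m m)"
  have d: "0 < d" using fpos[of m] m(1) by (fastforce simp: d_def)
  \<comment> \<open>\<open>d\<close> is the minimum of \<open>f([x, x])\<close> and
    \<open>v \<bullet> br k k\<close> the minimum of \<open>v \<bullet> [x, x]\<close> on the unit
    sphere; the \<open>1\<close> keeps the denominator positive.\<close>
  define e where "e = d / (1 + \<bar>v \<bullet> br k k\<bar>)"
  have e: "0 < e" using d by (simp add: e_def)
  let ?g = "\<lambda>y. f y + e * (v \<bullet> y)"
  have lin: "linear ?g"
    by (intro linear_compose_add f linear_compose_scale_right[where 'a = 'a and 'b = real, unfolded real_scaleR_def]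
        bounded_linear.linear[OF bounded_linear_inner_right])
  have unit: "0 \<le> ?g (br x x)" if "x \<in> ?S" for x
  proof -
    have "e * (- (v \<bullet> br k k)) \<le> e * (1 + \<bar>v \<bullet> br k k\<bar>)" using e by (intro mult_left_mono) auto
    also have "\<dots> = d" by (simp add: e_def)
    also have "\<dots> \<le> f (br x x)" using m(2)[OF that] by (simp add: d_def)
    finally have "0 \<le> f (br x x) + e * (v \<bullet> br k k)" by simp
    also have "\<dots> \<le> ?g (br x x)" using k(2)[OF that] e by simp
    finally show ?thesis .
  qed
  have "0 \<le> ?g (br x x)" if x: "x \<in> g1" for x
  proof (cases "x = 0")
    case True
    then show ?thesis using linear_0[OF f] by (simp add: br_simps)
  next
    case False
    have "br x x = (norm x)\<^sup>2 *\<^sub>R br (x /\<^sub>R norm x) (x /\<^sub>R norm x)"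
      using False by (simp add: br_simps power2_eq_square field_simps)
    then have "?g (br x x) = (norm x)\<^sup>2 * ?g (br (x /\<^sub>R norm x) (x /\<^sub>R norm x))"
      using linear_scale[OF lin] by simp
    moreover have "x /\<^sub>R norm x \<in> ?S" using False x subspace_scale[OF subspace_odd] by simp
    ultimately show ?thesis using unit by simp
  qed
  then have "?g v = 0" using v[OF lin] by blast
  moreover have "0 \<le> f (br x x)" if "x \<in> g1" for x
    using fpos[OF that] linear_0[OF f] by (cases "x = 0") (auto simp: br_simps less_imp_le)
  then have "f v = 0" by (rule v[OF f])
  ultimately show False using e \<open>v \<noteq> 0\<close> by simp
qed

text \<open>The odd part together with the span \<open>S\<close> of its brackets is a nonzero ideal,
  hence everything, so the even part is \<open>S\<close>. Polarization,
  \<open>2 [x, y] = [x + y, x + y] - [x, x] - [y, y]\<close>, reduces brackets to squares.\<close>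

lemma even_spanned_by_squares:
  assumes simple: "simple_superalgebra g0 g1 br" and "g1 \<noteq> {0}"
    and Z: "subspace Z" "\<And>x. x \<in> g1 \<Longrightarrow> br x x \<in> Z"
  shows "g0 \<subseteq> Z"
proof -
  define S where "S = span {br x y | x y. x \<in> g1 \<and> y \<in> g1}"
  define I where "I = {a + b | a b. a \<in> S \<and> b \<in> g1}"
  have sS: "subspace S" by (simp add: S_def)
  have S0: "S \<subseteq> g0" unfolding S_def by (rule span_minimal) (use graded subspace_even in auto)
  have SZ: "S \<subseteq> Z"
    unfolding S_def
  proof (rule span_minimal[OF _ Z(1)], safe)
    fix x y assume xy: "x \<in> g1" "y \<in> g1"
    have "br (x + y) (x + y) - br x x - br y y \<in> Z"
      using Z xy subspace_add[OF subspace_odd] by (intro subspace_diff) auto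
    moreover have "br (x + y) (x + y) - br x x - br y y = 2 *\<^sub>R br x y"
      using super_antisym(2)[OF xy] by (simp add: br_simps scaleR_2)
    ultimately have "(1 / 2) *\<^sub>R (2 *\<^sub>R br x y) \<in> Z" using subspace_scale[OF Z(1)] by metis
    then show "br x y \<in> Z" by simp
  qed
  have I: "subspace I" unfolding I_def by (rule subspace_sums[OF sS subspace_odd])
  have inI: "a \<in> I" if "a \<in> S \<or> a \<in> g1" for a
    using that subspace_0[OF subspace_odd] subspace_0[OF sS] unfolding I_def by force
  have hom: "br y u \<in> I \<and> br u y \<in> I" if yu: "y \<in> g0 \<union> g1" "u \<in> S \<or> u \<in> g1" for y u
  proof -
    have main: "br y u \<in> I"
    proof (cases "y \<in> g0")
      case True
      show ?thesis
      proof (cases "u \<in> S")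
        case True
        from this have "br y u \<in> S"
          unfolding S_def
        proof (induction rule: span_induct_alt)
          case base
          then show ?case by (simp add: br_simps span_zero)
        next
          case (step c w s)
          then obtain x z where xz: "x \<in> g1" "z \<in> g1" "w = br x z" by auto
          have "br (br y x) z \<in> S" "br x (br y z) \<in> S"
            unfolding S_def using xz graded(2)[OF \<open>y \<in> g0\<close>] by (auto intro!: span_base)
          then have "br y w \<in> S"
            using super_jacobi(1)[OF \<open>y \<in> g0\<close>, of x z] xz subspace_add[OF sS] by simp
          then show ?case using step unfolding S_def by (auto simp: br_simps intro!: span_add span_scale)
        qed
        then show ?thesis using inI by blast
      next
        case False
        then show ?thesis using yu True graded(2) inI by blast
      qed
    next
      case False
      then have "y \<in> g1" using yu by blast
      show ?thesis
      proof (cases "u \<in> S")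
        case True
        then show ?thesis using graded(3)[OF \<open>y \<in> g1\<close>] S0 inI by blast
      next
        case False
        then have "u \<in> g1" using yu by blast
        then have "br y u \<in> S" unfolding S_def using \<open>y \<in> g1\<close> by (auto intro!: span_base)
        then show ?thesis using inI by blast
      qed
    qed
    have "u \<in> g0 \<union> g1" using yu S0 by blast
    then have "br u y = - br y u \<or> br u y = br y u"
      using super_antisym(1)[of u y] super_antisym(1)[of y u] super_antisym(2)[of u y] yu by fastforce
    then show ?thesis using main subspace_neg[OF I] by metis
  qed
  have "super_ideal g0 g1 br I"
    unfolding super_ideal_def
  proof (intro conjI allI ballI)
    show "subspace I" by (rule I)
    show "I = {x + y | x y. x \<in> I \<inter> g0 \<and> y \<in> I \<inter> g1}"
    proof (intro equalityI subsetI)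
      fix z assume "z \<in> I"
      then obtain a b where "a \<in> S" "b \<in> g1" "z = a + b" unfolding I_def by auto
      then show "z \<in> {x + y | x y. x \<in> I \<inter> g0 \<and> y \<in> I \<inter> g1}" using inI S0 by blast
    next
      fix z assume "z \<in> {x + y | x y. x \<in> I \<inter> g0 \<and> y \<in> I \<inter> g1}"
      then show "z \<in> I" using subspace_add[OF I] by auto
    qed
    fix x y assume "y \<in> I"
    then obtain a b where ab: "a \<in> S" "b \<in> g1" "y = a + b" unfolding I_def by auto
    obtain p q where pq: "p \<in> g0" "q \<in> g1" "x = p + q" using direct_sum(2) by blast
    show "br x y \<in> I" "br y x \<in> I"
      using hom ab pq by (auto simp: br_simps intro!: subspace_add[OF I])
  qed
  moreover have "\<not> I = {0}" using inI assms(2) subspace_0[OF subspace_odd] by blast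
  ultimately have I1: "I = UNIV" using simple unfolding simple_superalgebra_def by blast
  show "g0 \<subseteq> Z"
  proof
    fix z assume z: "z \<in> g0"
    have "z \<in> I" using I1 by simp
    then obtain a b where ab: "a \<in> S" "b \<in> g1" "z = a + b" unfolding I_def by auto
    then have "z - a \<in> g0" using z S0 subspace_diff[OF subspace_even] by blast
    moreover have "z - a = b" using ab(3) by simp
    ultimately have "b \<in> g0 \<inter> g1" using ab(2) by simp
    then show "z \<in> Z" using direct_sum(1) ab SZ by auto
  qed
qed

end

section \<open>Quaternionic isotropic vectors and their nilpotent matrices\<close>

lemma sum_four_points:
  fixes f :: "nat \<Rightarrow> 'k::comm_ring_1"
  assumes "distinct [a, b, c, d]" "{a, b, c, d} \<subseteq> {..<n}" "\<And>i. i < n \<Longrightarrow> i \<notin> {a, b, c, d} \<Longrightarrow> f i = 0"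
  shows "(\<Sum>i<n. f i) = f a + f b + f c + f d"
proof -
  have "(\<Sum>i<n. f i) = (\<Sum>i\<in>{a, b, c, d}. f i)"
    by (rule sum.mono_neutral_right) (use assms in auto)
  then show ?thesis using assms(1) by (simp add: add.assoc)
qed

text \<open>Imaginary quaternions, as matrices in \<open>su(2)\<close>.\<close>

definition quat :: "real \<Rightarrow> real \<Rightarrow> real \<Rightarrow> bool \<Rightarrow> bool \<Rightarrow> complex" where
  "quat a b c s t = (if s then if t then - (\<i> * a) else - b + \<i> * c else if t then b + \<i> * c else \<i> * a)"

text \<open>For a sign \<open>e\<close>, the quaternionic vector \<open>u\<^sub>0 + e u\<^sub>p\<close> is isotropic; \<open>quat_row\<close> and \<open>quat_col\<close> are the
  complex coordinates of it and of its adjoint, and \<open>nilp\<close> is the matrix \<open>u x u\<^sup>*\<close> for \<open>x\<close> imaginary.\<close>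

definition quat_col :: "nat \<Rightarrow> nat \<Rightarrow> real \<Rightarrow> nat \<Rightarrow> complex" where
  "quat_col p n e i = (if i = 0 then 1 else if i = p then e else if i = n then 1 else if i = n + p then - e else 0)"

definition quat_row :: "nat \<Rightarrow> nat \<Rightarrow> real \<Rightarrow> nat \<Rightarrow> complex" where
  "quat_row p n e i = (if i = 0 then 1 else if i = p then - e else if i = n then 1 else if i = n + p then e else 0)"

definition nilp :: "nat \<Rightarrow> nat \<Rightarrow> real \<Rightarrow> real \<Rightarrow> real \<Rightarrow> real \<Rightarrow> complex mat" where
  "nilp p n e a b c = mat (2 * n) (2 * n)
    (\<lambda>(i, j). quat_col p n e i * quat a b c (n \<le> i) (n \<le> j) * quat_row p n e j)"

lemma nilp_carrier [simp]: "nilp p n e a b c \<in> carrier_mat (2 * n) (2 * n)"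
  and nilp_dim [simp]: "dim_row (nilp p n e a b c) = 2 * n" "dim_col (nilp p n e a b c) = 2 * n"
  by (simp_all add: nilp_def)

lemma quat_add: "quat (a + a') (b + b') (c + c') s t = quat a b c s t + quat a' b' c' s t"
  by (simp add: quat_def algebra_simps)

lemma quat_scale: "quat (r * a) (r * b) (r * c) s t = r * quat a b c s t"
  by (simp add: quat_def algebra_simps)

lemma nilp_add: "nilp p n e (a + a') (b + b') (c + c') = nilp p n e a b c + nilp p n e a' b' c'"
  by (rule eq_matI) (auto simp: nilp_def quat_add algebra_simps)

lemma nilp_scale: "nilp p n e (r * a) (r * b) (r * c) = of_real r \<cdot>\<^sub>m nilp p n e a b c"
  by (rule eq_matI) (simp_all add: nilp_def quat_scale mult.assoc mult.left_commute)

text \<open>The underlying set of \<open>sp_pq p (n - p)\<close>, with the total size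
  \<open>n\<close> as the parameter.\<close>

definition sp_set :: "nat \<Rightarrow> nat \<Rightarrow> complex mat set" where
  "sp_set p n = {X \<in> carrier_mat (2 * n) (2 * n). X = Jmat n * transpose_mat X * Jmat n \<and>
     mstar X * diag_block (Ipq p (n - p)) (Ipq p (n - p)) = - (diag_block (Ipq p (n - p)) (Ipq p (n - p)) * X)}"

text \<open>The diagonal of the Hermitian form \<open>K\<close> in the definition of
  \<open>sp(p,q)\<close>.\<close>

definition kap :: "nat \<Rightarrow> nat \<Rightarrow> nat \<Rightarrow> complex" where
  "kap p n i = (if i < n then sg p i else sg p (i - n))"

text \<open>In blocks of size \<open>n\<close> the symplectic condition reads
  \<open>D = - A^t\<close> with \<open>B\<close> and \<open>C\<close> symmetric. As \<open>K\<close>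
  is diagonal, the Hermitian condition compares single entries.\<close>

lemma sp_set_iff:
  assumes "p \<le> n"
  shows "X \<in> sp_set p n \<longleftrightarrow> X \<in> carrier_mat (2 * n) (2 * n) \<and>
    (\<forall>i<n. \<forall>j<n. X $$ (i + n, j + n) = - X $$ (j, i) \<and> X $$ (i, j + n) = X $$ (j, i + n) \<and>
       X $$ (i + n, j) = X $$ (j + n, i)) \<and>
    (\<forall>i<2 * n. \<forall>j<2 * n. cnj (X $$ (j, i)) * kap p n j = - (kap p n i * X $$ (i, j)))"
proof (cases "X \<in> carrier_mat (2 * n) (2 * n)")
  case X: True
  let ?K = "diag_block (Ipq p (n - p)) (Ipq p (n - p)) :: complex mat"
  have K: "?K \<in> carrier_mat (2 * n) (2 * n)"
  proof -
    have "?K \<in> carrier_mat (p + (n - p) + (p + (n - p))) (p + (n - p) + (p + (n - p)))"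
      unfolding diag_block_def by (rule four_block_carrier_mat) simp_all
    then show ?thesis using assms by (simp add: mult_2)
  qed
  have Ke: "?K $$ (i, j) = (if i = j then kap p n i else 0)" if "i < 2 * n" "j < 2 * n" for i j
  proof -
    have "Ipq p (n - p) $$ (i, j) = (if i = j then sg p i else 0 :: complex)" if "i < n" "j < n" for i j
      using that assms by (auto simp: Ipq_def diag_block_def sg_def)
    then show ?thesis using that assms by (auto simp: diag_block_def kap_def)
  qed
  have KX: "(?K * X) $$ (i, j) = kap p n i * X $$ (i, j)" if "i < 2 * n" "j < 2 * n" for i j
  proof -
    have "(?K * X) $$ (i, j) = (\<Sum>l<2 * n. (if i = l then kap p n i else 0) * X $$ (l, j))"
      using that X K by (auto simp: scalar_prod_def atLeast0LessThan Ke intro!: sum.cong)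
    also have "\<dots> = kap p n i * X $$ (i, j)"
      using that by (subst sum_one_point[of i]) auto
    finally show ?thesis .
  qed
  have XK: "(mstar X * ?K) $$ (i, j) = cnj (X $$ (j, i)) * kap p n j" if "i < 2 * n" "j < 2 * n" for i j
  proof -
    have "(mstar X * ?K) $$ (i, j) = (\<Sum>l<2 * n. cnj (X $$ (l, i)) * (if l = j then kap p n l else 0))"
      using that X K by (auto simp: scalar_prod_def atLeast0LessThan Ke intro!: sum.cong)
    also have "\<dots> = cnj (X $$ (j, i)) * kap p n j"
      using that by (subst sum_one_point[of j]) auto
    finally show ?thesis .
  qed
  have 1: "mstar X * ?K = - (?K * X) \<longleftrightarrow>
      (\<forall>i<2 * n. \<forall>j<2 * n. cnj (X $$ (j, i)) * kap p n j = - (kap p n i * X $$ (i, j)))"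
    (is "?L \<longleftrightarrow> ?R")
  proof
    assume L: ?L
    show ?R
    proof (intro allI impI)
      fix i j assume ij: "i < 2 * n" "j < 2 * n"
      have "(mstar X * ?K) $$ (i, j) = (- (?K * X)) $$ (i, j)" using L by simp
      also have "\<dots> = - (?K * X) $$ (i, j)" using ij X K by (simp del: index_mult_mat(1))
      finally show "cnj (X $$ (j, i)) * kap p n j = - (kap p n i * X $$ (i, j))"
        using XK[OF ij] KX[OF ij] by simp
    qed
  next
    assume R: ?R
    show ?L
    proof (rule eq_matI)
      fix i j assume "i < dim_row (- (?K * X))" "j < dim_col (- (?K * X))"
      then have ij: "i < 2 * n" "j < 2 * n" using X K by auto
      then show "(mstar X * ?K) $$ (i, j) = (- (?K * X)) $$ (i, j)"
        using R XK[OF ij] KX[OF ij] X K by (simp del: index_mult_mat(1))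
    qed (use X K in auto)
  qed
  have J: "(Jmat n * transpose_mat X * Jmat n) $$ (i, j) =
     (if i < n then if j < n then - X $$ (j + n, i + n) else X $$ (j - n, i + n)
      else if j < n then X $$ (j + n, i - n) else - X $$ (j - n, i - n))" if "i < 2 * n" "j < 2 * n" for i j
    using that X by (auto simp: Jmat_mult_left Jmat_mult_right)
  have 2: "X = Jmat n * transpose_mat X * Jmat n \<longleftrightarrow>
     (\<forall>i<n. \<forall>j<n. X $$ (i + n, j + n) = - X $$ (j, i) \<and> X $$ (i, j + n) = X $$ (j, i + n) \<and>
       X $$ (i + n, j) = X $$ (j + n, i))" (is "?L \<longleftrightarrow> ?R")
  proof
    assume L: ?L
    have e: "X $$ (i, j) = (Jmat n * transpose_mat X * Jmat n) $$ (i, j)" for i j using L by metis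
    show ?R
    proof (intro allI impI)
      fix i j assume ij: "i < n" "j < n"
      show "X $$ (i + n, j + n) = - X $$ (j, i) \<and> X $$ (i, j + n) = X $$ (j, i + n) \<and> X $$ (i + n, j) = X $$ (j + n, i)"
        using ij e[of "i + n" "j + n"] e[of i "j + n"] e[of "i + n" j] J[of "i + n" "j + n"] J[of i "j + n"] J[of "i + n" j]
        by simp
    qed
  next
    assume R: ?R
    show ?L
    proof (rule eq_matI)
      fix i j assume "i < dim_row (Jmat n * transpose_mat X * Jmat n)" "j < dim_col (Jmat n * transpose_mat X * Jmat n)"
      then have ij: "i < 2 * n" "j < 2 * n" by auto
      obtain i' where i': "(i < n \<and> i' = i) \<or> (\<not> i < n \<and> i = i' + n \<and> i' < n)"
        using ij by (metis add_diff_inverse_nat add.commute less_diff_conv2 mult_2 not_less)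
      obtain j' where j': "(j < n \<and> j' = j) \<or> (\<not> j < n \<and> j = j' + n \<and> j' < n)"
        using ij by (metis add_diff_inverse_nat add.commute less_diff_conv2 mult_2 not_less)
      show "X $$ (i, j) = (Jmat n * transpose_mat X * Jmat n) $$ (i, j)"
        unfolding J[OF ij] using i' j' R by auto
    qed (use X in auto)
  qed
  show ?thesis unfolding sp_set_def mem_Collect_eq 1 2 using X by blast
qed (simp add: sp_set_def)

text \<open>Both signs serve later: \<open>e = 1\<close> gives the nilpotent elements that act by
  \<open>ad\<close>, \<open>e = -1\<close> the opposite ones on which the quaternion
  \<open>quat_part\<close> is nonzero.\<close>

lemma nilp_in_sp_set:
  assumes "0 < p" "p < n" "e * e = 1"
  shows "nilp p n e a b c \<in> sp_set p n"
proof -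
  have "nilp p n e a b c $$ (i + n, j + n) = - nilp p n e a b c $$ (j, i) \<and>
      nilp p n e a b c $$ (i, j + n) = nilp p n e a b c $$ (j, i + n) \<and>
      nilp p n e a b c $$ (i + n, j) = nilp p n e a b c $$ (j + n, i)" if "i < n" "j < n" for i j
    using that assms by (auto simp: nilp_def quat_def quat_col_def quat_row_def)
  moreover have "cnj (nilp p n e a b c $$ (j, i)) * kap p n j = - (kap p n i * nilp p n e a b c $$ (i, j))"
    if "i < 2 * n" "j < 2 * n" for i j
  proof -
    have k: "kap p n k * quat_col p n e k = quat_row p n e k" "cnj (quat_col p n e k) = quat_col p n e k"
       "kap p n k * kap p n k = 1" for k
      using assms by (auto simp: kap_def sg_def quat_col_def quat_row_def)
    have k': "quat_row p n e k = kap p n k * quat_col p n e k" "cnj (quat_row p n e k) = kap p n k * quat_col p n e k" for k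
      using assms by (auto simp: kap_def sg_def quat_col_def quat_row_def)
    have kc: "cnj (kap p n k) = kap p n k" for k by (auto simp: kap_def sg_def)
    have q: "cnj (quat a b c s t) = - quat a b c t s" for s t
      by (auto simp: quat_def)
    show ?thesis
      using that kc by (simp add: nilp_def k' q k(2) mult_ac)
  qed
  ultimately show ?thesis using assms by (subst sp_set_iff) auto
qed

text \<open>With \<open>u\<close> the quaternionic column for \<open>e = 1\<close> and
  \<open>u'\<close> its adjoint row, this is the quaternion \<open>u' T u\<close> as a complex
  \<open>2 \<times> 2\<close> matrix. It is the only information on \<open>T\<close> that survives
  in \<open>N T N\<close> for \<open>N = u x u'\<close>.\<close>

definition quat_part :: "nat \<Rightarrow> nat \<Rightarrow> complex mat \<Rightarrow> bool \<Rightarrow> bool \<Rightarrow> complex" where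
  "quat_part p n T s t =
    (if s then
      if t then T $$ (n, n) - T $$ (n, n + p) + T $$ (n + p, n) - T $$ (n + p, n + p)
      else T $$ (n, 0) + T $$ (n, p) + T $$ (n + p, 0) + T $$ (n + p, p)
     else
      if t then T $$ (0, n) - T $$ (0, n + p) - T $$ (p, n) + T $$ (p, n + p)
      else T $$ (0, 0) + T $$ (0, p) - T $$ (p, 0) - T $$ (p, p))"

text \<open>Elements of \<open>sp(p,q)\<close> are skew for the quaternionic Hermitian form, so the
  value of that form at \<open>u\<close> and \<open>T u\<close> is an imaginary quaternion; three
  real numbers determine it.\<close>

lemma quat_part_quat:
  assumes "0 < p" "p < n" "T \<in> sp_set p n"
  shows "quat_part p n T s t = quat (Im (quat_part p n T False False)) (Re (quat_part p n T False True))
     (Im (quat_part p n T False True)) s t"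
proof -
  have p: "p \<le> n" "0 < n" using assms by auto
  note sp = assms(3)[unfolded sp_set_iff[OF p(1)]]
  have b: "T $$ (i + n, j + n) = - T $$ (j, i)" if "i < n" "j < n" for i j using sp that by blast
  have c: "cnj (T $$ (j, i)) * kap p n j = - (kap p n i * T $$ (i, j))" if "i < 2 * n" "j < 2 * n" for i j
    using sp that by blast
  have k: "kap p n 0 = 1" "kap p n p = -1" "kap p n n = 1" "kap p n (n + p) = -1"
    using assms by (auto simp: kap_def sg_def)
  have d: "T $$ (0, 0) = - cnj (T $$ (0, 0))" "T $$ (p, p) = - cnj (T $$ (p, p))" "T $$ (p, 0) = cnj (T $$ (0, p))"
    "T $$ (n, 0) = - cnj (T $$ (0, n))" "T $$ (n + p, 0) = cnj (T $$ (0, n + p))"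
    "T $$ (n, p) = cnj (T $$ (p, n))" "T $$ (n + p, p) = - cnj (T $$ (p, n + p))"
    using c[of 0 0] k assms apply simp
    using c[of p p] k assms apply simp
    using c[of p 0] k assms apply simp
    using c[of n 0] k assms apply simp
    using c[of "n + p" 0] k assms apply simp
    using c[of n p] k assms apply simp
    using c[of "n + p" p] k assms apply simp
    done
  have tt: "quat_part p n T True True = - quat_part p n T False False"
    using b[of 0 0] b[of 0 p] b[of p 0] b[of p p] p assms
    by (simp add: quat_part_def add.commute)
  have tf: "quat_part p n T True False = - cnj (quat_part p n T False True)"
    unfolding quat_part_def by (simp add: d(4-7) d(3)[symmetric])
  have ff: "Re (quat_part p n T False False) = 0"
    using d(1,2,3) by (simp add: quat_part_def complex_eq_iff)
  show ?thesis
    using tt tf ff by (cases s; cases t) (auto simp: quat_def complex_eq_iff)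
qed

lemma nilp_sum_left:
  assumes "0 < p" "p < n" "e = 1" "i < 2 * n"
  shows "(\<Sum>k<2 * n. nilp p n e a b c $$ (i, k) * g k) =
    quat_col p n e i * (quat a b c (n \<le> i) False * (g 0 - g p) + quat a b c (n \<le> i) True * (g n + g (n + p)))"
  by (subst sum_four_points[of 0 p n "n + p"])
    (use assms in \<open>auto simp: nilp_def quat_row_def algebra_simps\<close>)

lemma nilp_sum_right:
  assumes "0 < p" "p < n" "e = 1" "j < 2 * n"
  shows "(\<Sum>k<2 * n. g k * nilp p n e a b c $$ (k, j)) =
    ((g 0 + g p) * quat a b c False (n \<le> j) + (g n - g (n + p)) * quat a b c True (n \<le> j)) * quat_row p n e j"
  by (subst sum_four_points[of 0 p n "n + p"])
    (use assms in \<open>auto simp: nilp_def quat_col_def algebra_simps\<close>)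

text \<open>The inner factor of \<open>u x u' u x u'\<close> is \<open>u' u\<close>, which is zero
  by isotropy.\<close>

lemma nilp_square:
  assumes "0 < p" "p < n"
  shows "nilp p n 1 a b c * nilp p n 1 a b c = 0\<^sub>m (2 * n) (2 * n)"
proof (rule eq_matI)
  fix i j assume ij: "i < dim_row (0\<^sub>m (2 * n) (2 * n) :: complex mat)" "j < dim_col (0\<^sub>m (2 * n) (2 * n) :: complex mat)"
  have "(nilp p n 1 a b c * nilp p n 1 a b c) $$ (i, j) =
    (\<Sum>k<2 * n. nilp p n 1 a b c $$ (i, k) * nilp p n 1 a b c $$ (k, j))"
    using ij by (simp add: scalar_prod_def atLeast0LessThan)
  also have "\<dots> = 0"
    using ij assms by (subst nilp_sum_left) (auto simp: nilp_def quat_col_def)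
  finally show "(nilp p n 1 a b c * nilp p n 1 a b c) $$ (i, j) = 0\<^sub>m (2 * n) (2 * n) $$ (i, j)" using ij by simp
qed auto

text \<open>For imaginary quaternions \<open>x h + h x = - 2 (x \<bullet> h)\<close> and
  \<open>x x = - \<bar>x\<bar>^2\<close>, hence
  \<open>x h x = \<bar>x\<bar>^2 h - 2 (x \<bullet> h) x\<close>.\<close>

lemma quat_triple:
  fixes h1 h2 h3 a b c :: real
  defines "s \<equiv> a\<^sup>2 + b\<^sup>2 + c\<^sup>2" and "t \<equiv> 2 * (a * h1 + b * h2 + c * h3)"
  shows "(\<Sum>s\<in>UNIV. \<Sum>t\<in>UNIV. quat a b c x s * quat h1 h2 h3 s t * quat a b c t y) =
    quat (s * h1 - t * a) (s * h2 - t * b) (s * h3 - t * c) x y"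
  unfolding s_def t_def
  by (cases x; cases y) (simp_all add: UNIV_bool quat_def complex_eq_iff power2_eq_square algebra_simps)

text \<open>With \<open>N = u x u'\<close> the product \<open>N T N\<close> is
  \<open>u (x h x) u'\<close> for the imaginary quaternion \<open>h = u' T u\<close>, and
  \<open>x h x\<close> is again imaginary.\<close>

lemma nilp_sandwich:
  fixes a b c :: real
  assumes "0 < p" "p < n" "T \<in> sp_set p n"
  defines "h1 \<equiv> Im (quat_part p n T False False)" and "h2 \<equiv> Re (quat_part p n T False True)"
    and "h3 \<equiv> Im (quat_part p n T False True)"
  defines "s \<equiv> a\<^sup>2 + b\<^sup>2 + c\<^sup>2" and "t \<equiv> 2 * (a * h1 + b * h2 + c * h3)"
  shows "nilp p n 1 a b c * T * nilp p n 1 a b c = nilp p n 1 (s * h1 - t * a) (s * h2 - t * b) (s * h3 - t * c)"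
proof (rule eq_matI)
  let ?N = "nilp p n 1 a b c" and ?R = "nilp p n 1 (s * h1 - t * a) (s * h2 - t * b) (s * h3 - t * c)"
  have T: "T \<in> carrier_mat (2 * n) (2 * n)" using assms(3) by (simp add: sp_set_def)
  fix i j assume "i < dim_row ?R" "j < dim_col ?R"
  then have ij: "i < 2 * n" "j < 2 * n" by auto
  have qp: "quat_part p n T s t = quat h1 h2 h3 s t" for s t
    unfolding h1_def h2_def h3_def by (rule quat_part_quat[OF assms(1-3)])
  have NT: "(?N * T) $$ (i, k) = quat_col p n 1 i * (quat a b c (n \<le> i) False * (T $$ (0, k) - T $$ (p, k))
      + quat a b c (n \<le> i) True * (T $$ (n, k) + T $$ (n + p, k)))" if "k < 2 * n" for k
    using T that ij(1) nilp_sum_left[OF assms(1,2) refl ij(1), of a b c "\<lambda>l. T $$ (l, k)"]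
    by (simp add: scalar_prod_def atLeast0LessThan)
  have "(?N * T * ?N) $$ (i, j) = (\<Sum>k<2 * n. (?N * T) $$ (i, k) * ?N $$ (k, j))"
    using T ij by (simp add: scalar_prod_def[of _ "col _ _"] atLeast0LessThan)
  also have "\<dots> = (((?N * T) $$ (i, 0) + (?N * T) $$ (i, p)) * quat a b c False (n \<le> j)
      + ((?N * T) $$ (i, n) - (?N * T) $$ (i, n + p)) * quat a b c True (n \<le> j)) * quat_row p n 1 j"
    by (rule nilp_sum_right[OF assms(1,2) refl ij(2)])
  also have "\<dots> = quat_col p n 1 i * (\<Sum>s\<in>UNIV. \<Sum>t\<in>UNIV. quat a b c (n \<le> i) s * quat_part p n T s t *
      quat a b c t (n \<le> j)) * quat_row p n 1 j"
    using assms(1,2) by (simp add: NT UNIV_bool quat_part_def algebra_simps del: index_mult_mat(1))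
  also have "\<dots> = quat_col p n 1 i * quat (s * h1 - t * a) (s * h2 - t * b) (s * h3 - t * c) (n \<le> i) (n \<le> j) * quat_row p n 1 j"
    by (simp only: qp quat_triple s_def t_def)
  finally show "(?N * T * ?N) $$ (i, j) = ?R $$ (i, j)" using ij by (simp add: nilp_def)
qed (use assms(3) in \<open>auto simp: sp_set_def\<close>)

text \<open>The isotropic vectors for \<open>e = 1\<close> and \<open>e = -1\<close> pair to
  \<open>2\<close>, once on each side of the quaternion.\<close>

lemma quat_part_nilp_opposite:
  assumes "0 < p" "p < n"
  shows "quat_part p n (nilp p n (-1) a b c) s t = 4 * quat a b c s t"
  using assms by (cases s; cases t) (auto simp: quat_part_def nilp_def quat_col_def quat_row_def)

section \<open>Double commutators in \<open>sp(p,q)\<close> and the algebras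
  \<open>osp^*(m|p,q)\<close>\<close>

lemma supercommutator_even:
  fixes X Y :: "'k::ring_1 mat"
  assumes X: "X \<in> carrier_mat d d" and Y: "Y \<in> carrier_mat d d"
  shows "supercommutator (*) (+) (-) (mat_even d 0) (mat_odd d 0) X Y = X * Y - Y * X"
proof -
  have e: "mat_even d 0 M = M" "mat_odd d 0 M = 0\<^sub>m d d" if "M \<in> carrier_mat d d" for M :: "'k mat"
    using that by (auto intro!: eq_matI simp: mat_even_def mat_odd_def)
  show ?thesis
    unfolding supercommutator_def e[OF X] e[OF Y]
    using X Y by (intro eq_matI) (auto simp: left_mult_zero_mat[OF X] left_mult_zero_mat[OF Y]
        right_mult_zero_mat[OF X] right_mult_zero_mat[OF Y] simp del: index_mult_mat(1))
qed

text \<open>In \<open>N N T - 2 N T N + T N N\<close> only the middle term survives.\<close>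

lemma double_commutator_square_zero:
  fixes N T :: "'k::comm_ring_1 mat"
  assumes N: "N \<in> carrier_mat d d" and T: "T \<in> carrier_mat d d" and sq: "N * N = 0\<^sub>m d d"
  shows "N * (N * T - T * N) - (N * T - T * N) * N = (-2) \<cdot>\<^sub>m (N * T * N)"
proof -
  have NT: "N * T \<in> carrier_mat d d" and TN: "T * N \<in> carrier_mat d d" using N T by auto
  have "N * (N * T - T * N) = N * (N * T) - N * (T * N)"
    by (rule mult_minus_distrib_mat[OF N NT TN])
  also have "N * (N * T) = 0\<^sub>m d d" using assoc_mult_mat[OF N N T] sq left_mult_zero_mat[OF T] by simp
  also have "N * (T * N) = N * T * N" using assoc_mult_mat[OF N T N] by simp
  finally have 1: "N * (N * T - T * N) = 0\<^sub>m d d - N * T * N" .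
  have "(N * T - T * N) * N = N * T * N - T * N * N"
    by (rule minus_mult_distrib_mat[OF NT TN N])
  also have "T * N * N = 0\<^sub>m d d" using assoc_mult_mat[OF T N N] sq right_mult_zero_mat[OF T] by simp
  finally have 2: "(N * T - T * N) * N = N * T * N - 0\<^sub>m d d" .
  show ?thesis unfolding 1 2 using N T by (intro eq_matI) (auto simp del: index_mult_mat(1))
qed

lemma quat_part_add:
  assumes "p < n" "T \<in> carrier_mat (2 * n) (2 * n)" "T' \<in> carrier_mat (2 * n) (2 * n)"
  shows "quat_part p n (T + T') s t = quat_part p n T s t + quat_part p n T' s t"
  using assms by (auto simp: quat_part_def algebra_simps)

lemma quat_part_scale:
  assumes "p < n" "T \<in> carrier_mat (2 * n) (2 * n)"
  shows "quat_part p n (c \<cdot>\<^sub>m T) s t = c * quat_part p n T s t"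
  using assms by (auto simp: quat_part_def algebra_simps)

text \<open>Only the factor \<open>sp(p,q)\<close> of the even part is used. For imaginary quaternions \<open>x\<close> and \<open>h\<close> with \<open>|x| = 1\<close>,
  the product \<open>x h x\<close> is a reflection of \<open>h\<close>: it is \<open>-h\<close> for \<open>x\<close> parallel to \<open>h\<close>, and the sum over
  \<open>x = i, j, k\<close> is \<open>h\<close>. As \<open>(ad N\<^sub>x)\<^sup>2 [X, X]\<close> is \<open>-2\<close> times the nilpotent matrix of \<open>x h x\<close>, every
  semidefinite form vanishes on the nilpotent matrix of \<open>h\<close>.\<close>

lemma nondefinite_osp_star:
  fixes g0 g1 :: "'a::euclidean_space set"
  assumes alg: "real_lie_superalgebra g0 g1 br" and simple: "simple_superalgebra g0 g1 br" "g1 \<noteq> {0}"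
    and osp: "is_osp_star m p q (superalgebra_of g0 g1 br)" and pq: "0 < p" "0 < q" and m: "even m"
  shows "nondefinite g1 br"
proof (rule ccontr)
  assume pos: "\<not> nondefinite g1 br"
  interpret real_lie_superalgebra g0 g1 br by (rule alg)
  define n where "n = p + q"
  have n: "p < n" "p \<le> n" "0 < n" using pq by (auto simp: n_def)
  define SO :: "complex mat set" where
    "SO = {X \<in> carrier_mat m m. X = - transpose_mat X \<and> X * Jmat (m div 2) = Jmat (m div 2) * mcnj X}"
  have "sa_carrier (sp_pq p q) = sp_set p n"
    by (simp add: sp_pq_def sp_set_def sa_sub_def n_def Let_def)
  moreover obtain \<psi> where "sa_iso (sa_even_part (superalgebra_of g0 g1 br)) (sa_direct_sum (so_star m) (sp_pq p q)) \<psi>"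
    using osp unfolding is_osp_star_def sa_isomorphic_def by blast
  ultimately have bij: "bij_betw \<psi> g0 (SO \<times> sp_set p n)"
    and add: "\<And>x y. x \<in> g0 \<Longrightarrow> y \<in> g0 \<Longrightarrow> \<psi> (x + y) = (fst (\<psi> x) + fst (\<psi> y), snd (\<psi> x) + snd (\<psi> y))"
    and scale: "\<And>c x. x \<in> g0 \<Longrightarrow> \<psi> (c *\<^sub>R x) = (of_real c \<cdot>\<^sub>m fst (\<psi> x), of_real c \<cdot>\<^sub>m snd (\<psi> x))"
    and brk: "\<And>x y. x \<in> g0 \<Longrightarrow> y \<in> g0 \<Longrightarrow> \<psi> (br x y) =
      (supercommutator (*) (+) (-) (mat_even m 0) (mat_odd m 0) (fst (\<psi> x)) (fst (\<psi> y)),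
       supercommutator (*) (+) (-) (mat_even (2 * n) 0) (mat_odd (2 * n) 0) (snd (\<psi> x)) (snd (\<psi> y)))"
    by (auto simp: sa_iso_def sa_even_part_def sa_sub_def superalgebra_of_def sa_direct_sum_def
        so_star_def sp_pq_def gl_super_def SO_def n_def Let_def case_prod_beta)
  have inj: "x = y" if "\<psi> x = \<psi> y" "x \<in> g0" "y \<in> g0" for x y
    using bij that by (auto simp: bij_betw_def inj_on_def)
  have \<psi>: "fst (\<psi> x) \<in> carrier_mat m m" "snd (\<psi> x) \<in> sp_set p n" "snd (\<psi> x) \<in> carrier_mat (2 * n) (2 * n)"
    if "x \<in> g0" for x
  proof -
    have "\<psi> x \<in> SO \<times> sp_set p n" using bij that by (auto simp: bij_betw_def)
    then show "fst (\<psi> x) \<in> carrier_mat m m" "snd (\<psi> x) \<in> sp_set p n" "snd (\<psi> x) \<in> carrier_mat (2 * n) (2 * n)"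
      by (auto simp: SO_def sp_set_def)
  qed
  have brk': "\<psi> (br x y) = (fst (\<psi> x) * fst (\<psi> y) - fst (\<psi> y) * fst (\<psi> x), snd (\<psi> x) * snd (\<psi> y) - snd (\<psi> y) * snd (\<psi> x))"
    if "x \<in> g0" "y \<in> g0" for x y
    unfolding brk[OF that] using that \<psi> by (simp add: supercommutator_even)
  have SO0: "0\<^sub>m m m \<in> SO"
  proof -
    have "0\<^sub>m m m * Jmat (m div 2) = Jmat (m div 2) * mcnj (0\<^sub>m m m)"
      using m by (intro eq_matI) (auto simp: scalar_prod_def)
    moreover have "0\<^sub>m m m = - transpose_mat (0\<^sub>m m m :: complex mat)" by (rule eq_matI) auto
    ultimately show ?thesis by (simp add: SO_def)
  qed
  have ex: "\<exists>N\<in>g0. \<psi> N = (0\<^sub>m m m, nilp p n e a b c)" if "e * e = 1" for e a b c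
  proof -
    have "(0\<^sub>m m m, nilp p n e a b c) \<in> \<psi> ` g0"
      using bij SO0 nilp_in_sp_set[OF pq(1) n(1) that] by (simp add: bij_betw_def)
    then show ?thesis by (metis imageE)
  qed
  \<comment> \<open>\<open>v a b c\<close> is the element of the even part that corresponds to the
    nilpotent matrix of the imaginary quaternion with coordinates \<open>a\<close>,
    \<open>b\<close>, \<open>c\<close>. Injectivity of \<open>\<psi>\<close> makes it linear in
    these.\<close>
  define v where "v a b c = (SOME N. N \<in> g0 \<and> \<psi> N = (0\<^sub>m m m, nilp p n 1 a b c))" for a b c
  have v: "v a b c \<in> g0" "\<psi> (v a b c) = (0\<^sub>m m m, nilp p n 1 a b c)" for a b c
  proof -
    have "\<exists>N. N \<in> g0 \<and> \<psi> N = (0\<^sub>m m m, nilp p n 1 a b c)" using ex[of 1 a b c] by auto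
    from someI_ex[OF this] show "v a b c \<in> g0" "\<psi> (v a b c) = (0\<^sub>m m m, nilp p n 1 a b c)"
      by (simp_all add: v_def)
  qed
  have vadd: "v (a + a') (b + b') (c + c') = v a b c + v a' b' c'" for a b c a' b' c'
  proof (rule inj)
    have "0\<^sub>m m m = 0\<^sub>m m m + (0\<^sub>m m m :: complex mat)" by (rule eq_matI) auto
    then show "\<psi> (v (a + a') (b + b') (c + c')) = \<psi> (v a b c + v a' b' c')"
      by (simp add: add v nilp_add)
  qed (use v subspace_add[OF subspace_even] in auto)
  have vscale: "v (r * a) (r * b) (r * c) = r *\<^sub>R v a b c" for r a b c
  proof (rule inj)
    have "0\<^sub>m m m = of_real r \<cdot>\<^sub>m (0\<^sub>m m m :: complex mat)" by (rule eq_matI) auto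
    then show "\<psi> (v (r * a) (r * b) (r * c)) = \<psi> (r *\<^sub>R v a b c)"
      by (simp add: scale v nilp_scale)
  qed (use v subspace_scale[OF subspace_even] in auto)
  have brv: "\<psi> (br (v a b c) Y) = (0\<^sub>m m m, nilp p n 1 a b c * snd (\<psi> Y) - snd (\<psi> Y) * nilp p n 1 a b c)"
    if "Y \<in> g0" for a b c Y
    unfolding brk'[OF v(1) that] v(2)
    using \<psi>(1)[OF that] by (auto intro!: eq_matI simp: left_mult_zero_mat[OF \<psi>(1)[OF that]] right_mult_zero_mat[OF \<psi>(1)[OF that]])
  define h1 h2 h3 where "h1 Y = Im (quat_part p n (snd (\<psi> Y)) False False)"
    and "h2 Y = Re (quat_part p n (snd (\<psi> Y)) False True)" and "h3 Y = Im (quat_part p n (snd (\<psi> Y)) False True)" for Y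
  define s t where "s a b c = a\<^sup>2 + b\<^sup>2 + c\<^sup>2" and "t a b c Y = 2 * (a * h1 Y + b * h2 Y + c * h3 Y)" for a b c :: real and Y
  have double: "br (v a b c) (br (v a b c) Y) = v (-2 * (s a b c * h1 Y - t a b c Y * a))
      (-2 * (s a b c * h2 Y - t a b c Y * b)) (-2 * (s a b c * h3 Y - t a b c Y * c))" if Y: "Y \<in> g0" for a b c Y
  proof (rule inj)
    have b: "br (v a b c) Y \<in> g0" using graded(1) v Y by blast
    then show "br (v a b c) (br (v a b c) Y) \<in> g0" using graded(1) v by blast
    have "\<psi> (br (v a b c) (br (v a b c) Y)) = (0\<^sub>m m m, (-2) \<cdot>\<^sub>m (nilp p n 1 a b c * snd (\<psi> Y) * nilp p n 1 a b c))"
      unfolding brv[OF b] brv[OF Y] snd_conv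
      by (simp only: double_commutator_square_zero[OF nilp_carrier \<psi>(3)[OF Y] nilp_square[OF pq(1) n(1)]])
    also have "nilp p n 1 a b c * snd (\<psi> Y) * nilp p n 1 a b c =
        nilp p n 1 (s a b c * h1 Y - t a b c Y * a) (s a b c * h2 Y - t a b c Y * b) (s a b c * h3 Y - t a b c Y * c)"
      unfolding s_def t_def h1_def h2_def h3_def by (rule nilp_sandwich[OF pq(1) n(1) \<psi>(2)[OF Y]])
    also have "(-2) \<cdot>\<^sub>m \<dots> = nilp p n 1 (-2 * (s a b c * h1 Y - t a b c Y * a))
      (-2 * (s a b c * h2 Y - t a b c Y * b)) (-2 * (s a b c * h3 Y - t a b c Y * c))"
      by (simp only: nilp_scale) simp
    finally show "\<psi> (br (v a b c) (br (v a b c) Y)) = \<psi> (v (-2 * (s a b c * h1 Y - t a b c Y * a))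
      (-2 * (s a b c * h2 Y - t a b c Y * b)) (-2 * (s a b c * h3 Y - t a b c Y * c)))" unfolding v(2) .
  qed (rule v)
  \<comment> \<open>The double commutator is a multiple of \<open>N T N\<close>, and a further
    \<open>N\<close> on either side meets another \<open>N\<close>.\<close>
  have triple: "br (v a b c) (br (v a b c) (br (v a b c) Y)) = 0" if Y: "Y \<in> g0" for a b c Y
  proof (rule inj)
    have Z: "snd (\<psi> (br (v a b c) Y)) = nilp p n 1 a b c * snd (\<psi> Y) - snd (\<psi> Y) * nilp p n 1 a b c"
      by (simp add: brv[OF Y])
    let ?N = "nilp p n 1 a b c" let ?T = "snd (\<psi> Y)"
    have b: "br (v a b c) Y \<in> g0" using graded(1) v Y by blast
    have b2: "br (v a b c) (br (v a b c) Y) \<in> g0" using graded(1) v b by blast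
    then show "br (v a b c) (br (v a b c) (br (v a b c) Y)) \<in> g0" using graded(1) v by blast
    have NTN: "?N * ?T * ?N \<in> carrier_mat (2 * n) (2 * n)" using \<psi>(3)[OF Y] by auto
    have NT: "?N * ?T \<in> carrier_mat (2 * n) (2 * n)" using \<psi>(3)[OF Y] by auto
    have sq: "?N * ?N = 0\<^sub>m (2 * n) (2 * n)" by (rule nilp_square[OF pq(1) n(1)])
    have l: "?N * (?N * ?T * ?N) = 0\<^sub>m (2 * n) (2 * n)"
    proof -
      have "?N * (?N * ?T * ?N) = ?N * (?N * ?T) * ?N" by (rule assoc_mult_mat[symmetric, OF nilp_carrier NT nilp_carrier])
      also have "?N * (?N * ?T) = ?N * ?N * ?T" by (rule assoc_mult_mat[symmetric, OF nilp_carrier nilp_carrier \<psi>(3)[OF Y]])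
      finally show ?thesis by (simp add: sq left_mult_zero_mat[OF \<psi>(3)[OF Y]] left_mult_zero_mat[OF nilp_carrier])
    qed
    have r: "?N * ?T * ?N * ?N = 0\<^sub>m (2 * n) (2 * n)"
      unfolding assoc_mult_mat[OF NT nilp_carrier nilp_carrier] sq by (rule right_mult_zero_mat[OF NT])
    have "\<psi> (br (v a b c) (br (v a b c) (br (v a b c) Y))) = (0\<^sub>m m m, 0\<^sub>m (2 * n) (2 * n))"
      unfolding brv[OF b2] brv[OF b] brv[OF Y] snd_conv
        double_commutator_square_zero[OF nilp_carrier \<psi>(3)[OF Y] sq]
        mult_smult_distrib[OF nilp_carrier NTN] mult_smult_assoc_mat[OF NTN nilp_carrier] l r
      by (auto intro!: eq_matI)
    also have "\<dots> = \<psi> 0"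
      using scale[OF v(1), of 0 0 0 0] unfolding v(2) by (auto intro!: eq_matI)
    finally show "\<psi> (br (v a b c) (br (v a b c) (br (v a b c) Y))) = \<psi> 0" .
  qed (rule subspace_0[OF subspace_even])
  have hzero: "quat_part p n (snd (\<psi> (br X X))) False u = 0" if X: "X \<in> g1" for X u
  proof -
    let ?Y = "br X X"
    have Y: "?Y \<in> g0" using graded(4) X by blast
    define k1 k2 k3 where "k1 = h1 ?Y" and "k2 = h2 ?Y" and "k3 = h3 ?Y"
    define r where "r = k1\<^sup>2 + k2\<^sup>2 + k3\<^sup>2"
    \<comment> \<open>Semidefinite functionals separate points under the assumption of a positive
      one, so it is enough that each of them vanishes here. The inequality \<open>main\<close> is
      available for every imaginary quaternion \<open>(a, b, c)\<close>.\<close>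
    have "v k1 k2 k3 = 0"
    proof (rule semidefinite_forms_separate[OF pos simple(2)])
      fix f :: "'a \<Rightarrow> real" assume f: "linear f" "\<And>x. x \<in> g1 \<Longrightarrow> 0 \<le> f (br x x)"
      have main: "0 \<le> f (v (-2 * (s a b c * k1 - t a b c ?Y * a))
          (-2 * (s a b c * k2 - t a b c ?Y * b)) (-2 * (s a b c * k3 - t a b c ?Y * c)))" for a b c
        using semidefinite_second_derivative[OF f v(1) triple X, of a b c] unfolding double[OF Y] k1_def k2_def k3_def .
      have fs: "f (v (x * k1) (x * k2) (x * k3)) = x * f (v k1 k2 k3)" for x
        by (simp add: vscale linear_scale[OF f(1)])
      have "0 \<le> f (v ((2 * r) * k1) ((2 * r) * k2) ((2 * r) * k3))"
        using main[of k1 k2 k3] by (simp add: s_def t_def r_def k1_def[symmetric] k2_def[symmetric] k3_def[symmetric] power2_eq_square algebra_simps)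
      then have up: "0 \<le> 2 * r * f (v k1 k2 k3)" unfolding fs .
      have "0 \<le> f (v (2 * k1) (- 2 * k2) (- 2 * k3)) + f (v (- 2 * k1) (2 * k2) (- 2 * k3)) + f (v (- 2 * k1) (- 2 * k2) (2 * k3))"
        using main[of 1 0 0] main[of 0 1 0] main[of 0 0 1]
        by (simp add: s_def t_def k1_def[symmetric] k2_def[symmetric] k3_def[symmetric])
      also have "\<dots> = f (v ((-2) * k1) ((-2) * k2) ((-2) * k3))"
        by (simp add: linear_add[OF f(1), symmetric] vadd[symmetric])
      finally have down: "f (v k1 k2 k3) \<le> 0" unfolding fs by simp
      show "f (v k1 k2 k3) = 0"
      proof (cases "r = 0")
        case True
        then have "k1 = 0" "k2 = 0" "k3 = 0" unfolding r_def by (simp_all add: add_nonneg_eq_0_iff)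
        then show ?thesis using fs[of 0] by simp
      next
        case False
        then have "0 < r" unfolding r_def by (simp add: sum_power2_gt_zero_iff less_le)
        then show ?thesis using up down by (simp add: zero_le_mult_iff)
      qed
    qed
    then have "nilp p n 1 k1 k2 k3 = nilp p n 1 0 0 0"
      using v(2)[of k1 k2 k3] v(2)[of 0 0 0] vscale[of 0 0 0 0] by simp
    then have "nilp p n 1 k1 k2 k3 $$ (0, 0) = 0" "nilp p n 1 k1 k2 k3 $$ (0, n) = 0"
      using n by (auto simp: nilp_def quat_def)
    then have k: "k1 = 0" "k2 = 0" "k3 = 0"
      using n pq by (auto simp: nilp_def quat_def quat_col_def quat_row_def complex_eq_iff)
    have "quat_part p n (snd (\<psi> ?Y)) False u = quat k1 k2 k3 False u"
      unfolding k1_def k2_def k3_def h1_def h2_def h3_def by (rule quat_part_quat[OF pq(1) n(1) \<psi>(2)[OF Y]])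
    then show ?thesis by (simp add: k quat_def)
  qed
  \<comment> \<open>By \<open>hzero\<close> this subspace contains all odd squares, hence the whole
    even part. The nilpotent matrix for \<open>e = -1\<close> with quaternion coordinates
    \<open>1, 0, 0\<close> contradicts this, since its value is \<open>4 \<i>\<close>.\<close>
  define Z where "Z = {Y \<in> g0. quat_part p n (snd (\<psi> Y)) False False = 0}"
  have "g0 \<subseteq> Z"
  proof (rule even_spanned_by_squares[OF simple])
    have "\<psi> 0 = (of_real 0 \<cdot>\<^sub>m fst (\<psi> 0), of_real 0 \<cdot>\<^sub>m snd (\<psi> 0))" using scale[of 0 0] subspace_0[OF subspace_even] by simp
    then have "quat_part p n (snd (\<psi> 0)) False False = of_real 0 * quat_part p n (snd (\<psi> 0)) False False"
      using quat_part_scale[OF n(1) \<psi>(3)[OF subspace_0[OF subspace_even]]] by (metis snd_conv)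
    then show "subspace Z"
      using subspace_even \<psi>(3)
      by (auto simp: Z_def subspace_def add scale quat_part_add[OF n(1)] quat_part_scale[OF n(1)])
    show "br x x \<in> Z" if "x \<in> g1" for x using hzero[OF that] graded(4) that by (simp add: Z_def)
  qed
  moreover obtain Y where "Y \<in> g0" "\<psi> Y = (0\<^sub>m m m, nilp p n (-1) 1 0 0)" using ex[of "-1" 1 0 0] by auto
  ultimately have "quat_part p n (nilp p n (-1) 1 0 0) False False = 0" unfolding Z_def by force
  then show False using quat_part_nilp_opposite[OF pq(1) n(1), of 1 0 0 False False] by (simp add: quat_def)
qed

section \<open>Derivations of the Grassmann algebra\<close>

text \<open>The sign in \<open>\<xi>_I \<xi>_J = \<plusminus> \<xi>_{I \<union> J}\<close> for
  disjoint \<open>I\<close> and \<open>J\<close>. Multiplication and partial derivatives are both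
  expressed by it, so associativity and the Leibniz rule reduce to its behaviour under
  unions.\<close>

definition sgnp :: "nat set \<Rightarrow> nat set \<Rightarrow> 'k::comm_ring_1" where
  "sgnp I J = (-1) ^ card {(i, j). i \<in> I \<and> j \<in> J \<and> j < i}"

lemma finite_inversions: "finite I \<Longrightarrow> finite J \<Longrightarrow> finite {(i, j). i \<in> I \<and> j \<in> J \<and> j < (i::nat)}"
  by (rule finite_subset[of _ "I \<times> J"]) auto

lemma sgnp_square [simp]: "sgnp I J * sgnp I J = 1" "sgnp I J * (sgnp I J * x) = x"
  by (simp_all add: sgnp_def flip: power_mult_distrib mult.assoc)

lemma sgnp_Un_left:
  assumes "finite A" "finite B" "finite C" "A \<inter> B = {}"
  shows "sgnp (A \<union> B) C = sgnp A C * sgnp B C"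
proof -
  have "{(i, j). i \<in> A \<union> B \<and> j \<in> C \<and> j < i} =
      {(i, j). i \<in> A \<and> j \<in> C \<and> j < i} \<union> {(i, j). i \<in> B \<and> j \<in> C \<and> j < i}" by auto
  moreover have "card \<dots> = card {(i, j). i \<in> A \<and> j \<in> C \<and> j < i} + card {(i, j). i \<in> B \<and> j \<in> C \<and> j < i}"
    by (rule card_Un_disjoint) (use assms finite_inversions in auto)
  ultimately show ?thesis by (simp add: sgnp_def power_add)
qed

lemma sgnp_Un_right:
  assumes "finite A" "finite B" "finite C" "B \<inter> C = {}"
  shows "sgnp A (B \<union> C) = sgnp A B * sgnp A C"
proof -
  have "{(i, j). i \<in> A \<and> j \<in> B \<union> C \<and> j < i} =
      {(i, j). i \<in> A \<and> j \<in> B \<and> j < i} \<union> {(i, j). i \<in> A \<and> j \<in> C \<and> j < i}" by auto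
  moreover have "card \<dots> = card {(i, j). i \<in> A \<and> j \<in> B \<and> j < i} + card {(i, j). i \<in> A \<and> j \<in> C \<and> j < i}"
    by (rule card_Un_disjoint) (use assms finite_inversions in auto)
  ultimately show ?thesis by (simp add: sgnp_def power_add)
qed

text \<open>Every pair in \<open>A \<times> B\<close> is an inversion for exactly one of the two
  orders, because \<open>A\<close> and \<open>B\<close> are disjoint. So the two signs multiply to
  \<open>(-1)^(card A * card B)\<close>.\<close>

lemma sgnp_swap:
  assumes "finite A" "finite B" "A \<inter> B = {}"
  shows "sgnp B A = (-1) ^ (card A * card B) * sgnp A B"
proof -
  have "bij_betw (\<lambda>(i, j). (j, i)) {(i, j). i \<in> B \<and> j \<in> A \<and> j < i} {(i, j). i \<in> A \<and> j \<in> B \<and> i < j}"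
    by (rule bij_betwI[where g = "\<lambda>(i, j). (j, i)"]) auto
  then have c: "card {(i, j). i \<in> B \<and> j \<in> A \<and> j < i} = card {(i, j). i \<in> A \<and> j \<in> B \<and> i < j}"
    by (rule bij_betw_same_card)
  have "A \<times> B = {(i, j). i \<in> A \<and> j \<in> B \<and> j < i} \<union> {(i, j). i \<in> A \<and> j \<in> B \<and> i < j}"
    using assms(3) by (auto simp: neq_iff)
  then have "card (A \<times> B) = card ({(i, j). i \<in> A \<and> j \<in> B \<and> j < i} \<union> {(i, j). i \<in> A \<and> j \<in> B \<and> i < j})"
    by (rule arg_cong)
  also have "\<dots> = card {(i, j). i \<in> A \<and> j \<in> B \<and> j < i} + card {(i, j). i \<in> A \<and> j \<in> B \<and> i < j}"
    by (rule card_Un_disjoint)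
      (use finite_inversions[OF assms(1,2)] finite_subset[of "{(i, j). i \<in> A \<and> j \<in> B \<and> i < j}" "A \<times> B"] assms in auto)
  finally have "(-1) ^ (card A * card B) = (sgnp A B * sgnp B A :: 'a)"
    by (simp add: sgnp_def c card_cartesian_product power_add)
  then show ?thesis by (simp add: mult.commute)
qed

lemma sgnp_single: "sgnp {i} B = (-1) ^ card {j \<in> B. j < i}"
proof -
  have "bij_betw snd {(k, j). k \<in> {i} \<and> j \<in> B \<and> j < k} {j \<in> B. j < i}"
    by (rule bij_betwI[where g = "\<lambda>j. (i, j)"]) auto
  from bij_betw_same_card[OF this] show ?thesis unfolding sgnp_def by (rule arg_cong)
qed

lemma sgnp_single_right: "finite A \<Longrightarrow> i \<notin> A \<Longrightarrow> sgnp A {i} = (-1) ^ card A * sgnp {i} A"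
  by (subst sgnp_swap) auto

lemma gmult_sgnp: "gmult f h K = (\<Sum>I\<in>Pow K. sgnp I (K - I) * f I * h (K - I))"
  by (simp add: gmult_def sgnp_def)

lemma gpartial_sgnp: "gpartial i f I = (if i \<in> I then 0 else sgnp {i} I * f (insert i I))"
  by (simp add: gpartial_def sgnp_single)

lemma gmult_infinite: "infinite K \<Longrightarrow> gmult f h K = 0"
  by (simp add: gmult_def finite_Pow_iff)

lemma sum_Pow_insert:
  assumes "finite K" "i \<notin> K"
  shows "(\<Sum>I\<in>Pow (insert i K). h I) = (\<Sum>A\<in>Pow K. h A + h (insert i A))"
proof -
  have "(\<Sum>I\<in>Pow (insert i K). h I) = (\<Sum>I\<in>Pow K. h I) + (\<Sum>I\<in>insert i ` Pow K. h I)"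
    unfolding Pow_insert by (rule sum.union_disjoint) (use assms in auto)
  also have "(\<Sum>I\<in>insert i ` Pow K. h I) = (\<Sum>A\<in>Pow K. h (insert i A))"
    by (rule sum.reindex_cong[of "insert i"]) (use assms in \<open>auto simp: inj_on_def\<close>)
  finally show ?thesis by (simp add: sum.distrib)
qed

text \<open>Both sides sum over the ordered partitions of \<open>K\<close> into three parts, with
  the product of the three pairwise signs. At infinite \<open>K\<close> both sides are zero by the
  convention for infinite sums.\<close>

lemma gmult_assoc: "gmult (gmult f g) h = gmult f (gmult g h)"
proof
  fix K
  show "gmult (gmult f g) h K = gmult f (gmult g h) K"
  proof (cases "finite K")
    case False
    then show ?thesis by (simp add: gmult_infinite)
  next
    case True
    let ?L = "SIGMA I:Pow K. Pow I" and ?R = "SIGMA A:Pow K. Pow (K - A)"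
    have fin: "finite A" if "A \<subseteq> K" for A using True that finite_subset by blast
    have "gmult (gmult f g) h K = (\<Sum>I\<in>Pow K. \<Sum>A\<in>Pow I. sgnp I (K - I) * sgnp A (I - A) * f A * g (I - A) * h (K - I))"
      by (simp add: gmult_sgnp sum_distrib_left sum_distrib_right mult.assoc)
    also have "\<dots> = (\<Sum>(I, A)\<in>?L. sgnp I (K - I) * sgnp A (I - A) * f A * g (I - A) * h (K - I))"
      by (rule sum.Sigma) (use True fin in auto)
    also have "\<dots> = (\<Sum>(A, B)\<in>?R. sgnp A (K - A) * sgnp B (K - A - B) * f A * g B * h (K - A - B))"
    \<comment> \<open>The left sum runs over the union \<open>I\<close> of the first two parts and
      the first part \<open>A\<close>, the right one over the first part \<open>A\<close> and the
      second part \<open>B = I - A\<close>.\<close>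
    proof (rule sum.reindex_bij_witness[of _ "\<lambda>(A, B). (A \<union> B, A)" "\<lambda>(I, A). (A, I - A)"]; clarsimp)
      fix I A assume IA: "I \<subseteq> K" "A \<subseteq> I"
      have e: "K - A = (I - A) \<union> (K - I)" "K - A - (I - A) = K - I" "I = A \<union> (I - A)" using IA by auto
      have "sgnp I (K - I) = sgnp A (K - I) * (sgnp (I - A) (K - I) :: 'a)"
      proof -
        have "sgnp (A \<union> (I - A)) (K - I) = sgnp A (K - I) * (sgnp (I - A) (K - I) :: 'a)"
          by (rule sgnp_Un_left) (use IA fin[of A] fin[of "I - A"] fin[of "K - I"] in auto)
        then show ?thesis unfolding e(3)[symmetric] .
      qed
      moreover have "sgnp A (K - A) = sgnp A (I - A) * (sgnp A (K - I) :: 'a)"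
        unfolding e(1) by (rule sgnp_Un_right) (use IA fin[of A] fin[of "I - A"] fin[of "K - I"] in auto)
      ultimately show "sgnp A (K - A) * sgnp (I - A) (K - A - (I - A)) * f A * g (I - A) * h (K - A - (I - A)) =
          sgnp I (K - I) * sgnp A (I - A) * f A * g (I - A) * h (K - I)"
        unfolding e(2) by (simp add: mult_ac)
    qed auto
    also have "\<dots> = (\<Sum>A\<in>Pow K. \<Sum>B\<in>Pow (K - A). sgnp A (K - A) * sgnp B (K - A - B) * f A * g B * h (K - A - B))"
      by (rule sum.Sigma[symmetric]) (use True fin in auto)
    also have "\<dots> = gmult f (gmult g h) K"
      by (simp add: gmult_sgnp sum_distrib_left mult_ac)
    finally show ?thesis .
  qed
qed

lemma gmult_add_left: "gmult (\<lambda>I. a * f I + b * g I) h = (\<lambda>I. a * gmult f h I + b * gmult g h I)"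
  by (rule ext) (simp add: gmult_def sum.distrib sum_distrib_left algebra_simps)

lemma gmult_add_right: "gmult h (\<lambda>I. a * f I + b * g I) = (\<lambda>I. a * gmult h f I + b * gmult h g I)"
  by (rule ext) (simp add: gmult_def sum.distrib sum_distrib_left algebra_simps)

text \<open>The parity automorphism. With it the Leibniz rule for the odd operators
  \<open>gpartial i\<close> holds for inhomogeneous \<open>f\<close> as well.\<close>

definition gflip :: "'k::comm_ring_1 grassmann \<Rightarrow> 'k grassmann" where
  "gflip f = (\<lambda>I. (-1) ^ card I * f I)"

text \<open>Subsets of \<open>K\<close> are paired as \<open>A\<close> and
  \<open>insert i A\<close>. For \<open>i \<in> K\<close> the left side is zero and the
  contributions of each pair cancel on the right; otherwise each decomposition of
  \<open>insert i K\<close> has \<open>i\<close> in one of its two parts, and these are the two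
  terms.\<close>

lemma gpartial_gmult:
  "gpartial i (gmult f g) = (\<lambda>K. gmult (gpartial i f) g K + gmult (gflip f) (gpartial i g) K)"
proof
  fix K
  show "gpartial i (gmult f g) K = gmult (gpartial i f) g K + gmult (gflip f) (gpartial i g) K"
  proof (cases "finite K")
    case False
    then show ?thesis by (simp add: gmult_infinite gpartial_def)
  next
    case fin: True
    define S where "S = K - {i}"
    have S: "finite S" "i \<notin> S" using fin by (auto simp: S_def)
    have split: "sgnp {i} S = sgnp {i} A * (sgnp {i} (S - A) :: 'a)"
      "sgnp A (insert i (S - A)) = (-1) ^ card A * sgnp {i} A * (sgnp A (S - A) :: 'a)"
      "sgnp (insert i A) (S - A) = sgnp {i} (S - A) * (sgnp A (S - A) :: 'a)"
      "card (insert i A) = Suc (card A)" "insert i S - insert i A = S - A" "insert i S - A = insert i (S - A)" "i \<notin> A" "i \<notin> S - A"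
      if "A \<in> Pow S" for A
    proof -
      have A: "A \<subseteq> S" "finite A" "i \<notin> A" using that S finite_subset by auto
      have AS: "A \<union> (S - A) = S" using A by auto
      have "sgnp {i} (A \<union> (S - A)) = sgnp {i} A * (sgnp {i} (S - A) :: 'a)"
        by (rule sgnp_Un_right) (use A S in auto)
      then show "sgnp {i} S = sgnp {i} A * (sgnp {i} (S - A) :: 'a)" unfolding AS .
      show "sgnp A (insert i (S - A)) = (-1) ^ card A * sgnp {i} A * (sgnp A (S - A) :: 'a)"
        using sgnp_Un_right[of A "{i}" "S - A"] A S by (simp add: sgnp_single_right)
      show "sgnp (insert i A) (S - A) = sgnp {i} (S - A) * (sgnp A (S - A) :: 'a)"
        using sgnp_Un_left[of "{i}" A "S - A"] A S by simp
      show "card (insert i A) = Suc (card A)" using A by simp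
      show "insert i S - insert i A = S - A" "insert i S - A = insert i (S - A)" "i \<notin> A" "i \<notin> S - A" using A S by auto
    qed
    show ?thesis
    proof (cases "i \<in> K")
      case True
      then have K: "K = insert i S" by (auto simp: S_def)
      have "gmult (gpartial i f) g K + gmult (gflip f) (gpartial i g) K =
        (\<Sum>A\<in>Pow S. sgnp A (insert i S - A) * gpartial i f A * g (insert i S - A)
           + sgnp (insert i A) (insert i S - insert i A) * gpartial i f (insert i A) * g (insert i S - insert i A)
           + (sgnp A (insert i S - A) * gflip f A * gpartial i g (insert i S - A)
           + sgnp (insert i A) (insert i S - insert i A) * gflip f (insert i A) * gpartial i g (insert i S - insert i A)))"
        unfolding K gmult_sgnp sum_Pow_insert[OF S] by (simp add: sum.distrib)
      also have "\<dots> = 0"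
      proof (rule sum.neutral, rule ballI)
        fix A assume A: "A \<in> Pow S"
        show "sgnp A (insert i S - A) * gpartial i f A * g (insert i S - A)
           + sgnp (insert i A) (insert i S - insert i A) * gpartial i f (insert i A) * g (insert i S - insert i A)
           + (sgnp A (insert i S - A) * gflip f A * gpartial i g (insert i S - A)
           + sgnp (insert i A) (insert i S - insert i A) * gflip f (insert i A) * gpartial i g (insert i S - insert i A)) = 0"
          by (simp only: split[OF A]) (simp add: gpartial_sgnp gflip_def split(7,8)[OF A] split(4)[OF A] S(2) mult_ac)
      qed
      finally show ?thesis using True by (simp add: gpartial_def)
    next
      case False
      then have K: "K = S" by (auto simp: S_def)
      have "gpartial i (gmult f g) K = sgnp {i} S * (\<Sum>A\<in>Pow S. sgnp A (insert i S - A) * f A * g (insert i S - A)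
          + sgnp (insert i A) (insert i S - insert i A) * f (insert i A) * g (insert i S - insert i A))"
        unfolding gpartial_sgnp gmult_sgnp K sum_Pow_insert[OF S] using S by simp
      also have "\<dots> = (\<Sum>A\<in>Pow S. sgnp A (S - A) * gpartial i f A * g (S - A) + sgnp A (S - A) * gflip f A * gpartial i g (S - A))"
        unfolding sum_distrib_left
      proof (rule sum.cong[OF refl])
        fix A assume A: "A \<in> Pow S"
        show "sgnp {i} S * (sgnp A (insert i S - A) * f A * g (insert i S - A)
          + sgnp (insert i A) (insert i S - insert i A) * f (insert i A) * g (insert i S - insert i A)) =
          sgnp A (S - A) * gpartial i f A * g (S - A) + sgnp A (S - A) * gflip f A * gpartial i g (S - A)"
          by (simp only: split[OF A]) (simp add: gpartial_sgnp gflip_def split(7,8)[OF A] S(2) distrib_left mult_ac)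
      qed
      finally show ?thesis unfolding gmult_sgnp K by (simp add: sum.distrib)
    qed
  qed
qed

text \<open>Passing to complements exchanges the factors at the cost of
  \<open>(-1)^(card I * card (K - I))\<close>, and homogeneity makes this sign the same in all
  nonzero terms.\<close>

lemma gmult_supercommute:
  assumes f: "gpart b f = f" and g: "gpart c g = g"
  shows "gmult f g = (\<lambda>K. (if b \<or> c then 1 else -1) * gmult g f K)"
proof
  fix K
  show "gmult f g K = (if b \<or> c then 1 else -1) * gmult g f K"
  proof (cases "finite K")
    case False
    then show ?thesis by (simp add: gmult_infinite)
  next
    case True
    have f0: "f I = 0" if "even (card I) \<noteq> b" for I using fun_cong[OF f, of I] that by (simp add: gpart_def)
    have g0: "g I = 0" if "even (card I) \<noteq> c" for I using fun_cong[OF g, of I] that by (simp add: gpart_def)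
    have "gmult f g K = (\<Sum>I\<in>Pow K. sgnp (K - I) I * f (K - I) * g I)"
      unfolding gmult_sgnp
      by (rule sum.reindex_bij_witness[of _ "\<lambda>I. K - I" "\<lambda>I. K - I"]) (auto simp: double_diff)
    also have "\<dots> = (\<Sum>I\<in>Pow K. (if b \<or> c then 1 else -1) * (sgnp I (K - I) * g I * f (K - I)))"
    proof (rule sum.cong[OF refl])
      fix I assume "I \<in> Pow K"
      then have "sgnp (K - I) I = (-1) ^ (card I * card (K - I)) * (sgnp I (K - I) :: 'a)"
        using True finite_subset by (intro sgnp_swap) auto
      then show "sgnp (K - I) I * f (K - I) * g I = (if b \<or> c then 1 else -1) * (sgnp I (K - I) * g I * f (K - I))"
        using f0[of "K - I"] g0[of I] by (cases "even (card (K - I)) = b"; cases "even (card I) = c") (auto simp: mult_ac)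
    qed
    finally show ?thesis unfolding gmult_sgnp by (simp add: sum_distrib_left)
  qed
qed

section \<open>Monomials, the degree filtration and Leibniz operators\<close>

definition gmono :: "nat set \<Rightarrow> 'k::comm_ring_1 grassmann" where
  "gmono J = (\<lambda>I. of_bool (I = J))"

text \<open>The elements without terms of degree below \<open>k\<close>. Even derivations respect
  this filtration although they need not be homogeneous.\<close>

definition Gr :: "nat \<Rightarrow> nat \<Rightarrow> 'k::comm_ring_1 grassmann set" where
  "Gr n k = {f \<in> Grass n. \<forall>I. f I \<noteq> 0 \<longrightarrow> k \<le> card I}"

lemma Grass_zero: "f \<in> Grass n \<Longrightarrow> \<not> I \<subseteq> {..<n} \<Longrightarrow> f I = 0"
  by (auto simp: Grass_def)

lemma GrassI: "(\<And>I. \<not> I \<subseteq> {..<n} \<Longrightarrow> f I = 0) \<Longrightarrow> f \<in> Grass n"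
  by (auto simp: Grass_def)

lemma Grass_linear: "(f :: 'k::comm_ring_1 grassmann) \<in> Grass n \<Longrightarrow> g \<in> Grass n \<Longrightarrow> (\<lambda>I. a * f I + b * g I) \<in> Grass n"
  by (rule GrassI) (simp add: Grass_zero)

lemma Grass_zero_mem [simp]: "(\<lambda>I. 0) \<in> Grass n"
  by (simp add: Grass_def)

lemma gmono_Grass [simp]: "gmono J \<in> Grass n" if "J \<subseteq> {..<n}"
  using that by (intro GrassI) (auto simp: gmono_def)

lemma gmult_Grass:
  assumes "f \<in> Grass n" "g \<in> Grass n"
  shows "gmult f g \<in> Grass n"
proof (rule GrassI)
  fix K :: "nat set" assume K: "\<not> K \<subseteq> {..<n}"
  show "gmult f g K = 0"
    unfolding gmult_sgnp
  proof (rule sum.neutral, rule ballI)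
    fix I assume "I \<in> Pow K"
    then have "\<not> I \<subseteq> {..<n} \<or> \<not> K - I \<subseteq> {..<n}" using K by blast
    then show "sgnp I (K - I) * f I * g (K - I) = 0"
      using Grass_zero[OF assms(1), of I] Grass_zero[OF assms(2), of "K - I"] by (elim disjE) simp_all
  qed
qed

lemma gpartial_Grass: "f \<in> Grass n \<Longrightarrow> gpartial i f \<in> Grass n"
  by (rule GrassI) (auto simp: gpartial_def Grass_zero)

lemma gmult_gmono_left:
  assumes "finite K"
  shows "gmult (gmono A) h K = (if A \<subseteq> K then sgnp A (K - A) * h (K - A) else 0)"
proof (cases "A \<subseteq> K")
  case True
  have "gmult (gmono A) h K = (\<Sum>I\<in>{A}. sgnp I (K - I) * gmono A I * h (K - I))"
    unfolding gmult_sgnp by (rule sum.mono_neutral_right) (use True assms in \<open>auto simp: gmono_def\<close>)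
  then show ?thesis using True by (simp add: gmono_def)
next
  case False
  then show ?thesis unfolding gmult_sgnp by (auto intro!: sum.neutral simp: gmono_def)
qed

lemma Grass_infinite:
  assumes "f \<in> Grass n" "infinite I"
  shows "f I = 0"
proof (rule Grass_zero[OF assms(1)])
  show "\<not> I \<subseteq> {..<n}" using assms(2) finite_subset[of I "{..<n}"] by blast
qed

lemma gmult_one_left: "f \<in> Grass n \<Longrightarrow> gmult (gmono {}) f = f"
proof
  fix K assume "f \<in> Grass n"
  then show "gmult (gmono {}) f K = f K"
    by (cases "finite K") (simp_all add: gmult_gmono_left gmult_infinite Grass_infinite sgnp_def)
qed

lemma gmult_one_right: "f \<in> Grass n \<Longrightarrow> gmult f (gmono {}) = f"
proof
  fix K assume f: "f \<in> Grass n"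
  show "gmult f (gmono {}) K = f K"
  proof (cases "finite K")
    case True
    have "gmult f (gmono {}) K = (\<Sum>I\<in>{K}. sgnp I (K - I) * f I * gmono {} (K - I))"
      unfolding gmult_sgnp by (rule sum.mono_neutral_right) (use True in \<open>auto simp: gmono_def\<close>)
    then show ?thesis by (simp add: gmono_def sgnp_def)
  qed (simp add: gmult_infinite Grass_infinite[OF f])
qed

lemma gmult_zero [simp]: "gmult (\<lambda>I. 0) f = (\<lambda>I. 0)" "gmult f (\<lambda>I. 0) = (\<lambda>I. 0)"
  by (auto simp: gmult_def)

lemma gmono_insert:
  assumes "finite J" "\<And>j. j \<in> J \<Longrightarrow> i < j"
  shows "gmult (gmono {i}) (gmono J) = (gmono (insert i J) :: 'k::comm_ring_1 grassmann)"
proof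
  fix K :: "nat set"
  have e: "{j \<in> J. j < i} = {}" using assms(2) by (auto dest: less_asym)
  have s: "sgnp {i} J = (1 :: 'k)" unfolding sgnp_single e by simp
  have i: "i \<notin> J" using assms(2) by blast
  show "gmult (gmono {i}) (gmono J) K = (gmono (insert i J) K :: 'k)"
  proof (cases "finite K")
    case True
    have g: "gmult (gmono {i}) (gmono J) K = (if {i} \<subseteq> K then sgnp {i} (K - {i}) * gmono J (K - {i}) else 0 :: 'k)"
      by (rule gmult_gmono_left[OF True])
    show ?thesis
    proof (cases "K = insert i J")
      case True
      then have "K - {i} = J" "{i} \<subseteq> K" using i by auto
      then show ?thesis using True unfolding g by (simp add: s gmono_def)
    next
      case False
      then have "K - {i} \<noteq> J \<or> \<not> {i} \<subseteq> K" by blast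
      then show ?thesis using False unfolding g by (auto simp: gmono_def)
    qed
  next
    case False
    then have "K \<noteq> insert i J" using assms(1) by blast
    then show ?thesis using False by (simp add: gmult_infinite gmono_def)
  qed
qed

lemma Gr_linear: "f \<in> Gr n k \<Longrightarrow> g \<in> Gr n k \<Longrightarrow> (\<lambda>I. a * f I + b * g I) \<in> Gr n k"
  unfolding Gr_def using Grass_linear[of f n g a b] by force

lemma Gr_mono: "f \<in> Gr n k \<Longrightarrow> l \<le> k \<Longrightarrow> f \<in> Gr n l"
  by (force simp: Gr_def)

lemma Gr_zero [simp]: "(\<lambda>I. 0) \<in> Gr n k"
  by (simp add: Gr_def)

lemma Gr_gmult:
  assumes f: "f \<in> Gr n a" and g: "g \<in> Gr n b"
  shows "gmult f g \<in> Gr n (a + b)"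
proof -
  have "a + b \<le> card K" if K: "gmult f g K \<noteq> 0" for K
  proof -
    have fin: "finite K" using K gmult_infinite by blast
    obtain I where I: "I \<subseteq> K" "sgnp I (K - I) * f I * g (K - I) \<noteq> 0"
      using K unfolding gmult_sgnp by (meson PowD sum.not_neutral_contains_not_neutral)
    then have "f I \<noteq> 0" "g (K - I) \<noteq> 0" by auto
    then have "a \<le> card I" "b \<le> card (K - I)" using f g by (auto simp: Gr_def)
    moreover have "card K = card I + card (K - I)"
      using I(1) fin by (metis card_Diff_subset card_mono finite_subset le_add_diff_inverse)
    ultimately show ?thesis by simp
  qed
  then show ?thesis using gmult_Grass f g by (auto simp: Gr_def)
qed

lemma Gr_eq_zero:
  assumes "f \<in> Gr n k" "n < k"
  shows "f = (\<lambda>I. 0)"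
proof
  fix I
  show "f I = 0"
  proof (rule ccontr)
    assume nz: "f I \<noteq> 0"
    then have "I \<subseteq> {..<n}" "k \<le> card I" using assms(1) by (auto simp: Gr_def Grass_def)
    then show False using assms(2) card_mono[of "{..<n}" I] by simp
  qed
qed

lemma glinear_linear: "D \<in> glinear n \<Longrightarrow> f \<in> Grass n \<Longrightarrow> h \<in> Grass n \<Longrightarrow>
    D (\<lambda>I. a * f I + b * h I) = (\<lambda>I. a * D f I + b * D h I)"
  by (simp add: glinear_def)

lemma glinear_Grass: "D \<in> glinear n \<Longrightarrow> f \<in> Grass n \<Longrightarrow> D f \<in> Grass n"
  unfolding glinear_def by (auto simp: PiE_iff)

lemma glinear_zero: "D \<in> glinear n \<Longrightarrow> D (\<lambda>I. 0) = (\<lambda>I. 0)"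
  using glinear_linear[of D n "\<lambda>I. 0" "\<lambda>I. 0" 0 0] by simp

text \<open>\<open>f\<close> is assembled from its finitely many monomials. The generating case is
  restricted to monomials that occur in \<open>f\<close>, because a degree bound on \<open>f\<close>
  says nothing about the others.\<close>

lemma glinear_gmono_induct:
  assumes D: "D \<in> glinear n" and f: "f \<in> Grass n"
    and P0: "P (\<lambda>I. 0)" and P: "\<And>u v a b. P u \<Longrightarrow> P v \<Longrightarrow> P (\<lambda>I. a * u I + b * v I)"
    and gen: "\<And>J. J \<subseteq> {..<n} \<Longrightarrow> f J \<noteq> 0 \<Longrightarrow> P (D (gmono J))"
  shows "P (D f)"
proof -
  have "P (D (\<lambda>I. if I \<in> F then f I else 0))" if "finite F" "F \<subseteq> Pow {..<n}" for F
    using that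
  proof (induction F rule: finite_induct)
    case empty
    then show ?case using P0 glinear_zero[OF D] by simp
  next
    case (insert J F)
    let ?g = "\<lambda>I. if I \<in> F then f I else 0"
    have g: "?g \<in> Grass n" by (rule GrassI) (simp add: Grass_zero[OF f])
    have J: "gmono J \<in> Grass n" using insert.prems by (intro gmono_Grass) auto
    have eq: "(\<lambda>I. if I \<in> insert J F then f I else 0) = (\<lambda>I. 1 * ?g I + f J * gmono J I)"
      using insert.hyps(2) by (auto simp: gmono_def)
    have IH: "P (D ?g)" using insert by auto
    show ?case
    proof (cases "f J = 0")
      case True
      then have "(\<lambda>I. if I \<in> insert J F then f I else 0) = ?g" by auto
      then show ?thesis using IH by simp
    next
      case False
      then have "P (D (gmono J))" using gen insert.prems by blast
      then show ?thesis unfolding eq glinear_linear[OF D g J] by (rule P[OF IH])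
    qed
  qed
  from this[of "Pow {..<n}"] have "P (D (\<lambda>I. if I \<in> Pow {..<n} then f I else 0))" by simp
  moreover have "(\<lambda>I. if I \<in> Pow {..<n} then f I else 0) = f" using Grass_zero[OF f] by auto
  ultimately show ?thesis by simp
qed

text \<open>The sign \<open>c\<close> is \<open>1\<close> for even and \<open>-1\<close> for odd derivations.\<close>

definition leibniz :: "nat \<Rightarrow> 'k::comm_ring_1 gop \<Rightarrow> bool" where
  "leibniz n D \<longleftrightarrow> D \<in> glinear n \<and> D (gmono {}) = (\<lambda>I. 0) \<and>
    (\<exists>c. \<forall>i<n. \<forall>h\<in>Grass n. D (gmult (gmono {i}) h) = (\<lambda>I. gmult (D (gmono {i})) h I + c * gmult (gmono {i}) (D h) I))"

lemma leibniz_glinear: "leibniz n D \<Longrightarrow> D \<in> glinear n"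
  unfolding leibniz_def by blast

lemma leibniz_one: "leibniz n D \<Longrightarrow> D (gmono {}) = (\<lambda>I. 0)"
  unfolding leibniz_def by blast

lemma gpart_gmono: "gpart b (gmono J) = gmono J" if "even (card J) = b"
  using that by (auto simp: gpart_def gmono_def)

lemma gmono_gparity: "J \<subseteq> {..<n} \<Longrightarrow> even (card J) = b \<Longrightarrow> gmono J \<in> gparity n b"
  by (simp add: gparity_def gpart_gmono)

lemma gparity_Grass: "f \<in> gparity n b \<Longrightarrow> f \<in> Grass n"
  by (simp add: gparity_def)

lemma one_derivation:
  assumes "D \<in> glinear n" "D (gmult (gmono {}) (gmono {})) = (\<lambda>I. gmult (D (gmono {})) (gmono {}) I + gmult (gmono {}) (D (gmono {})) I)"
  shows "D (gmono {}) = (\<lambda>I. 0)"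
proof
  fix I
  have G: "D (gmono {}) \<in> Grass n" using glinear_Grass[OF assms(1)] by simp
  have one: "gmult (gmono {}) (gmono {}) = (gmono {} :: 'a grassmann)" by (rule gmult_one_left[of _ n]) simp
  have "D (gmono {}) = (\<lambda>I. D (gmono {}) I + D (gmono {}) I)"
    using assms(2) unfolding one gmult_one_left[OF G] gmult_one_right[OF G] .
  then have "D (gmono {}) I = D (gmono {}) I + D (gmono {}) I" by (rule fun_cong)
  then show "D (gmono {}) I = 0" by simp
qed

lemma der_evenD:
  assumes "D \<in> der_even n"
  shows "D \<in> glinear n" "f \<in> gparity n b \<Longrightarrow> D f \<in> gparity n b"
    "f \<in> Grass n \<Longrightarrow> h \<in> Grass n \<Longrightarrow> D (gmult f h) = (\<lambda>I. gmult (D f) h I + gmult f (D h) I)"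
proof -
  note D = assms[unfolded der_even_def, simplified mem_Collect_eq]
  show "D \<in> glinear n" by (rule conjunct1[OF D])
  show "D f \<in> gparity n b" if "f \<in> gparity n b"
    using conjunct1[OF conjunct2[OF D], rule_format, of b] that by (rule subsetD[OF _ imageI])
  show "D (gmult f h) = (\<lambda>I. gmult (D f) h I + gmult f (D h) I)" if "f \<in> Grass n" "h \<in> Grass n"
    by (rule conjunct2[OF conjunct2[OF D], rule_format, OF that])
qed

lemma der_oddD:
  assumes "D \<in> der_odd n"
  shows "D \<in> glinear n" "f \<in> gparity n b \<Longrightarrow> D f \<in> gparity n (\<not> b)"
    "f \<in> gparity n True \<Longrightarrow> h \<in> Grass n \<Longrightarrow> D (gmult f h) = (\<lambda>I. gmult (D f) h I + gmult f (D h) I)"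
    "f \<in> gparity n False \<Longrightarrow> h \<in> Grass n \<Longrightarrow> D (gmult f h) = (\<lambda>I. gmult (D f) h I - gmult f (D h) I)"
proof -
  note D = assms[unfolded der_odd_def, simplified mem_Collect_eq]
  show "D \<in> glinear n" by (rule conjunct1[OF D])
  show "D f \<in> gparity n (\<not> b)" if "f \<in> gparity n b"
    using conjunct1[OF conjunct2[OF D], rule_format, of b] that by (rule subsetD[OF _ imageI])
  show "D (gmult f h) = (\<lambda>I. gmult (D f) h I + gmult f (D h) I)" if "f \<in> gparity n True" "h \<in> Grass n"
    by (rule conjunct1[OF conjunct2[OF conjunct2[OF D]], rule_format, OF that])
  show "D (gmult f h) = (\<lambda>I. gmult (D f) h I - gmult f (D h) I)" if "f \<in> gparity n False" "h \<in> Grass n"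
    by (rule conjunct2[OF conjunct2[OF conjunct2[OF D]], rule_format, OF that])
qed

lemma leibnizI:
  assumes "D \<in> glinear n" "D (gmono {}) = (\<lambda>I. 0)"
    "\<And>i h. i < n \<Longrightarrow> h \<in> Grass n \<Longrightarrow> D (gmult (gmono {i}) h) = (\<lambda>I. gmult (D (gmono {i})) h I + c * gmult (gmono {i}) (D h) I)"
  shows "leibniz n D"
  unfolding leibniz_def by (intro conjI exI[of _ c] allI impI ballI assms)

lemma der_even_leibniz: "leibniz n D" if D: "D \<in> der_even n"
proof (rule leibnizI[where c = 1])
  show "D \<in> glinear n" by (rule der_evenD(1)[OF D])
  then show "D (gmono {}) = (\<lambda>I. 0)"
    by (rule one_derivation) (rule der_evenD(3)[OF D]; simp)
  show "D (gmult (gmono {i}) h) = (\<lambda>I. gmult (D (gmono {i})) h I + 1 * gmult (gmono {i}) (D h) I)"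
    if "i < n" "h \<in> Grass n" for i h
    unfolding mult_1 by (rule der_evenD(3)[OF D]) (use that in simp_all)
qed

lemma der_odd_leibniz: "leibniz n D" if D: "D \<in> der_odd n"
proof (rule leibnizI[where c = "-1"])
  have 1: "gmono {} \<in> gparity n True" by (rule gmono_gparity) simp_all
  show "D \<in> glinear n" by (rule der_oddD(1)[OF D])
  then show "D (gmono {}) = (\<lambda>I. 0)"
    by (rule one_derivation) (rule der_oddD(3)[OF D 1 gparity_Grass[OF 1]])
  show "D (gmult (gmono {i}) h) = (\<lambda>I. gmult (D (gmono {i})) h I + -1 * gmult (gmono {i}) (D h) I)"
    if i: "i < n" and h: "h \<in> Grass n" for i h
  proof -
    have "gmono {i} \<in> gparity n False" by (rule gmono_gparity) (use i in simp_all)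
    from der_oddD(4)[OF D this h] show ?thesis by (simp only: mult_minus1 diff_conv_add_uminus)
  qed
qed

text \<open>\<open>d\<close> is the amount by which \<open>D\<close> may lower the degree,
  \<open>0\<close> for even and \<open>1\<close> for odd derivations; the subtractions are
  truncated. The induction splits off the smallest generator, so that no signs appear.\<close>

lemma leibniz_gmono_filtered:
  assumes L: "leibniz n D" and gen: "\<And>i. i < n \<Longrightarrow> D (gmono {i}) \<in> Gr n (1 - d)"
    and J: "J \<subseteq> {..<n}"
  shows "D (gmono J) \<in> Gr n (card J - d)"
proof -
  have "finite J" using J finite_subset by blast
  then show ?thesis using J
  proof (induction J rule: finite_linorder_min_induct)
    case empty
    then show ?case using leibniz_one[OF L] by simp
  next
    case (insert i J)
    obtain c where c: "D (gmult (gmono {i}) h) = (\<lambda>I. gmult (D (gmono {i})) h I + c * gmult (gmono {i}) (D h) I)"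
      if "h \<in> Grass n" for h using L insert.prems unfolding leibniz_def by blast
    have iJ: "i \<notin> J" "i < n" "J \<subseteq> {..<n}" using insert by auto
    have e: "gmono (insert i J) = gmult (gmono {i}) (gmono J)"
      by (rule gmono_insert[symmetric]) (use insert.hyps in auto)
    have card: "card (insert i J) = Suc (card J)" using insert.hyps iJ by simp
    have "gmono J \<in> Gr n (card J)" using iJ by (auto simp: Gr_def) (auto simp: gmono_def)
    from Gr_gmult[OF gen[OF iJ(2)] this]
    have 1: "gmult (D (gmono {i})) (gmono J) \<in> Gr n (card (insert i J) - d)"
      by (rule Gr_mono) (simp add: card)
    have "gmono {i} \<in> Gr n 1" using iJ by (auto simp: Gr_def) (auto simp: gmono_def)
    from Gr_gmult[OF this insert.IH[OF iJ(3)]]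
    have 2: "gmult (gmono {i}) (D (gmono J)) \<in> Gr n (card (insert i J) - d)"
      by (rule Gr_mono) (simp add: card)
    show ?case unfolding e c[OF gmono_Grass[OF iJ(3)]] using Gr_linear[OF 1 2, of 1 c] by simp
  qed
qed

lemma leibniz_filtered:
  assumes L: "leibniz n D" and gen: "\<And>i. i < n \<Longrightarrow> D (gmono {i}) \<in> Gr n (1 - d)" and f: "f \<in> Gr n k"
  shows "D f \<in> Gr n (k - d)"
proof -
  have fG: "f \<in> Grass n" using f unfolding Gr_def by blast
  have mono: "D (gmono J) \<in> Gr n (k - d)" if J: "J \<subseteq> {..<n}" "f J \<noteq> 0" for J
  proof -
    have "k \<le> card J" using f J(2) unfolding Gr_def by blast
    then have "k - d \<le> card J - d" by simp
    with leibniz_gmono_filtered[OF L gen J(1)] show ?thesis by (rule Gr_mono)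
  qed
  show ?thesis
    using glinear_gmono_induct[of D n f "\<lambda>u. u \<in> Gr n (k - d)", OF leibniz_glinear[OF L] fG Gr_zero Gr_linear mono] .
qed

text \<open>Splitting off the smallest generator of a monomial reduces the value of \<open>D\<close>
  to its values on generators.\<close>

lemma leibniz_eq_zero:
  assumes L: "leibniz n D" and gen: "\<And>i. i < n \<Longrightarrow> D (gmono {i}) = (\<lambda>I. 0)" and f: "f \<in> Grass n"
  shows "D f = (\<lambda>I. 0)"
proof -
  have mono: "D (gmono J) = (\<lambda>I. 0)" if "J \<subseteq> {..<n}" for J
  proof -
    have "finite J" using that finite_subset by blast
    then show ?thesis using that
    proof (induction J rule: finite_linorder_min_induct)
      case empty
      then show ?case using leibniz_one[OF L] by simp
    next
      case (insert i J)
      then have iJ: "i < n" "J \<subseteq> {..<n}" by auto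
      have e: "gmono (insert i J) = gmult (gmono {i}) (gmono J)"
        by (rule gmono_insert[symmetric]) (use insert.hyps in auto)
      obtain c where c: "D (gmult (gmono {i}) h) = (\<lambda>I. gmult (D (gmono {i})) h I + c * gmult (gmono {i}) (D h) I)"
        if "h \<in> Grass n" for h using L iJ unfolding leibniz_def by blast
      show ?case unfolding e c[OF gmono_Grass[OF iJ(2)]] using insert.IH iJ gen by simp
    qed
  qed
  show ?thesis
    using glinear_gmono_induct[of D n f "\<lambda>u. u = (\<lambda>I. 0)", OF leibniz_glinear[OF L] f refl _ mono] by simp
qed

section \<open>Homogeneous derivations and their brackets\<close>

definition gzero :: "nat \<Rightarrow> 'k::comm_ring_1 gop" where
  "gzero n = (\<lambda>f\<in>Grass n. \<lambda>I. 0)"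

lemma gop_eqI:
  assumes "D \<in> glinear n" "E \<in> glinear n" "\<And>f. f \<in> Grass n \<Longrightarrow> D f = E f"
  shows "D = E"
proof
  fix f
  show "D f = E f"
  proof (cases "f \<in> Grass n")
    case False
    then show ?thesis using assms(1,2) by (auto simp: glinear_def PiE_iff extensional_def)
  qed (rule assms(3))
qed

lemma gzero_glinear: "gzero n \<in> glinear n"
  by (auto simp: glinear_def gzero_def Grass_linear)

lemma gparity_zero [simp]: "(\<lambda>I. 0) \<in> gparity n b"
  by (simp add: gparity_def gpart_def)

lemma gzero_der: "gzero n \<in> der_even n" "gzero n \<in> der_odd n"
  using gzero_glinear[of n]
  by (auto simp: der_even_def der_odd_def gzero_def gmult_Grass gparity_Grass)

lemma gpart_Grass: "f \<in> Grass n \<Longrightarrow> gpart b f \<in> Grass n"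
  by (rule GrassI) (simp add: gpart_def Grass_zero)

lemma gpart_gparity: "f \<in> Grass n \<Longrightarrow> gpart b f \<in> gparity n b"
  by (simp add: gparity_def gpart_Grass) (auto simp: gpart_def)

lemma gpart_sum: "(\<lambda>I. 1 * gpart True f I + 1 * gpart False f I) = (f :: 'k::comm_ring_1 grassmann)"
  by (rule ext) (simp add: gpart_def)

lemma gpart_other: "f \<in> gparity n b \<Longrightarrow> gpart (\<not> b) f = (\<lambda>I. 0)"
proof
  fix I assume "f \<in> gparity n b"
  then have "f I = gpart b f I" by (simp add: gparity_def)
  then show "gpart (\<not> b) f I = 0" by (simp add: gpart_def split: if_splits)
qed

text \<open>Together with its odd counterpart this collapses the eight products in
  \<open>supercommutator\<close> to a plain commutator or anticommutator for homogeneous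
  operators.\<close>

lemma gop_even_der_even:
  assumes D: "D \<in> der_even n"
  shows "gop_even n D = D" "gop_odd n D = gzero n"
proof -
  have L: "D \<in> glinear n" and par: "\<And>f b. f \<in> gparity n b \<Longrightarrow> D f \<in> gparity n b"
    using der_evenD[OF D] by blast+
  have p: "D (gpart b f) \<in> gparity n b" if "f \<in> Grass n" for f b using par gpart_gparity that by blast
  have s: "D f I = D (gpart True f) I + D (gpart False f) I" if "f \<in> Grass n" for f I
    using glinear_linear[OF L gpart_Grass gpart_Grass, of f f 1 True 1 False] that gpart_sum[of f] by simp
  have g: "gpart b (D (gpart b f)) = D (gpart b f)" if "f \<in> Grass n" for f b
    using p[OF that] by (simp add: gparity_def)
  show "gop_even n D = D"
  proof
    fix f show "gop_even n D f = D f"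
    proof (cases "f \<in> Grass n")
      case True
      then show ?thesis by (auto simp: gop_even_def g s[of f])
    next
      case False
      then show ?thesis using L by (auto simp: gop_even_def glinear_def PiE_iff extensional_def)
    qed
  qed
  have "gpart False (D (gpart True f)) = (\<lambda>I. 0)" "gpart True (D (gpart False f)) = (\<lambda>I. 0)" if "f \<in> Grass n" for f
    using gpart_other[OF p[OF that, of True]] gpart_other[OF p[OF that, of False]] by simp_all
  then show "gop_odd n D = gzero n" by (auto simp: gop_odd_def gzero_def fun_eq_iff restrict_def)
qed

lemma gop_even_der_odd:
  assumes D: "D \<in> der_odd n"
  shows "gop_odd n D = D" "gop_even n D = gzero n"
proof -
  have L: "D \<in> glinear n" and par: "\<And>f b. f \<in> gparity n b \<Longrightarrow> D f \<in> gparity n (\<not> b)"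
    using der_oddD[OF D] by blast+
  have p: "D (gpart b f) \<in> gparity n (\<not> b)" if "f \<in> Grass n" for f b using par gpart_gparity that by blast
  have s: "D f I = D (gpart True f) I + D (gpart False f) I" if "f \<in> Grass n" for f I
    using glinear_linear[OF L gpart_Grass gpart_Grass, of f f 1 True 1 False] that gpart_sum[of f] by simp
  have g: "gpart False (D (gpart True f)) = D (gpart True f)" "gpart True (D (gpart False f)) = D (gpart False f)" if "f \<in> Grass n" for f
    using p[OF that, of True] p[OF that, of False] by (simp_all add: gparity_def)
  show "gop_odd n D = D"
  proof
    fix f show "gop_odd n D f = D f"
    proof (cases "f \<in> Grass n")
      case True
      then show ?thesis by (auto simp: gop_odd_def g s[of f])
    next
      case False
      then show ?thesis using L by (auto simp: gop_odd_def glinear_def PiE_iff extensional_def)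
    qed
  qed
  have "gpart True (D (gpart True f)) = (\<lambda>I. 0)" "gpart False (D (gpart False f)) = (\<lambda>I. 0)" if "f \<in> Grass n" for f
    using gpart_other[OF p[OF that, of True]] gpart_other[OF p[OF that, of False]] by simp_all
  then show "gop_even n D = gzero n" by (auto simp: gop_even_def gzero_def fun_eq_iff restrict_def)
qed

lemma br_der_even_left:
  assumes D: "D \<in> der_even n" and E: "E \<in> der_even n \<union> der_odd n"
  shows "sa_br (der_grass n) D E = (\<lambda>f\<in>Grass n. \<lambda>I. D (E f) I - E (D f) I)"
proof -
  have L: "D \<in> glinear n" "E \<in> glinear n" using der_evenD(1)[OF D] der_evenD(1) der_oddD(1) E by blast+
  have b: "sa_br (der_grass n) D E = supercommutator (\<lambda>D E. \<lambda>f\<in>Grass n. D (E f)) (gop_add n) (gop_diff n) (gop_even n) (gop_odd n) D E"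
    by (simp add: der_grass_def)
  have m: "D f \<in> Grass n" "E f \<in> Grass n" if "f \<in> Grass n" for f using glinear_Grass L that by blast+
  have z: "D (\<lambda>I. 0) = (\<lambda>I. 0)" "E (\<lambda>I. 0) = (\<lambda>I. 0)" using glinear_zero L by blast+
  show ?thesis
  proof (cases "E \<in> der_even n")
    case True
    show ?thesis
      unfolding b supercommutator_def gop_even_der_even[OF D] gop_even_der_even[OF True]
      by (auto simp: gop_add_def gop_diff_def gzero_def fun_eq_iff m z)
  next
    case False
    then have E': "E \<in> der_odd n" using E by blast
    show ?thesis
      unfolding b supercommutator_def gop_even_der_even[OF D] gop_even_der_odd[OF E']
      by (auto simp: gop_add_def gop_diff_def gzero_def fun_eq_iff m z)
  qed
qed

lemma br_der_odd_odd:
  assumes D: "D \<in> der_odd n"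
  shows "sa_br (der_grass n) D D = (\<lambda>f\<in>Grass n. \<lambda>I. D (D f) I + D (D f) I)"
proof -
  have L: "D \<in> glinear n" by (rule der_oddD(1)[OF D])
  have b: "sa_br (der_grass n) D D = supercommutator (\<lambda>D E. \<lambda>f\<in>Grass n. D (E f)) (gop_add n) (gop_diff n) (gop_even n) (gop_odd n) D D"
    by (simp add: der_grass_def)
  have m: "D f \<in> Grass n" if "f \<in> Grass n" for f using glinear_Grass L that by blast
  show ?thesis
    unfolding b supercommutator_def gop_even_der_odd[OF D]
    by (auto simp: gop_add_def gop_diff_def gzero_def fun_eq_iff m glinear_zero[OF L])
qed

lemma glinear_undefined: "D \<in> glinear n \<Longrightarrow> f \<notin> Grass n \<Longrightarrow> D f = undefined"
  by (auto simp: glinear_def PiE_iff extensional_def)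

lemma gparity_iff: "f \<in> gparity n b \<longleftrightarrow> f \<in> Grass n \<and> (\<forall>I. f I \<noteq> 0 \<longrightarrow> even (card I) = b)"
  by (auto simp: gparity_def gpart_def fun_eq_iff)

lemma gparity_linear:
  fixes f g :: "'k::comm_ring_1 grassmann"
  assumes "f \<in> gparity n b" "g \<in> gparity n b"
  shows "(\<lambda>I. x * f I + y * g I) \<in> gparity n b"
proof -
  have "x * f I + y * g I = 0" if "even (card I) \<noteq> b" for I
  proof -
    have "f I = 0" "g I = 0" using assms that unfolding gparity_iff by blast+
    then show ?thesis by simp
  qed
  moreover have "(\<lambda>I. x * f I + y * g I) \<in> Grass n"
    using assms by (intro Grass_linear) (simp_all add: gparity_Grass)
  ultimately show ?thesis unfolding gparity_iff by blast
qed

lemma gparity_scale: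
  fixes f :: "'k::comm_ring_1 grassmann"
  shows "f \<in> gparity n b \<Longrightarrow> (\<lambda>I. x * f I) \<in> gparity n b"
  using gparity_linear[of f n b f x 0] by simp

lemma gparity_sum:
  fixes u :: "nat \<Rightarrow> 'k::comm_ring_1 grassmann"
  assumes "finite S" "\<And>i. i \<in> S \<Longrightarrow> u i \<in> gparity n b"
  shows "(\<lambda>I. \<Sum>i\<in>S. u i I) \<in> gparity n b"
  using assms
proof (induction S rule: finite_induct)
  case (insert i S)
  have "(\<lambda>I. 1 * u i I + 1 * (\<Sum>i\<in>S. u i I)) \<in> gparity n b"
    by (rule gparity_linear) (use insert in auto)
  then show ?case using insert.hyps by simp
qed simp

lemma gmult_gparity:
  assumes f: "f \<in> gparity n b" and g: "g \<in> gparity n c"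
  shows "gmult f g \<in> gparity n (b = c)"
proof -
  have "even (card K) = (b = c)" if K: "gmult f g K \<noteq> 0" for K
  proof -
    have fin: "finite K" using K gmult_infinite by blast
    obtain I where I: "I \<subseteq> K" "sgnp I (K - I) * f I * g (K - I) \<noteq> 0"
      using K unfolding gmult_sgnp by (meson PowD sum.not_neutral_contains_not_neutral)
    then have "f I \<noteq> 0" "g (K - I) \<noteq> 0" by auto
    then have "even (card I) = b" "even (card (K - I)) = c" using f g unfolding gparity_iff by blast+
    moreover have "card K = card I + card (K - I)"
      using I(1) fin by (metis card_Diff_subset card_mono finite_subset le_add_diff_inverse)
    ultimately show ?thesis by auto
  qed
  moreover have "gmult f g \<in> Grass n" by (rule gmult_Grass[OF gparity_Grass[OF f] gparity_Grass[OF g]])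
  ultimately show ?thesis unfolding gparity_iff by blast
qed

lemma gpartial_nonzeroD:
  assumes "f \<in> Grass n" "gpartial i f I \<noteq> 0"
  shows "i \<notin> I" "f (insert i I) \<noteq> 0" "finite I"
proof -
  show 1: "i \<notin> I" "f (insert i I) \<noteq> 0" using assms(2) by (auto simp: gpartial_def split: if_splits)
  show "finite I" using Grass_infinite[OF assms(1), of "insert i I"] 1(2) by auto
qed

lemma gpartial_gparity:
  assumes f: "f \<in> gparity n b"
  shows "gpartial i f \<in> gparity n (\<not> b)"
proof -
  have "even (card I) = (\<not> b)" if I: "gpartial i f I \<noteq> 0" for I
  proof -
    note * = gpartial_nonzeroD[OF gparity_Grass[OF f] I]
    then have "even (card (insert i I)) = b" using f unfolding gparity_iff by blast
    then show ?thesis using * by auto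
  qed
  then show ?thesis unfolding gparity_iff using gpartial_Grass[OF gparity_Grass[OF f]] by blast
qed

lemma gpartial_Gr:
  assumes f: "f \<in> Gr n k"
  shows "gpartial i f \<in> Gr n (k - 1)"
proof -
  have fG: "f \<in> Grass n" using f unfolding Gr_def by blast
  have "k - 1 \<le> card I" if I: "gpartial i f I \<noteq> 0" for I
  proof -
    note * = gpartial_nonzeroD[OF fG I]
    then have "k \<le> card (insert i I)" using f unfolding Gr_def by blast
    then show ?thesis using * by simp
  qed
  then show ?thesis unfolding Gr_def using gpartial_Grass[OF fG] by blast
qed

lemma gpartial_linear: "gpartial i (\<lambda>I. a * f I + b * g I) = (\<lambda>I. a * gpartial i f I + b * gpartial i g I)"
  by (rule ext) (simp add: gpartial_def algebra_simps)

lemma gpartial_gmono: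
  "gpartial i (gmono J) = (if i \<in> J then (\<lambda>I. sgnp {i} (J - {i}) * gmono (J - {i}) I) else (\<lambda>I. 0))"
proof
  fix I
  have "insert i I = J \<and> i \<notin> I \<longleftrightarrow> i \<in> J \<and> I = J - {i}" by auto
  then show "gpartial i (gmono J) I = (if i \<in> J then (\<lambda>I. sgnp {i} (J - {i}) * gmono (J - {i}) I) else (\<lambda>I. 0)) I"
    by (cases "i \<in> J \<and> I = J - {i}") (auto simp: gpartial_sgnp gmono_def)
qed

lemma gmult_sum_left: "gmult (\<lambda>I. \<Sum>i\<in>S. u i I) h = (\<lambda>I. \<Sum>i\<in>S. gmult (u i) h I)"
  by (rule ext) (simp add: gmult_def sum_distrib_left sum_distrib_right sum.swap[of _ S])

lemma gmult_sum_right: "gmult h (\<lambda>I. \<Sum>i\<in>S. u i I) = (\<lambda>I. \<Sum>i\<in>S. gmult h (u i) I)"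
  by (rule ext) (simp add: gmult_def sum_distrib_left sum_distrib_right sum.swap[of _ S])

lemma gmult_scale_left: "gmult (\<lambda>I. a * f I) h = (\<lambda>I. a * gmult f h I)"
  using gmult_add_left[of a f 0 f h] by simp

lemma gmult_scale_right: "gmult h (\<lambda>I. a * f I) = (\<lambda>I. a * gmult h f I)"
  using gmult_add_right[of h a f 0 f] by simp

section \<open>Vector fields as derivations\<close>

lemma vector_field_apply: "h \<in> Grass n \<Longrightarrow> vector_field n F h = (\<lambda>I. \<Sum>i<n. gmult (F i) (gpartial i h) I)"
  by (simp add: vector_field_def)

lemma vector_field_glinear:
  assumes F: "\<And>i. i < n \<Longrightarrow> F i \<in> Grass n"
  shows "vector_field n F \<in> glinear n"
  unfolding glinear_def mem_Collect_eq
proof (intro conjI ballI allI)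
  have "(\<lambda>I. \<Sum>i<n. gmult (F i) (gpartial i f) I) \<in> Grass n" if "f \<in> Grass n" for f
  proof (rule GrassI)
    fix I :: "nat set" assume "\<not> I \<subseteq> {..<n}"
    then show "(\<Sum>i<n. gmult (F i) (gpartial i f) I) = 0"
      using Grass_zero[OF gmult_Grass[OF F gpartial_Grass[OF that]]] by simp
  qed
  then show "vector_field n F \<in> Grass n \<rightarrow>\<^sub>E Grass n" by (simp add: vector_field_def)
  fix f h :: "'a grassmann" and a b assume "f \<in> Grass n" "h \<in> Grass n"
  then show "vector_field n F (\<lambda>I. a * f I + b * h I) = (\<lambda>I. a * vector_field n F f I + b * vector_field n F h I)"
    by (simp add: vector_field_apply Grass_linear gpartial_linear gmult_add_right sum.distrib sum_distrib_left)
qed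

text \<open>Two signs combine: moving \<open>gpartial i\<close> past \<open>f\<close> gives
  \<open>gflip f\<close>, and moving \<open>F i\<close> past it gives the supercommutation sign. In
  total there is a minus sign when the field and \<open>f\<close> are both odd; even coefficients
  (\<open>c\<close> true) belong to an odd field since \<open>gpartial i\<close> is odd.\<close>

lemma vector_field_leibniz:
  fixes F :: "nat \<Rightarrow> 'k::comm_ring_1 grassmann"
  assumes F: "\<And>i. i < n \<Longrightarrow> F i \<in> gparity n c" and f: "f \<in> gparity n b" and h: "h \<in> Grass n"
  defines "s \<equiv> (if c \<and> \<not> b then -1 else 1)"
  shows "vector_field n F (gmult f h) = (\<lambda>I. gmult (vector_field n F f) h I + s * gmult f (vector_field n F h) I)"
proof
  fix I
  have fG: "f \<in> Grass n" by (rule gparity_Grass[OF f])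
  have "f K = 0" if "even (card K) \<noteq> b" for K using f that unfolding gparity_iff by blast
  then have "gflip f K = (if b then 1 else -1) * f K" for K
    by (cases "even (card K) = b") (auto simp: gflip_def)
  then have flip: "gflip f = (\<lambda>K. (if b then 1 else -1) * f K)" by (rule ext)
  have swap: "gmult (F i) (gflip f) = (\<lambda>K. s * gmult f (F i) K)" if "i < n" for i
  proof -
    have "gmult (F i) f = (\<lambda>K. (if c \<or> b then 1 else -1) * gmult f (F i) K)"
      by (rule gmult_supercommute) (use F[OF that] f in \<open>simp_all add: gparity_def\<close>)
    then show ?thesis unfolding flip gmult_scale_right by (auto simp: s_def)
  qed
  have summand: "gmult (F i) (gpartial i (gmult f h)) I =
      gmult (gmult (F i) (gpartial i f)) h I + s * gmult f (gmult (F i) (gpartial i h)) I" if "i < n" for i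
  proof -
    have "gmult (F i) (gpartial i (gmult f h)) = gmult (F i) (\<lambda>K. 1 * gmult (gpartial i f) h K + 1 * gmult (gflip f) (gpartial i h) K)"
      by (simp add: gpartial_gmult)
    also have "\<dots> = (\<lambda>K. 1 * gmult (F i) (gmult (gpartial i f) h) K + 1 * gmult (F i) (gmult (gflip f) (gpartial i h)) K)"
      by (rule gmult_add_right)
    also have "gmult (F i) (gmult (gpartial i f) h) = gmult (gmult (F i) (gpartial i f)) h" by (rule gmult_assoc[symmetric])
    also have "gmult (F i) (gmult (gflip f) (gpartial i h)) = gmult (gmult (F i) (gflip f)) (gpartial i h)" by (rule gmult_assoc[symmetric])
    also have "\<dots> = (\<lambda>K. s * gmult f (gmult (F i) (gpartial i h)) K)"
      unfolding swap[OF that] gmult_scale_left gmult_assoc ..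
    finally show ?thesis by simp
  qed
  have "vector_field n F (gmult f h) I = (\<Sum>i<n. gmult (F i) (gpartial i (gmult f h)) I)"
    by (simp add: vector_field_apply gmult_Grass[OF fG h])
  also have "\<dots> = (\<Sum>i<n. gmult (gmult (F i) (gpartial i f)) h I + s * gmult f (gmult (F i) (gpartial i h)) I)"
    by (rule sum.cong) (auto simp: summand)
  also have "\<dots> = gmult (vector_field n F f) h I + s * gmult f (vector_field n F h) I"
    by (simp add: vector_field_apply fG h gmult_sum_left gmult_sum_right sum.distrib sum_distrib_left)
  finally show "vector_field n F (gmult f h) I = gmult (vector_field n F f) h I + s * gmult f (vector_field n F h) I" .
qed

lemma vector_field_gparity:
  assumes F: "\<And>i. i < n \<Longrightarrow> F i \<in> gparity n c" and f: "f \<in> gparity n b"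
  shows "vector_field n F f \<in> gparity n (c = (\<not> b))"
proof -
  have "(\<lambda>I. \<Sum>i<n. gmult (F i) (gpartial i f) I) \<in> gparity n (c = (\<not> b))"
    by (rule gparity_sum) (use gmult_gparity[OF F gpartial_gparity[OF f]] in auto)
  then show ?thesis by (simp add: vector_field_apply gparity_Grass[OF f])
qed

lemma vector_field_der_odd:
  assumes F: "\<And>i. i < n \<Longrightarrow> F i \<in> gparity n True"
  shows "vector_field n F \<in> der_odd n"
  unfolding der_odd_def mem_Collect_eq
proof (intro conjI allI ballI image_subsetI)
  show "vector_field n F \<in> glinear n" by (rule vector_field_glinear) (rule gparity_Grass[OF F])
  show "vector_field n F f \<in> gparity n (\<not> b)" if "f \<in> gparity n b" for b f
    using vector_field_gparity[OF F that] by simp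
  show "vector_field n F (gmult f h) = (\<lambda>I. gmult (vector_field n F f) h I + gmult f (vector_field n F h) I)"
    if "f \<in> gparity n True" "h \<in> Grass n" for f h
    using vector_field_leibniz[OF F that] by simp
  show "vector_field n F (gmult f h) = (\<lambda>I. gmult (vector_field n F f) h I - gmult f (vector_field n F h) I)"
    if "f \<in> gparity n False" "h \<in> Grass n" for f h
    using vector_field_leibniz[OF F that] by simp
qed

lemma vector_field_der_even:
  assumes F: "\<And>i. i < n \<Longrightarrow> F i \<in> gparity n False"
  shows "vector_field n F \<in> der_even n"
  unfolding der_even_def mem_Collect_eq
proof (intro conjI allI ballI image_subsetI)
  let ?D = "vector_field n F"
  show L: "?D \<in> glinear n" by (rule vector_field_glinear) (rule gparity_Grass[OF F])
  show "?D f \<in> gparity n b" if "f \<in> gparity n b" for b f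
    using vector_field_gparity[OF F that] by simp
  fix f h :: "'a grassmann" assume f: "f \<in> Grass n" and h: "h \<in> Grass n"
  \<comment> \<open>The even Leibniz rule is demanded for inhomogeneous \<open>f\<close>, while the
    rule for vector fields treats homogeneous \<open>f\<close>; hence the splitting.\<close>
  let ?u = "gpart True f" and ?v = "gpart False f"
  have uv: "?u \<in> gparity n True" "?v \<in> gparity n False" using gpart_gparity[OF f] by blast+
  have uvG: "?u \<in> Grass n" "?v \<in> Grass n" using gpart_Grass[OF f] by blast+
  have l: "?D (gmult ?u h) = (\<lambda>I. gmult (?D ?u) h I + gmult ?u (?D h) I)"
    "?D (gmult ?v h) = (\<lambda>I. gmult (?D ?v) h I + gmult ?v (?D h) I)"
    using vector_field_leibniz[OF F uv(1) h] vector_field_leibniz[OF F uv(2) h] by simp_all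
  have f': "f = (\<lambda>I. 1 * ?u I + 1 * ?v I)" by (rule gpart_sum[symmetric])
  have "?D (gmult (\<lambda>I. 1 * ?u I + 1 * ?v I) h) = ?D (\<lambda>I. 1 * gmult ?u h I + 1 * gmult ?v h I)"
    by (simp only: gmult_add_left)
  also have "\<dots> = (\<lambda>I. 1 * ?D (gmult ?u h) I + 1 * ?D (gmult ?v h) I)"
    by (rule glinear_linear[OF L gmult_Grass[OF uvG(1) h] gmult_Grass[OF uvG(2) h]])
  also have "\<dots> = (\<lambda>I. gmult (\<lambda>I. 1 * ?D ?u I + 1 * ?D ?v I) h I + gmult (\<lambda>I. 1 * ?u I + 1 * ?v I) (?D h) I)"
    by (simp only: l gmult_add_left) (simp add: algebra_simps)
  also have "(\<lambda>I. 1 * ?D ?u I + 1 * ?D ?v I) = ?D (\<lambda>I. 1 * ?u I + 1 * ?v I)"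
    by (rule glinear_linear[OF L uvG, symmetric])
  finally show "?D (gmult f h) = (\<lambda>I. gmult (?D f) h I + gmult f (?D h) I)" unfolding f'[symmetric] .
qed

lemma vector_field_gmono:
  assumes F: "F j \<in> Grass n" and j: "j < n"
  shows "vector_field n F (gmono {j}) = F j"
proof
  fix I
  have "(gmono {j} :: 'a grassmann) \<in> Grass n" by (rule gmono_Grass) (use j in simp)
  then have "vector_field n F (gmono {j}) I = (\<Sum>i<n. gmult (F i) (gpartial i (gmono {j})) I)"
    by (simp only: vector_field_apply)
  also have "\<dots> = (\<Sum>i\<in>{j}. gmult (F i) (gpartial i (gmono {j})) I)"
    by (rule sum.mono_neutral_right) (use j in \<open>auto simp: gpartial_gmono\<close>)
  also have "\<dots> = gmult (F j) (gmono {}) I" by (simp add: gpartial_gmono sgnp_def)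
  also have "\<dots> = F j I" by (simp only: gmult_one_right[OF F])
  finally show "vector_field n F (gmono {j}) I = F j I" .
qed

section \<open>Derivations that raise the degree\<close>

definition fil :: "nat \<Rightarrow> nat \<Rightarrow> 'k::comm_ring_1 gop \<Rightarrow> bool" where
  "fil n d D \<longleftrightarrow> (\<forall>k. \<forall>f\<in>Gr n k. D f \<in> Gr n (k + d))"

lemma filD: "fil n d D \<Longrightarrow> f \<in> Gr n k \<Longrightarrow> D f \<in> Gr n (k + d)"
  by (simp add: fil_def)

lemma gmono_Gr: "J \<subseteq> {..<n} \<Longrightarrow> gmono J \<in> Gr n (card J)"
  unfolding Gr_def using gmono_Grass[of J n] by (auto simp: gmono_def)

lemma Gr_Grass: "f \<in> Gr n k \<Longrightarrow> f \<in> Grass n"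
  by (simp add: Gr_def)

lemma Grass_Gr: "f \<in> Grass n \<Longrightarrow> f \<in> Gr n 0"
  by (simp add: Gr_def)

text \<open>An even derivation sends a generator to an odd element, which has no constant term, so
  the degree of a generator does not drop.\<close>

lemma der_even_fil:
  assumes D: "D \<in> der_even n"
  shows "fil n 0 D"
proof -
  have "D (gmono {i}) \<in> Gr n (1 - 0)" if i: "i < n" for i
  proof -
    have "gmono {i} \<in> gparity n False" by (rule gmono_gparity) (use i in simp_all)
    from der_evenD(2)[OF D this] have "D (gmono {i}) \<in> gparity n False" .
    moreover from this have "1 \<le> card I" if "D (gmono {i}) I \<noteq> 0" for I
      using that unfolding gparity_iff by (metis One_nat_def Suc_leI even_zero neq0_conv)
    ultimately show ?thesis unfolding Gr_def gparity_iff by simp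
  qed
  from leibniz_filtered[OF der_even_leibniz[OF D] this] show ?thesis unfolding fil_def by simp
qed

lemma der_odd_filtered:
  assumes D: "D \<in> der_odd n" and f: "f \<in> Gr n k"
  shows "D f \<in> Gr n (k - 1)"
proof (rule leibniz_filtered[OF der_odd_leibniz[OF D] _ f])
  fix i assume "i < n"
  then have "D (gmono {i}) \<in> Grass n" by (intro glinear_Grass[OF der_oddD(1)[OF D]]) simp
  then show "D (gmono {i}) \<in> Gr n (1 - 1)" by (simp add: Gr_def)
qed

text \<open>The image of a generator has degree at least \<open>d + 1 > n\<close>, hence is
  zero.\<close>

lemma leibniz_high_fil:
  assumes L: "leibniz n D" and fil: "fil n d D" "n \<le> d"
  shows "D = gzero n"
proof (rule gop_eqI[OF leibniz_glinear[OF L] gzero_glinear])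
  fix f :: "'a grassmann" assume f: "f \<in> Grass n"
  have "D (gmono {i}) = (\<lambda>I. 0)" if i: "i < n" for i
  proof -
    have "gmono {i} \<in> Gr n 1" using gmono_Gr[of "{i}" n] i by simp
    from filD[OF fil(1) this] show ?thesis by (rule Gr_eq_zero) (use fil(2) in simp)
  qed
  from leibniz_eq_zero[OF L this f] show "D f = gzero n f" using f by (simp add: gzero_def)
qed

lemma fil_bracket:
  assumes D: "D \<in> der_even n" and E: "E \<in> der_even n" and fil: "fil n d D" "fil n e E"
  shows "fil n (d + e) (sa_br (der_grass n) D E)"
  unfolding fil_def
proof (intro allI ballI)
  fix k and f :: "'a grassmann" assume f: "f \<in> Gr n k"
  have "sa_br (der_grass n) D E f = (\<lambda>I. 1 * D (E f) I + (-1) * E (D f) I)"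
    using br_der_even_left[OF D, of E] E Gr_Grass[OF f] by simp
  moreover have "D (E f) \<in> Gr n (k + (d + e))" "E (D f) \<in> Gr n (k + (d + e))"
    using filD[OF fil(1) filD[OF fil(2) f]] filD[OF fil(2) filD[OF fil(1) f]] by (simp_all add: ac_simps)
  ultimately show "sa_br (der_grass n) D E f \<in> Gr n (k + (d + e))" using Gr_linear by metis
qed

text \<open>The abelian ideal consists of the even elements that raise the degree by at least
  \<open>d\<close>: brackets within it raise the degree by \<open>2 d\<close> and are zero by
  \<open>top\<close>. Bracketing with such an element is nilpotent on odd derivations, as these
  lower the degree by at most one.\<close>

lemma nondefinite_der_grass:
  fixes g0 g1 :: "'a::euclidean_space set"
  assumes alg: "real_lie_superalgebra g0 g1 br"
    and simple: "simple_superalgebra g0 g1 br" "g1 \<noteq> {0}"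
    and rf: "real_form_of (superalgebra_of g0 g1 br) (sa_sub (der_grass n) S)"
    and a: "a \<in> S" "a \<in> der_even n" "fil n d a" "a \<noteq> gzero n" and d: "0 < d"
    and top: "\<And>D. D \<in> S \<Longrightarrow> D \<in> der_even n \<Longrightarrow> fil n (2 * d) D \<Longrightarrow> D = gzero n"
  shows "nondefinite g1 br"
proof -
  let ?M = "sa_sub (der_grass n) S"
  define \<aa> where "\<aa> = {D \<in> S \<inter> der_even n. fil n d D}"
  have M: "sa_even ?M = S \<inter> der_even n" "sa_odd ?M = S \<inter> der_odd n" "sa_br ?M = sa_br (der_grass n)"
    "sa_add ?M = gop_add n" "sa_scale ?M = (\<lambda>c D. \<lambda>f\<in>Grass n. \<lambda>I. c * D f I)" "sa_zero ?M = gzero n"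
    by (simp_all add: sa_sub_def der_grass_def gzero_def)
  show ?thesis
  proof (rule nondefinite_if_abelian_ideal[OF alg simple rf, where \<aa> = \<aa> and k = "n + 2"])
    show "sa_scale ?M 0 x = sa_zero ?M" for x by (simp add: M gzero_def)
    show "\<aa> \<subseteq> sa_even ?M" unfolding M \<aa>_def by blast
    show "sa_add ?M x y \<in> \<aa>" if "x \<in> \<aa>" "y \<in> \<aa>" "sa_add ?M x y \<in> sa_even ?M" for x y
    proof -
      have "fil n d (gop_add n x y)"
        unfolding fil_def
      proof (intro allI ballI)
        fix k and f :: "complex grassmann" assume f: "f \<in> Gr n k"
        have "x f \<in> Gr n (k + d)" "y f \<in> Gr n (k + d)" using that f filD unfolding \<aa>_def by blast+
        from Gr_linear[OF this, of 1 1] show "gop_add n x y f \<in> Gr n (k + d)"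
          using Gr_Grass[OF f] by (simp add: gop_add_def)
      qed
      then show ?thesis using that(3) unfolding M \<aa>_def by blast
    qed
    show "sa_scale ?M c x \<in> \<aa>" if "x \<in> \<aa>" "sa_scale ?M c x \<in> sa_even ?M" for c x
    proof -
      have "fil n d (\<lambda>f\<in>Grass n. \<lambda>I. c * x f I)"
        unfolding fil_def
      proof (intro allI ballI)
        fix k and f :: "complex grassmann" assume f: "f \<in> Gr n k"
        have "x f \<in> Gr n (k + d)" using that f filD unfolding \<aa>_def by blast
        from Gr_linear[OF this this, of c 0] show "(\<lambda>f\<in>Grass n. \<lambda>I. c * x f I) f \<in> Gr n (k + d)"
          using Gr_Grass[OF f] by simp
      qed
      then show ?thesis using that(2) unfolding M \<aa>_def by blast
    qed
    show "sa_br ?M x y \<in> \<aa>" if "x \<in> \<aa>" "y \<in> sa_even ?M" "sa_br ?M x y \<in> sa_even ?M" for x y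
      using that fil_bracket[of x n y d 0] der_even_fil[of y n] unfolding M \<aa>_def by simp
    show "sa_br ?M x y = sa_zero ?M" if "x \<in> \<aa>" "y \<in> \<aa>" "sa_br ?M x y \<in> sa_even ?M" for x y
      using that fil_bracket[of x n y d d] top unfolding M \<aa>_def by (simp add: mult_2)
    show "(sa_br ?M x ^^ (n + 2)) y = sa_zero ?M"
      if x: "x \<in> \<aa>" and y: "y \<in> sa_odd ?M" and it: "\<And>j. (sa_br ?M x ^^ j) y \<in> sa_odd ?M" for x y
    proof -
      let ?y = "\<lambda>j. (sa_br (der_grass n) x ^^ j) y"
      have xd: "x \<in> der_even n" "fil n d x" using x unfolding \<aa>_def by blast+
      have yo: "?y j \<in> der_odd n" for j using it[of j] unfolding M by blast
      \<comment> \<open>Each bracket with \<open>x\<close> gains \<open>d \<ge> 1\<close>, and the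
        odd derivation at the start loses at most \<open>1\<close>. After \<open>n + 2\<close>
        brackets the gain is therefore at least \<open>n\<close>, which forces zero.\<close>
      have fl: "?y j f \<in> Gr n (k + j * d - 1)" if "f \<in> Gr n k" for j k f
        using that
      proof (induction j arbitrary: k f)
        case 0
        then show ?case using der_odd_filtered[OF yo[of 0]] by simp
      next
        case (Suc j)
        have e: "?y (Suc j) f = (\<lambda>I. 1 * x (?y j f) I + (-1) * ?y j (x f) I)"
          using br_der_even_left[OF xd(1), of "?y j"] yo[of j] Gr_Grass[OF Suc.prems] by simp
        have 1: "x (?y j f) \<in> Gr n (k + Suc j * d - 1)"
          by (rule Gr_mono[OF filD[OF xd(2) Suc.IH[OF Suc.prems]]]) simp
        have 2: "?y j (x f) \<in> Gr n (k + Suc j * d - 1)"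
          by (rule Gr_mono[OF Suc.IH[OF filD[OF xd(2) Suc.prems]]]) simp
        show ?case unfolding e by (rule Gr_linear[OF 1 2])
      qed
      have "fil n n (?y (n + 2))"
        unfolding fil_def
      proof (intro allI ballI)
        fix k and f :: "complex grassmann" assume f: "f \<in> Gr n k"
        have "(n + 2) * 1 \<le> (n + 2) * d" using d by (intro mult_le_mono2) simp
        then show "?y (n + 2) f \<in> Gr n (k + n)" by (intro Gr_mono[OF fl[OF f]]) simp
      qed
      from leibniz_high_fil[OF der_odd_leibniz[OF yo] this] show ?thesis unfolding M by simp
    qed
    show "\<exists>a\<in>\<aa>. a \<noteq> sa_zero ?M" using a unfolding M \<aa>_def by blast
  qed
qed

text \<open>The monomial vector field \<open>\<xi>_J \<partial>_0\<close>, of degree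
  \<open>card J - 1\<close>.\<close>

definition gfield :: "nat \<Rightarrow> nat set \<Rightarrow> 'k::comm_ring_1 gop" where
  "gfield n J = vector_field n (\<lambda>k. if k = 0 then gmono J else (\<lambda>I. 0))"

lemma gfield_degree:
  assumes J: "J \<subseteq> {..<n}" "odd (card J)" and n: "0 < n"
  shows "(gfield n J :: 'k::comm_ring_1 gop) \<in> der_even n" "fil n (card J - 1) (gfield n J :: 'k gop)"
    "(gfield n J :: 'k gop) \<noteq> gzero n"
proof -
  let ?F = "\<lambda>k. if k = 0 then gmono J else (\<lambda>I. 0) :: 'k grassmann"
  have "(gmono J :: 'k grassmann) \<in> gparity n False" by (rule gmono_gparity[OF J(1)]) (use J(2) in simp)
  then have F: "?F k \<in> gparity n False" for k by simp
  show "(gfield n J :: 'k gop) \<in> der_even n" unfolding gfield_def by (rule vector_field_der_even) (rule F)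
  have app: "(gfield n J :: 'k gop) h = gmult (gmono J) (gpartial 0 h)" if "h \<in> Grass n" for h
  proof
    fix I
    have "gfield n J h I = (\<Sum>i<n. gmult (?F i) (gpartial i h) I)" by (simp add: gfield_def vector_field_apply[OF that])
    also have "\<dots> = (\<Sum>i\<in>{0}. gmult (?F i) (gpartial i h) I)" by (rule sum.mono_neutral_right) (use n in auto)
    finally show "gfield n J h I = gmult (gmono J) (gpartial 0 h) I" by simp
  qed
  show "fil n (card J - 1) (gfield n J :: 'k gop)"
    unfolding fil_def
  proof (intro allI ballI)
    fix k and h :: "'k grassmann" assume h: "h \<in> Gr n k"
    have "gmult (gmono J) (gpartial 0 h) \<in> Gr n (card J + (k - 1))"
      by (rule Gr_gmult[OF gmono_Gr[OF J(1)] gpartial_Gr[OF h]])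
    moreover have "k + (card J - 1) \<le> card J + (k - 1)" using J(2) by (cases "card J") auto
    ultimately show "gfield n J h \<in> Gr n (k + (card J - 1))"
      unfolding app[OF Gr_Grass[OF h]] by (rule Gr_mono)
  qed
  have "(gfield n J :: 'k gop) (gmono {0}) = gmono J"
    unfolding gfield_def by (subst vector_field_gmono) (use n gmono_Grass[OF J(1)] in auto)
  then have "(gfield n J :: 'k gop) (gmono {0}) J = 1" by (simp add: gmono_def)
  moreover have "gzero n (gmono {0}) J = (0 :: 'k)"
    using n by (simp add: gzero_def)
  ultimately show "(gfield n J :: 'k gop) \<noteq> gzero n" by auto
qed

lemma der_even_carrier: "D \<in> der_even n \<Longrightarrow> D \<in> sa_carrier (der_grass n)"
proof -
  assume D: "D \<in> der_even n"
  have "gop_add n D (gzero n) = D"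
    using der_evenD(1)[OF D] by (auto simp: gop_add_def gzero_def glinear_def PiE_iff extensional_def fun_eq_iff)
  then show ?thesis using D gzero_der(2) by (force simp: der_grass_def)
qed

lemma nondefinite_W:
  fixes g0 g1 :: "'a::euclidean_space set"
  assumes alg: "real_lie_superalgebra g0 g1 br"
    and simple: "simple_superalgebra g0 g1 br" "g1 \<noteq> {0}"
    and rf: "real_form_of (superalgebra_of g0 g1 br) (W_complex n)" and n: "3 \<le> n"
  shows "nondefinite g1 br"
proof -
  \<comment> \<open>An odd number of generators makes the field even. With the largest such number
    the degree \<open>d = card J - 1\<close> satisfies \<open>2 d \<ge> n\<close>, so brackets
    within the ideal vanish.\<close>
  define J where "J = (if even n then {1..<n} else {..<n})"
  have J: "J \<subseteq> {..<n}" "odd (card J)" "2 \<le> card J" "n \<le> 2 * (card J - 1)" using n by (auto simp: J_def)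
  have e: "der_even n \<subseteq> sa_carrier (W_complex n)" using der_even_carrier by blast
  have o: "der_odd n \<subseteq> sa_carrier (W_complex n)"
  proof
    fix D :: "complex gop" assume D: "D \<in> der_odd n"
    have "gop_add n (gzero n) D = D"
      using der_oddD(1)[OF D] by (auto simp: gop_add_def gzero_def glinear_def PiE_iff extensional_def fun_eq_iff)
    then show "D \<in> sa_carrier (W_complex n)" using D gzero_der(1) by (force simp: der_grass_def)
  qed
  have "sa_even (W_complex n) = der_even n" "sa_odd (W_complex n) = der_odd n" by (simp_all add: der_grass_def)
  then have W: "sa_sub (W_complex n) (sa_carrier (W_complex n)) = W_complex n"
    using e o unfolding sa_sub_def by (simp add: Int_absorb1)
  show ?thesis
  proof (rule nondefinite_der_grass[OF alg simple _ der_even_carrier gfield_degree(1) gfield_degree(2,3)])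
    show "real_form_of (superalgebra_of g0 g1 br) (sa_sub (W_complex n) (sa_carrier (W_complex n)))"
      unfolding W by (rule rf)
    show "gfield n J \<in> der_even n" using gfield_degree(1)[OF J(1,2)] n by simp
    show "D = gzero n" if "D \<in> der_even n" "fil n (2 * (card J - 1)) D" for D
      by (rule leibniz_high_fil[OF der_even_leibniz[OF that(1)] that(2) J(4)])
  qed (use J n in auto)
qed

text \<open>Only the coefficient of \<open>\<partial>_0\<close> is nonzero, and as
  \<open>0 \<notin> J\<close> it does not involve the generator numbered \<open>0\<close>; so the
  divergence vanishes.\<close>

lemma gfield_S_set:
  assumes J: "J \<subseteq> {..<n}" "odd (card J)" "0 \<notin> J" and n: "0 < n"
  shows "gfield n J \<in> S_set n"
  unfolding S_set_def mem_Collect_eq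
proof (intro conjI exI allI impI)
  show "gfield n J \<in> sa_carrier (W_complex n)" by (rule der_even_carrier[OF gfield_degree(1)[OF J(1,2) n]])
  show "gfield n J = vector_field n (\<lambda>k. if k = 0 then gmono J else (\<lambda>I. 0))" by (simp add: gfield_def)
  show "(if i = 0 then gmono J else (\<lambda>I. 0) :: complex grassmann) \<in> Grass n" for i
    by (simp add: gmono_Grass[OF J(1)])
  show "(\<Sum>i<n. gpartial i (if i = 0 then gmono J else (\<lambda>I. 0)) I) = (0 :: complex)" for I
  proof (rule sum.neutral, rule ballI)
    fix i
    have "gpartial i (\<lambda>I. 0) I = (0 :: complex)" by (simp add: gpartial_def)
    then show "gpartial i (if i = 0 then gmono J else (\<lambda>I. 0)) I = (0 :: complex)" using J(3) by (simp add: gpartial_gmono)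
  qed
qed

text \<open>A vector field of degree \<open>n - 1\<close> is \<open>\<Sum> c\<^sub>i \<xi>\<^sub>1 \<cdots> \<xi>\<^sub>n \<partial>\<^sub>i\<close>; the coefficients \<open>c\<^sub>i\<close> are read off its divergence.\<close>

lemma S_set_top_degree:
  assumes D: "D \<in> S_set n" and top: "\<And>i. i < n \<Longrightarrow> D (gmono {i}) \<in> Gr n n"
  shows "D = gzero n"
proof -
  obtain F where F: "\<And>i. i < n \<Longrightarrow> F i \<in> Grass n" "D = vector_field n F"
    and div: "\<And>I. (\<Sum>i<n. gpartial i (F i) I) = 0"
    using D unfolding S_set_def by blast
  have Fi: "F i \<in> Gr n n" if "i < n" for i
    using top[OF that] vector_field_gmono[of F i n, OF F(1)[OF that] that] unfolding F(2) by simp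
  have zero: "F i = (\<lambda>I. 0)" if i: "i < n" for i
  proof
    fix I
    \<comment> \<open>Evaluated at this set the divergence retains only the summand
      \<open>k = i\<close>, since \<open>gpartial k\<close> vanishes at sets that contain
      \<open>k\<close>.\<close>
    let ?T = "{..<n} - {i}"
    have "(\<Sum>k<n. gpartial k (F k) ?T) = (\<Sum>k\<in>{i}. gpartial k (F k) ?T)"
      by (rule sum.mono_neutral_right) (use i in \<open>auto simp: gpartial_def\<close>)
    also have "\<dots> = sgnp {i} ?T * F i {..<n}" using i by (simp add: gpartial_sgnp insert_absorb)
    finally have e: "sgnp {i} ?T * F i {..<n} = 0" using div[of ?T] by simp
    have "F i {..<n} = sgnp {i} ?T * (sgnp {i} ?T * F i {..<n})" by (simp only: sgnp_square(2))
    also have "\<dots> = 0" unfolding e by simp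
    finally have "F i {..<n} = 0" .
    moreover have "I = {..<n}" if "F i I \<noteq> 0"
    proof (rule card_subset_eq)
      show "I \<subseteq> {..<n}" using Grass_zero[OF F(1)[OF i]] that by blast
      have "n \<le> card I" using Fi[OF i] that unfolding Gr_def by blast
      then show "card I = card {..<n}" using card_mono[OF finite_lessThan \<open>I \<subseteq> {..<n}\<close>] by simp
    qed simp
    ultimately show "F i I = 0" by blast
  qed
  show ?thesis
  proof (rule gop_eqI[OF _ gzero_glinear])
    show "D \<in> glinear n" unfolding F(2) by (rule vector_field_glinear[OF F(1)])
    fix f :: "complex grassmann" assume f: "f \<in> Grass n"
    show "D f = gzero n f" unfolding F(2) using f zero by (simp add: vector_field_apply gzero_def)
  qed
qed

lemma nondefinite_S:
  fixes g0 g1 :: "'a::euclidean_space set"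
  assumes alg: "real_lie_superalgebra g0 g1 br"
    and simple: "simple_superalgebra g0 g1 br" "g1 \<noteq> {0}"
    and rf: "real_form_of (superalgebra_of g0 g1 br) (S_complex n)" and n: "4 \<le> n"
  shows "nondefinite g1 br"
proof -
  \<comment> \<open>\<open>J\<close> must omit \<open>0\<close> for zero divergence and have odd
    size for an even field. For \<open>n = 5\<close> this only gives \<open>2 d = n - 1\<close>, so
    fields of degree \<open>n - 1\<close> have to be excluded by their divergence rather than by
    degree.\<close>
  define J where "J = (if even n then {1..<n} else {1..<n - 1})"
  have J: "J \<subseteq> {..<n}" "odd (card J)" "0 \<notin> J" "2 \<le> card J" "n - 1 \<le> 2 * (card J - 1)"
    using n by (auto simp: J_def elim!: oddE)
  have n0: "0 < n" using n by simp
  show ?thesis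
  proof (rule nondefinite_der_grass[OF alg simple rf[unfolded S_complex_def] gfield_S_set[OF J(1-3) n0]
        gfield_degree(1)[OF J(1,2) n0] gfield_degree(2)[OF J(1,2) n0] gfield_degree(3)[OF J(1,2) n0]])
    show "D = gzero n" if D: "D \<in> S_set n" "fil n (2 * (card J - 1)) D" for D
    proof (rule S_set_top_degree[OF D(1)])
      fix i assume "i < n"
      then have "gmono {i} \<in> Gr n 1" using gmono_Gr[of "{i}" n] by simp
      from filD[OF D(2) this] show "D (gmono {i}) \<in> Gr n n" by (rule Gr_mono) (use J(5) in simp)
    qed
  qed (use J(4) in simp)
qed

lemma nondefinite_S_tilde:
  fixes g0 g1 :: "'a::euclidean_space set"
  assumes alg: "real_lie_superalgebra g0 g1 br"
    and simple: "simple_superalgebra g0 g1 br" "g1 \<noteq> {0}"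
    and rf: "real_form_of (superalgebra_of g0 g1 br) (S_tilde_complex n)" and n: "4 \<le> n" "even n"
  shows "nondefinite g1 br"
proof -
  define J where "J = {1..<n}"
  have J: "J \<subseteq> {..<n}" "odd (card J)" "0 \<notin> J" "2 \<le> card J" "n \<le> 2 * (card J - 1)"
    using n by (auto simp: J_def)
  have n0: "0 < n" using n by simp
  let ?a = "gfield n J :: complex gop"
  \<comment> \<open>The values of \<open>?a\<close> have no constant term, so the top monomial
    annihilates them and multiplication by \<open>1 + \<xi>_0 \<cdots> \<xi>_{n-1}\<close> leaves
    \<open>?a\<close> unchanged. Thus \<open>?a\<close> lies in the deformed algebra because it lies
    in \<open>S(n)\<close>.\<close>
  have "(\<lambda>h\<in>Grass n. gmult (\<lambda>I. of_bool (I = {}) + of_bool (I = {..<n})) (?a h)) = ?a"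
  proof
    fix h
    show "(\<lambda>h\<in>Grass n. gmult (\<lambda>I. of_bool (I = {}) + of_bool (I = {..<n})) (?a h)) h = ?a h"
    proof (cases "h \<in> Grass n")
      case True
      have u: "?a h \<in> Gr n 1"
        by (rule Gr_mono[OF filD[OF gfield_degree(2)[OF J(1,2) n0] Grass_Gr[OF True]]]) (use J(4) in simp)
      have "gmult (gmono {..<n}) (?a h) \<in> Gr n (n + 1)"
        using Gr_gmult[OF gmono_Gr[of "{..<n}" n] u] by simp
      then have z: "gmult (gmono {..<n}) (?a h) = (\<lambda>I. 0)" by (rule Gr_eq_zero) simp
      have "gmult (\<lambda>I. 1 * gmono {} I + 1 * gmono {..<n} I) (?a h) = ?a h"
        unfolding gmult_add_left z gmult_one_left[OF Gr_Grass[OF u]] by simp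
      then show ?thesis using True by (simp add: gmono_def)
    next
      case False
      then show ?thesis using glinear_undefined[OF der_evenD(1)[OF gfield_degree(1)[OF J(1,2) n0]] False] by simp
    qed
  qed
  then have a: "?a \<in> {D \<in> sa_carrier (W_complex n).
     (\<lambda>h\<in>Grass n. gmult (\<lambda>I. of_bool (I = {}) + of_bool (I = {..<n})) (D h)) \<in> S_set n}"
    using gfield_S_set[OF J(1-3) n0] der_even_carrier[OF gfield_degree(1)[OF J(1,2) n0]] by simp
  show ?thesis
  proof (rule nondefinite_der_grass[OF alg simple rf[unfolded S_tilde_complex_def] a
        gfield_degree(1)[OF J(1,2) n0] gfield_degree(2)[OF J(1,2) n0] gfield_degree(3)[OF J(1,2) n0]])
    show "D = gzero n" if "D \<in> der_even n" "fil n (2 * (card J - 1)) D" for D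
      by (rule leibniz_high_fil[OF der_even_leibniz[OF that(1)] that(2) J(5)])
  qed (use J(4) in simp)
qed

text \<open>Unlike in \<open>leibniz\<close>, the sign is a parameter here, so that two operators
  with the same sign can be subtracted.\<close>

definition leibniz_sign :: "nat \<Rightarrow> 'k::comm_ring_1 \<Rightarrow> 'k gop \<Rightarrow> bool" where
  "leibniz_sign n c D \<longleftrightarrow> D \<in> glinear n \<and> D (gmono {}) = (\<lambda>I. 0) \<and>
    (\<forall>i<n. \<forall>h\<in>Grass n. D (gmult (gmono {i}) h) = (\<lambda>I. gmult (D (gmono {i})) h I + c * gmult (gmono {i}) (D h) I))"

lemma leibniz_signD:
  assumes "leibniz_sign n c D"
  shows "D \<in> glinear n" "D (gmono {}) = (\<lambda>I. 0)"
    "i < n \<Longrightarrow> h \<in> Grass n \<Longrightarrow> D (gmult (gmono {i}) h) = (\<lambda>I. gmult (D (gmono {i})) h I + c * gmult (gmono {i}) (D h) I)"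
  using assms unfolding leibniz_sign_def by blast+

lemma leibniz_sign_leibniz: "leibniz_sign n c D \<Longrightarrow> leibniz n D"
  by (rule leibnizI[of D n c]) (rule leibniz_signD; assumption)+

lemma leibniz_signI:
  assumes "D \<in> glinear n" "D (gmono {}) = (\<lambda>I. 0)"
    "\<And>i h. i < n \<Longrightarrow> h \<in> Grass n \<Longrightarrow> D (gmult (gmono {i}) h) = (\<lambda>I. gmult (D (gmono {i})) h I + c * gmult (gmono {i}) (D h) I)"
  shows "leibniz_sign n c D"
  unfolding leibniz_sign_def by (intro conjI allI impI ballI assms)

lemma gmono_odd: "i < n \<Longrightarrow> gmono {i} \<in> gparity n False"
  by (rule gmono_gparity) auto

lemma gmono_single_Grass: "i < n \<Longrightarrow> gmono {i} \<in> Grass n"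
  by (rule gmono_Grass) simp

lemma der_odd_leibniz_sign:
  assumes D: "D \<in> der_odd n"
  shows "leibniz_sign n (-1) D"
proof (rule leibniz_signI)
  show "D \<in> glinear n" by (rule der_oddD(1)[OF D])
  show "D (gmono {}) = (\<lambda>I. 0)" by (rule leibniz_one[OF der_odd_leibniz[OF D]])
  show "D (gmult (gmono {i}) h) = (\<lambda>I. gmult (D (gmono {i})) h I + -1 * gmult (gmono {i}) (D h) I)"
    if "i < n" "h \<in> Grass n" for i h
    using der_oddD(4)[OF D gmono_odd[OF that(1)] that(2)] by (simp only: mult_minus1 diff_conv_add_uminus)
qed

lemma glinear_combination:
  fixes D E :: "'k::comm_ring_1 gop"
  assumes D: "D \<in> glinear n" and E: "E \<in> glinear n"
  shows "(\<lambda>f\<in>Grass n. \<lambda>I. x * D f I + y * E f I) \<in> glinear n"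
  unfolding glinear_def mem_Collect_eq
proof (intro conjI ballI allI)
  show "(\<lambda>f\<in>Grass n. \<lambda>I. x * D f I + y * E f I) \<in> Grass n \<rightarrow>\<^sub>E Grass n"
    by (auto intro!: Grass_linear glinear_Grass[OF D] glinear_Grass[OF E])
  fix f h :: "'k grassmann" and a b assume f: "f \<in> Grass n" and h: "h \<in> Grass n"
  show "(\<lambda>f\<in>Grass n. \<lambda>I. x * D f I + y * E f I) (\<lambda>I. a * f I + b * h I) =
      (\<lambda>I. a * (\<lambda>f\<in>Grass n. \<lambda>I. x * D f I + y * E f I) f I + b * (\<lambda>f\<in>Grass n. \<lambda>I. x * D f I + y * E f I) h I)"
    using f h by (simp add: Grass_linear glinear_linear[OF D f h] glinear_linear[OF E f h] algebra_simps)
qed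

lemma glinear_compose:
  fixes D E :: "'k::comm_ring_1 gop"
  assumes D: "D \<in> glinear n" and E: "E \<in> glinear n"
  shows "(\<lambda>f\<in>Grass n. D (E f)) \<in> glinear n"
  unfolding glinear_def mem_Collect_eq
proof (intro conjI ballI allI)
  show "(\<lambda>f\<in>Grass n. D (E f)) \<in> Grass n \<rightarrow>\<^sub>E Grass n"
    using glinear_Grass[OF D] glinear_Grass[OF E] by auto
  fix f h :: "'k grassmann" and a b assume f: "f \<in> Grass n" and h: "h \<in> Grass n"
  have "D (E (\<lambda>I. a * f I + b * h I)) = (\<lambda>I. a * D (E f) I + b * D (E h) I)"
    unfolding glinear_linear[OF E f h] by (rule glinear_linear[OF D glinear_Grass[OF E f] glinear_Grass[OF E h]])
  then show "(\<lambda>f\<in>Grass n. D (E f)) (\<lambda>I. a * f I + b * h I) =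
      (\<lambda>I. a * (\<lambda>f\<in>Grass n. D (E f)) f I + b * (\<lambda>f\<in>Grass n. D (E f)) h I)"
    using f h by (simp add: Grass_linear)
qed

lemma glinear_scale: "D \<in> glinear n \<Longrightarrow> f \<in> Grass n \<Longrightarrow> D (\<lambda>I. a * f I) = (\<lambda>I. a * D f I)"
  using glinear_linear[of D n f f a 0] by simp

text \<open>The mixed products of first derivatives cancel between \<open>D E\<close> and
  \<open>E D\<close>. With this the commutator can be identified by its values on
  generators.\<close>

lemma commutator_leibniz_sign:
  fixes D E :: "'k::comm_ring_1 gop"
  assumes D: "D \<in> der_even n" and E: "E \<in> der_odd n"
  shows "leibniz_sign n (-1) (\<lambda>f\<in>Grass n. \<lambda>I. D (E f) I - E (D f) I)"
proof (rule leibniz_signI)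
  have LD: "D \<in> glinear n" and LE: "E \<in> glinear n" using der_evenD(1)[OF D] der_oddD(1)[OF E] .
  let ?T = "\<lambda>f\<in>Grass n. \<lambda>I. D (E f) I - E (D f) I"
  have T: "?T = (\<lambda>f\<in>Grass n. \<lambda>I. 1 * (\<lambda>f\<in>Grass n. D (E f)) f I + (-1) * (\<lambda>f\<in>Grass n. E (D f)) f I)"
    by (auto simp: fun_eq_iff)
  show "?T \<in> glinear n" unfolding T by (rule glinear_combination[OF glinear_compose[OF LD LE] glinear_compose[OF LE LD]])
  show "?T (gmono {}) = (\<lambda>I. 0)"
    by (simp add: leibniz_one[OF der_even_leibniz[OF D]] leibniz_one[OF der_odd_leibniz[OF E]] glinear_zero[OF LD] glinear_zero[OF LE])
  fix i and h :: "'k grassmann" assume i: "i < n" and h: "h \<in> Grass n"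
  let ?x = "gmono {i} :: 'k grassmann"
  have x: "?x \<in> Grass n" "?x \<in> gparity n False" by (rule gmono_single_Grass[OF i], rule gmono_odd[OF i])
  have Dx: "D ?x \<in> gparity n False" by (rule der_evenD(2)[OF D x(2)])
  have G: "D h \<in> Grass n" "E h \<in> Grass n" "E ?x \<in> Grass n" "D ?x \<in> Grass n"
    using glinear_Grass[OF LD] glinear_Grass[OF LE] h x(1) by blast+
  have Exh: "E (gmult ?x h) = (\<lambda>I. 1 * gmult (E ?x) h I + (-1) * gmult ?x (E h) I)"
    using der_oddD(4)[OF E x(2) h] by simp
  have Dxh: "D (gmult ?x h) = (\<lambda>I. 1 * gmult (D ?x) h I + 1 * gmult ?x (D h) I)"
    using der_evenD(3)[OF D x(1) h] by simp
  have 1: "D (E (gmult ?x h)) = (\<lambda>I. 1 * D (gmult (E ?x) h) I + (-1) * D (gmult ?x (E h)) I)"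
    unfolding Exh by (rule glinear_linear[OF LD gmult_Grass[OF G(3) h] gmult_Grass[OF x(1) G(2)]])
  have 2: "E (D (gmult ?x h)) = (\<lambda>I. 1 * E (gmult (D ?x) h) I + 1 * E (gmult ?x (D h)) I)"
    unfolding Dxh by (rule glinear_linear[OF LE gmult_Grass[OF G(4) h] gmult_Grass[OF x(1) G(1)]])
  show "?T (gmult ?x h) = (\<lambda>I. gmult (?T ?x) h I + -1 * gmult ?x (?T h) I)"
  proof
    fix I
    have "?T (gmult ?x h) I = D (E (gmult ?x h)) I - E (D (gmult ?x h)) I" by (simp add: gmult_Grass x h)
    also have "\<dots> = (1 * gmult (D (E ?x)) h I + (-1) * gmult (E (D ?x)) h I)
        + -1 * (1 * gmult ?x (D (E h)) I + (-1) * gmult ?x (E (D h)) I)"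
      unfolding 1 2 der_evenD(3)[OF D G(3) h] der_evenD(3)[OF D x(1) G(2)] der_oddD(4)[OF E Dx h] der_oddD(4)[OF E x(2) G(1)]
      by (simp add: algebra_simps)
    also have "\<dots> = gmult (\<lambda>I. 1 * D (E ?x) I + (-1) * E (D ?x) I) h I + -1 * gmult ?x (\<lambda>I. 1 * D (E h) I + (-1) * E (D h) I) I"
      by (simp only: gmult_add_left gmult_add_right)
    finally show "?T (gmult ?x h) I = gmult (?T ?x) h I + -1 * gmult ?x (?T h) I"
      using x(1) h by simp
  qed
qed

text \<open>For a generator \<open>x\<close> the element \<open>D x\<close> is even, so the mixed
  terms \<open>D x * D h\<close> appear with opposite signs and cancel. Hence \<open>D (D f)\<close>
  vanishes for all \<open>f\<close> once it does for generators.\<close>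

lemma square_leibniz_sign:
  fixes D :: "'k::comm_ring_1 gop"
  assumes D: "D \<in> der_odd n"
  shows "leibniz_sign n 1 (\<lambda>f\<in>Grass n. D (D f))"
proof (rule leibniz_signI)
  have L: "D \<in> glinear n" by (rule der_oddD(1)[OF D])
  let ?T = "\<lambda>f\<in>Grass n. D (D f)"
  show "?T \<in> glinear n" by (rule glinear_compose[OF L L])
  show "?T (gmono {}) = (\<lambda>I. 0)"
    by (simp add: leibniz_one[OF der_odd_leibniz[OF D]] glinear_zero[OF L])
  fix i and h :: "'k grassmann" assume i: "i < n" and h: "h \<in> Grass n"
  let ?x = "gmono {i} :: 'k grassmann"
  have x: "?x \<in> Grass n" "?x \<in> gparity n False" by (rule gmono_single_Grass[OF i], rule gmono_odd[OF i])
  have Dx: "D ?x \<in> gparity n True" using der_oddD(2)[OF D x(2)] by simp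
  have G: "D h \<in> Grass n" "D ?x \<in> Grass n" using glinear_Grass[OF L] h x(1) by blast+
  have Dxh: "D (gmult ?x h) = (\<lambda>I. 1 * gmult (D ?x) h I + (-1) * gmult ?x (D h) I)"
    using der_oddD(4)[OF D x(2) h] by simp
  have 1: "D (D (gmult ?x h)) = (\<lambda>I. 1 * D (gmult (D ?x) h) I + (-1) * D (gmult ?x (D h)) I)"
    unfolding Dxh by (rule glinear_linear[OF L gmult_Grass[OF G(2) h] gmult_Grass[OF x(1) G(1)]])
  show "?T (gmult ?x h) = (\<lambda>I. gmult (?T ?x) h I + 1 * gmult ?x (?T h) I)"
  proof
    fix I
    have "?T (gmult ?x h) I = D (D (gmult ?x h)) I" by (simp add: gmult_Grass x h)
    also have "\<dots> = gmult (D (D ?x)) h I + 1 * gmult ?x (D (D h)) I"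
      unfolding 1 der_oddD(3)[OF D Dx h] der_oddD(4)[OF D x(2) G(1)] by (simp add: algebra_simps)
    finally show "?T (gmult ?x h) I = gmult (?T ?x) h I + 1 * gmult ?x (?T h) I"
      using x(1) h by simp
  qed
qed

text \<open>The difference satisfies the Leibniz rule with the same sign and kills the
  generators.\<close>

lemma leibniz_sign_eqI:
  fixes D E :: "'k::comm_ring_1 gop"
  assumes D: "leibniz_sign n c D" and E: "leibniz_sign n c E"
    and gen: "\<And>i. i < n \<Longrightarrow> D (gmono {i}) = E (gmono {i})"
  shows "D = E"
proof (rule gop_eqI[OF leibniz_signD(1)[OF D] leibniz_signD(1)[OF E]])
  fix f :: "'k grassmann" assume f: "f \<in> Grass n"
  let ?T = "\<lambda>f\<in>Grass n. \<lambda>I. 1 * D f I + (-1) * E f I"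
  have "leibniz_sign n c ?T"
  proof (rule leibniz_signI)
    show "?T \<in> glinear n" by (rule glinear_combination[OF leibniz_signD(1)[OF D] leibniz_signD(1)[OF E]])
    show "?T (gmono {}) = (\<lambda>I. 0)" by (simp add: leibniz_signD(2)[OF D] leibniz_signD(2)[OF E])
    fix i and h :: "'k grassmann" assume i: "i < n" and h: "h \<in> Grass n"
    let ?x = "gmono {i} :: 'k grassmann"
    have x: "?x \<in> Grass n" by (rule gmono_single_Grass[OF i])
    show "?T (gmult ?x h) = (\<lambda>I. gmult (?T ?x) h I + c * gmult ?x (?T h) I)"
    proof
      fix I
      have "?T (gmult ?x h) I = 1 * D (gmult ?x h) I + (-1) * E (gmult ?x h) I" by (simp add: gmult_Grass x h)
      also have "\<dots> = (1 * gmult (D ?x) h I + (-1) * gmult (E ?x) h I) + c * (1 * gmult ?x (D h) I + (-1) * gmult ?x (E h) I)"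
        unfolding leibniz_signD(3)[OF D i h] leibniz_signD(3)[OF E i h] by (simp add: algebra_simps)
      also have "\<dots> = gmult (\<lambda>I. 1 * D ?x I + (-1) * E ?x I) h I + c * gmult ?x (\<lambda>I. 1 * D h I + (-1) * E h I) I"
        by (simp only: gmult_add_left gmult_add_right)
      finally show "?T (gmult ?x h) I = gmult (?T ?x) h I + c * gmult ?x (?T h) I" using x h by simp
    qed
  qed
  moreover have "?T (gmono {i}) = (\<lambda>I. 0)" if "i < n" for i
    using gen[OF that] gmono_single_Grass[OF that, where 'a = 'k] by (simp add: fun_eq_iff)
  ultimately have "?T f = (\<lambda>I. 0)" by (rule leibniz_eq_zero[OF leibniz_sign_leibniz _ f])
  then show "D f = E f" using f by (simp add: fun_eq_iff)
qed

section \<open>Hamiltonian vector fields\<close>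

lemma leibniz_sign_pair:
  fixes D :: "'k::comm_ring_1 gop"
  assumes D: "leibniz_sign n c D" and ab: "a < b" "b < n"
  shows "D (gmono {a, b}) = (\<lambda>I. gmult (D (gmono {a})) (gmono {b}) I + c * gmult (gmono {a}) (D (gmono {b})) I)"
proof -
  have "gmono {a, b} = (gmult (gmono {a}) (gmono {b}) :: 'k grassmann)"
    by (rule gmono_insert[symmetric]) (use ab in auto)
  then show ?thesis using leibniz_signD(3)[OF D, of a "gmono {b}"] ab gmono_single_Grass[of b n, where 'a = 'k] by simp
qed

lemma gmult_gmono_overlap: "A \<inter> B \<noteq> {} \<Longrightarrow> gmult (gmono A) (gmono B) = (\<lambda>I. 0)"
proof
  fix K assume AB: "A \<inter> B \<noteq> {}"
  show "gmult (gmono A) (gmono B) K = 0"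
  proof (cases "finite K")
    case True
    have "K - A \<noteq> B" using AB by blast
    then show ?thesis by (simp add: gmult_gmono_left[OF True]) (simp add: gmono_def)
  qed (simp add: gmult_infinite)
qed

lemma gpartial_scale: "gpartial i (\<lambda>I. a * f I) = (\<lambda>I. a * gpartial i f I)"
  by (rule ext) (simp add: gpartial_def)

lemma gpartial_uminus: "gpartial i (\<lambda>I. - f I) = (\<lambda>I. - gpartial i f I)"
  by (rule ext) (simp add: gpartial_def)

lemma gmult_uminus_left: "gmult (\<lambda>I. - f I) h = (\<lambda>I. - gmult f h I)"
  by (rule ext) (simp add: gmult_def sum_negf)

lemma gmult_uminus_right: "gmult f (\<lambda>I. - h I) = (\<lambda>I. - gmult f h I)"
  by (rule ext) (simp add: gmult_def sum_negf)

lemma sgnp_empty: "sgnp {i} {} = 1"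
  by (simp add: sgnp_single)

lemma sgnp_insert:
  assumes "finite B" "a \<notin> B"
  shows "sgnp {i} (insert a B) = (if a < i then - sgnp {i} B else sgnp {i} B)"
proof -
  have "{j \<in> insert a B. j < i} = (if a < i then insert a {j \<in> B. j < i} else {j \<in> B. j < i})" by auto
  then show ?thesis unfolding sgnp_single using assms by (cases "a < i") simp_all
qed

text \<open>The Hamiltonian vector field of \<open>f\<close>; the signs are the
  \<open>\<epsilon>_i\<close> of the quadratic form of signature \<open>(p, n - p)\<close>.\<close>

definition hfield :: "nat \<Rightarrow> nat \<Rightarrow> real grassmann \<Rightarrow> real gop" where
  "hfield p n f = vector_field n (\<lambda>i I. (if i < p then 1 else -1) * gpartial i f I)"

lemma hfield_der:
  assumes "f \<in> gparity n b"
  shows "b \<Longrightarrow> hfield p n f \<in> der_even n" "\<not> b \<Longrightarrow> hfield p n f \<in> der_odd n"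
proof -
  have F: "(\<lambda>I. (if i < p then 1 else -1) * gpartial i f I) \<in> gparity n (\<not> b)" for i
    by (rule gparity_scale[OF gpartial_gparity[OF assms]])
  show "hfield p n f \<in> der_even n" if b unfolding hfield_def
    by (rule vector_field_der_even) (use F that in simp)
  show "hfield p n f \<in> der_odd n" if "\<not> b" unfolding hfield_def
    by (rule vector_field_der_odd) (use F that in simp)
qed

lemma hfield_gmono:
  assumes "f \<in> Grass n" "j < n"
  shows "hfield p n f (gmono {j}) = (\<lambda>I. (if j < p then 1 else -1) * gpartial j f I)"
  unfolding hfield_def
proof (rule vector_field_gmono[where F = "\<lambda>i I. (if i < p then 1 else -1) * gpartial i f I", OF _ assms(2)])
  show "(\<lambda>I. (if j < p then 1 else -1) * gpartial j f I) \<in> Grass n"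
    using Grass_linear[OF gpartial_Grass[OF assms(1)] Grass_zero_mem, of "if j < p then 1 else -1" j 0] by simp
qed

text \<open>The Hamiltonian field of \<open>\<xi>\<^sub>0\<xi>\<^sub>1\<xi>\<^sub>2\<close> squares to zero; up to sign it is the commutator of the Hamiltonian
  fields of \<open>\<xi>\<^sub>2\<xi>\<^sub>3\<close> and \<open>\<xi>\<^sub>0\<xi>\<^sub>1\<xi>\<^sub>3\<close>, hence it lies in the derived algebra.\<close>

lemma nondefinite_H:
  fixes g0 g1 :: "'a::euclidean_space set"
  assumes iso: "superalgebra_of g0 g1 br \<cong>\<^sub>s H_real p q" and n4: "4 < p + q"
  shows "nondefinite g1 br"
proof -
  define n where "n = p + q"
  have n: "4 < n" using n4 by (simp add: n_def)
  define e :: "nat \<Rightarrow> real" where "e i = (if i < p then 1 else -1)" for i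
  let ?k = "gmono {2, 3} :: real grassmann" and ?g = "gmono {0, 1, 3} :: real grassmann"
  \<comment> \<open>Contracting the index \<open>3\<close> that \<open>?k\<close> and
    \<open>?g\<close> share leaves \<open>\<xi>_0 \<xi>_1 \<xi>_2\<close> with the factor
    \<open>- e 3\<close>; this is the Hamiltonian of the commutator of \<open>K\<close> and
    \<open>E\<close>.\<close>
  let ?f = "\<lambda>I. - e 3 * gmono {0, 1, 2} I"
  have sub: "{2, 3} \<subseteq> {..<n}" "{0, 1, 3} \<subseteq> {..<n}" "{0, 1, 2} \<subseteq> {..<n}" using n by auto
  have par: "?k \<in> gparity n True" "?g \<in> gparity n False" "?f \<in> gparity n False"
    by (rule gmono_gparity[OF sub(1)], simp, rule gmono_gparity[OF sub(2)], simp,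
        rule gparity_scale, rule gmono_gparity[OF sub(3)], simp)
  note G = par[THEN gparity_Grass]
  define K where "K = hfield p n ?k"
  define E where "E = hfield p n ?g"
  define D where "D = hfield p n ?f"
  have K: "K \<in> der_even n" unfolding K_def by (rule hfield_der(1)[OF par(1)]) simp
  have E: "E \<in> der_odd n" unfolding E_def by (rule hfield_der(2)[OF par(2)]) simp
  have D: "D \<in> der_odd n" unfolding D_def by (rule hfield_der(2)[OF par(3)]) simp
  have LD: "D \<in> glinear n" and LE: "E \<in> glinear n" and LK: "K \<in> glinear n"
    using der_oddD(1)[OF D] der_oddD(1)[OF E] der_evenD(1)[OF K] .
  have diff: "{0, 1, 3} - {0} = {1, 3::nat}" "{0, 1, 3} - {1} = {0, 3::nat}" "{0, 1, 3} - {3} = {0, 1::nat}"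
    "{0, 1, 2} - {0} = {1, 2::nat}" "{0, 1, 2} - {1} = {0, 2::nat}" "{0, 1, 2} - {2} = {0, 1::nat}"
    "{2, 3} - {2} = {3::nat}" "{2, 3} - {3} = {2::nat}" by auto
  have Kv: "K (gmono {0}) = (\<lambda>I. 0)" "K (gmono {1}) = (\<lambda>I. 0)" "K (gmono {2}) = (\<lambda>I. e 2 * gmono {3} I)"
    "K (gmono {3}) = (\<lambda>I. - e 3 * gmono {2} I)" "\<And>j. 3 < j \<Longrightarrow> j < n \<Longrightarrow> K (gmono {j}) = (\<lambda>I. 0)"
    using n unfolding K_def
    by (simp_all add: hfield_gmono[OF G(1)] gpartial_gmono diff sgnp_insert sgnp_empty e_def)
  have Ev: "E (gmono {0}) = (\<lambda>I. e 0 * gmono {1, 3} I)" "E (gmono {1}) = (\<lambda>I. - e 1 * gmono {0, 3} I)" "E (gmono {2}) = (\<lambda>I. 0)"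
    "E (gmono {3}) = (\<lambda>I. e 3 * gmono {0, 1} I)" "\<And>j. 3 < j \<Longrightarrow> j < n \<Longrightarrow> E (gmono {j}) = (\<lambda>I. 0)"
    using n unfolding E_def
    by (simp_all add: hfield_gmono[OF G(2)[simplified]] gpartial_gmono diff[simplified] sgnp_insert sgnp_empty e_def)
  have Dv: "D (gmono {0}) = (\<lambda>I. - e 0 * e 3 * gmono {1, 2} I)" "D (gmono {1}) = (\<lambda>I. e 1 * e 3 * gmono {0, 2} I)"
    "D (gmono {2}) = (\<lambda>I. - e 2 * e 3 * gmono {0, 1} I)" "\<And>j. 2 < j \<Longrightarrow> j < n \<Longrightarrow> D (gmono {j}) = (\<lambda>I. 0)"
    using n unfolding D_def
    by (simp_all add: hfield_gmono[OF G(3)[simplified]] gpartial_uminus gpartial_scale gpartial_gmono diff[simplified] sgnp_insert sgnp_empty)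
      (simp_all add: e_def)
  let ?C = "\<lambda>f\<in>Grass n. \<lambda>I. K (E f) I - E (K f) I"
  have mG: "gmono J \<in> Grass n" if "J \<subseteq> {0, 1, 2, 3}" for J :: "nat set"
    by (rule gmono_Grass) (use that n in auto)
  note KL = der_even_leibniz[OF K] 
  have Ks: "leibniz_sign n 1 K"
    by (rule leibniz_signI) (use LK leibniz_one[OF KL] der_evenD(3)[OF K gmono_single_Grass] in simp_all)
  have z: "K (\<lambda>I. 0) = (\<lambda>I. 0)" "E (\<lambda>I. 0) = (\<lambda>I. 0)" "D (\<lambda>I. 0) = (\<lambda>I. 0)" using glinear_zero LK LE LD by blast+
  have m: "gmult (gmono {1}) (gmono {2}) = (gmono {1, 2} :: real grassmann)"
    "gmult (gmono {0}) (gmono {2}) = (gmono {0, 2} :: real grassmann)"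
    by (rule gmono_insert; auto)+
  have K13: "K (gmono {1, 3}) = (\<lambda>I. - e 3 * gmono {1, 2} I)"
    using n by (subst leibniz_sign_pair[OF Ks]) (simp_all add: Kv[simplified] gmult_uminus_right gmult_scale_right m[simplified])
  have K03: "K (gmono {0, 3}) = (\<lambda>I. - e 3 * gmono {0, 2} I)"
    using n by (subst leibniz_sign_pair[OF Ks]) (simp_all add: Kv[simplified] gmult_uminus_right gmult_scale_right m[simplified])
  have K01: "K (gmono {0, 1}) = (\<lambda>I. 0)"
    using n by (subst leibniz_sign_pair[OF Ks]) (simp_all add: Kv[simplified])
  \<comment> \<open>Both sides obey the odd Leibniz rule, so it suffices to compare them on
    generators.\<close>
  have DC: "D = ?C"
  proof (rule leibniz_sign_eqI[OF der_odd_leibniz_sign[OF D] commutator_leibniz_sign[OF K E]])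
    fix i assume i: "i < n"
    have C: "?C (gmono {i}) = (\<lambda>I. K (E (gmono {i})) I - E (K (gmono {i})) I)"
      by (rule restrict_apply'[OF gmono_single_Grass[OF i]])
    consider "i = 0" | "i = 1" | "i = 2" | "i = 3" | "3 < i" by linarith
    then show "D (gmono {i}) = ?C (gmono {i})"
    proof cases
      case 1
      show ?thesis unfolding C unfolding 1 Dv Ev Kv z glinear_scale[OF LK mG[of "{1, 3}", simplified], simplified] K13[simplified]
        using glinear_scale[OF LK mG[of "{1, 3}"], of "e 0"] by (simp add: K13[simplified] fun_eq_iff)
    next
      case 2
      show ?thesis unfolding C unfolding 2 Dv Ev Kv z
        using glinear_scale[OF LK mG[of "{0, 3}"], of "- e 1"] by (simp add: K03 fun_eq_iff)
    next
      case 3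
      show ?thesis unfolding C unfolding 3 Dv Ev Kv z
        using glinear_scale[OF LE mG[of "{3}"], of "e 2"] by (simp add: Ev fun_eq_iff)
    next
      case 4
      have D3: "D (gmono {3}) = (\<lambda>I. 0)" using Dv(4)[of 3] n by simp
      show ?thesis unfolding C unfolding 4 D3 Ev Kv
        using glinear_scale[OF LK mG[of "{0, 1}"], of "e 3"] glinear_scale[OF LE mG[of "{2}"], of "- e 3"] 
        by (simp add: K01[simplified] Ev fun_eq_iff)
    next
      case 5
      show ?thesis unfolding C Dv(4)[OF order.strict_trans[OF _ 5] i, simplified] Ev(5)[OF 5 i] Kv(5)[OF 5 i] z by simp
    qed
  qed
  note Ds = der_odd_leibniz_sign[OF D]
  \<comment> \<open>In each term of the Leibniz rule some generator occurs twice; likewise for the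
    other two pairs.\<close>
  have D12: "D (gmono {1, 2}) = (\<lambda>I. 0)"
    using n by (subst leibniz_sign_pair[OF Ds])
      (simp_all add: Dv[simplified] gmult_uminus_left gmult_uminus_right gmult_scale_left gmult_scale_right gmult_gmono_overlap fun_eq_iff)
  have D02: "D (gmono {0, 2}) = (\<lambda>I. 0)"
    using n by (subst leibniz_sign_pair[OF Ds])
      (simp_all add: Dv[simplified] gmult_uminus_left gmult_uminus_right gmult_scale_left gmult_scale_right gmult_gmono_overlap fun_eq_iff)
  have D01: "D (gmono {0, 1}) = (\<lambda>I. 0)"
    using n by (subst leibniz_sign_pair[OF Ds])
      (simp_all add: Dv[simplified] gmult_uminus_left gmult_uminus_right gmult_scale_left gmult_scale_right gmult_gmono_overlap fun_eq_iff)
  have DD: "D (D f) = (\<lambda>I. 0)" if f: "f \<in> Grass n" for f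
  proof -
    have gen: "(\<lambda>f\<in>Grass n. D (D f)) (gmono {i}) = (\<lambda>I. 0)" if i: "i < n" for i
    proof -
      consider "i = 0" | "i = 1" | "i = 2" | "2 < i" by linarith
      then have "D (D (gmono {i})) = (\<lambda>I. 0)"
      proof cases
        case 1
        show ?thesis unfolding 1 Dv using glinear_scale[OF LD mG[of "{1, 2}"], of "- e 0 * e 3"] by (simp add: D12[simplified])
      next
        case 2
        show ?thesis unfolding 2 Dv using glinear_scale[OF LD mG[of "{0, 2}"], of "e 1 * e 3"] by (simp add: D02)
      next
        case 3
        show ?thesis unfolding 3 Dv using glinear_scale[OF LD mG[of "{0, 1}"], of "- e 2 * e 3"] by (simp add: D01[simplified])
      next
        case 4
        show ?thesis unfolding Dv(4)[OF 4 i] z ..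
      qed
      then show ?thesis unfolding restrict_apply'[OF gmono_single_Grass[OF i]] .
    qed
    from leibniz_eq_zero[OF leibniz_sign_leibniz[OF square_leibniz_sign[OF D]] gen f]
    show ?thesis using f by simp
  qed
  define S :: "real gop set" where "S = {vector_field n (\<lambda>i I. (if i < p then 1 else -1) * gpartial i f I) | f. f \<in> Grass n}"
  define N where "N = sa_sub (der_grass n) S"
  define T :: "real gop set" where "T = \<Inter>{U. sa_subspace N U \<and> (\<forall>x\<in>sa_carrier N. \<forall>y\<in>sa_carrier N. sa_br N x y \<in> U)}"
  have H: "H_real p q = sa_sub N T"
    unfolding H_real_def sa_derived_def T_def N_def S_def n_def ..
  have inS: "K \<in> S" "E \<in> S" "D \<in> S" unfolding S_def K_def E_def D_def hfield_def using G by blast+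
  have brKE: "sa_br N K E = D"
    unfolding DC using br_der_even_left[OF K, of E] E by (simp add: N_def sa_sub_def)
  \<comment> \<open>Each subspace in the intersection that defines \<open>T\<close> contains all
    brackets, in particular \<open>[K, E] = D\<close>.\<close>
  have "D \<in> T"
    unfolding T_def using inS brKE by (auto simp: N_def sa_sub_def)
  then have Dodd: "D \<in> sa_odd (H_real p q)"
    using inS D unfolding H by (simp add: sa_sub_def N_def der_grass_def)
  obtain \<phi> where \<phi>: "sa_iso (superalgebra_of g0 g1 br) (H_real p q) \<phi>"
    using iso unfolding sa_isomorphic_def by blast
  have inj: "inj \<phi>" and scale: "\<And>c x. \<phi> (c *\<^sub>R x) = sa_scale (der_grass n) c (\<phi> x)"
    and brk: "\<And>x y. \<phi> (br x y) = sa_br (der_grass n) (\<phi> x) (\<phi> y)" and odd: "\<phi> ` g1 = sa_odd (H_real p q)"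
    using \<phi> unfolding H by (auto simp: sa_iso_def superalgebra_of_def bij_betw_def sa_sub_def N_def)
  obtain x where x: "x \<in> g1" "\<phi> x = D" using Dodd unfolding odd[symmetric] by blast
  have z0: "\<phi> 0 = gzero n" using scale[of 0 x] by (simp add: der_grass_def gzero_def)
  have "\<phi> (br x x) = gzero n"
    unfolding brk x(2) br_der_odd_odd[OF D] gzero_def by (rule restrict_ext) (simp add: DD)
  then have "br x x = 0" using injD[OF inj, of "br x x" 0] z0 by simp
  moreover have "x \<noteq> 0"
  proof
    assume "x = 0"
    then have "D = gzero n" using x(2) z0 by simp
    then have "D (gmono {0}) {1, 2} = 0" using gmono_single_Grass[of 0 n, where 'a = real] n by (simp add: gzero_def)
    then show False unfolding Dv by (simp add: gmono_def e_def split: if_splits)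
  qed
  ultimately show ?thesis using nondefinite_if_square_zero[of x g1 br] x(1) by blast
qed

text \<open>The condition on \<open>sl(m|n)\<close> admits the degenerate sizes \<open>m = 0\<close>
  or \<open>n = 0\<close>. Then the odd part is a single coset and injectivity reduces it to zero,
  which is incompatible with a nonzero odd part.\<close>

lemma g1_trivial_if_no_odd_block:
  fixes g0 g1 :: "'a::euclidean_space set"
  assumes alg: "real_lie_superalgebra g0 g1 br"
    and iso: "superalgebra_of g0 g1 br \<cong>\<^sub>s sa_mod_center (sa_sub (gl_super \<sigma> m n) S)" and mn: "m = 0 \<or> n = 0"
  shows "g1 = {0}"
proof -
  obtain \<phi> where \<phi>: "sa_iso (superalgebra_of g0 g1 br) (sa_mod_center (sa_sub (gl_super \<sigma> m n) S)) \<phi>"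
    using iso unfolding sa_isomorphic_def by blast
  have inj: "inj \<phi>" and odd: "\<phi> ` g1 = sa_odd (sa_mod_center (sa_sub (gl_super \<sigma> m n) S))"
    using \<phi> by (auto simp: sa_iso_def superalgebra_of_def bij_betw_def)
  have zero: "mat_odd m n X = 0\<^sub>m (m + n) (m + n)" for X :: "'b mat"
    unfolding mat_odd_def by (rule eq_matI) (use mn in auto)
  have "sa_odd (sa_sub (gl_super \<sigma> m n) S) \<subseteq> {0\<^sub>m (m + n) (m + n)}"
    by (auto simp: sa_sub_def gl_super_def zero)
  then obtain c where "\<phi> ` g1 \<subseteq> {c}"
    unfolding odd sa_mod_center_def Let_def superalgebra.simps by (metis image_mono image_insert image_empty)
  then have c: "\<phi> x = c" if "x \<in> g1" for x using that by blast
  have "0 \<in> g1" using alg by (auto simp: real_lie_superalgebra_def subspace_0)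
  moreover have "x = 0" if "x \<in> g1" for x
    by (rule injD[OF inj]) (simp add: c that \<open>0 \<in> g1\<close>)
  ultimately show ?thesis by blast
qed

theorem theorem6p2p1:
  fixes G :: "'g::{t2_space, second_countable_topology} monoid"
    and A :: "('g, 'e::euclidean_space) chart set"
    and g0 g1 :: "'a::euclidean_space set"
    and br :: "'a \<Rightarrow> 'a \<Rightarrow> 'a"
    and \<iota> :: "'a \<Rightarrow> ('g \<Rightarrow> real) \<Rightarrow> ('g \<Rightarrow> real)"
    and Ad :: "'g \<Rightarrow> 'a \<Rightarrow> 'a"
    and L :: "(real, 'a) superalgebra"
    and H0 H1 :: "'h::complex_hilbert_space set"
    and \<pi> :: "'g \<Rightarrow> 'h \<Rightarrow> 'h"
    and \<rho> :: "'a \<Rightarrow> 'h \<Rightarrow> 'h"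
  assumes "lie_supergroup G A g0 g1 br \<iota> Ad"
    and "connected (UNIV :: 'g set)"
    and "simple_superalgebra g0 g1 br"
    and "g1 \<noteq> {0}"
    and "L = superalgebra_of g0 g1 br"
    and "(\<exists>m n. (m > 2 \<or> n > 2) \<and> L \<cong>\<^sub>s sl_real m n)
       \<or> (\<exists>p q r s. p > 0 \<and> q > 0 \<and> r > 0 \<and> s > 0 \<and> L \<cong>\<^sub>s su p q r s)
       \<or> (\<exists>p q. p > 0 \<and> q > 0 \<and> p + q > 2 \<and> L \<cong>\<^sub>s su_star p q)
       \<or> (\<exists>m. m > 1 \<and> L \<cong>\<^sub>s pqbar m)
       \<or> (\<exists>m. m > 1 \<and> L \<cong>\<^sub>s usp m)
       \<or> (\<exists>m p q. m > 0 \<and> even m \<and> p > 0 \<and> q > 0 \<and> is_osp_star m p q L)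
       \<or> (\<exists>p q n. p > 0 \<and> q > 0 \<and> n > 0 \<and> L \<cong>\<^sub>s osp p q n)
       \<or> (\<exists>n. n > 1 \<and> real_form_of L (P_complex n))
       \<or> (\<exists>n. n > 2 \<and> L \<cong>\<^sub>s psq_real n)
       \<or> (\<exists>n. n > 2 \<and> even n \<and> L \<cong>\<^sub>s psq_star n)
       \<or> (\<exists>p q. p > 0 \<and> q > 0 \<and> L \<cong>\<^sub>s psq p q)
       \<or> (\<exists>n\<ge>3. real_form_of L (W_complex n))
       \<or> (\<exists>n\<ge>4. real_form_of L (S_complex n))
       \<or> (\<exists>n\<ge>4. even n \<and> real_form_of L (S_tilde_complex n))
       \<or> (\<exists>p q. p + q > 4 \<and> L \<cong>\<^sub>s H_real p q)"
    and "unitary_representation G A g0 g1 br \<iota> Ad H0 H1 \<pi> \<rho>"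
  shows "\<forall>X. \<forall>v\<in>smooth_vectors A \<pi>. \<rho> X v = 0"
proof -
  have alg: "real_lie_superalgebra g0 g1 br" using assms(1) by (simp add: lie_supergroup_def)
  note simple = assms(3,4) and form = assms(6)[unfolded assms(5)]
  have sl: "nondefinite g1 br" if iso: "superalgebra_of g0 g1 br \<cong>\<^sub>s sl_real m n" for m n
  proof -
    have "\<not> (m = 0 \<or> n = 0)"
      using g1_trivial_if_no_odd_block[OF alg iso[unfolded sl_real_def]] simple(2) by blast
    then show ?thesis using nondefinite_sl_real[OF iso] by simp
  qed
  have "nondefinite g1 br"
    using form
    by (elim disjE exE conjE)
      ((rule sl nondefinite_su nondefinite_su_star nondefinite_pqbar nondefinite_usp nondefinite_osp_star[OF alg simple]
        nondefinite_osp nondefinite_P[OF alg] nondefinite_psq_real nondefinite_psq_star nondefinite_psq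
        nondefinite_W[OF alg simple] nondefinite_S[OF alg simple] nondefinite_S_tilde[OF alg simple] nondefinite_H; assumption)+)
  then show ?thesis
    by (rule unitary_representation.rho_trivial_if_nondefinite[OF assms(7) simple(1)])
qed

end
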